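(* There is an absolute constant $C>0$ such that for every integer $N\ge1$ and every $\beta>0$: (i) for every $u\in H^1(\mathbb{R})$, $\|u-\widehat{I}_N^\beta u\|\le C\bigl(\beta^{-1}N^{-1/3}E_N^\beta(\partial_xu)+N^{1/6}E_N^\beta(u)\bigr)$; (ii) for every $u\in H^1(\mathbb{R})$, $\|\partial_x(u-\widehat{I}_N^\beta u)\|\le C\bigl(N^{1/6}E_N^\beta(\partial_xu)+\beta N^{2/3}E_N^\beta(u)\bigr)$; (iii) for every $u\in H^2(\mathbb{R})$, $\|\partial_x^2(u-\widehat{I}_N^\beta u)\|\le C\bigl(E_N^\beta(\partial_x^2u)+\beta N^{2/3}E_N^\beta(\partial_xu)+\beta^2N^{7/6}E_N^\beta(u)\bigr)$.
   Context: $\|\cdot\|$ is the $L^2(\mathbb{R})$ norm, $\mathbb{I}_A$ the indicator function of $A$, $\mathcal{F}[u](k)=\frac{1}{\sqrt{2\pi}}\int u(x)e^{-ikx}dx$. Hermite functions: $\widehat{H}_n(x)=\frac{1}{\pi^{1/4}\sqrt{2^nn!}}e^{-x^2/2}H_n(x)$, $H_n$ the Hermite polynomials (orthogonal w.r.t. $e^{-x^2}$, $\int H_n^2e^{-x^2}=\sqrt\pi 2^nn!$). $\widehat{P}_N^\beta=\{e^{-\beta^2x^2/2}\psi(x):\ \psi\text{ a polynomial of degree}\le N\}$. Let $x_0<\dots<x_N$ be the roots of $\widehat{H}_{N+1}$; the interpolation operator $\widehat{I}_N^\beta$ maps $u$ to the unique element of $\widehat{P}_N^\beta$ with $\widehat{I}_N^\beta[u](x_j/\beta)=u(x_j/\beta)$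 for $0\le j\le N$. For $w\in L^2(\mathbb{R})$ define $E_N^\beta(w)=\|w\cdot\mathbb{I}_{\{|x|>\frac{1}{2\sqrt2}\sqrt N/\beta\}}\|+\|\mathcal{F}[w](k)\cdot\mathbb{I}_{\{|k|>\frac{1}{2\sqrt2}\sqrt N\beta\}}\|+\|w\|e^{-N/16}$. *)

theory Defs
  imports "HOL-Analysis.Analysis" "HOL-Computational_Algebra.Polynomial"
begin

definition L2 :: "(real \<Rightarrow> complex) \<Rightarrow> bool" where
  "L2 f \<longleftrightarrow> f \<in> borel_measurable lborel \<and> integrable lborel (\<lambda>x. (cmod (f x))^2)"

definition L2norm :: "(real \<Rightarrow> complex) \<Rightarrow> real" where
  "L2norm f = sqrt (LINT x|lborel. (cmod (f x))^2)"

definition fourier_trunc :: "real \<Rightarrow> (real \<Rightarrow> complex) \<Rightarrow> real \<Rightarrow> complex" where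
  "fourier_trunc R u k =
     complex_of_real (1 / sqrt (2 * pi)) *
       (LINT x:{-R..R}|lborel. u x * exp (- \<i> * complex_of_real (k * x)))"

definition fourier :: "(real \<Rightarrow> complex) \<Rightarrow> real \<Rightarrow> complex" where
  "fourier u = (SOME W. L2 W \<and>
      ((\<lambda>R. L2norm (\<lambda>k. W k - fourier_trunc R u k)) \<longlongrightarrow> 0) at_top)"

definition test_fun :: "(real \<Rightarrow> real) \<Rightarrow> bool" where
  "test_fun \<phi> \<longleftrightarrow> (\<forall>k x. ((deriv ^^ k) \<phi>) differentiable (at x)) \<and> bounded {x. \<phi> x \<noteq> 0}"

definition weak_deriv :: "(real \<Rightarrow> complex) \<Rightarrow> (real \<Rightarrow> complex) \<Rightarrow> bool" where
  "weak_deriv u v \<longleftrightarrow> (\<forall>\<phi>. test_fun \<phi> \<longrightarrow>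
      (LINT x|lborel. u x * complex_of_real (deriv \<phi> x)) =
      - (LINT x|lborel. v x * complex_of_real (\<phi> x)))"

text \<open>u in H^1 with (weak) derivative u1; u is taken to be the continuous representative.\<close>
definition H1 :: "(real \<Rightarrow> complex) \<Rightarrow> (real \<Rightarrow> complex) \<Rightarrow> bool" where
  "H1 u u1 \<longleftrightarrow> continuous_on UNIV u \<and> L2 u \<and> L2 u1 \<and> weak_deriv u u1"

definition H2 :: "(real \<Rightarrow> complex) \<Rightarrow> (real \<Rightarrow> complex) \<Rightarrow> (real \<Rightarrow> complex) \<Rightarrow> bool" where
  "H2 u u1 u2 \<longleftrightarrow> H1 u u1 \<and> continuous_on UNIV u1 \<and> L2 u2 \<and> weak_deriv u1 u2"

fun hermite :: "nat \<Rightarrow> real \<Rightarrow> real" where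
  "hermite 0 x = 1"
| "hermite (Suc 0) x = 2 * x"
| "hermite (Suc (Suc n)) x = 2 * x * hermite (Suc n) x - 2 * real (Suc n) * hermite n x"

definition hermite_fun :: "nat \<Rightarrow> real \<Rightarrow> real" where
  "hermite_fun n x = exp (- (x\<^sup>2) / 2) * hermite n x / (pi powr (1/4) * sqrt ((2::real) ^ n * fact n))"

definition Pspace :: "nat \<Rightarrow> real \<Rightarrow> (real \<Rightarrow> complex) set" where
  "Pspace N \<beta> = {p. \<exists>\<psi> :: complex poly. degree \<psi> \<le> N \<and>
      p = (\<lambda>x. complex_of_real (exp (- (\<beta>\<^sup>2 * x\<^sup>2) / 2)) * poly \<psi> (complex_of_real x))}"

definition interp :: "nat \<Rightarrow> real \<Rightarrow> (real \<Rightarrow> complex) \<Rightarrow> real \<Rightarrow> complex" where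
  "interp N \<beta> u = (THE p. p \<in> Pspace N \<beta> \<and>
      (\<forall>x. hermite_fun (Suc N) x = 0 \<longrightarrow> p (x / \<beta>) = u (x / \<beta>)))"

definition E_err :: "nat \<Rightarrow> real \<Rightarrow> (real \<Rightarrow> complex) \<Rightarrow> real" where
  "E_err N \<beta> w =
     L2norm (\<lambda>x. w x * indicator {x. \<bar>x\<bar> > 1 / (2 * sqrt 2) * sqrt (real N) / \<beta>} x)
   + L2norm (\<lambda>k. fourier w k * indicator {k. \<bar>k\<bar> > 1 / (2 * sqrt 2) * sqrt (real N) * \<beta>} k)
   + L2norm w * exp (- real N / 16)"

end

(*
  Write h_n for the n-th Hermite function, P for the L2-projection onto h_0,...,h_N, and take beta = 1
  (the general case follows by dilation).

  Projection.  Let V u (q,p) be the inner product of u with the Gaussian coherent state centred at (q,p);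
  V is an isometry into L2 of the phase plane.  The n-th Hermite coefficients of coherent states are Poisson
  weights with mean (q^2+p^2)/2, so V(u - P u) is exponentially small on the square |q|,|p| <= sqrt(N/2),
  while the mass of V u outside this square is controlled, up to a Gaussian tail exp(-N/8), by the tails of
  u and of its Fourier transform.  Since |u - P u|^2 = <u - P u, u>, this gives |u - P u| <= C E_N(u).

  Stability.  At a zero x_j of y = h_{N+1} the Lagrange function y/(x - x_j) has norm sqrt 2 and value
  y'(x_j) at x_j, and distinct Lagrange functions are orthogonal, hence |I v|^2 = sum 2 |v(x_j)|^2 / y'(x_j)^2.
  A WKB-type energy argument yields y'(x_j)^2 >= c N^(1/6), and neighbouring zeros are at least c N^(-1/2)
  apart; therefore |I v| <= C (N^(1/6) |v| + N^(-1/3) |v'|).  The theorem follows by applying this to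
  v = u - P u, as I u = P u + I v, together with the inverse inequality |p'| <= C sqrt N |p|.
*)
theory Submission
  imports Defs "HOL-Probability.Probability" "HOL-Real_Asymp.Real_Asymp"
begin

subsection \<open>Square-integrable functions\<close>

text \<open>The constants of \<open>E_err\<close> come from one balance. Let
  \<open>M = sqrt N / (2 * sqrt 2)\<close>, so \<open>M^2 = N / 8\<close>. The phase-plane square
  has half-side \<open>2 * M\<close>, twice the cut-off: mass at \<open>|x| <= M\<close> has to
  travel at least \<open>M\<close> to leave it, which costs \<open>exp (- M^2)\<close>, and the root
  of this is \<open>exp (- N / 16)\<close>. On the square the Poisson mean is at most
  \<open>N / 2\<close>, so the residual has density of order \<open>(exp (1/2) / 2) ^ N\<close>
  there; \<open>exp (5/8) < 2\<close> puts this below \<open>exp (- N / 8)\<close>. In the stability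
  bound the node spacing gives a factor \<open>sqrt N\<close> and the slopes a divisor N^(1/6); the
  root of the quotient is N^(1/6). The slope bound is critical at the outermost nodes, where the WKB
  frequency \<open>S = sqrt (2 * n + 1 - x^2)\<close> is least. A Hardy-type comparison shows
  \<open>S^6 >= N\<close> at every node, and also bounds the accumulated WKB error
  \<open>x / S^3\<close> by 1. Projection and differentiation do not commute; the defect lives on
  the modes N and N+1 and costs a factor \<open>sqrt N\<close>. Since \<open>fourier\<close> is a
  choice among L2 limits and \<open>H1\<close> only tests against smooth functions, Plancherel and a
  fundamental theorem of calculus for \<open>u\<close> have to be derived first.\<close>

lemma Cauchy_Schwarz_integral:
  fixes f g :: "'a \<Rightarrow> real"
  assumes [measurable]: "f \<in> borel_measurable M" "g \<in> borel_measurable M"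
    and f2: "integrable M (\<lambda>x. (f x)\<^sup>2)" and g2: "integrable M (\<lambda>x. (g x)\<^sup>2)"
  shows "integrable M (\<lambda>x. f x * g x)"
    and "(LINT x|M. \<bar>f x * g x\<bar>) \<le> sqrt (LINT x|M. (f x)\<^sup>2) * sqrt (LINT x|M. (g x)\<^sup>2)"
proof -
  have young: "2 * \<bar>a * b\<bar> \<le> t * a\<^sup>2 + b\<^sup>2 / t" if "t > 0" for a b t :: real
  proof -
    have "0 \<le> (t * \<bar>a\<bar> - \<bar>b\<bar>)\<^sup>2 / t" using that by simp
    also have "\<dots> = t * a\<^sup>2 + b\<^sup>2 / t - 2 * \<bar>a * b\<bar>"
      using that by (simp add: power2_eq_square field_simps abs_mult)
    finally show ?thesis by simp
  qed
  show int: "integrable M (\<lambda>x. f x * g x)"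
    by (rule Bochner_Integration.integrable_bound[OF Bochner_Integration.integrable_add[OF f2 g2]])
      (use young[of 1] in \<open>auto intro!: AE_I2 simp: abs_mult\<close>, smt (verit) abs_mult zero_le_power2 abs_ge_zero)
  define A where "A = (LINT x|M. (f x)\<^sup>2)"
  define B where "B = (LINT x|M. (g x)\<^sup>2)"
  define I where "I = (LINT x|M. \<bar>f x * g x\<bar>)"
  have A0: "A \<ge> 0" and B0: "B \<ge> 0" unfolding A_def B_def by simp_all
  \<comment> \<open>Young's inequality is integrated with a free weight; the minimising one is
    \<open>t = sqrt B / sqrt A\<close>.\<close>
  have le: "2 * I \<le> t * A + B / t" if "t > 0" for t
  proof -
    have "2 * I = (LINT x|M. 2 * \<bar>f x * g x\<bar>)" unfolding I_def by simp
    also have "\<dots> \<le> (LINT x|M. t * (f x)\<^sup>2 + (g x)\<^sup>2 / t)"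
      using int f2 g2 young[OF that] by (intro integral_mono) auto
    also have "\<dots> = t * A + B / t" unfolding A_def B_def using f2 g2 by simp
    finally show ?thesis .
  qed
  show "I \<le> sqrt A * sqrt B"
  proof (cases "A = 0 \<or> B = 0")
    case False
    then have p: "A > 0" "B > 0" using A0 B0 by auto
    then have "2 * I \<le> (sqrt B / sqrt A) * A + B / (sqrt B / sqrt A)" by (intro le) simp
    also have "(sqrt B / sqrt A) * A = sqrt A * sqrt B"
      using p real_sqrt_mult_self[of A] by (simp add: field_simps)
    also have "B / (sqrt B / sqrt A) = sqrt A * sqrt B"
      using p real_sqrt_mult_self[of B] by (simp add: field_simps)
    finally show ?thesis by simp
  next
    \<comment> \<open>The optimal weight degenerates here, so a positive \<open>I\<close> is refuted
      by a weight that is merely extreme enough: the surviving term is at most \<open>I\<close>,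
      against \<open>2 * I\<close> on the left.\<close>
    case True
    have "I \<le> 0"
    proof (rule ccontr)
      assume "\<not> I \<le> 0"
      then have I: "I > 0" by simp
      from True show False
      proof
        assume "A = 0"
        then have "2 * I \<le> B / ((B + 1) / I)" using le[of "(B + 1) / I"] I B0 by simp
        also have "\<dots> = I * (B / (B + 1))" by simp
        also have "\<dots> \<le> I * 1" using I B0 by (intro mult_left_mono) auto
        finally show False using I by simp
      next
        assume "B = 0"
        then have "2 * I \<le> I / (A + 1) * A" using le[of "I / (A + 1)"] I A0 by simp
        also have "\<dots> = I * (A / (A + 1))" by simp
        also have "\<dots> \<le> I * 1" using I A0 by (intro mult_left_mono) auto
        finally show False using I by simp
      qed
    qed
    then show ?thesis using True by auto
  qed
qed

section \<open>Closure properties and norm inequalities of L2\<close>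

lemma L2_measurable: "L2 f \<Longrightarrow> f \<in> borel_measurable lborel"
  by (simp add: L2_def)

lemma L2_integrable: "L2 f \<Longrightarrow> integrable lborel (\<lambda>x. (cmod (f x))\<^sup>2)"
  by (simp add: L2_def)

lemma L2norm_nonneg [simp]: "L2norm f \<ge> 0"
  by (simp add: L2norm_def)

lemma L2norm_power2: "(L2norm f)\<^sup>2 = (LINT x|lborel. (cmod (f x))\<^sup>2)"
  by (simp add: L2norm_def)

lemma L2_mult_integrable:
  assumes "L2 f" "L2 g"
  shows "integrable lborel (\<lambda>x. f x * g x)"
  and "(LINT x|lborel. cmod (f x * g x)) \<le> L2norm f * L2norm g"
  and "cmod (LINT x|lborel. f x * g x) \<le> L2norm f * L2norm g"
proof -
  note [measurable] = assms[THEN L2_measurable]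
  note CS = Cauchy_Schwarz_integral[of "\<lambda>x. cmod (f x)" lborel "\<lambda>x. cmod (g x)", OF _ _ L2_integrable[OF assms(1)] L2_integrable[OF assms(2)]]
  show 1: "integrable lborel (\<lambda>x. f x * g x)"
    using CS(1) by (rule Bochner_Integration.integrable_bound) (auto simp: norm_mult)
  show 2: "(LINT x|lborel. cmod (f x * g x)) \<le> L2norm f * L2norm g"
    using CS(2) by (simp add: norm_mult L2norm_def)
  show "cmod (LINT x|lborel. f x * g x) \<le> L2norm f * L2norm g"
    using 2 integral_norm_bound[of lborel "\<lambda>x. f x * g x"] by linarith
qed

lemma L2_cmult [intro]: "L2 f \<Longrightarrow> L2 (\<lambda>x. c * f x)"
  by (auto simp: L2_def norm_mult power_mult_distrib)

lemma L2norm_cmult: "L2norm (\<lambda>x. c * f x) = cmod c * L2norm f"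
  by (simp add: L2norm_def norm_mult power_mult_distrib real_sqrt_mult)

lemma L2_uminus [intro]: "L2 f \<Longrightarrow> L2 (\<lambda>x. - f x)"
  by (simp add: L2_def)

lemma L2_zero [simp, intro]: "L2 (\<lambda>x. 0)"
  by (simp add: L2_def)

lemma L2_add [intro]:
  assumes "L2 f" "L2 g" shows "L2 (\<lambda>x. f x + g x)"
proof -
  note [measurable] = assms[THEN L2_measurable]
  have "integrable lborel (\<lambda>x. 2 * (cmod (f x))\<^sup>2 + 2 * (cmod (g x))\<^sup>2)"
    using assms[THEN L2_integrable] by simp
  then have "integrable lborel (\<lambda>x. (cmod (f x + g x))\<^sup>2)"
  proof (rule Bochner_Integration.integrable_bound)
    have "(cmod (f x + g x))\<^sup>2 \<le> 2 * (cmod (f x))\<^sup>2 + 2 * (cmod (g x))\<^sup>2" for x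
    proof -
      have "(cmod (f x + g x))\<^sup>2 \<le> (cmod (f x) + cmod (g x))\<^sup>2"
        by (intro power_mono norm_triangle_ineq) simp
      also have "\<dots> \<le> 2 * (cmod (f x))\<^sup>2 + 2 * (cmod (g x))\<^sup>2"
        using sum_squares_bound[of "cmod (f x)" "cmod (g x)"] by (simp add: power2_sum)
      finally show ?thesis .
    qed
    then show "AE x in lborel. norm ((cmod (f x + g x))\<^sup>2) \<le> norm (2 * (cmod (f x))\<^sup>2 + 2 * (cmod (g x))\<^sup>2)"
      by (intro AE_I2) (metis abs_of_nonneg dual_order.trans real_norm_def zero_le_power2)
  qed simp
  then show ?thesis by (simp add: L2_def)
qed

lemma L2_diff [intro]: "L2 f \<Longrightarrow> L2 g \<Longrightarrow> L2 (\<lambda>x. f x - g x)"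
  using L2_add[OF _ L2_uminus, of f g] by simp

lemma L2_sum [intro]: "(\<And>i. i \<in> A \<Longrightarrow> L2 (f i)) \<Longrightarrow> L2 (\<lambda>x. \<Sum>i\<in>A. f i x)"
  by (induction A rule: infinite_finite_induct) auto

lemma L2_bound:
  assumes "L2 g" and [measurable]: "f \<in> borel_measurable lborel" and le: "\<And>x. cmod (f x) \<le> C * cmod (g x)"
  shows "L2 f"
proof -
  note [measurable] = L2_measurable[OF assms(1)]
  have "integrable lborel (\<lambda>x. C\<^sup>2 * (cmod (g x))\<^sup>2)" using L2_integrable[OF assms(1)] by simp
  then have "integrable lborel (\<lambda>x. (cmod (f x))\<^sup>2)"
  proof (rule Bochner_Integration.integrable_bound)
    show "AE x in lborel. norm ((cmod (f x))\<^sup>2) \<le> norm (C\<^sup>2 * (cmod (g x))\<^sup>2)"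
      using power_mono[OF le norm_ge_zero, where n=2] by (intro AE_I2) (auto simp: power_mult_distrib)
  qed simp
  then show ?thesis by (simp add: L2_def)
qed

lemma L2_indicator [intro]:
  assumes "L2 f" and [measurable]: "A \<in> sets lborel"
  shows "L2 (\<lambda>x. f x * indicator A x)"
proof (rule L2_bound[OF assms(1), where C=1])
  note [measurable] = L2_measurable[OF assms(1)]
  show "(\<lambda>x. f x * indicator A x) \<in> borel_measurable lborel" by measurable
qed (auto simp: norm_mult indicator_def)

lemma L2norm_mono:
  assumes "L2 g" "\<And>x. cmod (f x) \<le> cmod (g x)"
  shows "L2norm f \<le> L2norm g"
  unfolding L2norm_def
  by (intro real_sqrt_le_mono integral_mono' L2_integrable assms power_mono) auto

lemma L2norm_triangle:
  assumes "L2 f" "L2 g"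
  shows "L2norm (\<lambda>x. f x + g x) \<le> L2norm f + L2norm g"
proof -
  note [measurable] = assms[THEN L2_measurable]
  note i = L2_integrable[OF L2_add[OF assms]] L2_mult_integrable(1)[OF assms, THEN integrable_norm] assms[THEN L2_integrable]
  have "(L2norm (\<lambda>x. f x + g x))\<^sup>2 \<le> (LINT x|lborel. (cmod (f x))\<^sup>2 + (cmod (g x))\<^sup>2 + 2 * cmod (f x * g x))"
    unfolding L2norm_power2
  proof (rule integral_mono)
    show "(cmod (f x + g x))\<^sup>2 \<le> (cmod (f x))\<^sup>2 + (cmod (g x))\<^sup>2 + 2 * cmod (f x * g x)" for x
      using power_mono[OF norm_triangle_ineq[of "f x" "g x"] norm_ge_zero, of 2]
      by (simp add: power2_sum norm_mult mult.assoc)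
  qed (use i in auto)
  also have "\<dots> = (L2norm f)\<^sup>2 + (L2norm g)\<^sup>2 + 2 * (LINT x|lborel. cmod (f x * g x))"
    using i by (simp add: L2norm_power2)
  also have "\<dots> \<le> (L2norm f + L2norm g)\<^sup>2"
    using L2_mult_integrable(2)[OF assms] by (simp add: power2_sum mult.assoc)
  finally show ?thesis by (rule power2_le_imp_le) simp
qed

lemma L2norm_minus: "L2norm (\<lambda>x. f x - g x) = L2norm (\<lambda>x. g x - f x)"
  by (simp add: L2norm_def norm_minus_commute)

lemma L2norm_triangle_diff:
  assumes "L2 f" "L2 g"
  shows "L2norm (\<lambda>x. f x - g x) \<le> L2norm f + L2norm g"
  using L2norm_triangle[OF assms(1) L2_uminus[OF assms(2)]] L2norm_cmult[of "-1" g] by simp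

lemma L2norm_triangle_minus:
  assumes "L2 f" "L2 g"
  shows "L2norm f \<le> L2norm g + L2norm (\<lambda>x. f x - g x)"
  using L2norm_triangle[OF assms(2) L2_diff[OF assms]] by simp

lemma nn_integral_L2: "L2 f \<Longrightarrow> (\<integral>\<^sup>+x. ennreal ((cmod (f x))\<^sup>2) \<partial>lborel) = ennreal ((L2norm f)\<^sup>2)"
  by (simp add: L2norm_power2 nn_integral_eq_integral L2_integrable)

lemma L2_nn_integralI:
  assumes [measurable]: "f \<in> borel_measurable lborel" and "(\<integral>\<^sup>+x. ennreal ((cmod (f x))\<^sup>2) \<partial>lborel) \<le> ennreal (C\<^sup>2)" "C \<ge> 0"
  shows "L2 f" "L2norm f \<le> C"
proof -
  show 1: "L2 f" unfolding L2_def
    using assms(2) by (auto intro!: integrableI_nonneg simp: le_less_trans[OF _ ennreal_less_top])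
  have "ennreal ((L2norm f)\<^sup>2) \<le> ennreal (C\<^sup>2)" using nn_integral_L2[OF 1] assms(2) by simp
  then have "(L2norm f)\<^sup>2 \<le> C\<^sup>2" by (simp add: ennreal_le_iff)
  then show "L2norm f \<le> C" using assms(3) by (rule power2_le_imp_le)
qed

lemma L2norm_indicator_tail:
  assumes "L2 f"
  shows "(\<lambda>n. L2norm (\<lambda>x. f x * indicator {x. \<bar>x\<bar> > real n} x)) \<longlonglongrightarrow> 0"
proof -
  note [measurable] = L2_measurable[OF assms]
  have "(\<lambda>n. LINT x|lborel. (cmod (f x * indicator {x. \<bar>x\<bar> > real n} x))\<^sup>2) \<longlonglongrightarrow> (LINT (x::real)|lborel. 0 :: real)"
  proof (rule integral_dominated_convergence[OF _ _ L2_integrable[OF assms]])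
    show "AE x in lborel. (\<lambda>n. (cmod (f x * indicator {x. \<bar>x\<bar> > real n} x))\<^sup>2) \<longlonglongrightarrow> 0"
    proof (rule AE_I2)
      fix x :: real
      obtain N where N: "\<bar>x\<bar> \<le> real N" using real_arch_simple by blast
      have "\<forall>\<^sub>F n in sequentially. (cmod (f x * indicator {x. \<bar>x\<bar> > real n} x))\<^sup>2 = 0"
        using eventually_ge_at_top[of N] by eventually_elim (use N in \<open>auto simp: indicator_def\<close>)
      then show "(\<lambda>n. (cmod (f x * indicator {x. \<bar>x\<bar> > real n} x))\<^sup>2) \<longlonglongrightarrow> 0"
        by (rule tendsto_eventually)
    qed
  qed (auto simp: indicator_def)
  from tendsto_real_sqrt[OF this] show ?thesis by (simp add: L2norm_def)
qed

section \<open>Continuity of translations in L1 and L2\<close>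

lemma tendsto_shift_indicator_L1:
  fixes A :: "real set" and X :: "nat \<Rightarrow> real"
  assumes A [measurable]: "A \<in> sets lborel" and fin: "emeasure lborel A < \<infinity>" and X: "X \<longlonglongrightarrow> 0"
  shows "(\<lambda>n. LINT x|lborel. \<bar>indicator A (x + X n) - indicator A x :: real\<bar>) \<longlonglongrightarrow> 0"
proof (rule LIMSEQ_I)
  have shift: "(LINT x|lborel. f (x + t)) = (LINT x|lborel. f x)" "integrable lborel (\<lambda>x. f (x + t)) \<longleftrightarrow> integrable lborel f"
    for t :: real and f :: "real \<Rightarrow> real"
    using lborel_integral_real_affine[of 1 f t] lborel_integrable_real_affine_iff[of 1 f t] by (simp_all add: add.commute)
  fix r :: real assume r: "r > 0"
  \<comment> \<open>For an open set, each of its points stays inside under all small translations,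
    so dominated convergence applies to \<open>U\<close>; outer regularity transfers the result to
    \<open>A\<close>.\<close>
  obtain U where U: "A \<subseteq> U" "open U" "emeasure lborel (U - A) < ennreal (r/4)"
    using outer_regular_lborel[of A "r/4"] A r by auto
  have U_sets [measurable]: "U \<in> sets lborel" using U(2) by simp
  have UA: "emeasure lborel U = emeasure lborel A + emeasure lborel (U - A)"
    using U(1) A U_sets by (subst plus_emeasure) (auto simp: Un_absorb1 intro!: sets.Diff)
  have finU: "emeasure lborel U < \<infinity>" 
    unfolding UA using fin U(3) by (metis ennreal_add_less_top ennreal_less_top infinity_ennreal_def less_trans)
  have expand: "(LINT x|lborel. \<bar>a x - b x\<bar> + \<bar>c x - d x\<bar> + ((a x - c x) + 2 * e x))
      = (LINT x|lborel. \<bar>a x - b x\<bar>) + (LINT x|lborel. \<bar>c x - d x\<bar>) + (((LINT x|lborel. a x) - (LINT x|lborel. c x)) + 2 * (LINT x|lborel. e x))"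
    if "integrable lborel a" "integrable lborel b" "integrable lborel c" "integrable lborel d" "integrable lborel e" for a b c d e :: "real \<Rightarrow> real"
    using that by simp
  have iU: "integrable lborel (indicator U :: real \<Rightarrow> real)" and iA: "integrable lborel (indicator A :: real \<Rightarrow> real)"
    using finU fin A U_sets by (auto intro!: integrable_real_indicator)
  have UAd: "(LINT x|lborel. \<bar>indicator U x - indicator A x :: real\<bar>) < r / 4"
  proof -
    have "(LINT x|lborel. \<bar>indicator U x - indicator A x :: real\<bar>) = (LINT x|lborel. indicator (U - A) x)"
      using U(1) by (intro Bochner_Integration.integral_cong) (auto simp: indicator_def)
    also have "\<dots> = measure lborel (U - A)" by simp
    also have "\<dots> < r / 4"
    proof -
      have "emeasure lborel (U - A) \<noteq> \<top>" using U(3) by (metis ennreal_less_top less_trans less_irrefl)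
      from emeasure_eq_ennreal_measure[OF this] show ?thesis using U(3) r by (simp add: ennreal_less_iff)
    qed
    finally show ?thesis .
  qed
  have lim: "(\<lambda>n. LINT x|lborel. indicator U x * (1 - indicator U (x + X n)) :: real) \<longlonglongrightarrow> (LINT (x::real)|lborel. 0 :: real)"
  proof (rule integral_dominated_convergence[OF _ _ iU])
    show "AE x in lborel. (\<lambda>n. indicator U x * (1 - indicator U (x + X n)) :: real) \<longlonglongrightarrow> 0"
    proof (rule AE_I2)
      fix x :: real
      have "(\<lambda>n. x + X n) \<longlonglongrightarrow> x + 0" by (intro tendsto_intros X)
      then have "\<forall>\<^sub>F n in sequentially. x + X n \<in> U" if "x \<in> U"
        using topological_tendstoD[of "\<lambda>n. x + X n" x sequentially U] U(2) that by simp
      then have "\<forall>\<^sub>F n in sequentially. indicator U x * (1 - indicator U (x + X n)) = (0 :: real)"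
        by (cases "x \<in> U") (auto elim!: eventually_mono)
      then show "(\<lambda>n. indicator U x * (1 - indicator U (x + X n)) :: real) \<longlonglongrightarrow> 0" by (rule tendsto_eventually)
    qed
  qed (auto simp: indicator_def)
  obtain N where N: "\<And>n. n \<ge> N \<Longrightarrow> (LINT x|lborel. indicator U x * (1 - indicator U (x + X n)) :: real) < r / 4"
    using order_tendstoD(2)[OF lim, of "r/4"] r by (auto simp: eventually_sequentially)
  show "\<exists>N. \<forall>n\<ge>N. norm ((LINT x|lborel. \<bar>indicator A (x + X n) - indicator A x :: real\<bar>) - 0) < r"
  proof (intro exI allI impI)
    fix n assume n: "n \<ge> N"
    have iUs: "integrable lborel (\<lambda>x. indicator U (x + X n) :: real)" and iAs: "integrable lborel (\<lambda>x. indicator A (x + X n) :: real)"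
      using iU iA by (auto simp: shift(2))
    have iUU: "integrable lborel (\<lambda>x. indicator U x * (1 - indicator U (x + X n)) :: real)"
      using iU by (rule Bochner_Integration.integrable_bound) (auto simp: indicator_def)
    \<comment> \<open>Pointwise \<open>|1_U(x+t) - 1_U(x)| = (1_U(x+t) - 1_U(x)) + 2 * 1_U(x) * (1 -
      1_U(x+t))\<close>. The bracket integrates to 0 by translation invariance, so only points
      leaving \<open>U\<close> count. They cost \<open>2 * (r/4)\<close>, and the two replacements
      of \<open>A\<close> by \<open>U\<close> cost \<open>r/4\<close> each.\<close>
    have "(LINT x|lborel. \<bar>indicator A (x + X n) - indicator A x :: real\<bar>)
      \<le> (LINT x|lborel. \<bar>indicator U (x + X n) - indicator A (x + X n)\<bar> + \<bar>indicator U x - indicator A x\<bar> 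
           + ((indicator U (x + X n) - indicator U x) + 2 * (indicator U x * (1 - indicator U (x + X n)))))"
      using iU iA iUs iAs iUU
      by (intro integral_mono integrable_abs Bochner_Integration.integrable_add Bochner_Integration.integrable_diff integrable_mult_right)
         (rule iU iA iUs iAs iUU | (auto simp: indicator_def)[1])+
    also have "\<dots> = (LINT x|lborel. \<bar>indicator U (x + X n) - indicator A (x + X n)\<bar>) + (LINT x|lborel. \<bar>indicator U x - indicator A x\<bar>)
        + (((LINT x|lborel. indicator U (x + X n)) - (LINT x|lborel. indicator U x)) + 2 * (LINT x|lborel. indicator U x * (1 - indicator U (x + X n))))"
      by (rule expand[OF iUs iAs iU iA iUU])
    also have "\<dots> < r"
      using UAd N[OF n] shift(1)[of "\<lambda>x. \<bar>indicator U x - indicator A x\<bar>" "X n"] shift(1)[of "indicator U" "X n"] by simp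
    finally show "norm ((LINT x|lborel. \<bar>indicator A (x + X n) - indicator A x :: real\<bar>) - 0) < r" by simp
  qed
qed

text \<open>Induction along the generation of integrable functions: indicators are done, and since
  translation is an L1 isometry the property passes to sums and to dominated limits.\<close>

lemma tendsto_shift_L1:
  fixes f :: "real \<Rightarrow> complex"
  assumes "integrable lborel f" and X: "X \<longlonglongrightarrow> (0::real)"
  shows "(\<lambda>n. LINT x|lborel. cmod (f (x + X n) - f x)) \<longlonglongrightarrow> 0"
  using assms(1)
proof (induct rule: integrable_induct)
  case (base A c)
  have "(\<lambda>n. cmod c * (LINT x|lborel. \<bar>indicator A (x + X n) - indicator A x :: real\<bar>)) \<longlonglongrightarrow> cmod c * 0"
    using base by (intro tendsto_intros tendsto_shift_indicator_L1 X) auto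
  then show ?case
    by (simp add: scaleR_diff_left[symmetric] mult.commute flip: integral_mult_right_zero)
next
  case (add f g)
  have shift: "integrable lborel (\<lambda>x. f (x + t)) \<longleftrightarrow> integrable lborel f" for t and f :: "real \<Rightarrow> complex"
    using lborel_integrable_real_affine_iff[of 1 f t] by (simp add: add.commute)
  note i = add(1,3)[THEN shift[THEN iffD2]] add(1,3)
  show ?case
  proof (rule tendsto_sandwich[OF _ _ tendsto_const])
    show "\<forall>\<^sub>F n in sequentially. (LINT x|lborel. cmod (f (x + X n) + g (x + X n) - (f x + g x)))
       \<le> (LINT x|lborel. cmod (f (x + X n) - f x)) + (LINT x|lborel. cmod (g (x + X n) - g x))"
    proof (intro always_eventually allI)
      fix n
      note j = i(1,2)[of "X n"] i(3,4)
      have "(LINT x|lborel. cmod (f (x + X n) + g (x + X n) - (f x + g x))) \<le> (LINT x|lborel. cmod (f (x + X n) - f x) + cmod (g (x + X n) - g x))"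
        using j norm_triangle_ineq[of "f (x + X n) - f x" "g (x + X n) - g x" for x]
        by (intro integral_mono Bochner_Integration.integrable_add integrable_norm Bochner_Integration.integrable_diff) (auto simp: algebra_simps)
      also have "\<dots> = (LINT x|lborel. cmod (f (x + X n) - f x)) + (LINT x|lborel. cmod (g (x + X n) - g x))"
        using j by (intro Bochner_Integration.integral_add integrable_norm Bochner_Integration.integrable_diff)
      finally show "(LINT x|lborel. cmod (f (x + X n) + g (x + X n) - (f x + g x)))
       \<le> (LINT x|lborel. cmod (f (x + X n) - f x)) + (LINT x|lborel. cmod (g (x + X n) - g x))" .
    qed
    show "(\<lambda>n. (LINT x|lborel. cmod (f (x + X n) - f x)) + (LINT x|lborel. cmod (g (x + X n) - g x))) \<longlonglongrightarrow> 0"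
      using tendsto_add[OF add(2,4)] by simp
  qed simp
next
  case (lim f s)
  have shifti: "integrable lborel (\<lambda>x. f (x + t)) \<longleftrightarrow> integrable lborel f" for t and f :: "real \<Rightarrow> complex"
    using lborel_integrable_real_affine_iff[of 1 f t] by (simp add: add.commute)
  have shift: "(LINT x|lborel. f (x + t)) = (LINT x|lborel. f x)" for t and f :: "real \<Rightarrow> real"
    using lborel_integral_real_affine[of 1 f t] by (simp add: add.commute)
  have [measurable]: "f \<in> borel_measurable lborel" "\<And>i. s i \<in> borel_measurable lborel"
    using lim(1,5) by auto
  have d: "(\<lambda>i. LINT x|lborel. cmod (s i x - f x)) \<longlonglongrightarrow> (LINT (x::real)|lborel. 0 :: real)"
  \<comment> \<open>The approximants obey \<open>|s i| <= 2 * |f|\<close>, hence the majorant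
    \<open>3 * |f|\<close>.\<close>
  proof (rule integral_dominated_convergence[OF _ _ integrable_mult_right[OF integrable_norm[OF lim(5)], of 3]])
    show "AE x in lborel. (\<lambda>i. cmod (s i x - f x)) \<longlonglongrightarrow> 0"
      using lim(3) by (intro AE_I2) (auto simp: tendsto_norm_zero_iff LIM_zero_iff)
    show "AE x in lborel. norm (cmod (s i x - f x)) \<le> 3 * cmod (f x)" for i
      using lim(4)[of _ i] norm_triangle_ineq4[of "s i x" "f x" for x] by (intro AE_I2) (smt (verit) space_lborel UNIV_I real_norm_def abs_norm_cancel)
  qed auto
  show ?case
  proof (rule LIMSEQ_I)
    fix r :: real assume r: "r > 0"
    obtain i where i: "(LINT x|lborel. cmod (s i x - f x)) < r / 3"
      using order_tendstoD(2)[OF d, of "r/3"] r by (auto simp: eventually_sequentially)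
    obtain N where N: "\<And>n. n \<ge> N \<Longrightarrow> (LINT x|lborel. cmod (s i (x + X n) - s i x)) < r / 3"
      using order_tendstoD(2)[OF lim(2)[of i], of "r/3"] r by (auto simp: eventually_sequentially)
    show "\<exists>N. \<forall>n\<ge>N. norm ((LINT x|lborel. cmod (f (x + X n) - f x)) - 0) < r"
    proof (intro exI allI impI)
      fix n assume n: "n \<ge> N"
      note j = lim(1)[of i] lim(5) lim(1)[of i, THEN shifti[THEN iffD2, of _ "X n"]] lim(5)[THEN shifti[THEN iffD2, of _ "X n"]]
      have "(LINT x|lborel. cmod (f (x + X n) - f x)) \<le> (LINT x|lborel. cmod (s i (x + X n) - f (x + X n))
           + cmod (s i (x + X n) - s i x) + cmod (s i x - f x))"
        using j by (intro integral_mono) (auto intro!: norm_triangle_sub,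
           smt (verit) norm_triangle_ineq4 norm_minus_commute norm_triangle_ineq add_diff_eq diff_add_cancel norm_diff_triangle_ineq norm_triangle_sub norm_diff_triangle_le)
      also have "\<dots> = (LINT x|lborel. cmod (s i (x + X n) - f (x + X n))) + (LINT x|lborel. cmod (s i (x + X n) - s i x)) + (LINT x|lborel. cmod (s i x - f x))"
        using j by simp
      also have "\<dots> < r" using shift[of "\<lambda>x. cmod (s i x - f x)" "X n"] i N[OF n] by simp
      finally show "norm ((LINT x|lborel. cmod (f (x + X n) - f x)) - 0) < r" by simp
    qed
  qed
qed

lemma L2_shift: "L2 f \<Longrightarrow> L2 (\<lambda>x. f (x + t))"
  using lborel_integrable_real_affine_iff[of 1 "\<lambda>x. (cmod (f x))\<^sup>2" t]
  by (auto simp: L2_def add.commute)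

lemma L2norm_shift: "L2norm (\<lambda>x. f (x + t)) = L2norm f"
  using lborel_integral_real_affine[of 1 "\<lambda>x. (cmod (f x))\<^sup>2" t]
  by (auto simp: L2norm_def add.commute)

text \<open>Cutting the domain puts the truncations into L1; cutting the height as well makes them
  bounded, which later converts L1 convergence of translations into L2 convergence.\<close>

lemma L2_truncate:
  assumes "L2 f"
  shows "\<exists>F. (\<forall>n. integrable lborel (F n) \<and> L2 (F n) \<and> (\<forall>x. cmod (F n x) \<le> real n)) \<and>
    (\<lambda>n. L2norm (\<lambda>x. f x - F n x)) \<longlonglongrightarrow> 0"
proof -
  define F where "F = (\<lambda>n x. if \<bar>x\<bar> \<le> real n \<and> cmod (f x) \<le> real n then f x else 0)"
  note [measurable] = L2_measurable[OF assms(1)]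
  have [measurable]: "F n \<in> borel_measurable lborel" for n unfolding F_def by measurable
  have 1: "L2 (F n)" for n by (rule L2_bound[OF assms(1), where C=1]) (auto simp: F_def)
  have 2: "cmod (F n x) \<le> n" for n x by (auto simp: F_def)
  have 3: "integrable lborel (F n)" for n
  proof (rule Bochner_Integration.integrable_bound)
    show "integrable lborel (\<lambda>x. real n * indicator {- real n..real n} x :: real)" by simp
  qed (auto simp: F_def indicator_def)
  have "(\<lambda>n. LINT x|lborel. (cmod (f x - F n x))\<^sup>2) \<longlonglongrightarrow> (LINT (x::real)|lborel. 0 :: real)"
  proof (rule integral_dominated_convergence[OF _ _ L2_integrable[OF assms(1)]])
    show "AE x in lborel. (\<lambda>n. (cmod (f x - F n x))\<^sup>2) \<longlonglongrightarrow> 0"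
    proof (rule AE_I2)
      fix x :: real
      obtain N where N: "max \<bar>x\<bar> (cmod (f x)) \<le> real N" using real_arch_simple by blast
      have "\<forall>\<^sub>F n in sequentially. (cmod (f x - F n x))\<^sup>2 = 0"
        using eventually_ge_at_top[of N] by eventually_elim (use N in \<open>auto simp: F_def\<close>)
      then show "(\<lambda>n. (cmod (f x - F n x))\<^sup>2) \<longlonglongrightarrow> 0"
        by (rule tendsto_eventually)
    qed
  qed (auto simp: F_def)
  from tendsto_real_sqrt[OF this] have "(\<lambda>n. L2norm (\<lambda>x. f x - F n x)) \<longlonglongrightarrow> 0" by (simp add: L2norm_def)
  with 1 2 3 show ?thesis by blast
qed

lemma tendsto_shift_L2:
  assumes f: "L2 f" and X: "X \<longlonglongrightarrow> (0::real)"
  shows "(\<lambda>n. L2norm (\<lambda>x. f (x + X n) - f x)) \<longlonglongrightarrow> 0"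
proof (rule LIMSEQ_I)
  fix r :: real assume r: "r > 0"
  obtain F where F: "\<And>n. integrable lborel (F n)" "\<And>n. L2 (F n)" "\<And>n x. cmod (F n x) \<le> real n" "(\<lambda>n. L2norm (\<lambda>x. f x - F n x)) \<longlonglongrightarrow> 0"
    using L2_truncate[OF f] by metis
  note tr = F
  obtain i where i: "L2norm (\<lambda>x. f x - F i x) < r / 4"
    using eventually_happens[OF order_tendstoD(2)[OF tr(4), of "r/4"]] r by auto
  have "(\<lambda>n. sqrt (2 * real i * (LINT x|lborel. cmod (F i (x + X n) - F i x)))) \<longlonglongrightarrow> sqrt (2 * real i * 0)"
    by (intro tendsto_intros tendsto_shift_L1 tr X)
  then obtain N where N: "\<And>n. n \<ge> N \<Longrightarrow> sqrt (2 * real i * (LINT x|lborel. cmod (F i (x + X n) - F i x))) < r / 4"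
    using order_tendstoD(2)[of _ "sqrt (2 * real i * 0)" sequentially "r/4"] r by (auto simp: eventually_sequentially)
  have shifti: "integrable lborel (\<lambda>x. f (x + t)) \<longleftrightarrow> integrable lborel f" for t and f :: "real \<Rightarrow> complex"
    using lborel_integrable_real_affine_iff[of 1 f t] by (simp add: add.commute)
  show "\<exists>N. \<forall>n\<ge>N. norm (L2norm (\<lambda>x. f (x + X n) - f x) - 0) < r"
  proof (intro exI allI impI)
    fix n assume n: "n \<ge> N"
    note L = f tr(2)[of i] f[THEN L2_shift, of "X n"] tr(2)[of i, THEN L2_shift, of "X n"]
    \<comment> \<open>As \<open>|F i| <= i\<close>, the difference \<open>d\<close> satisfies
      \<open>|d|^2 <= 2 * i * |d|\<close>, and the L1 statement applies.\<close>
    have "(LINT x|lborel. (cmod (F i (x + X n) - F i x))\<^sup>2) \<le> (LINT x|lborel. 2 * real i * cmod (F i (x + X n) - F i x))"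
    proof (rule integral_mono)
      show "(cmod (F i (x + X n) - F i x))\<^sup>2 \<le> 2 * real i * cmod (F i (x + X n) - F i x)" for x
        using tr(3)[of i "x + X n"] tr(3)[of i x] norm_triangle_ineq4[of "F i (x + X n)" "F i x"]
        by (auto simp: power2_eq_square intro!: mult_right_mono)
    qed (use L tr(1)[of i] shifti in \<open>auto intro!: L2_integrable\<close>)
    then have "L2norm (\<lambda>x. F i (x + X n) - F i x) \<le> sqrt (2 * real i * (LINT x|lborel. cmod (F i (x + X n) - F i x)))"
      by (simp add: L2norm_def)
    then have a: "L2norm (\<lambda>x. F i (x + X n) - F i x) < r / 4" using N[OF n] by simp
    have b: "L2norm (\<lambda>x. f (x + X n) - F i (x + X n)) < r / 4" using i L2norm_shift[of "\<lambda>x. f x - F i x"] by simp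
    have "(\<lambda>x. f (x + X n) - f x) = (\<lambda>x. ((f (x + X n) - F i (x + X n)) + (F i (x + X n) - F i x)) - (f x - F i x))"
      by auto
    then have "L2norm (\<lambda>x. f (x + X n) - f x) = L2norm (\<lambda>x. ((f (x + X n) - F i (x + X n)) + (F i (x + X n) - F i x)) - (f x - F i x))"
      by (rule arg_cong)
    also have "\<dots> \<le> L2norm (\<lambda>x. (f (x + X n) - F i (x + X n)) + (F i (x + X n) - F i x)) + L2norm (\<lambda>x. f x - F i x)"
      using L by (intro L2norm_triangle_diff L2_add L2_diff)
    also have "\<dots> \<le> L2norm (\<lambda>x. (f (x + X n) - F i (x + X n))) + L2norm (\<lambda>x. F i (x + X n) - F i x) + L2norm (\<lambda>x. f x - F i x)"
      using L by (intro add_right_mono L2norm_triangle L2_add L2_diff)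
    finally show "norm (L2norm (\<lambda>x. f (x + X n) - f x) - 0) < r" using a b i r by simp
  qed
qed

section \<open>Completeness of L2 (Riesz-Fischer)\<close>

lemma L2_complete:
  assumes F: "\<And>n. L2 (F n)"
    and cauchy: "\<And>e. e > 0 \<Longrightarrow> \<exists>N. \<forall>m\<ge>N. \<forall>n\<ge>N. L2norm (\<lambda>x. F m x - F n x) < e"
  shows "\<exists>W. L2 W \<and> (\<lambda>n. L2norm (\<lambda>x. W x - F n x)) \<longlonglongrightarrow> 0"
proof -
  have [measurable]: "F n \<in> borel_measurable lborel" for n using F by (rule L2_measurable)
  obtain K where K: "\<And>j m n. m \<ge> K j \<Longrightarrow> n \<ge> K j \<Longrightarrow> L2norm (\<lambda>x. F m x - F n x) < (1/2) ^ j"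
    using cauchy[of "(1/2)^j" for j] by (auto simp: Bex_def) metis
  \<comment> \<open>Taking maxima lets the single index \<open>k i\<close> meet every tolerance
    \<open>(1/2) ^ j\<close> with \<open>j <= i\<close>.\<close>
  define k where "k = (\<lambda>j. Max (K ` {..j}))"
  have k: "K j \<le> k i" if "j \<le> i" for i j using that unfolding k_def by (intro Max_ge) auto
  \<comment> \<open>The squares of the increments get weights \<open>2 ^ j\<close>. Because the norm
    of \<open>D j\<close> is at most \<open>(1/2) ^ j\<close>, the weighted squares keep a summable
    integral; and since \<open>2 * b <= 2 ^ j * b^2 + (1/2) ^ j\<close>, a finite weighted sum at
    \<open>x\<close> forces absolute convergence of the increments there.\<close>
  define D where "D = (\<lambda>j x. F (k (Suc j)) x - F (k j) x)"
  have [measurable]: "D j \<in> borel_measurable lborel" for j unfolding D_def by simp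
  have D: "L2 (D j)" "L2norm (D j) \<le> (1/2) ^ j" for j
    unfolding D_def using F K[of j "k (Suc j)" "k j"] k[of j j] k[of j "Suc j"] by (auto intro: less_imp_le)
  have "(\<integral>\<^sup>+x. (\<Sum>j. ennreal (2 ^ j * (cmod (D j x))\<^sup>2)) \<partial>lborel) = (\<Sum>j. \<integral>\<^sup>+x. ennreal (2 ^ j * (cmod (D j x))\<^sup>2) \<partial>lborel)"
    by (rule nn_integral_suminf) simp
  also have "\<dots> = (\<Sum>j. ennreal (2 ^ j * (L2norm (D j))\<^sup>2))"
    using D(1) by (intro arg_cong[where f=suminf] ext) (simp add: ennreal_mult nn_integral_cmult nn_integral_L2)
  also have "\<dots> \<le> (\<Sum>j. ennreal ((1/2) ^ j))"
  proof (rule suminf_le)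
    fix j
    have "(2::real) ^ j * (L2norm (D j))\<^sup>2 \<le> 2 ^ j * ((1/2) ^ j)\<^sup>2"
      using D(2)[of j] by (intro mult_left_mono power_mono) auto
    also have "\<dots> = (1/2) ^ j" by (simp add: power2_eq_square field_simps)
    finally show "ennreal (2 ^ j * (L2norm (D j))\<^sup>2) \<le> ennreal ((1/2) ^ j)" by (rule ennreal_leI)
  qed auto
  also have "\<dots> = ennreal (\<Sum>j. (1/2) ^ j)" by (rule suminf_ennreal2) (auto intro: summable_geometric)
  also have "\<dots> < \<infinity>" by simp
  finally have "AE x in lborel. (\<Sum>j. ennreal (2 ^ j * (cmod (D j x))\<^sup>2)) \<noteq> \<infinity>"
    by (intro nn_integral_PInf_AE) auto
  then have ae: "AE x in lborel. convergent (\<lambda>j. F (k j) x)"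
  proof eventually_elim
    fix x assume "(\<Sum>j. ennreal (2 ^ j * (cmod (D j x))\<^sup>2)) \<noteq> \<infinity>"
    then have "summable (\<lambda>j. 2 ^ j * (cmod (D j x))\<^sup>2)"
      by (intro summable_suminf_not_top) auto
    then have s1: "summable (\<lambda>j. 2 ^ j * (cmod (D j x))\<^sup>2 + (1/2) ^ j)"
      by (intro summable_add) (auto intro: summable_geometric)
    have "summable (\<lambda>j. D j x)"
    proof (rule summable_comparison_test'[OF s1, of 0])
      fix j
      define b where "b = cmod (D j x)"
      have "2 * (2 ^ j * b) * 1 \<le> (2 ^ j * b)\<^sup>2 + 1\<^sup>2" by (rule sum_squares_bound)
      also have "(2 ^ j * b)\<^sup>2 + 1\<^sup>2 = 2 ^ j * (2 ^ j * b\<^sup>2 + (1/2) ^ j)"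
        by (simp add: power2_eq_square field_simps)
      finally have "2 ^ j * (2 * b) \<le> 2 ^ j * (2 ^ j * b\<^sup>2 + (1/2) ^ j)" by (simp add: mult_ac)
      then have "2 * b \<le> 2 ^ j * b\<^sup>2 + (1/2) ^ j" by simp
      moreover have "b \<ge> 0" by (simp add: b_def)
      ultimately have "b \<le> 2 ^ j * b\<^sup>2 + (1/2) ^ j" by linarith
      then show "norm (D j x) \<le> 2 ^ j * (cmod (D j x))\<^sup>2 + (1/2) ^ j" by (simp add: b_def)
    qed
    then have "convergent (\<lambda>n. \<Sum>j<n. D j x)" by (simp add: summable_iff_convergent)
    then have "convergent (\<lambda>n. (\<Sum>j<n. D j x) + F (k 0) x)" by (intro convergent_add convergent_const)
    moreover have "(\<Sum>j<n. D j x) + F (k 0) x = F (k n) x" for n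
      unfolding D_def using sum_lessThan_telescope[of "\<lambda>j. F (k j) x" n] by simp
    ultimately show "convergent (\<lambda>j. F (k j) x)" by simp
  qed
  define W where "W = (\<lambda>x. lim (\<lambda>j. F (k j) x))"
  have [measurable]: "W \<in> borel_measurable lborel" unfolding W_def by measurable
  have conv: "AE x in lborel. (\<lambda>j. F (k j) x) \<longlonglongrightarrow> W x"
    using ae by eventually_elim (simp add: W_def convergent_LIMSEQ_iff)
  \<comment> \<open>Fatou's lemma along the subsequence turns the Cauchy bound into a distance to
    the limit, for every \<open>n\<close> beyond \<open>K i\<close> and not only for the members of
    the subsequence.\<close>
  have bnd: "L2 (\<lambda>x. W x - F n x) \<and> L2norm (\<lambda>x. W x - F n x) \<le> (1/2) ^ i" if n: "n \<ge> K i" for n i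
  proof -
    have "(\<integral>\<^sup>+x. ennreal ((cmod (W x - F n x))\<^sup>2) \<partial>lborel) = (\<integral>\<^sup>+x. liminf (\<lambda>j. ennreal ((cmod (F (k j) x - F n x))\<^sup>2)) \<partial>lborel)"
    proof (rule nn_integral_cong_AE, use conv in eventually_elim)
      fix x assume "(\<lambda>j. F (k j) x) \<longlonglongrightarrow> W x"
      then have "(\<lambda>j. ennreal ((cmod (F (k j) x - F n x))\<^sup>2)) \<longlonglongrightarrow> ennreal ((cmod (W x - F n x))\<^sup>2)"
        by (intro tendsto_intros tendsto_ennrealI)
      then show "ennreal ((cmod (W x - F n x))\<^sup>2) = liminf (\<lambda>j. ennreal ((cmod (F (k j) x - F n x))\<^sup>2))"
        by (intro lim_imp_Liminf[symmetric]) auto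
    qed
    also have "\<dots> \<le> liminf (\<lambda>j. \<integral>\<^sup>+x. ennreal ((cmod (F (k j) x - F n x))\<^sup>2) \<partial>lborel)"
      by (rule nn_integral_liminf) simp
    also have "\<dots> = liminf (\<lambda>j. ennreal ((L2norm (\<lambda>x. F (k j) x - F n x))\<^sup>2))"
      using F by (subst nn_integral_L2) auto
    also have "\<dots> \<le> liminf (\<lambda>j. ennreal (((1/2) ^ i)\<^sup>2))"
    proof (rule Liminf_mono)
      show "\<forall>\<^sub>F j in sequentially. ennreal ((L2norm (\<lambda>x. F (k j) x - F n x))\<^sup>2) \<le> ennreal (((1/2) ^ i)\<^sup>2)"
        using eventually_ge_at_top[of i]
      proof eventually_elim
        fix j assume "i \<le> j"
        then have "L2norm (\<lambda>x. F (k j) x - F n x) \<le> (1/2) ^ i" using K[of i "k j" n] k[of i j] n by simp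
        then show "ennreal ((L2norm (\<lambda>x. F (k j) x - F n x))\<^sup>2) \<le> ennreal (((1/2) ^ i)\<^sup>2)"
          by (intro ennreal_leI power_mono) auto
      qed
    qed
    also have "\<dots> = ennreal (((1/2) ^ i)\<^sup>2)" by (simp add: Liminf_const)
    finally show ?thesis using L2_nn_integralI[of "\<lambda>x. W x - F n x" "(1/2)^i"] by auto
  qed
  have "L2 (\<lambda>x. (W x - F (K 0) x) + F (K 0) x)" using bnd[of 0 "K 0"] F by (intro L2_add) auto
  then have "L2 W" by simp
  moreover have "(\<lambda>n. L2norm (\<lambda>x. W x - F n x)) \<longlonglongrightarrow> 0"
  proof (rule LIMSEQ_I)
    fix r :: real assume "r > 0"
    then obtain i where i: "(1/2) ^ i < r" using real_arch_pow_inv[of r "1/2"] by auto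
    then show "\<exists>N. \<forall>n\<ge>N. norm (L2norm (\<lambda>x. W x - F n x) - 0) < r"
      using bnd[of i] by (intro exI[of _ "K i"]) (auto intro: le_less_trans)
  qed
  ultimately show ?thesis by blast
qed

subsection \<open>Rapidly decaying functions and Gaussian integrals\<close>

text \<open>Decay is asked of the function alone, not of its derivatives, so the class is stable
  under multiplication by bounded continuous factors such as \<open>iexp\<close>.\<close>

definition rapid :: "(real \<Rightarrow> 'a::real_normed_vector) \<Rightarrow> bool" where
  "rapid f \<longleftrightarrow> continuous_on UNIV f \<and> (\<forall>k. \<exists>C. \<forall>x. \<bar>x\<bar> ^ k * norm (f x) \<le> C)"

lemma rapidI: "continuous_on UNIV f \<Longrightarrow> (\<And>k. \<exists>C. \<forall>x. \<bar>x\<bar> ^ k * norm (f x) \<le> C) \<Longrightarrow> rapid f"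
  by (simp add: rapid_def)

lemma rapid_continuous: "rapid f \<Longrightarrow> continuous_on UNIV f"
  by (simp add: rapid_def)

lemma rapid_bound: "rapid f \<Longrightarrow> \<exists>C. \<forall>x. \<bar>x\<bar> ^ k * norm (f x) \<le> C"
  by (simp add: rapid_def)

lemma rapid_add:
  assumes "rapid f" "rapid g" shows "rapid (\<lambda>x. f x + g x)"
proof (rule rapidI)
  show "continuous_on UNIV (\<lambda>x. f x + g x)" using assms[THEN rapid_continuous] by (intro continuous_intros)
  fix k
  obtain C D where "\<And>x. \<bar>x\<bar> ^ k * norm (f x) \<le> C" "\<And>x. \<bar>x\<bar> ^ k * norm (g x) \<le> D"
    using rapid_bound[OF assms(1), of k] rapid_bound[OF assms(2), of k] by auto
  then have "\<bar>x\<bar> ^ k * norm (f x) + \<bar>x\<bar> ^ k * norm (g x) \<le> C + D" for x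
    by (intro add_mono) auto
  moreover have "\<bar>x\<bar> ^ k * norm (f x + g x) \<le> \<bar>x\<bar> ^ k * norm (f x) + \<bar>x\<bar> ^ k * norm (g x)" for x
    unfolding distrib_left[symmetric] by (intro mult_left_mono norm_triangle_ineq) auto
  ultimately have "\<bar>x\<bar> ^ k * norm (f x + g x) \<le> C + D" for x
    by (rule order_trans[rotated])
  then show "\<exists>C. \<forall>x. \<bar>x\<bar> ^ k * norm (f x + g x) \<le> C" by blast
qed

lemma rapid_mult_bounded:
  fixes f g :: "real \<Rightarrow> 'a::real_normed_field"
  assumes "rapid f" "continuous_on UNIV g" "\<And>x. norm (g x) \<le> B"
  shows "rapid (\<lambda>x. f x * g x)"
proof (rule rapidI)
  show "continuous_on UNIV (\<lambda>x. f x * g x)" using rapid_continuous[OF assms(1)] assms(2) by (intro continuous_intros)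
  fix k
  obtain C where C: "\<And>x. \<bar>x\<bar> ^ k * norm (f x) \<le> C"
    using rapid_bound[OF assms(1), of k] by auto
  have B: "B \<ge> 0" using assms(3) norm_ge_zero order_trans by blast
  have "\<bar>x\<bar> ^ k * norm (f x * g x) \<le> C * B" for x
  proof -
    have "\<bar>x\<bar> ^ k * norm (f x) * norm (g x) \<le> C * B"
      using C[of x] assms(3)[of x] order_trans[OF _ C[of x], of 0] by (intro mult_mono) auto
    then show ?thesis by (simp add: norm_mult mult.assoc)
  qed
  then show "\<exists>C. \<forall>x. \<bar>x\<bar> ^ k * norm (f x * g x) \<le> C" by blast
qed

lemma rapid_imp_bounded: "rapid f \<Longrightarrow> \<exists>B. \<forall>x. norm (f x) \<le> B"
  using rapid_bound[of f 0] by simp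

lemma rapid_mult:
  fixes f g :: "real \<Rightarrow> 'a::real_normed_field"
  shows "rapid f \<Longrightarrow> rapid g \<Longrightarrow> rapid (\<lambda>x. f x * g x)"
  using rapid_imp_bounded[of g] rapid_mult_bounded[of f g] rapid_continuous[of g] by blast

lemma rapid_cmult:
  fixes f :: "real \<Rightarrow> 'a::real_normed_field"
  shows "rapid f \<Longrightarrow> rapid (\<lambda>x. c * f x)"
  using rapid_mult_bounded[of f "\<lambda>_. c" "norm c"] by (simp add: mult.commute)

lemma rapid_diff:
  fixes f :: "real \<Rightarrow> 'a::real_normed_field"
  shows "rapid f \<Longrightarrow> rapid g \<Longrightarrow> rapid (\<lambda>x. f x - g x)"
  using rapid_add[of f "\<lambda>x. - 1 * g x"] rapid_cmult[of g "-1"] by simp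

lemma rapid_mult_ident:
  fixes f :: "real \<Rightarrow> real"
  assumes "rapid f" shows "rapid (\<lambda>x. x * f x)"
proof (rule rapidI)
  show "continuous_on UNIV (\<lambda>x. x * f x)" using rapid_continuous[OF assms(1)] by (intro continuous_intros)
  show "\<exists>C. \<forall>x. \<bar>x\<bar> ^ k * norm (x * f x) \<le> C" for k
    using rapid_bound[OF assms, of "Suc k"] by (simp add: abs_mult mult_ac)
qed

lemma rapid_of_real: "rapid f \<Longrightarrow> rapid (\<lambda>x. complex_of_real (f x))"
  by (auto simp: rapid_def intro!: continuous_intros)

section \<open>Gaussians, and integrals of rapidly decaying functions\<close>

lemma power_le_exp:
  fixes t :: real assumes "t \<ge> 0" shows "t ^ k / fact k \<le> exp t"
proof -
  have "(\<Sum>n\<in>{k}. t ^ n /\<^sub>R fact n) \<le> (\<Sum>n. t ^ n /\<^sub>R fact n)"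
    using assms exp_converges[of t] by (intro sum_le_suminf) (auto simp: sums_iff)
  then show ?thesis using exp_converges[of t] by (simp add: sums_iff field_simps)
qed

text \<open>One term of the exponential series at \<open>x^2 / 2\<close> controls
  \<open>(x^2) ^ k\<close>, and \<open>|x| ^ k <= 1 + (x^2) ^ k\<close>.\<close>

lemma rapid_gaussian: "rapid (\<lambda>x::real. exp (- x\<^sup>2 / 2))"
proof (rule rapidI)
  fix k
  have "\<bar>x\<bar> ^ k * norm (exp (- x\<^sup>2 / 2)) \<le> 1 + 2 ^ k * fact k" for x :: real
  proof -
    have "(x\<^sup>2 / 2) ^ k / fact k \<le> exp (x\<^sup>2 / 2)"
      by (rule power_le_exp) simp
    then have "(x\<^sup>2) ^ k \<le> 2 ^ k * fact k * exp (x\<^sup>2 / 2)"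
      by (simp add: field_simps power_divide)
    moreover have "\<bar>x\<bar> ^ k \<le> 1 + (x\<^sup>2) ^ k"
    proof (cases "\<bar>x\<bar> \<le> 1")
      case True
      then show ?thesis using power_le_one[of "\<bar>x\<bar>" k] by (simp add: add_increasing2)
    next
      case False
      then have "\<bar>x\<bar> ^ k \<le> \<bar>x\<bar> ^ (2 * k)" by (intro power_increasing) auto
      then show ?thesis by (simp add: power_mult power_even_abs)
    qed
    ultimately have "\<bar>x\<bar> ^ k * exp (- x\<^sup>2 / 2) \<le> (1 + 2 ^ k * fact k * exp (x\<^sup>2 / 2)) * exp (- x\<^sup>2 / 2)"
      by (intro mult_right_mono) auto
    also have "\<dots> = exp (- x\<^sup>2 / 2) + 2 ^ k * fact k"
      by (simp add: algebra_simps flip: exp_add)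
    also have "\<dots> \<le> 1 + 2 ^ k * fact k" by simp
    finally show ?thesis by simp
  qed
  then show "\<exists>C. \<forall>x::real. \<bar>x\<bar> ^ k * norm (exp (- x\<^sup>2 / 2)) \<le> C" by blast
qed (auto intro!: continuous_intros)

lemma integrable_inverse_1_plus_square_lborel: "integrable lborel (\<lambda>x::real. inverse (1 + x\<^sup>2))"
  using integrable_inverse_1_plus_square by (simp add: set_integrable_def einterval_def)

text \<open>The decay orders 0 and 2 together give the majorant
  \<open>(C + D) / (1 + x^2)\<close>.\<close>

lemma rapid_integrable:
  fixes f :: "real \<Rightarrow> 'a::{banach, second_countable_topology}"
  assumes "rapid f" shows "integrable lborel f"
proof -
  obtain C D where CD: "\<And>x. \<bar>x\<bar> ^ 0 * norm (f x) \<le> C" "\<And>x. \<bar>x\<bar> ^ 2 * norm (f x) \<le> D"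
    using rapid_bound[OF assms, of 0] rapid_bound[OF assms, of 2] by blast
  have "norm (f x) \<le> (C + D) * inverse (1 + x\<^sup>2)" for x
  proof -
    have "(1 + x\<^sup>2) * norm (f x) \<le> C + D" using CD[of x] by (simp add: distrib_right)
    then show ?thesis by (simp add: field_simps add_pos_nonneg)
  qed
  then have le: "norm (f x) \<le> norm ((C + D) * inverse (1 + x\<^sup>2))" for x
    using order_trans abs_ge_self by (metis real_norm_def)
  show ?thesis
    by (rule Bochner_Integration.integrable_bound[of _ "\<lambda>x. (C + D) * inverse (1 + x\<^sup>2)"])
      (use le rapid_continuous[OF assms] integrable_inverse_1_plus_square_lborel in \<open>auto intro!: borel_measurable_continuous_onI\<close>)
qed

lemma rapid_tendsto:
  assumes "rapid f" shows "(f \<longlongrightarrow> 0) at_top" "(f \<longlongrightarrow> 0) at_bot"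
proof -
  obtain D where D: "\<And>x. \<bar>x\<bar> ^ 1 * norm (f x) \<le> D"
    using rapid_bound[OF assms, of 1] by blast
  have le: "norm (f x) \<le> D / \<bar>x\<bar>" if "x \<noteq> 0" for x
    using D[of x] that by (simp add: field_simps)
  show "(f \<longlongrightarrow> 0) at_top"
  proof (rule Lim_null_comparison)
    show "\<forall>\<^sub>F x in at_top. norm (f x) \<le> D / \<bar>x\<bar>"
      using eventually_gt_at_top[of 0] by eventually_elim (rule le, simp)
    show "((\<lambda>x::real. D / \<bar>x\<bar>) \<longlongrightarrow> 0) at_top" by real_asymp
  qed
  show "(f \<longlongrightarrow> 0) at_bot"
  proof (rule Lim_null_comparison)
    show "\<forall>\<^sub>F x in at_bot. norm (f x) \<le> D / \<bar>x\<bar>"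
      using eventually_gt_at_bot[of 0] by eventually_elim (rule le, simp)
    show "((\<lambda>x::real. D / \<bar>x\<bar>) \<longlongrightarrow> 0) at_bot" by real_asymp
  qed
qed

text \<open>Integration by parts on the whole line: applied to products, it yields the relations
  among Hermite functions, coherent states and Lagrange functions without boundary terms.\<close>

lemma rapid_integral_derivative:
  fixes F f :: "real \<Rightarrow> 'a::euclidean_space"
  assumes d: "\<And>x. (F has_vector_derivative f x) (at x)" and "rapid F" "rapid f"
  shows "(LINT x|lborel. f x) = 0"
proof -
  have "(LBINT x=-\<infinity>..\<infinity>. f x) = 0 - 0"
  proof (rule interval_integral_FTC_integrable)
    show "isCont f x" for x using rapid_continuous[OF assms(3)] by (simp add: continuous_on_eq_continuous_at)
    show "set_integrable lborel (einterval (-\<infinity>) \<infinity>) f"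
      using rapid_integrable[OF assms(3)] by (simp add: set_integrable_def einterval_def)
    show "((F \<circ> real_of_ereal) \<longlongrightarrow> 0) (at_right (-\<infinity>))"
      using rapid_tendsto(2)[OF assms(2)] by (simp add: ereal_tendsto_simps)
    show "((F \<circ> real_of_ereal) \<longlongrightarrow> 0) (at_left \<infinity>)"
      using rapid_tendsto(1)[OF assms(2)] by (simp add: ereal_tendsto_simps)
  qed (use d in auto)
  then show ?thesis by (simp add: interval_lebesgue_integral_def set_lebesgue_integral_def einterval_def)
qed

lemma rapid_L2:
  assumes "rapid f" shows "L2 f"
proof -
  have "rapid (\<lambda>x. (cmod (f x))\<^sup>2)"
  proof -
    have "rapid (\<lambda>x. cmod (f x))" using assms by (auto simp: rapid_def intro!: continuous_intros)
    then show ?thesis using rapid_mult[of "\<lambda>x. cmod (f x)" "\<lambda>x. cmod (f x)"] by (simp add: power2_eq_square)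
  qed
  then show ?thesis unfolding L2_def using rapid_integrable rapid_continuous[OF assms]
    by (auto intro!: borel_measurable_continuous_onI)
qed

text \<open>The substitution \<open>x = b + t / sqrt a\<close> reduces the integral to the
  characteristic function of the standard normal law.\<close>

lemma integral_gaussian_iexp:
  fixes a b s :: real assumes a: "a > 0"
  shows "(LINT x|lborel. complex_of_real (exp (- a * (x - b)\<^sup>2 / 2)) * iexp (s * x)) =
    complex_of_real (sqrt (2 * pi / a)) * iexp (s * b) * complex_of_real (exp (- s\<^sup>2 / (2 * a)))"
proof -
  have std: "(LINT x|lborel. complex_of_real (exp (- x\<^sup>2 / 2)) * iexp (t * x)) = sqrt (2 * pi) * exp (- t\<^sup>2 / 2)" for t
  proof -
    have "complex_of_real (exp (- t\<^sup>2 / 2)) = (LINT x|density lborel std_normal_density. iexp (t * x))"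
      using char_std_normal_distribution[THEN fun_cong, of t] by (simp add: char_def)
    also have "\<dots> = (LINT x|lborel. std_normal_density x *\<^sub>R iexp (t * x))"
      by (intro integral_density) (auto simp: normal_density_nonneg)
    also have "\<dots> = (LINT x|lborel. complex_of_real (1 / sqrt (2 * pi)) * (complex_of_real (exp (- x\<^sup>2 / 2)) * iexp (t * x)))"
      by (intro Bochner_Integration.integral_cong) (auto simp: std_normal_density_def scaleR_conv_of_real)
    also have "\<dots> = complex_of_real (1 / sqrt (2 * pi)) * (LINT x|lborel. complex_of_real (exp (- x\<^sup>2 / 2)) * iexp (t * x))"
      by (rule integral_mult_right_zero)
    finally show ?thesis by (simp add: field_simps)
  qed
  define r where "r = sqrt a"
  have r: "r > 0" "r\<^sup>2 = a" using a by (auto simp: r_def)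
  have "(LINT x|lborel. complex_of_real (exp (- a * (x - b)\<^sup>2 / 2)) * iexp (s * x)) =
    (1 / r) *\<^sub>R (LINT x|lborel. complex_of_real (exp (- a * (b + (1/r) * x - b)\<^sup>2 / 2)) * iexp (s * (b + (1/r) * x)))"
    using r by (subst lborel_integral_real_affine[of "1/r" _ b]) auto
  also have "(\<lambda>x. complex_of_real (exp (- a * (b + (1/r) * x - b)\<^sup>2 / 2)) * iexp (s * (b + (1/r) * x)))
      = (\<lambda>x. iexp (s * b) * (complex_of_real (exp (- x\<^sup>2 / 2)) * iexp ((s / r) * x)))"
  proof
    fix x
    have "a * (b + (1/r) * x - b)\<^sup>2 = x\<^sup>2" using r a by (simp add: power_divide power_mult_distrib)
    moreover have "iexp (s * (b + (1/r) * x)) = iexp (s * b) * iexp ((s / r) * x)"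
      by (simp add: exp_add[symmetric] algebra_simps)
    ultimately show "complex_of_real (exp (- a * (b + (1/r) * x - b)\<^sup>2 / 2)) * iexp (s * (b + (1/r) * x))
      = iexp (s * b) * (complex_of_real (exp (- x\<^sup>2 / 2)) * iexp ((s / r) * x))" by simp
  qed
  also have "(1 / r) *\<^sub>R (LINT x|lborel. iexp (s * b) * (complex_of_real (exp (- x\<^sup>2 / 2)) * iexp ((s / r) * x)))
     = (1 / r) * iexp (s * b) * (sqrt (2 * pi) * exp (- (s / r)\<^sup>2 / 2))"
    unfolding integral_mult_right_zero std by (simp add: scaleR_conv_of_real)
  also have "\<dots> = complex_of_real (sqrt (2 * pi) / r) * iexp (s * b) * complex_of_real (exp (- s\<^sup>2 / (2 * a)))"
    using r by (simp add: power_divide mult.commute)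
  also have "sqrt (2 * pi) / r = sqrt (2 * pi / a)" by (simp add: r_def real_sqrt_divide)
  finally show ?thesis .
qed

subsection \<open>Hermite functions\<close>

lemma hermite_fun_eq: "hermite_fun n x = hermite n x * exp (- x\<^sup>2 / 2) / (pi powr (1/4) * sqrt (2 ^ n * fact n))"
  by (simp add: hermite_fun_def)

lemma hermite_norm_Suc: "sqrt ((2::real) ^ Suc n * fact (Suc n)) = sqrt (2 * real (Suc n)) * sqrt (2 ^ n * fact n)"
  by (simp add: real_sqrt_mult[symmetric] algebra_simps)

lemma hermite_rec: "2 * x * hermite n x = hermite (Suc n) x + 2 * real n * hermite (n - 1) x"
  by (cases n) auto

lemma hermite_fun_raise: "hermite (Suc n) x * exp (- x\<^sup>2 / 2) / (pi powr (1/4) * sqrt (2 ^ n * fact n)) = sqrt (2 * real (Suc n)) * hermite_fun (Suc n) x"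
  unfolding hermite_fun_eq hermite_norm_Suc by (simp add: field_simps)

lemma hermite_fun_lower: "real n * hermite (n - 1) x * exp (- x\<^sup>2 / 2) / (pi powr (1/4) * sqrt (2 ^ n * fact n)) = sqrt (real n / 2) * hermite_fun (n - 1) x"
proof (cases n)
  case (Suc m)
  have "sqrt (real (Suc m) / 2) * sqrt (2 * real (Suc m)) = real (Suc m)"
    unfolding real_sqrt_mult real_sqrt_divide by (simp del: of_nat_Suc)
  then have q: "real (Suc m) / sqrt (2 * real (Suc m)) = sqrt (real (Suc m) / 2)"
    by (simp add: field_simps)
  show ?thesis
    unfolding Suc hermite_fun_eq hermite_norm_Suc q[symmetric] by (simp add: mult_ac)
qed simp

text \<open>The normalised three-term recurrence. At \<open>n = 0\<close> the truncated index
  \<open>n - 1\<close> is harmless because its coefficient \<open>sqrt (real n / 2)\<close>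
  vanishes; the same convention is used throughout.\<close>

lemma hermite_fun_rec:
  "x * hermite_fun n x = sqrt (real n / 2) * hermite_fun (n - 1) x + sqrt (real (Suc n) / 2) * hermite_fun (Suc n) x"
proof -
  have s: "sqrt (2 * real (Suc n)) / 2 = sqrt (real (Suc n) / 2)"
    unfolding real_sqrt_mult real_sqrt_divide by (simp del: of_nat_Suc add: field_simps)
  have "x * hermite_fun n x = (2 * x * hermite n x) / 2 * exp (- x\<^sup>2 / 2) / (pi powr (1/4) * sqrt (2 ^ n * fact n))"
    by (simp add: hermite_fun_eq)
  also have "\<dots> = sqrt (2 * real (Suc n)) / 2 * hermite_fun (Suc n) x + sqrt (real n / 2) * hermite_fun (n - 1) x"
    unfolding hermite_rec hermite_fun_lower[symmetric] using hermite_fun_raise[of n x]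
    by (simp add: field_simps)
  finally show ?thesis unfolding s by simp
qed

lemma hermite_deriv: "(hermite n has_real_derivative 2 * real n * hermite (n - 1) x) (at x)"
proof (induction n arbitrary: x rule: induct_nat_012)
  case 0
  have "hermite 0 = (\<lambda>x. 1)" by auto
  then show ?case by simp
next
  case 1
  have "hermite (Suc 0) = (\<lambda>x. 2 * x)" by auto
  then show ?case by (auto intro!: derivative_eq_intros)
next
  case (ge2 n)
  have "hermite (Suc (Suc n)) = (\<lambda>x. 2 * x * hermite (Suc n) x - 2 * real (Suc n) * hermite n x)" by auto
  moreover have "2 * real (Suc n) * (2 * x * hermite n x) = 2 * real (Suc n) * (hermite (Suc n) x + 2 * real n * hermite (n - 1) x)"
    by (simp only: hermite_rec)
  ultimately show ?case
    by (auto intro!: derivative_eq_intros ge2 simp: algebra_simps)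
qed

lemma hermite_fun_deriv_lower: 
  "(hermite_fun n has_real_derivative sqrt (2 * real n) * hermite_fun (n - 1) x - x * hermite_fun n x) (at x)"
proof -
  define k where "k = 1 / (pi powr (1/4) * sqrt (2 ^ n * fact n))"
  have eq: "hermite_fun n = (\<lambda>x. k * (hermite n x * exp (- x\<^sup>2 / 2)))"
    by (auto simp: hermite_fun_eq k_def)
  have s: "sqrt (2 * real n) = 2 * sqrt (real n / 2)"
    by (simp add: real_sqrt_divide real_sqrt_mult field_simps)
  have "(hermite_fun n has_real_derivative k * (2 * real n * hermite (n - 1) x * exp (- x\<^sup>2 / 2) - x * (hermite n x * exp (- x\<^sup>2 / 2)))) (at x)"
    unfolding eq by (auto intro!: derivative_eq_intros hermite_deriv)
  also have "k * (2 * real n * hermite (n - 1) x * exp (- x\<^sup>2 / 2) - x * (hermite n x * exp (- x\<^sup>2 / 2)))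
     = sqrt (2 * real n) * hermite_fun (n - 1) x - x * hermite_fun n x"
    unfolding s mult.assoc hermite_fun_lower[symmetric] eq by (simp add: k_def right_diff_distrib)
  finally show ?thesis .
qed

text \<open>Half the difference of the lowering and raising forms of the derivative. This form stays
  in the Hermite basis, so coefficients of derivatives can be read off.\<close>

definition hermite_fun' :: "nat \<Rightarrow> real \<Rightarrow> real" where
  "hermite_fun' n x = sqrt (real n / 2) * hermite_fun (n - 1) x - sqrt (real (Suc n) / 2) * hermite_fun (Suc n) x"

lemma sqrt_double_half: "sqrt (2 * real n) = 2 * sqrt (real n / 2)"
  by (simp add: real_sqrt_divide real_sqrt_mult field_simps)

lemma hermite_fun'_lower: "hermite_fun' n x = sqrt (2 * real n) * hermite_fun (n - 1) x - x * hermite_fun n x"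
  unfolding hermite_fun'_def sqrt_double_half using hermite_fun_rec[of x n] by linarith

lemma hermite_fun'_raise: "hermite_fun' n x = x * hermite_fun n x - sqrt (2 * real (Suc n)) * hermite_fun (Suc n) x"
  unfolding hermite_fun'_def sqrt_double_half using hermite_fun_rec[of x n] by linarith

lemma DERIV_hermite_fun: "(hermite_fun n has_real_derivative hermite_fun' n x) (at x)"
  using hermite_fun_deriv_lower unfolding hermite_fun'_lower .

text \<open>The harmonic oscillator equation: differentiate the lowering form, then raise the
  lowered function back.\<close>

lemma DERIV_hermite_fun': "(hermite_fun' n has_real_derivative (x\<^sup>2 - (2 * real n + 1)) * hermite_fun n x) (at x)"
proof -
  have eq: "hermite_fun' n = (\<lambda>x. sqrt (2 * real n) * hermite_fun (n - 1) x - x * hermite_fun n x)"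
    by (rule ext) (rule hermite_fun'_lower)
  have "((\<lambda>x. sqrt (2 * real n) * hermite_fun (n - 1) x - x * hermite_fun n x) has_real_derivative sqrt (2 * real n) * hermite_fun' (n - 1) x - (hermite_fun n x + x * hermite_fun' n x)) (at x)"
    by (rule derivative_eq_intros DERIV_hermite_fun refl)+ simp
  then have d: "(hermite_fun' n has_real_derivative sqrt (2 * real n) * hermite_fun' (n - 1) x - (hermite_fun n x + x * hermite_fun' n x)) (at x)"
    by (simp only: eq[symmetric])
  have 1: "sqrt (2 * real n) * hermite_fun' (n - 1) x = x * (sqrt (2 * real n) * hermite_fun (n - 1) x) - 2 * real n * hermite_fun n x"
    by (cases n) (simp_all add: hermite_fun'_raise right_diff_distrib)
  have 2: "x * hermite_fun' n x = x * (sqrt (2 * real n) * hermite_fun (n - 1) x) - x\<^sup>2 * hermite_fun n x"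
    unfolding hermite_fun'_lower by (simp add: right_diff_distrib power2_eq_square)
  show ?thesis
    by (rule DERIV_cong[OF d]) (unfold 1 2, simp add: algebra_simps)
qed

lemmas DERIV_hermite_fun_chain [derivative_intros] = DERIV_hermite_fun[THEN DERIV_chain2] DERIV_hermite_fun'[THEN DERIV_chain2]

lemma continuous_hermite_fun: "continuous_on A (hermite_fun n)" "continuous_on A (hermite_fun' n)"
  by (rule DERIV_continuous_on, rule has_field_derivative_at_within, rule DERIV_hermite_fun DERIV_hermite_fun')+

lemma measurable_hermite_fun [measurable]: "hermite_fun n \<in> borel_measurable borel" "hermite_fun' n \<in> borel_measurable borel"
  by (rule borel_measurable_continuous_onI, rule continuous_hermite_fun)+

lemma rapid_hermite: "rapid (\<lambda>x. hermite n x * exp (- x\<^sup>2 / 2))"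
proof (induction n rule: induct_nat_012)
  case 0
  then show ?case using rapid_gaussian by simp
next
  case 1
  then show ?case using rapid_cmult[OF rapid_mult_ident[OF rapid_gaussian], of 2] by (simp add: mult.assoc)
next
  case (ge2 n)
  have "(\<lambda>x. hermite (Suc (Suc n)) x * exp (- x\<^sup>2 / 2)) = (\<lambda>x. 2 * (x * (hermite (Suc n) x * exp (- x\<^sup>2 / 2)))
      - 2 * real (Suc n) * (hermite n x * exp (- x\<^sup>2 / 2)))"
    by (rule ext) (simp add: left_diff_distrib)
  then show ?case
    using rapid_diff[OF rapid_cmult[OF rapid_mult_ident[OF ge2(2)], of 2] rapid_cmult[OF ge2(1), of "2 * real (Suc n)"]]
    by simp
qed

lemma rapid_hermite_fun: "rapid (hermite_fun n)"
proof -
  have "hermite_fun n = (\<lambda>x. (1 / (pi powr (1/4) * sqrt (2 ^ n * fact n))) * (hermite n x * exp (- x\<^sup>2 / 2)))"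
    by (rule ext) (simp add: hermite_fun_eq)
  then show ?thesis using rapid_cmult[OF rapid_hermite[of n], of "1 / (pi powr (1/4) * sqrt (2 ^ n * fact n))"] by metis
qed

lemma rapid_hermite_fun': "rapid (hermite_fun' n)"
  unfolding hermite_fun'_def[abs_def]
  by (rule rapid_diff[OF rapid_cmult[OF rapid_hermite_fun] rapid_cmult[OF rapid_hermite_fun]])

lemma rapid_hermite_fun_mult:
  "rapid (\<lambda>x. hermite_fun n x * hermite_fun m x)" "rapid (\<lambda>x. x * (hermite_fun n x * hermite_fun m x))"
  by (rule rapid_mult[OF rapid_hermite_fun rapid_hermite_fun] rapid_mult_ident[OF rapid_mult[OF rapid_hermite_fun rapid_hermite_fun]])+

lemma integrable_hermite_fun_mult [simp]: "integrable lborel (\<lambda>x. hermite_fun n x * hermite_fun m x)"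
  by (rule rapid_integrable[OF rapid_hermite_fun_mult(1)])

text \<open>In the derivative of \<open>h_n * h_m\<close> the raising form is used for one factor
  and the lowering form for the other, so the terms with a factor \<open>x\<close> cancel.\<close>

lemma hermite_fun_inner_step:
  "sqrt (2 * real (Suc n)) * (LINT x|lborel. hermite_fun (Suc n) x * hermite_fun m x)
    = sqrt (2 * real m) * (LINT x|lborel. hermite_fun n x * hermite_fun (m - 1) x)"
proof -
  have "(LINT x|lborel. sqrt (2 * real m) * (hermite_fun n x * hermite_fun (m - 1) x)
           - sqrt (2 * real (Suc n)) * (hermite_fun (Suc n) x * hermite_fun m x)) = 0"
  proof (rule rapid_integral_derivative)
    show "((\<lambda>x. hermite_fun n x * hermite_fun m x) has_vector_derivative sqrt (2 * real m) * (hermite_fun n x * hermite_fun (m - 1) x)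
           - sqrt (2 * real (Suc n)) * (hermite_fun (Suc n) x * hermite_fun m x)) (at x)" for x
      unfolding has_real_derivative_iff_has_vector_derivative[symmetric]
      by (auto intro!: derivative_eq_intros DERIV_hermite_fun) (subst hermite_fun'_raise, subst hermite_fun'_lower, simp add: algebra_simps)
  qed (rule rapid_diff[OF rapid_cmult rapid_cmult] rapid_hermite_fun_mult)+
  then show ?thesis by simp
qed

lemma hermite_fun_0: "hermite_fun 0 x = exp (- x\<^sup>2 / 2) / pi powr (1/4)"
  by (simp add: hermite_fun_def)

lemma pi_quarter: "pi powr (1/4) * pi powr (1/4) = sqrt pi" "pi powr (1/4) > 0"
  by (auto simp flip: powr_add simp: powr_half_sqrt)

lemma hermite_fun_0_0: "(LINT x|lborel. hermite_fun 0 x * hermite_fun 0 x) = 1"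
proof -
  have "(LINT x|lborel. complex_of_real (exp (- 2 * (x - 0)\<^sup>2 / 2)) * iexp (0 * x)) = complex_of_real (sqrt pi)"
    by (subst integral_gaussian_iexp) auto
  then have "complex_of_real (LINT x|lborel. exp (- x\<^sup>2)) = complex_of_real (sqrt pi)"
    by (simp flip: integral_complex_of_real)
  then have "(LINT x|lborel. exp (- x\<^sup>2)) = sqrt pi" by (rule of_real_eq_iff[THEN iffD1])
  moreover have "hermite_fun 0 x * hermite_fun 0 x = exp (- x\<^sup>2) / sqrt pi" for x
    unfolding hermite_fun_0 pi_quarter(1)[symmetric] by (simp flip: exp_add)
  ultimately show ?thesis by simp
qed

text \<open>Each step lowers both indices by one until one of them is 0; there the factor
  \<open>sqrt (2 * real 0)\<close> kills the product, unless both are 0 and the Gaussian integral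
  remains.\<close>

lemma hermite_fun_orthonormal:
  "(LINT x|lborel. hermite_fun n x * hermite_fun m x) = (if n = m then 1 else 0)"
proof (induction n arbitrary: m)
  case 0
  show ?case
  proof (cases m)
    case (Suc k)
    then show ?thesis using hermite_fun_inner_step[of k 0] by (simp add: mult.commute)
  qed (simp add: hermite_fun_0_0)
next
  case (Suc n)
  have "sqrt (2 * real (Suc n)) * (LINT x|lborel. hermite_fun (Suc n) x * hermite_fun m x) = sqrt (2 * real m) * (if n = m - 1 then 1 else 0)"
    unfolding hermite_fun_inner_step Suc ..
  then show ?case by (cases m) (auto split: if_splits)
qed

definition herm :: "nat \<Rightarrow> real \<Rightarrow> complex" where "herm n x = complex_of_real (hermite_fun n x)"

lemma L2_herm [intro, simp]: "L2 (herm n)"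
  unfolding herm_def[abs_def] by (rule rapid_L2[OF rapid_of_real[OF rapid_hermite_fun]])

lemma herm_orthonormal: "(LINT x|lborel. herm n x * herm m x) = (if n = m then 1 else 0)"
  using hermite_fun_orthonormal[of n m] unfolding herm_def of_real_mult[symmetric] integral_complex_of_real by simp

text \<open>As \<open>herm n\<close> is real-valued, this bilinear integral is the inner product
  with the n-th Hermite function.\<close>

definition coef :: "nat \<Rightarrow> (real \<Rightarrow> complex) \<Rightarrow> complex" where
  "coef n w = (LINT x|lborel. herm n x * w x)"

definition hsum :: "(nat \<Rightarrow> complex) \<Rightarrow> nat \<Rightarrow> real \<Rightarrow> complex" where
  "hsum c K x = (\<Sum>n\<le>K. c n * herm n x)"

definition hproj :: "nat \<Rightarrow> (real \<Rightarrow> complex) \<Rightarrow> real \<Rightarrow> complex" where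
  "hproj K w = hsum (\<lambda>n. coef n w) K"

lemma L2_hsum [intro, simp]: "L2 (hsum c K)"
  unfolding hsum_def[abs_def] by (intro L2_sum L2_cmult L2_herm)

lemma L2_hproj [intro, simp]: "L2 (hproj K w)"
  unfolding hproj_def by auto

lemma coef_diff: "L2 u \<Longrightarrow> L2 v \<Longrightarrow> coef n (\<lambda>x. u x - v x) = coef n u - coef n v"
  unfolding coef_def by (simp add: right_diff_distrib L2_mult_integrable)

lemma coef_hsum: "coef n (hsum c K) = (if n \<le> K then c n else 0)"
proof -
  have hh: "complex_integrable lborel (\<lambda>x. herm n x * herm m x)" for m
    by (rule L2_mult_integrable) auto
  have "coef n (hsum c K) = (LINT x|lborel. (\<Sum>m\<le>K. c m * (herm n x * herm m x)))"
    unfolding coef_def hsum_def by (simp add: sum_distrib_left mult_ac)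
  also have "\<dots> = (\<Sum>m\<le>K. c m * (LINT x|lborel. herm n x * herm m x))"
    using hh by simp
  finally show ?thesis by (simp add: herm_orthonormal if_distrib cong: if_cong)
qed

text \<open>Completing the square in the coefficients. One identity serves several purposes:
  \<open>c n = coef n w\<close> gives the projection error, and \<open>w = 0\<close> gives Parseval
  for finite sums.\<close>

lemma L2norm_minus_hsum:
  assumes w: "L2 w"
  shows "(L2norm (\<lambda>x. w x - hsum c K x))\<^sup>2 = (L2norm w)\<^sup>2 - (\<Sum>n\<le>K. (cmod (coef n w))\<^sup>2) + (\<Sum>n\<le>K. (cmod (coef n w - c n))\<^sup>2)"
proof -
  have cI: "coef n w = (LINT x|lborel. herm n x * w x)" for n by (simp add: coef_def)
  have wi: "complex_integrable lborel (\<lambda>x. w x * cnj (w x))"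
    unfolding complex_norm_square[symmetric] using L2_integrable[OF w] by (rule integrable_of_real)
  have hw: "complex_integrable lborel (\<lambda>x. herm n x * w x)" for n
    by (rule L2_mult_integrable[OF L2_herm w])
  have hwc: "complex_integrable lborel (\<lambda>x. herm n x * cnj (w x))" for n
    using integrable_cnj[of lborel "\<lambda>x. herm n x * w x"] hw[of n] by (simp add: herm_def)
  have cc: "(LINT x|lborel. herm n x * cnj (w x)) = cnj (coef n w)" for n
    using Bochner_Integration.integral_cnj[of lborel "\<lambda>x. herm n x * w x"] unfolding cI by (simp add: herm_def)
  have hh: "complex_integrable lborel (\<lambda>x. herm n x * herm m x)" for n m
    by (rule L2_mult_integrable) auto
  have ex: "(w x - hsum c K x) * cnj (w x - hsum c K x) = w x * cnj (w x) - (\<Sum>n\<le>K. cnj (c n) * (herm n x * w x)) - (\<Sum>n\<le>K. c n * (herm n x * cnj (w x)))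
        + (\<Sum>n\<le>K. \<Sum>m\<le>K. c n * cnj (c m) * (herm n x * herm m x))" for x
  proof -
    have "cnj (hsum c K x) = (\<Sum>n\<le>K. cnj (c n) * herm n x)" by (simp add: hsum_def herm_def)
    then have "(w x - hsum c K x) * cnj (w x - hsum c K x) = w x * cnj (w x) - w x * (\<Sum>n\<le>K. cnj (c n) * herm n x)
        - (\<Sum>n\<le>K. c n * herm n x) * cnj (w x) + (\<Sum>n\<le>K. c n * herm n x) * (\<Sum>n\<le>K. cnj (c n) * herm n x)"
      by (simp add: hsum_def algebra_simps)
    also have "w x * (\<Sum>n\<le>K. cnj (c n) * herm n x) = (\<Sum>n\<le>K. cnj (c n) * (herm n x * w x))"
      by (simp add: sum_distrib_left mult_ac)
    also have "(\<Sum>n\<le>K. c n * herm n x) * cnj (w x) = (\<Sum>n\<le>K. c n * (herm n x * cnj (w x)))"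
      by (simp add: sum_distrib_left mult_ac)
    also have "(\<Sum>n\<le>K. c n * herm n x) * (\<Sum>n\<le>K. cnj (c n) * herm n x) = (\<Sum>n\<le>K. \<Sum>m\<le>K. c n * cnj (c m) * (herm n x * herm m x))"
      by (simp add: sum_product mult_ac)
    finally show ?thesis .
  qed
  have "complex_of_real ((L2norm (\<lambda>x. w x - hsum c K x))\<^sup>2) = (LINT x|lborel. (w x - hsum c K x) * cnj (w x - hsum c K x))"
    unfolding L2norm_power2 integral_complex_of_real[symmetric] complex_norm_square ..
  also have "\<dots> = (LINT x|lborel. w x * cnj (w x)) - (\<Sum>n\<le>K. cnj (c n) * coef n w) - (\<Sum>n\<le>K. c n * cnj (coef n w))
        + (\<Sum>n\<le>K. \<Sum>m\<le>K. c n * cnj (c m) * (LINT x|lborel. herm n x * herm m x))"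
    unfolding ex using wi hw hwc hh by (simp add: cc cI)
  also have "(\<Sum>n\<le>K. \<Sum>m\<le>K. c n * cnj (c m) * (LINT x|lborel. herm n x * herm m x)) = (\<Sum>n\<le>K. c n * cnj (c n))"
    by (simp add: herm_orthonormal if_distrib cong: if_cong)
  also have "(LINT x|lborel. w x * cnj (w x)) = complex_of_real ((L2norm w)\<^sup>2)"
    unfolding L2norm_power2 integral_complex_of_real[symmetric] complex_norm_square ..
  also have "complex_of_real ((L2norm w)\<^sup>2) - (\<Sum>n\<le>K. cnj (c n) * coef n w) - (\<Sum>n\<le>K. c n * cnj (coef n w)) + (\<Sum>n\<le>K. c n * cnj (c n))
     = complex_of_real ((L2norm w)\<^sup>2 - (\<Sum>n\<le>K. (cmod (coef n w))\<^sup>2) + (\<Sum>n\<le>K. (cmod (coef n w - c n))\<^sup>2))"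
    unfolding of_real_add of_real_diff of_real_sum complex_norm_square complex_cnj_diff right_diff_distrib left_diff_distrib
    by (simp add: sum_subtractf sum.distrib mult.commute)
  finally show ?thesis by (simp only: of_real_eq_iff)
qed

lemma L2norm_hsum: "(L2norm (hsum c K))\<^sup>2 = (\<Sum>n\<le>K. (cmod (c n))\<^sup>2)"
proof -
  have "L2norm (\<lambda>x. 0 - hsum c K x) = L2norm (hsum c K)" by (simp add: L2norm_def)
  moreover have "L2norm (\<lambda>x. 0) = 0" by (simp add: L2norm_def)
  ultimately show ?thesis using L2norm_minus_hsum[OF L2_zero, of c K] by (simp add: coef_def)
qed

lemma L2norm_minus_hproj:
  "L2 w \<Longrightarrow> (L2norm (\<lambda>x. w x - hproj K w x))\<^sup>2 = (L2norm w)\<^sup>2 - (\<Sum>n\<le>K. (cmod (coef n w))\<^sup>2)"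
  unfolding hproj_def by (simp add: L2norm_minus_hsum)

lemma coef_minus_hproj: "L2 w \<Longrightarrow> n \<le> K \<Longrightarrow> coef n (\<lambda>x. w x - hproj K w x) = 0"
  by (simp add: coef_diff hproj_def coef_hsum)

lemma coef_minus_hproj_gt: "L2 w \<Longrightarrow> n > K \<Longrightarrow> coef n (\<lambda>x. w x - hproj K w x) = coef n w"
  by (simp add: coef_diff hproj_def coef_hsum)

lemma cmod_coef_le: "L2 w \<Longrightarrow> cmod (coef n w) \<le> L2norm w"
proof -
  assume w: "L2 w"
  have "L2norm (herm n) = 1"
    using hermite_fun_orthonormal[of n n] by (simp add: L2norm_def herm_def power2_eq_square)
  then show ?thesis using L2_mult_integrable(3)[OF L2_herm w, of n] by (simp add: coef_def)
qed

subsection \<open>Hermite polynomials and coherent states\<close>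

text \<open>The Hermite polynomials as formal polynomials over any commutative ring: the complex
  version describes \<open>Pspace\<close>, the real one is divided by linear factors at the
  nodes.\<close>

fun hpoly :: "nat \<Rightarrow> 'a::comm_ring_1 poly" where
  "hpoly 0 = 1"
| "hpoly (Suc 0) = [:0, 2:]"
| "hpoly (Suc (Suc n)) = [:0, 2:] * hpoly (Suc n) - smult (2 * of_nat (Suc n)) (hpoly n)"

lemma poly_hpoly: "poly (hpoly n) (of_real x :: 'a::{real_algebra_1, comm_ring_1}) = of_real (hermite n x)"
  by (induction n rule: hpoly.induct) (auto simp: algebra_simps)

lemma coeff_hpoly_gt: "m > n \<Longrightarrow> coeff (hpoly n) m = 0"
proof (induction n arbitrary: m rule: hpoly.induct)
  case 1
  then show ?case by (simp add: coeff_eq_0)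
next
  case 2
  then show ?case by (simp add: coeff_eq_0)
next
  case (3 n)
  then obtain m' where "m = Suc m'" by (cases m) auto
  then show ?case using 3 by simp
qed

lemma degree_hpoly_le: "degree (hpoly n) \<le> n"
  by (intro degree_le) (auto intro: coeff_hpoly_gt)

lemma coeff_hpoly: "coeff (hpoly n) n = 2 ^ n"
  by (induction n rule: hpoly.induct) (auto simp: coeff_hpoly_gt)

lemma herm_hpoly:
  "herm n x = of_real (exp (- x\<^sup>2 / 2)) * (poly (hpoly n) (of_real x) / of_real (pi powr (1/4) * sqrt (2 ^ n * fact n)))"
  unfolding herm_def poly_hpoly hermite_fun_eq by simp

lemma hermite_norm_pos: "pi powr (1/4) * sqrt (2 ^ n * fact n) > 0"
  by simp

lemma hsum_cong: "(\<And>n. n \<le> K \<Longrightarrow> c n = d n) \<Longrightarrow> hsum c K = hsum d K"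
  by (auto simp: hsum_def)

text \<open>The top coefficient is peeled off with a multiple of \<open>hpoly (Suc K)\<close>, whose
  leading coefficient is \<open>2 ^ Suc K\<close>.\<close>

lemma gaussian_poly_eq_hsum:
  fixes \<psi> :: "complex poly"
  assumes "degree \<psi> \<le> K"
  shows "\<exists>c. \<forall>x. of_real (exp (- x\<^sup>2 / 2)) * poly \<psi> (of_real x) = hsum c K x"
  using assms
proof (induction K arbitrary: \<psi>)
  case 0
  then obtain a where a: "\<psi> = [:a:]" by (metis degree_eq_zeroE le_zero_eq)
  then show ?case
    by (intro exI[of _ "\<lambda>_. a * of_real (pi powr (1/4))"]) (simp add: hsum_def herm_hpoly)
next
  case (Suc K)
  define k where "k = complex_of_real (pi powr (1/4) * sqrt (2 ^ Suc K * fact (Suc K)))"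
  have k: "k \<noteq> 0" using hermite_norm_pos[of "Suc K"] unfolding k_def of_real_eq_0_iff by linarith
  define a where "a = coeff \<psi> (Suc K) / 2 ^ Suc K"
  define \<psi>' where "\<psi>' = \<psi> - smult a (hpoly (Suc K))"
  have "degree \<psi>' \<le> K"
  proof (rule degree_le, intro allI impI)
    fix i assume "K < i"
    then consider "i = Suc K" | "i > Suc K" by linarith
    then show "coeff \<psi>' i = 0"
    proof cases
      case 1
      then show ?thesis by (simp only: \<psi>'_def coeff_diff coeff_smult coeff_hpoly) (simp add: a_def)
    next
      case 2
      then show ?thesis using Suc.prems by (simp add: \<psi>'_def coeff_hpoly_gt coeff_eq_0 del: hpoly.simps)
    qed
  qed
  from Suc.IH[OF this] obtain c where c: "\<And>x. of_real (exp (- x\<^sup>2 / 2)) * poly \<psi>' (of_real x) = hsum c K x" by blast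
  have "of_real (exp (- x\<^sup>2 / 2)) * poly \<psi> (of_real x) = hsum (c(Suc K := a * k)) (Suc K) x" for x
  proof -
    have "poly \<psi> z = poly \<psi>' z + a * poly (hpoly (Suc K)) z" for z
      by (simp add: \<psi>'_def del: hpoly.simps)
    then have "of_real (exp (- x\<^sup>2 / 2)) * poly \<psi> (of_real x) = hsum c K x + a * (of_real (exp (- x\<^sup>2 / 2)) * poly (hpoly (Suc K)) (of_real x))"
      by (simp only: c[symmetric] distrib_left mult.left_commute)
    also have "of_real (exp (- x\<^sup>2 / 2)) * poly (hpoly (Suc K)) (of_real x) = k * herm (Suc K) x"
      unfolding herm_hpoly k_def[symmetric] using k by (simp del: hpoly.simps)
    also have "hsum c K x = hsum (c(Suc K := a * k)) K x"
      by (rule fun_cong[OF hsum_cong]) auto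
    finally show ?thesis by (simp add: hsum_def mult.assoc)
  qed
  then show ?case by blast
qed

lemma hsum_eq_gaussian_poly:
  "\<exists>\<psi>::complex poly. degree \<psi> \<le> K \<and> (\<forall>x. hsum c K x = of_real (exp (- x\<^sup>2 / 2)) * poly \<psi> (of_real x))"
proof (intro exI conjI allI)
  let ?\<psi> = "\<Sum>n\<le>K. smult (c n / of_real (pi powr (1/4) * sqrt (2 ^ n * fact n))) (hpoly n)"
  show "degree ?\<psi> \<le> K"
    by (rule degree_sum_le) (use degree_hpoly_le in \<open>auto intro: order_trans degree_smult_le\<close>)
  show "hsum c K x = of_real (exp (- x\<^sup>2 / 2)) * poly ?\<psi> (of_real x)" for x
    by (simp add: hsum_def herm_hpoly poly_sum sum_distrib_left mult_ac)
qed

text \<open>Such products lie in the span of the Hermite functions up to \<open>N\<close>, so their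
  coefficient of index \<open>Suc N\<close> is 0.\<close>

lemma hermite_fun_orth_poly:
  fixes p :: "real poly"
  assumes "degree p \<le> N"
  shows "(LINT x|lborel. hermite_fun (Suc N) x * (exp (- x\<^sup>2 / 2) * poly p x)) = 0"
proof -
  define \<psi> where "\<psi> = map_poly complex_of_real p"
  have \<psi>: "poly \<psi> (of_real x) = of_real (poly p x)" for x
    unfolding \<psi>_def by (induction p) (auto simp: map_poly_pCons)
  have "degree \<psi> \<le> N" using assms unfolding \<psi>_def by (simp add: degree_map_poly)
  from gaussian_poly_eq_hsum[OF this] obtain c where c: "\<And>x. of_real (exp (- x\<^sup>2 / 2)) * poly \<psi> (of_real x) = hsum c N x" by blast
  have "complex_of_real (LINT x|lborel. hermite_fun (Suc N) x * (exp (- x\<^sup>2 / 2) * poly p x)) = coef (Suc N) (hsum c N)"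
    unfolding coef_def c[symmetric] \<psi> herm_def of_real_mult[symmetric] integral_complex_of_real ..
  then show ?thesis by (simp add: coef_hsum)
qed

text \<open>The complex conjugate of the usual wave packet at position \<open>q\<close> and momentum
  \<open>p\<close>; the plain integral against \<open>u\<close> is then the inner product, and also
  a Fourier integral in \<open>p\<close>.\<close>

definition coherent :: "real \<Rightarrow> real \<Rightarrow> real \<Rightarrow> complex" where
  "coherent q p x = complex_of_real (hermite_fun 0 (x - q)) * iexp (- p * x)"

lemma measurable_coherent [measurable]:
  "(\<lambda>x. coherent (f x) (g x) (k x)) \<in> borel_measurable M" if [measurable]: "f \<in> borel_measurable M" "g \<in> borel_measurable M" "k \<in> borel_measurable M"
  unfolding coherent_def by measurable

lemma cmod_coherent: "cmod (coherent q p x) = hermite_fun 0 (x - q)"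
  unfolding coherent_def norm_mult norm_of_real norm_exp_i_times by (simp add: hermite_fun_0)

lemma hermite_fun_0_nonneg: "hermite_fun 0 x \<ge> 0"
  by (simp add: hermite_fun_0)

lemma integrable_gaussian_shift: "integrable lborel (\<lambda>x. (hermite_fun 0 (x - q))\<^sup>2)"
  and integral_gaussian_shift: "(LINT x|lborel. (hermite_fun 0 (x - q))\<^sup>2) = 1"
  using lborel_integral_real_affine[of 1 "\<lambda>x. (hermite_fun 0 x)\<^sup>2" "- q"] hermite_fun_orthonormal[of 0 0]
    lborel_integrable_real_affine_iff[of 1 "\<lambda>x. (hermite_fun 0 x)\<^sup>2" "- q"] integrable_hermite_fun_mult[of 0 0]
  by (simp_all add: power2_eq_square)

lemma L2_coherent [simp, intro]: "L2 (coherent q p)"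
  using integrable_gaussian_shift[of q] by (simp add: L2_def cmod_coherent)

lemma L2norm_coherent: "L2norm (coherent q p) = 1"
  by (simp add: L2norm_def cmod_coherent integral_gaussian_shift)

lemma coef_coherent_0: "(cmod (coef 0 (coherent q p)))\<^sup>2 = exp (- (q\<^sup>2 + p\<^sup>2) / 2)"
proof -
  have "hermite_fun 0 x * hermite_fun 0 (x - q) = exp (- q\<^sup>2 / 4) / sqrt pi * exp (- 2 * (x - q / 2)\<^sup>2 / 2)" for x
  proof -
    have "hermite_fun 0 x * hermite_fun 0 (x - q) = exp (- x\<^sup>2 / 2 + - (x - q)\<^sup>2 / 2) / sqrt pi"
      unfolding hermite_fun_0 pi_quarter(1)[symmetric] exp_add by simp
    also have "- x\<^sup>2 / 2 + - (x - q)\<^sup>2 / 2 = - q\<^sup>2 / 4 + - 2 * (x - q / 2)\<^sup>2 / 2"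
      by (simp add: power2_eq_square field_simps)
    finally show ?thesis unfolding exp_add by simp
  qed
  then have "herm 0 x * coherent q p x = complex_of_real (exp (- q\<^sup>2 / 4) / sqrt pi) * (complex_of_real (exp (- 2 * (x - q / 2)\<^sup>2 / 2)) * iexp (- p * x))" for x
    unfolding herm_def coherent_def mult.assoc[symmetric] of_real_mult[symmetric] by simp
  then have "coef 0 (coherent q p) = complex_of_real (exp (- q\<^sup>2 / 4) / sqrt pi) * (LINT x|lborel. complex_of_real (exp (- 2 * (x - q / 2)\<^sup>2 / 2)) * iexp (- p * x))"
    unfolding coef_def by simp
  also have "\<dots> = complex_of_real (exp (- q\<^sup>2 / 4)) * iexp (- p * (q / 2)) * complex_of_real (exp (- p\<^sup>2 / 4))"
    by (subst integral_gaussian_iexp) auto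
  finally have "cmod (coef 0 (coherent q p)) = exp (- q\<^sup>2 / 4) * exp (- p\<^sup>2 / 4)"
    by (simp add: norm_mult del: of_real_mult of_real_minus)
  then show ?thesis
    by (simp add: power2_eq_square field_simps flip: exp_add)
qed

text \<open>Coherent states are eigenvectors of the lowering operator. Concretely, in the derivative
  of \<open>h_n\<close> times the packet the terms with a factor \<open>x\<close> cancel and the
  eigenvalue \<open>q - i p\<close> remains.\<close>

lemma coef_coherent_Suc:
  "complex_of_real (sqrt (2 * real (Suc n))) * coef (Suc n) (coherent q p) = Complex q (- p) * coef n (coherent q p)"
proof -
  let ?F = "\<lambda>x. herm n x * coherent q p x"
  have bnd: "rapid (\<lambda>x. herm m x * coherent q p x)" for m
  proof (rule rapid_mult_bounded)
    show "rapid (herm m)" unfolding herm_def[abs_def] by (rule rapid_of_real[OF rapid_hermite_fun])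
    show "continuous_on UNIV (coherent q p)" unfolding coherent_def[abs_def]
      by (intro continuous_intros continuous_on_compose2[OF continuous_hermite_fun(1)]) auto
    show "norm (coherent q p x) \<le> 1 / pi powr (1/4)" for x
      unfolding cmod_coherent hermite_fun_0 by (intro divide_right_mono) auto
  qed
  have "(LINT x|lborel. Complex q (- p) * ?F x - complex_of_real (sqrt (2 * real (Suc n))) * (herm (Suc n) x * coherent q p x)) = 0"
  proof (rule rapid_integral_derivative)
    fix x
    have g: "((\<lambda>x. hermite_fun 0 (x - q)) has_real_derivative - (x - q) * hermite_fun 0 (x - q)) (at x)"
      by (auto intro!: derivative_eq_intros simp: hermite_fun'_lower algebra_simps)
    have "(?F has_vector_derivative (herm n x * (complex_of_real (hermite_fun 0 (x - q)) * (- \<i> * p * iexp (- p * x)) + complex_of_real (- (x - q) * hermite_fun 0 (x - q)) * iexp (- p * x))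
       + complex_of_real (hermite_fun' n x) * coherent q p x)) (at x)"
      unfolding herm_def coherent_def
    proof (intro has_vector_derivative_mult has_vector_derivative_of_real)
      show "((\<lambda>x. iexp (- p * x)) has_vector_derivative - \<i> * p * iexp (- p * x)) (at x)"
      proof -
        have "((\<lambda>z. exp (- \<i> * p * z)) has_field_derivative - \<i> * p * exp (- \<i> * p * of_real x)) (at (of_real x))"
          by (auto intro!: derivative_eq_intros)
        from has_vector_derivative_real_field[OF this] show ?thesis by (simp add: mult.assoc)
      qed
    qed (use g DERIV_hermite_fun in \<open>simp_all add: has_real_derivative_iff_has_vector_derivative\<close>)
    also have "(herm n x * (complex_of_real (hermite_fun 0 (x - q)) * (- \<i> * p * iexp (- p * x)) + complex_of_real (- (x - q) * hermite_fun 0 (x - q)) * iexp (- p * x))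
       + complex_of_real (hermite_fun' n x) * coherent q p x) = Complex q (- p) * ?F x - complex_of_real (sqrt (2 * real (Suc n))) * (herm (Suc n) x * coherent q p x)"
      unfolding hermite_fun'_raise herm_def coherent_def Complex_eq by (simp add: algebra_simps)
    finally show "(?F has_vector_derivative Complex q (- p) * ?F x - complex_of_real (sqrt (2 * real (Suc n))) * (herm (Suc n) x * coherent q p x)) (at x)" .
  qed (rule bnd rapid_diff[OF rapid_cmult rapid_cmult])+
  then show ?thesis
    unfolding coef_def using bnd[THEN rapid_integrable] by simp
qed

lemma coef_coherent:
  "(cmod (coef n (coherent q p)))\<^sup>2 = exp (- (q\<^sup>2 + p\<^sup>2) / 2) * ((q\<^sup>2 + p\<^sup>2) / 2) ^ n / fact n"
proof (induction n)
  case 0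
  then show ?case using coef_coherent_0 by simp
next
  case (Suc n)
  have "(cmod (complex_of_real (sqrt (2 * real (Suc n))) * coef (Suc n) (coherent q p)))\<^sup>2 = (cmod (Complex q (- p) * coef n (coherent q p)))\<^sup>2"
    unfolding coef_coherent_Suc ..
  then have "2 * real (Suc n) * (cmod (coef (Suc n) (coherent q p)))\<^sup>2 = (q\<^sup>2 + p\<^sup>2) * (cmod (coef n (coherent q p)))\<^sup>2"
    unfolding norm_mult power_mult_distrib norm_of_real power2_abs by (simp add: cmod_def)
  then have "(cmod (coef (Suc n) (coherent q p)))\<^sup>2 = (q\<^sup>2 + p\<^sup>2) * (cmod (coef n (coherent q p)))\<^sup>2 / (2 * real (Suc n))"
    by (simp add: field_simps del: of_nat_Suc)
  then show ?case unfolding Suc by (simp del: of_nat_Suc add: mult_ac)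
qed

text \<open>Exponential tilting: the term of index \<open>n > K\<close> is multiplied by
  \<open>2 ^ n / 2 ^ Suc K\<close>, which is at least 1, and the tilted series is completed to
  \<open>exp (2 * \<mu>)\<close>.\<close>

lemma exp_tail_bound:
  fixes \<mu> :: real assumes "\<mu> \<ge> 0"
  shows "exp \<mu> - (\<Sum>n\<le>K. \<mu> ^ n / fact n) \<le> exp (2 * \<mu>) / 2 ^ Suc K"
proof -
  have s: "(\<lambda>n. t ^ n / fact n) sums exp t" for t :: real
    using exp_converges[of t] by (simp add: field_simps)
  have "exp \<mu> - (\<Sum>n\<le>K. \<mu> ^ n / fact n) = (\<Sum>n. \<mu> ^ (n + Suc K) / fact (n + Suc K))"
    using suminf_minus_initial_segment[OF sums_summable[OF s[of \<mu>]], of "Suc K"] s[of \<mu>, THEN sums_unique]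
    by (simp add: lessThan_Suc_atMost)
  also have "\<dots> \<le> (\<Sum>n. (2 * \<mu>) ^ (n + Suc K) / fact (n + Suc K) / 2 ^ Suc K)"
  proof (rule suminf_le)
    show "summable (\<lambda>n. \<mu> ^ (n + Suc K) / fact (n + Suc K))"
      using s[of \<mu>] by (intro summable_ignore_initial_segment) (auto simp: sums_iff)
    show "summable (\<lambda>n. (2 * \<mu>) ^ (n + Suc K) / fact (n + Suc K) / 2 ^ Suc K)"
      using s[of "2 * \<mu>"] by (intro summable_divide summable_ignore_initial_segment) (auto simp: sums_iff)
    fix n
    have "\<mu> ^ (n + Suc K) * 1 \<le> \<mu> ^ (n + Suc K) * 2 ^ n" using assms by (intro mult_left_mono) auto
    moreover have "(2 * \<mu>) ^ (n + Suc K) / fact (n + Suc K) / 2 ^ Suc K = \<mu> ^ (n + Suc K) * 2 ^ n / fact (n + Suc K)"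
      by (simp add: power_mult_distrib power_add)
    ultimately show "\<mu> ^ (n + Suc K) / fact (n + Suc K) \<le> (2 * \<mu>) ^ (n + Suc K) / fact (n + Suc K) / 2 ^ Suc K"
      using divide_right_mono[of "\<mu> ^ (n + Suc K) * 1" "\<mu> ^ (n + Suc K) * 2 ^ n" "fact (n + Suc K)"] by (simp only: fact_ge_zero mult_1_right)
  qed
  also have "\<dots> = (\<Sum>n. (2 * \<mu>) ^ (n + Suc K) / fact (n + Suc K)) / 2 ^ Suc K"
    using s[of "2 * \<mu>"] by (intro suminf_divide summable_ignore_initial_segment) (auto simp: sums_iff)
  also have "(\<Sum>n. (2 * \<mu>) ^ (n + Suc K) / fact (n + Suc K)) = exp (2 * \<mu>) - (\<Sum>n<Suc K. (2 * \<mu>) ^ n / fact n)"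
    using suminf_minus_initial_segment[OF sums_summable[OF s[of "2 * \<mu>"]], of "Suc K"] s[of "2 * \<mu>", THEN sums_unique]
    by simp
  also have "\<dots> / 2 ^ Suc K \<le> exp (2 * \<mu>) / 2 ^ Suc K"
    using assms by (intro divide_right_mono) (simp_all add: sum_nonneg del: sum.lessThan_Suc)
  finally show ?thesis by simp
qed

text \<open>Only the part of the coherent state beyond index \<open>K\<close> pairs with
  \<open>v\<close>. Its squared norm is a Poisson tail, at most
  \<open>exp (- \<mu>) * exp (2 * \<mu>) / 2 ^ Suc K\<close>.\<close>

lemma coherent_inner_orth_bound:
  assumes v: "L2 v" and orth: "\<And>n. n \<le> K \<Longrightarrow> coef n v = 0"
  shows "(cmod (LINT x|lborel. coherent q p x * v x))\<^sup>2 \<le> (L2norm v)\<^sup>2 * (exp ((q\<^sup>2 + p\<^sup>2) / 2) / 2 ^ Suc K)"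
proof -
  define \<mu> where "\<mu> = (q\<^sup>2 + p\<^sup>2) / 2"
  have \<mu>: "\<mu> \<ge> 0" by (simp add: \<mu>_def)
  have "- (q\<^sup>2 + p\<^sup>2) / 2 = - \<mu>" by (simp add: \<mu>_def field_simps)
  then have cc: "(cmod (coef n (coherent q p)))\<^sup>2 = exp (- \<mu>) * \<mu> ^ n / fact n" for n
    by (simp only: coef_coherent \<mu>_def[symmetric])
  let ?P = "hproj K (coherent q p)"
  have hv: "complex_integrable lborel (\<lambda>x. herm n x * v x)" for n by (rule L2_mult_integrable[OF L2_herm v])
  have "(LINT x|lborel. ?P x * v x) = (LINT x|lborel. (\<Sum>n\<le>K. coef n (coherent q p) * (herm n x * v x)))"
    by (simp add: hproj_def hsum_def sum_distrib_right mult.assoc)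
  also have "\<dots> = (\<Sum>n\<le>K. coef n (coherent q p) * coef n v)"
    using hv by (simp add: coef_def)
  also have "\<dots> = 0" using orth by simp
  finally have e: "(LINT x|lborel. coherent q p x * v x) = (LINT x|lborel. (coherent q p x - ?P x) * v x)"
    using v by (simp add: left_diff_distrib L2_mult_integrable)
  have "cmod (LINT x|lborel. coherent q p x * v x) \<le> L2norm (\<lambda>x. coherent q p x - ?P x) * L2norm v"
    unfolding e using v by (intro L2_mult_integrable L2_diff) auto
  then have "(cmod (LINT x|lborel. coherent q p x * v x))\<^sup>2 \<le> (L2norm (\<lambda>x. coherent q p x - ?P x) * L2norm v)\<^sup>2"
    by (intro power_mono) auto
  also have "\<dots> = (1 - (\<Sum>n\<le>K. exp (- \<mu>) * \<mu> ^ n / fact n)) * (L2norm v)\<^sup>2"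
    by (simp add: power_mult_distrib L2norm_minus_hproj L2norm_coherent cc)
  also have "1 - (\<Sum>n\<le>K. exp (- \<mu>) * \<mu> ^ n / fact n) = exp (- \<mu>) * (exp \<mu> - (\<Sum>n\<le>K. \<mu> ^ n / fact n))"
    by (simp add: right_diff_distrib sum_distrib_left flip: exp_add)
  also have "\<dots> * (L2norm v)\<^sup>2 \<le> (exp (- \<mu>) * (exp (2 * \<mu>) / 2 ^ Suc K)) * (L2norm v)\<^sup>2"
    using exp_tail_bound[OF \<mu>, of K] by (intro mult_right_mono mult_left_mono) auto
  also have "exp (- \<mu>) * (exp (2 * \<mu>) / 2 ^ Suc K) = exp \<mu> / 2 ^ Suc K"
    by (simp flip: exp_add)
  finally show ?thesis by (simp add: \<mu>_def mult.commute)
qed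

subsection \<open>Plancherel theorem\<close>

text \<open>The absolutely convergent transform on L1, as opposed to \<open>fourier\<close>, which
  is an L2 limit of such integrals.\<close>

definition ft :: "(real \<Rightarrow> complex) \<Rightarrow> real \<Rightarrow> complex" where
  "ft f p = complex_of_real (1 / sqrt (2 * pi)) * (LINT x|lborel. f x * iexp (- p * x))"

lemma norm_iexp [simp]: "cmod (iexp (x * y)) = 1" "cmod (iexp (- x * y)) = 1"
  by (rule norm_exp_i_times)+

lemma borel_measurable_cnj [measurable]:
  "f \<in> borel_measurable M \<Longrightarrow> (\<lambda>x. cnj (f x)) \<in> borel_measurable M"
  by (rule measurable_compose[OF _ borel_measurable_continuous_onI]) (auto intro!: continuous_intros)

lemma iexp_mult: "iexp (x * p) * iexp (- y * p) = iexp ((x - y) * p)"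
  unfolding exp_add[symmetric] distrib_left[symmetric] of_real_add[symmetric] by (simp add: algebra_simps)

lemma measurable_ft [measurable]:
  assumes [measurable]: "f \<in> borel_measurable lborel" "k \<in> borel_measurable M"
  shows "(\<lambda>x. ft f (k x)) \<in> borel_measurable M"
proof -
  have [measurable]: "ft f \<in> borel_measurable borel" unfolding ft_def[abs_def] by measurable
  show ?thesis by measurable
qed

lemma integrable_mult_iexp:
  assumes "integrable lborel f" shows "integrable lborel (\<lambda>x. f x * iexp (c * x))"
  by (rule Bochner_Integration.integrable_bound[OF assms]) (use assms in \<open>auto simp: norm_mult\<close>)

lemma cmod_ft_le:
  assumes "integrable lborel f"
  shows "cmod (ft f p) \<le> (LINT x|lborel. cmod (f x))"
proof -
  have "cmod (ft f p) = 1 / sqrt (2 * pi) * cmod (LINT x|lborel. f x * iexp (- p * x))"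
    unfolding ft_def norm_mult norm_of_real by simp
  also have "\<dots> \<le> 1 * (LINT x|lborel. cmod (f x * iexp (- p * x)))"
  proof (intro mult_mono integral_norm_bound)
    have "1 \<le> 2 * pi" using pi_gt3 by simp
    then have "1 \<le> sqrt (2 * pi)" by simp
    then show "1 / sqrt (2 * pi) \<le> 1" by simp
  qed auto
  finally show ?thesis by (simp add: norm_mult del: of_real_mult of_real_minus)
qed

text \<open>Fubini for a kernel whose modulus is a multiple of \<open>|f x| * |g p|\<close>.\<close>

lemma ft_multiplication_formula:
  assumes f: "integrable lborel f" and g: "integrable lborel g"
  shows "(LINT p|lborel. ft f p * g p) = (LINT x|lborel. f x * ft g x)"
proof -
  note [measurable] = borel_measurable_integrable[OF f] borel_measurable_integrable[OF g]
  define c where "c = complex_of_real (1 / sqrt (2 * pi))"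
  have int: "integrable (lborel \<Otimes>\<^sub>M lborel) (case_prod (\<lambda>x p. c * (f x * g p * iexp (- p * x))))"
  proof (rule lborel_pair.Fubini_integrable)
    show "integrable lborel (\<lambda>x. LINT p|lborel. norm (case_prod (\<lambda>x p. c * (f x * g p * iexp (- p * x))) (x, p)))"
      using integrable_norm[OF f] by (simp add: norm_mult del: of_real_mult of_real_minus)
    show "AE x in lborel. integrable lborel (\<lambda>p. case_prod (\<lambda>x p. c * (f x * g p * iexp (- p * x))) (x, p))"
    proof (rule AE_I2)
      fix x
      have "integrable lborel (\<lambda>p. (c * f x) * (g p * iexp ((- x) * p)))"
        by (intro integrable_mult_right integrable_mult_iexp g)
      then show "integrable lborel (\<lambda>p. case_prod (\<lambda>x p. c * (f x * g p * iexp (- p * x))) (x, p))"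
        by (simp add: mult_ac)
    qed
  qed measurable
  have "(LINT p|lborel. ft f p * g p) = (LINT p|lborel. LINT x|lborel. c * (f x * g p * iexp (- p * x)))"
  proof (rule Bochner_Integration.integral_cong)
    fix p
    have "ft f p * g p = (c * g p) * (LINT x|lborel. f x * iexp (- p * x))" by (simp add: ft_def c_def)
    also have "\<dots> = (LINT x|lborel. (c * g p) * (f x * iexp (- p * x)))" by simp
    finally show "ft f p * g p = (LINT x|lborel. c * (f x * g p * iexp (- p * x)))" by (simp add: mult_ac)
  qed simp
  also have "\<dots> = (LINT x|lborel. LINT p|lborel. c * (f x * g p * iexp (- p * x)))"
    by (rule lborel_pair.Fubini_integral[OF int])
  also have "\<dots> = (LINT x|lborel. f x * ft g x)"
  proof (rule Bochner_Integration.integral_cong)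
    fix x
    have "f x * ft g x = (c * f x) * (LINT p|lborel. g p * iexp (- x * p))" by (simp add: ft_def c_def)
    also have "\<dots> = (LINT p|lborel. (c * f x) * (g p * iexp (- x * p)))" by simp
    finally have e: "f x * ft g x = (LINT p|lborel. (c * f x) * (g p * iexp (- x * p)))" .
    show "(LINT p|lborel. c * (f x * g p * iexp (- p * x))) = f x * ft g x" unfolding e by (simp add: mult_ac)
  qed simp
  finally show ?thesis .
qed

lemma ft_gaussian_iexp:
  assumes a: "a > 0"
  shows "ft (\<lambda>p. complex_of_real (exp (- a * (p - b)\<^sup>2 / 2)) * iexp (x * p)) y =
    complex_of_real (1 / sqrt a * exp (- (x - y)\<^sup>2 / (2 * a))) * iexp ((x - y) * b)"
proof -
  have "(LINT p|lborel. complex_of_real (exp (- a * (p - b)\<^sup>2 / 2)) * iexp (x * p) * iexp (- y * p))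
    = (LINT p|lborel. complex_of_real (exp (- a * (p - b)\<^sup>2 / 2)) * iexp ((x - y) * p))"
    unfolding mult.assoc iexp_mult ..
  also have "\<dots> = complex_of_real (sqrt (2 * pi / a)) * iexp ((x - y) * b) * complex_of_real (exp (- (x - y)\<^sup>2 / (2 * a)))"
    by (rule integral_gaussian_iexp[OF a])
  finally show ?thesis unfolding ft_def by (simp add: real_sqrt_divide)
qed

lemma integrable_gaussian:
  assumes "a > 0" shows "integrable lborel (\<lambda>p::real. exp (- a * (p - b)\<^sup>2 / 2))"
proof -
  have "integrable lborel (\<lambda>p. normal_density b (1 / sqrt a) p * sqrt (2 * pi / a))"
    using assms by (intro integrable_mult_left integrable_normal_density) auto
  moreover have "normal_density b (1 / sqrt a) p * sqrt (2 * pi / a) = exp (- a * (p - b)\<^sup>2 / 2)" for p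
    using assms by (simp add: normal_density_def power_divide real_sqrt_divide field_simps)
  ultimately show ?thesis by simp
qed

text \<open>The Gaussian damping makes the frequency integral converge although \<open>f\<close> is
  only in L1. Two uses of the multiplication formula turn the damped energy into an average of
  autocorrelations of \<open>f\<close> at normally distributed shifts \<open>e * s\<close>.\<close>

lemma ft_gaussian_energy:
  assumes f: "integrable lborel f" and e: "e > 0"
  shows "complex_of_real (LINT p|lborel. exp (- e\<^sup>2 * p\<^sup>2 / 2) * (cmod (ft f p))\<^sup>2)
     = (LINT x|lborel. f x * (LINT s|lborel. std_normal_density s *\<^sub>R cnj (f (x + e * s))))"
    and "integrable lborel (\<lambda>x. f x * (LINT s|lborel. std_normal_density s *\<^sub>R cnj (f (x + e * s))))"
    and "integrable lborel (\<lambda>p. exp (- e\<^sup>2 * p\<^sup>2 / 2) * (cmod (ft f p))\<^sup>2)"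
proof -
  note [measurable] = borel_measurable_integrable[OF f]
  define g where "g = (\<lambda>p. complex_of_real (exp (- e\<^sup>2 * p\<^sup>2 / 2)) * cnj (ft f p))"
  define C where "C = (LINT x|lborel. cmod (f x))"
  have C: "cmod (ft f p) \<le> C" "C \<ge> 0" for p using cmod_ft_le[OF f] by (auto simp: C_def)
  have gauss: "integrable lborel (\<lambda>p::real. exp (- e\<^sup>2 * p\<^sup>2 / 2))"
    using integrable_gaussian[of "e\<^sup>2" 0] e by simp
  have g: "integrable lborel g"
  proof (rule Bochner_Integration.integrable_bound[OF integrable_mult_right[OF gauss, of C]])
    show "AE x in lborel. norm (g x) \<le> norm (C * exp (- e\<^sup>2 * x\<^sup>2 / 2))"
      using C by (intro AE_I2) (auto simp: g_def norm_mult mult.commute[of C] intro!: mult_left_mono)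
  qed (simp add: g_def)
  show int3: "integrable lborel (\<lambda>p. exp (- e\<^sup>2 * p\<^sup>2 / 2) * (cmod (ft f p))\<^sup>2)"
  proof (rule Bochner_Integration.integrable_bound[OF integrable_mult_right[OF gauss, of "C\<^sup>2"]])
    show "AE x in lborel. norm (exp (- e\<^sup>2 * x\<^sup>2 / 2) * (cmod (ft f x))\<^sup>2) \<le> norm (C\<^sup>2 * exp (- e\<^sup>2 * x\<^sup>2 / 2))"
      using C by (intro AE_I2) (auto simp: abs_mult mult.commute[of "C\<^sup>2"] intro!: mult_left_mono power_mono)
  qed simp
  have ftg: "ft g x = (LINT s|lborel. std_normal_density s *\<^sub>R cnj (f (x + e * s)))" for x
  proof -
    define k where "k = (\<lambda>p. complex_of_real (exp (- e\<^sup>2 * (p - 0)\<^sup>2 / 2)) * iexp (x * p))"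
    have k: "integrable lborel k" unfolding k_def
      using integrable_gaussian[of "e\<^sup>2" 0] e by (intro integrable_mult_iexp integrable_of_real) auto
    have fc: "integrable lborel (\<lambda>x. cnj (f x))" using f by simp
    have cnjft: "cnj (ft f (- p)) = ft (\<lambda>x. cnj (f x)) p" for p
      unfolding ft_def complex_cnj_mult Bochner_Integration.integral_cnj[symmetric] by (simp add: exp_cnj)
    have "ft g x = complex_of_real (1 / sqrt (2 * pi)) * (LINT p|lborel. g p * iexp (- x * p))" by (simp add: ft_def)
    \<comment> \<open>Reflecting \<open>p\<close> makes \<open>cnj (ft f (- p))\<close> the
      transform of \<open>cnj f\<close>, so the multiplication formula can be used a second
      time.\<close>
    also have "(LINT p|lborel. g p * iexp (- x * p)) = (LINT p|lborel. g (- p) * iexp (x * p))"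
      using lborel_integral_real_affine[of "-1" "\<lambda>p. g p * iexp (- x * p)" 0] by simp
    also have "\<dots> = (LINT p|lborel. ft (\<lambda>x. cnj (f x)) p * k p)"
      by (intro Bochner_Integration.integral_cong) (auto simp: g_def k_def cnjft)
    also have "\<dots> = (LINT y|lborel. cnj (f y) * ft k y)"
      by (rule ft_multiplication_formula[OF fc k])
    also have "\<dots> = (LINT y|lborel. cnj (f y) * complex_of_real (1 / e * exp (- (x - y)\<^sup>2 / (2 * e\<^sup>2))))"
      unfolding k_def using e by (subst ft_gaussian_iexp) auto
    also have "\<dots> = e *\<^sub>R (LINT s|lborel. cnj (f (x + e * s)) * complex_of_real (1 / e * exp (- (x - (x + e * s))\<^sup>2 / (2 * e\<^sup>2))))"
      using e by (subst lborel_integral_real_affine[of e _ x]) auto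
    also have "\<dots> = (LINT s|lborel. e *\<^sub>R (cnj (f (x + e * s)) * complex_of_real (1 / e * exp (- (x - (x + e * s))\<^sup>2 / (2 * e\<^sup>2)))))"
      by simp
    also have "complex_of_real (1 / sqrt (2 * pi)) * \<dots> = (LINT s|lborel. complex_of_real (1 / sqrt (2 * pi)) * (e *\<^sub>R (cnj (f (x + e * s)) * complex_of_real (1 / e * exp (- (x - (x + e * s))\<^sup>2 / (2 * e\<^sup>2))))))"
      by simp
    also have "\<dots> = (LINT s|lborel. std_normal_density s *\<^sub>R cnj (f (x + e * s)))"
      using e by (intro Bochner_Integration.integral_cong)
        (auto simp: std_normal_density_def scaleR_conv_of_real power_mult_distrib)
    finally show ?thesis .
  qed
  have "complex_of_real (LINT p|lborel. exp (- e\<^sup>2 * p\<^sup>2 / 2) * (cmod (ft f p))\<^sup>2) = (LINT p|lborel. ft f p * g p)"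
    unfolding integral_complex_of_real[symmetric] of_real_mult complex_norm_square g_def by (simp add: mult_ac)
  also have "\<dots> = (LINT x|lborel. f x * ft g x)" by (rule ft_multiplication_formula[OF f g])
  finally show "complex_of_real (LINT p|lborel. exp (- e\<^sup>2 * p\<^sup>2 / 2) * (cmod (ft f p))\<^sup>2)
     = (LINT x|lborel. f x * (LINT s|lborel. std_normal_density s *\<^sub>R cnj (f (x + e * s))))" unfolding ftg .
  have [measurable]: "g \<in> borel_measurable lborel" using g by auto
  have "integrable lborel (\<lambda>x. f x * ft g x)"
  proof (rule Bochner_Integration.integrable_bound[OF integrable_mult_right[OF f, of "complex_of_real (LINT x|lborel. cmod (g x))"]])
    show "AE x in lborel. norm (f x * ft g x) \<le> norm (complex_of_real (LINT x|lborel. cmod (g x)) * f x)"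
      using cmod_ft_le[OF g] by (intro AE_I2) (auto simp: norm_mult mult.commute intro!: mult_right_mono mult_left_mono order_trans[OF _ abs_ge_self])
  qed measurable
  then show "integrable lborel (\<lambda>x. f x * (LINT s|lborel. std_normal_density s *\<^sub>R cnj (f (x + e * s))))"
    unfolding ftg .
qed

text \<open>The difference to the squared norm is the normal average of the pairing of
  \<open>f\<close> with \<open>f (x + e * s) - f x\<close>. It is at most the norm of
  \<open>f\<close> times the L2 modulus of continuity, which tends to 0 and is bounded by twice the
  norm.\<close>

lemma plancherel_gaussian_limit:
  assumes f: "integrable lborel f" and f2: "L2 f"
  shows "(\<lambda>n. LINT p|lborel. exp (- (1 / real (Suc n))\<^sup>2 * p\<^sup>2 / 2) * (cmod (ft f p))\<^sup>2) \<longlonglongrightarrow> (L2norm f)\<^sup>2"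
proof -
  note [measurable] = borel_measurable_integrable[OF f]
  define e where "e = (\<lambda>n. 1 / real (Suc n))"
  have e: "e n > 0" for n by (simp add: e_def)
  have e0: "e \<longlonglongrightarrow> 0" unfolding e_def using LIMSEQ_inverse_real_of_nat by (simp add: inverse_eq_divide)
  let ?d = "\<lambda>n s. L2norm (\<lambda>x. f (x + e n * s) - f x)"
  have shift: "L2norm (\<lambda>x. f (x + t)) = L2norm f" for t by (rule L2norm_shift)
  have d_le: "?d n s \<le> 2 * L2norm f" for n s
    using L2norm_triangle_diff[OF L2_shift[OF f2, of "e n * s"] f2] shift by simp
  have meas_d [measurable]: "(\<lambda>s. ?d n s) \<in> borel_measurable lborel" for n
    unfolding L2norm_def by measurable
  have lim: "(\<lambda>n. LINT s|lborel. std_normal_density s * (L2norm f * ?d n s)) \<longlonglongrightarrow> (LINT (s::real)|lborel. 0 :: real)"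
  proof (rule integral_dominated_convergence[where w="\<lambda>s. std_normal_density s * (2 * (L2norm f)\<^sup>2)"])
    show "AE s in lborel. (\<lambda>n. std_normal_density s * (L2norm f * ?d n s)) \<longlonglongrightarrow> 0"
    proof (rule AE_I2)
      fix s :: real
      have "(\<lambda>n. e n * s) \<longlonglongrightarrow> 0 * s" by (intro tendsto_intros e0)
      then have "(\<lambda>n. ?d n s) \<longlonglongrightarrow> 0" using tendsto_shift_L2[OF f2, of "\<lambda>n. e n * s"] by simp
      then have "(\<lambda>n. std_normal_density s * (L2norm f * ?d n s)) \<longlonglongrightarrow> std_normal_density s * (L2norm f * 0)"
        by (intro tendsto_intros)
      then show "(\<lambda>n. std_normal_density s * (L2norm f * ?d n s)) \<longlonglongrightarrow> 0" by simp
    qed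
    show "AE s in lborel. norm (std_normal_density s * (L2norm f * ?d n s)) \<le> std_normal_density s * (2 * (L2norm f)\<^sup>2)" for n
    proof (rule AE_I2)
      fix s :: real
      have "L2norm f * ?d n s \<le> L2norm f * (2 * L2norm f)" by (intro mult_left_mono d_le) simp
      then show "norm (std_normal_density s * (L2norm f * ?d n s)) \<le> std_normal_density s * (2 * (L2norm f)\<^sup>2)"
        by (auto simp: abs_mult power2_eq_square intro!: mult_left_mono)
    qed
  qed auto
  have bound: "\<bar>(LINT p|lborel. exp (- (e n)\<^sup>2 * p\<^sup>2 / 2) * (cmod (ft f p))\<^sup>2) - (L2norm f)\<^sup>2\<bar>
      \<le> (LINT s|lborel. std_normal_density s * (L2norm f * ?d n s))" for n
  proof -
    let ?I = "LINT p|lborel. exp (- (e n)\<^sup>2 * p\<^sup>2 / 2) * (cmod (ft f p))\<^sup>2"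
    note en = ft_gaussian_energy[OF f e[of n]]
    have ff: "integrable lborel (\<lambda>x. f x * cnj (f x))"
      unfolding complex_norm_square[symmetric] using L2_integrable[OF f2] by (rule integrable_of_real)
    have fs: "integrable lborel (\<lambda>s. std_normal_density s *\<^sub>R (cnj (f (x + e n * s))))" for x
    proof (rule Bochner_Integration.integrable_bound)
      show "integrable lborel (\<lambda>s. f (x + e n * s))"
        using lborel_integrable_real_affine_iff[of "e n" f x] e[of n] f by simp
      have "std_normal_density s \<le> 1" for s
      proof -
        have "std_normal_density s = exp (- s\<^sup>2 / 2) / sqrt (2 * pi)" by (simp add: std_normal_density_def)
        also have "\<dots> \<le> 1 / 1" using pi_gt3 by (intro frac_le) auto
        finally show ?thesis by simp
      qed
      then show "AE s in lborel. norm (std_normal_density s *\<^sub>R (cnj (f (x + e n * s)))) \<le> norm (f (x + e n * s))"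
        by (intro AE_I2) (auto intro: mult_left_le_one_le)
    qed measurable
    have inner: "(LINT s|lborel. std_normal_density s *\<^sub>R cnj (f (x + e n * s))) - cnj (f x) = (LINT s|lborel. std_normal_density s *\<^sub>R (cnj (f (x + e n * s)) - cnj (f x)))" for x
      using fs[of x] by (simp add: scaleR_diff_right)
    have int0: "integrable lborel (\<lambda>x. f x * (LINT s|lborel. std_normal_density s *\<^sub>R (cnj (f (x + e n * s)) - cnj (f x))))"
      using Bochner_Integration.integrable_diff[OF en(2) ff] unfolding inner[symmetric] right_diff_distrib .
    have "complex_of_real (?I - (L2norm f)\<^sup>2) = (LINT x|lborel. f x * (LINT s|lborel. std_normal_density s *\<^sub>R cnj (f (x + e n * s)))) - (LINT x|lborel. f x * cnj (f x))"
    proof -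
      have "complex_of_real ((L2norm f)\<^sup>2) = (LINT x|lborel. f x * cnj (f x))"
        unfolding L2norm_power2 integral_complex_of_real[symmetric] complex_norm_square ..
      then show ?thesis unfolding of_real_diff en(1) by simp
    qed
    also have "\<dots> = (LINT x|lborel. f x * (LINT s|lborel. std_normal_density s *\<^sub>R (cnj (f (x + e n * s)) - cnj (f x))))"
      using en(2) ff by (subst Bochner_Integration.integral_diff[symmetric]) (auto simp: right_diff_distrib[symmetric] inner)
    finally have "ennreal (cmod (complex_of_real (?I - (L2norm f)\<^sup>2))) \<le> (\<integral>\<^sup>+x. ennreal (cmod (f x * (LINT s|lborel. std_normal_density s *\<^sub>R (cnj (f (x + e n * s)) - cnj (f x))))) \<partial>lborel)"
      using integral_norm_bound_ennreal[OF int0] by (simp only:)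
    also have "\<dots> \<le> (\<integral>\<^sup>+x. \<integral>\<^sup>+s. ennreal (std_normal_density s * (cmod (f x) * cmod (f (x + e n * s) - f x))) \<partial>lborel \<partial>lborel)"
    proof (rule nn_integral_mono)
      fix x
      have i: "integrable lborel (\<lambda>s. std_normal_density s *\<^sub>R (cnj (f (x + e n * s)) - cnj (f x)))"
        unfolding scaleR_diff_right using fs[of x] by (intro Bochner_Integration.integrable_diff) auto
      have "ennreal (cmod (f x * (LINT s|lborel. std_normal_density s *\<^sub>R (cnj (f (x + e n * s)) - cnj (f x)))))
        = ennreal (cmod (f x)) * ennreal (cmod (LINT s|lborel. std_normal_density s *\<^sub>R (cnj (f (x + e n * s)) - cnj (f x))))"
        by (simp add: norm_mult ennreal_mult)
      also have "\<dots> \<le> ennreal (cmod (f x)) * (\<integral>\<^sup>+s. ennreal (cmod (std_normal_density s *\<^sub>R (cnj (f (x + e n * s)) - cnj (f x)))) \<partial>lborel)"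
        using i by (intro mult_left_mono integral_norm_bound_ennreal) auto
      also have "\<dots> = (\<integral>\<^sup>+s. ennreal (cmod (f x)) * ennreal (cmod (std_normal_density s *\<^sub>R (cnj (f (x + e n * s)) - cnj (f x)))) \<partial>lborel)"
        by (rule nn_integral_cmult[symmetric]) simp
      also have "\<dots> = (\<integral>\<^sup>+s. ennreal (std_normal_density s * (cmod (f x) * cmod (f (x + e n * s) - f x))) \<partial>lborel)"
        by (intro nn_integral_cong) (simp add: ennreal_mult[symmetric] mult_ac flip: complex_cnj_diff)
      finally show "ennreal (cmod (f x * (LINT s|lborel. std_normal_density s *\<^sub>R (cnj (f (x + e n * s)) - cnj (f x))))) \<le> \<dots>" .
    qed
    \<comment> \<open>The shift integral is moved outside, so that Cauchy-Schwarz in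
      \<open>x\<close> applies for each fixed shift \<open>s\<close>.\<close>
    also have "\<dots> = (\<integral>\<^sup>+s. \<integral>\<^sup>+x. ennreal (std_normal_density s * (cmod (f x) * cmod (f (x + e n * s) - f x))) \<partial>lborel \<partial>lborel)"
      by (rule lborel_pair.Fubini') measurable
    also have "\<dots> \<le> (\<integral>\<^sup>+s. ennreal (std_normal_density s * (L2norm f * ?d n s)) \<partial>lborel)"
    proof (rule nn_integral_mono)
      fix s
      note L = f2 L2_diff[OF L2_shift[OF f2, of "e n * s"] f2]
      have "(\<integral>\<^sup>+x. ennreal (std_normal_density s * (cmod (f x) * cmod (f (x + e n * s) - f x))) \<partial>lborel)
        = ennreal (std_normal_density s * (LINT x|lborel. cmod (f x * (f (x + e n * s) - f x))))"
        using L2_mult_integrable(1)[OF L, THEN integrable_norm]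
        by (subst nn_integral_eq_integral) (auto simp: norm_mult)
      also have "\<dots> \<le> ennreal (std_normal_density s * (L2norm f * ?d n s))"
        by (intro ennreal_leI mult_left_mono L2_mult_integrable(2)[OF L]) simp
      finally show "(\<integral>\<^sup>+x. ennreal (std_normal_density s * (cmod (f x) * cmod (f (x + e n * s) - f x))) \<partial>lborel) \<le> \<dots>" .
    qed
    also have "\<dots> = ennreal (LINT s|lborel. std_normal_density s * (L2norm f * ?d n s))"
    proof (rule nn_integral_eq_integral)
      show "integrable lborel (\<lambda>s. std_normal_density s * (L2norm f * ?d n s))"
      proof (rule Bochner_Integration.integrable_bound)
        show "integrable lborel (\<lambda>s. std_normal_density s * (2 * (L2norm f)\<^sup>2))" by simp
        show "AE s in lborel. norm (std_normal_density s * (L2norm f * ?d n s)) \<le> norm (std_normal_density s * (2 * (L2norm f)\<^sup>2))"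
        proof (rule AE_I2)
          fix s :: real
          have "L2norm f * ?d n s \<le> L2norm f * (2 * L2norm f)" by (intro mult_left_mono d_le) simp
          then show "norm (std_normal_density s * (L2norm f * ?d n s)) \<le> norm (std_normal_density s * (2 * (L2norm f)\<^sup>2))"
            by (auto simp: abs_mult power2_eq_square intro!: mult_left_mono)
        qed
      qed measurable
    qed auto
    finally show ?thesis
      unfolding norm_of_real by (rule ennreal_le_iff[THEN iffD1, rotated]) (auto intro!: integral_nonneg)
  qed
  have "(\<lambda>n. (LINT p|lborel. exp (- (e n)\<^sup>2 * p\<^sup>2 / 2) * (cmod (ft f p))\<^sup>2) - (L2norm f)\<^sup>2) \<longlonglongrightarrow> 0"
    by (rule Lim_null_comparison[OF always_eventually]) (use lim bound in auto)
  then show ?thesis unfolding e_def by (simp only: LIM_zero_iff)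
qed

text \<open>As the damping is removed, the damped energies converge monotonically to the full energy
  and, by the previous limit, to the squared norm. Working with the extended integral makes square
  integrability of \<open>ft f\<close> part of the outcome.\<close>

theorem plancherel:
  assumes f: "integrable lborel f" and f2: "L2 f"
  shows "(\<integral>\<^sup>+p. ennreal ((cmod (ft f p))\<^sup>2) \<partial>lborel) = ennreal ((L2norm f)\<^sup>2)"
    and "L2 (ft f)" and "L2norm (ft f) = L2norm f"
proof -
  note [measurable] = borel_measurable_integrable[OF f]
  let ?F = "\<lambda>n p. exp (- (1 / real (Suc n))\<^sup>2 * p\<^sup>2 / 2) * (cmod (ft f p))\<^sup>2"
  have A: "(\<lambda>n. \<integral>\<^sup>+p. ennreal (?F n p) \<partial>lborel) \<longlonglongrightarrow> (\<integral>\<^sup>+p. ennreal ((cmod (ft f p))\<^sup>2) \<partial>lborel)"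
  proof (rule nn_integral_LIMSEQ)
    show "incseq (\<lambda>n p. ennreal (?F n p))"
    proof (rule incseq_SucI, rule le_funI, rule ennreal_leI, rule mult_right_mono)
      fix n and p :: real
      have "(1 / real (Suc (Suc n)))\<^sup>2 \<le> (1 / real (Suc n))\<^sup>2" by (intro power_mono divide_left_mono) auto
      then have "(1 / real (Suc (Suc n)))\<^sup>2 * p\<^sup>2 \<le> (1 / real (Suc n))\<^sup>2 * p\<^sup>2" by (intro mult_right_mono) auto
      then show "exp (- (1 / real (Suc n))\<^sup>2 * p\<^sup>2 / 2) \<le> exp (- (1 / real (Suc (Suc n)))\<^sup>2 * p\<^sup>2 / 2)" by simp
    qed simp
    fix p
    have "(\<lambda>n. ?F n p) \<longlonglongrightarrow> exp (- 0\<^sup>2 * p\<^sup>2 / 2) * (cmod (ft f p))\<^sup>2"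
      using LIMSEQ_inverse_real_of_nat by (intro tendsto_intros) (auto simp: inverse_eq_divide)
    then show "(\<lambda>n. ennreal (?F n p)) \<longlonglongrightarrow> ennreal ((cmod (ft f p))\<^sup>2)" by (intro tendsto_ennrealI) simp
  qed simp
  have B: "(\<integral>\<^sup>+p. ennreal (?F n p) \<partial>lborel) = ennreal (LINT p|lborel. ?F n p)" for n
    by (intro nn_integral_eq_integral ft_gaussian_energy f) auto
  have C: "(\<lambda>n. ennreal (LINT p|lborel. ?F n p)) \<longlonglongrightarrow> ennreal ((L2norm f)\<^sup>2)"
    by (intro tendsto_ennrealI plancherel_gaussian_limit f f2)
  show 1: "(\<integral>\<^sup>+p. ennreal ((cmod (ft f p))\<^sup>2) \<partial>lborel) = ennreal ((L2norm f)\<^sup>2)"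
    by (rule LIMSEQ_unique[OF A[unfolded B] C])
  show 2: "L2 (ft f)" using L2_nn_integralI(1)[of "ft f" "L2norm f"] 1 by simp
  then show "L2norm (ft f) = L2norm f"
    using nn_integral_L2[OF 2] 1 by simp
qed

subsection \<open>The L2 Fourier transform and the Husimi transform\<close>

lemma fourier_trunc_eq_ft: "fourier_trunc R u = ft (\<lambda>x. u x * indicator {-R..R} x)"
proof
  fix k
  have "(LINT x:{-R..R}|lborel. u x * exp (- \<i> * complex_of_real (k * x))) = (LINT x|lborel. u x * indicator {-R..R} x * iexp (- k * x))"
    unfolding set_lebesgue_integral_def by (intro Bochner_Integration.integral_cong) (auto simp: indicator_def scaleR_conv_of_real)
  then show "fourier_trunc R u k = ft (\<lambda>x. u x * indicator {-R..R} x) k"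
    unfolding fourier_trunc_def ft_def by simp
qed

lemma L2_truncated:
  assumes "L2 u"
  shows "L2 (\<lambda>x. u x * indicator {-R..R} x)" "integrable lborel (\<lambda>x. u x * indicator {-R..R::real} x)"
proof -
  show 1: "L2 (\<lambda>x. u x * indicator {-R..R} x)" by (rule L2_indicator[OF assms]) simp
  have "L2 (\<lambda>x. indicator {-R..R} x)"
    unfolding L2_def
  proof
    have "integrable lborel (indicator {-R..R} :: real \<Rightarrow> real)" by (intro integrable_real_indicator) (auto simp: emeasure_lborel_Icc_eq)
    moreover have "(\<lambda>x. (cmod (indicator {-R..R} x))\<^sup>2) = indicator {-R..R}" by (auto simp: indicator_def)
    ultimately show "integrable lborel (\<lambda>x. (cmod (indicator {-R..R} x))\<^sup>2)" by (simp only:)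
  qed simp
  then show "integrable lborel (\<lambda>x. u x * indicator {-R..R} x)" by (rule L2_mult_integrable(1)[OF assms])
qed

lemma ft_diff:
  assumes "integrable lborel f" "integrable lborel g"
  shows "ft (\<lambda>x. f x - g x) p = ft f p - ft g p"
  unfolding ft_def left_diff_distrib using assms[THEN integrable_mult_iexp, of "- p"]
  by (simp add: right_diff_distrib)

lemma L2norm_ft_truncated_diff:
  assumes u: "L2 u" and R: "R \<ge> S" "S \<ge> 0"
  shows "L2norm (\<lambda>k. fourier_trunc R u k - fourier_trunc S u k) \<le> L2norm (\<lambda>x. u x * indicator {x. \<bar>x\<bar> > S} x)"
proof -
  note t = L2_truncated[OF u]
  have "(\<lambda>k. fourier_trunc R u k - fourier_trunc S u k) = ft (\<lambda>x. u x * indicator {-R..R} x - u x * indicator {-S..S} x)"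
    unfolding fourier_trunc_eq_ft by (rule ext) (rule ft_diff[symmetric, OF t(2) t(2)])
  then have "L2norm (\<lambda>k. fourier_trunc R u k - fourier_trunc S u k) = L2norm (\<lambda>x. u x * indicator {-R..R} x - u x * indicator {-S..S} x)"
    using plancherel(3)[OF Bochner_Integration.integrable_diff[OF t(2) t(2)] L2_diff[OF t(1) t(1)]] by (simp only:)
  also have "\<dots> \<le> L2norm (\<lambda>x. u x * indicator {x. \<bar>x\<bar> > S} x)"
  proof (rule L2norm_mono)
    show "L2 (\<lambda>x. u x * indicator {x. \<bar>x\<bar> > S} x)"
      by (rule L2_indicator[OF u]) auto
  qed (use R in \<open>auto simp: indicator_def\<close>)
  finally show ?thesis .
qed

lemma L2norm_tail_antimono:
  assumes u: "L2 u" and "R \<ge> S"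
  shows "L2norm (\<lambda>x. u x * indicator {x. \<bar>x\<bar> > R} x) \<le> L2norm (\<lambda>x. u x * indicator {x. \<bar>x\<bar> > (S::real)} x)"
proof (rule L2norm_mono)
  show "L2 (\<lambda>x. u x * indicator {x. \<bar>x\<bar> > S} x)"
    by (rule L2_indicator[OF u]) auto
qed (use assms in \<open>auto simp: indicator_def\<close>)

text \<open>By Plancherel the transforms of truncations differ by at most a tail of
  \<open>u\<close>. Completeness gives a limit along the integers, and the same tail bound extends
  the convergence to real radii.\<close>

lemma fourier_exists:
  assumes u: "L2 u"
  shows "\<exists>W. L2 W \<and> ((\<lambda>R. L2norm (\<lambda>k. W k - fourier_trunc R u k)) \<longlongrightarrow> 0) at_top"
proof -
  note t = L2_truncated[OF u]
  have L: "L2 (fourier_trunc R u)" for R unfolding fourier_trunc_eq_ft by (rule plancherel(2)[OF t(2) t(1)])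
  let ?T = "\<lambda>n. L2norm (\<lambda>x. u x * indicator {x. \<bar>x\<bar> > real n} x)"
  have T: "?T \<longlonglongrightarrow> 0" by (rule L2norm_indicator_tail[OF u])
  have "\<exists>W. L2 W \<and> (\<lambda>n. L2norm (\<lambda>k. W k - fourier_trunc (real n) u k)) \<longlonglongrightarrow> 0"
  proof (rule L2_complete)
    fix e :: real assume "e > 0"
    then obtain N where N: "?T N < e"
      using eventually_happens[OF order_tendstoD(2)[OF T, of e]] by auto
    have "L2norm (\<lambda>k. fourier_trunc (real m) u k - fourier_trunc (real n) u k) < e" if "m \<ge> n" "n \<ge> N" for m n
    proof -
      have "L2norm (\<lambda>k. fourier_trunc (real m) u k - fourier_trunc (real n) u k) \<le> ?T n"
        using that by (intro L2norm_ft_truncated_diff u) auto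
      also have "\<dots> \<le> ?T N" using that by (intro L2norm_tail_antimono u) auto
      finally show ?thesis using N by simp
    qed
    then show "\<exists>N. \<forall>m\<ge>N. \<forall>n\<ge>N. L2norm (\<lambda>k. fourier_trunc (real m) u k - fourier_trunc (real n) u k) < e"
      by (metis nle_le L2norm_minus)
  qed (rule L)
  then obtain W where W: "L2 W" and lim: "(\<lambda>n. L2norm (\<lambda>k. W k - fourier_trunc (real n) u k)) \<longlonglongrightarrow> 0" by blast
  have "((\<lambda>R. L2norm (\<lambda>k. W k - fourier_trunc R u k)) \<longlongrightarrow> 0) at_top"
  proof (rule tendstoI)
    fix e :: real assume e: "e > 0"
    obtain N where N: "?T N < e / 2" "L2norm (\<lambda>k. W k - fourier_trunc (real N) u k) < e / 2"
      using eventually_happens[OF eventually_conj[OF order_tendstoD(2)[OF T, of "e/2"] order_tendstoD(2)[OF lim, of "e/2"]]] e by auto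
    show "\<forall>\<^sub>F R in at_top. dist (L2norm (\<lambda>k. W k - fourier_trunc R u k)) 0 < e"
      using eventually_ge_at_top[of "real N"]
    proof eventually_elim
      fix R assume R: "real N \<le> R"
      have "L2norm (\<lambda>k. W k - fourier_trunc R u k) = L2norm (\<lambda>k. (W k - fourier_trunc (real N) u k) - (fourier_trunc R u k - fourier_trunc (real N) u k))"
        by simp
      also have "\<dots> \<le> L2norm (\<lambda>k. W k - fourier_trunc (real N) u k) + L2norm (\<lambda>k. fourier_trunc R u k - fourier_trunc (real N) u k)"
        using W L by (intro L2norm_triangle_diff L2_diff)
      also have "\<dots> < e" using N L2norm_ft_truncated_diff[OF u R] by simp
      finally show "dist (L2norm (\<lambda>k. W k - fourier_trunc R u k)) 0 < e" by (simp add: dist_real_def)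
    qed
  qed
  with W show ?thesis by blast
qed

text \<open>The choice in \<open>fourier\<close> fixes the transform only up to null sets; every
  later statement about it rests on these two facts.\<close>

lemma fourier_spec:
  assumes "L2 u"
  shows "L2 (fourier u)" "((\<lambda>R. L2norm (\<lambda>k. fourier u k - fourier_trunc R u k)) \<longlongrightarrow> 0) at_top"
  using someI_ex[OF fourier_exists[OF assms]] unfolding fourier_def by auto

lemma fourier_lim_sequentially:
  assumes "L2 u"
  shows "(\<lambda>n. L2norm (\<lambda>k. fourier u k - fourier_trunc (real n) u k)) \<longlonglongrightarrow> 0"
  by (rule filterlim_compose[OF fourier_spec(2)[OF assms] filterlim_real_sequentially])

lemma L2norm_fourier_le:
  assumes u: "L2 u" shows "L2norm (fourier u) \<le> L2norm u"
proof (rule tendsto_lowerbound)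
  note t = L2_truncated[OF u]
  have L: "L2 (fourier_trunc R u)" for R unfolding fourier_trunc_eq_ft by (rule plancherel(2)[OF t(2) t(1)])
  show "(\<lambda>n. L2norm u + L2norm (\<lambda>k. fourier u k - fourier_trunc (real n) u k)) \<longlonglongrightarrow> L2norm u"
    using tendsto_add[OF tendsto_const fourier_lim_sequentially[OF u]] by simp
  show "\<forall>\<^sub>F n in sequentially. L2norm (fourier u) \<le> L2norm u + L2norm (\<lambda>k. fourier u k - fourier_trunc (real n) u k)"
  proof (intro always_eventually allI)
    fix n
    have "L2norm (fourier_trunc (real n) u) = L2norm (\<lambda>x. u x * indicator {-real n..real n} x)"
      unfolding fourier_trunc_eq_ft by (rule plancherel(3)[OF t(2) t(1)])
    also have "\<dots> \<le> L2norm u" by (intro L2norm_mono u) (auto simp: indicator_def)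
    finally show "L2norm (fourier u) \<le> L2norm u + L2norm (\<lambda>k. fourier u k - fourier_trunc (real n) u k)"
      using L2norm_triangle_minus[OF fourier_spec(1)[OF u] L, of "real n"] by simp
  qed
qed simp

text \<open>The short-time Fourier transform with Gaussian window. The factor
  \<open>1 / sqrt (2 * pi)\<close> makes it an isometry into L2 of the plane with Lebesgue
  measure.\<close>

definition husimi :: "(real \<Rightarrow> complex) \<Rightarrow> real \<Rightarrow> real \<Rightarrow> complex" where
  "husimi u q p = complex_of_real (1 / sqrt (2 * pi)) * (LINT x|lborel. coherent q p x * u x)"

lemma husimi_ft: "husimi u q p = ft (\<lambda>x. complex_of_real (hermite_fun 0 (x - q)) * u x) p"
  unfolding husimi_def ft_def coherent_def by (simp add: mult_ac)

lemma measurable_husimi [measurable]: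
  assumes [measurable]: "u \<in> borel_measurable lborel" "f \<in> borel_measurable M" "g \<in> borel_measurable M"
  shows "(\<lambda>z. husimi u (f z) (g z)) \<in> borel_measurable M"
proof -
  have [measurable]: "(\<lambda>(q, p). husimi u q p) \<in> borel_measurable (borel \<Otimes>\<^sub>M borel)"
    unfolding husimi_def by measurable
  have "(\<lambda>z. (\<lambda>(q, p). husimi u q p) (f z, g z)) \<in> borel_measurable M" by measurable
  then show ?thesis by simp
qed

lemma husimi_diff: "L2 u \<Longrightarrow> L2 v \<Longrightarrow> husimi (\<lambda>x. u x - v x) q p = husimi u q p - husimi v q p"
  unfolding husimi_def using L2_mult_integrable(1)[OF L2_coherent, of u q p] L2_mult_integrable(1)[OF L2_coherent, of v q p]
  by (simp add: right_diff_distrib)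

lemma cmod_husimi_le: "L2 u \<Longrightarrow> cmod (husimi u q p) \<le> L2norm u"
proof -
  assume u: "L2 u"
  have "1 \<le> 2 * pi" using pi_gt3 by simp
  then have "1 / sqrt (2 * pi) \<le> 1" by simp
  then have "cmod (husimi u q p) \<le> 1 * cmod (LINT x|lborel. coherent q p x * u x)"
    unfolding husimi_def norm_mult norm_of_real by (intro mult_right_mono) auto
  also have "\<dots> \<le> L2norm u" using L2_mult_integrable(3)[OF L2_coherent u, of q p] by (simp add: L2norm_coherent)
  finally show ?thesis .
qed

lemma hermite_fun_0_le: "hermite_fun 0 x \<le> 1"
proof -
  have "1 \<le> pi powr (1/4)" using pi_gt3 by (intro ge_one_powr_ge_zero) auto
  then have "exp (- x\<^sup>2 / 2) / pi powr (1/4) \<le> 1 / 1" by (intro frac_le) auto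
  then show ?thesis by (simp add: hermite_fun_0)
qed

text \<open>For fixed \<open>q\<close> this is Plancherel for the windowed function: the window is
  square integrable, so the product is in L1, and it is bounded by 1, so the product is in
  L2.\<close>

lemma husimi_fibre:
  assumes u: "L2 u"
  shows "(\<integral>\<^sup>+p. ennreal ((cmod (husimi u q p))\<^sup>2) \<partial>lborel) = (\<integral>\<^sup>+x. ennreal ((hermite_fun 0 (x - q))\<^sup>2 * (cmod (u x))\<^sup>2) \<partial>lborel)"
proof -
  note [measurable] = L2_measurable[OF u]
  let ?f = "\<lambda>x. complex_of_real (hermite_fun 0 (x - q)) * u x"
  have "L2 (\<lambda>x. complex_of_real (hermite_fun 0 (x - q)))"
    using integrable_gaussian_shift[of q] by (auto simp: L2_def)
  then have 1: "integrable lborel ?f" by (rule L2_mult_integrable(1)[OF _ u])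
  have 2: "L2 ?f"
    using hermite_fun_0_le hermite_fun_0_nonneg
    by (intro L2_bound[OF u, where C=1]) (auto simp: norm_mult intro: mult_right_le_one_le mult_left_le_one_le)
  show ?thesis
    unfolding husimi_ft plancherel(1)[OF 1 2] nn_integral_L2[OF 2, symmetric]
    by (simp add: norm_mult power_mult_distrib)
qed

text \<open>The probability that \<open>x\<close> plus a centred normal variable of variance 1/2
  falls into \<open>B\<close>, since the squared ground state is that density.\<close>

definition spread :: "real set \<Rightarrow> real \<Rightarrow> ennreal" where
  "spread B x = (\<integral>\<^sup>+q. indicator B q * ennreal ((hermite_fun 0 (x - q))\<^sup>2) \<partial>lborel)"

lemma measurable_spread [measurable]:
  assumes [measurable]: "B \<in> sets borel" shows "spread B \<in> borel_measurable borel"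
  unfolding spread_def[abs_def] by measurable

text \<open>The position marginal of the phase-space density is \<open>|u|^2\<close> smeared by a
  Gaussian; Tonelli moves the smearing onto the set \<open>B\<close>.\<close>

lemma husimi_marginal:
  assumes u: "L2 u" and [measurable]: "B \<in> sets borel"
  shows "(\<integral>\<^sup>+q. indicator B q * (\<integral>\<^sup>+p. ennreal ((cmod (husimi u q p))\<^sup>2) \<partial>lborel) \<partial>lborel) = (\<integral>\<^sup>+x. spread B x * ennreal ((cmod (u x))\<^sup>2) \<partial>lborel)"
proof -
  note [measurable] = L2_measurable[OF u]
  have "(\<integral>\<^sup>+q. indicator B q * (\<integral>\<^sup>+p. ennreal ((cmod (husimi u q p))\<^sup>2) \<partial>lborel) \<partial>lborel)
     = (\<integral>\<^sup>+q. \<integral>\<^sup>+x. indicator B q * ennreal ((hermite_fun 0 (x - q))\<^sup>2) * ennreal ((cmod (u x))\<^sup>2) \<partial>lborel \<partial>lborel)"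
    unfolding husimi_fibre[OF u] by (simp add: nn_integral_cmult[symmetric] ennreal_mult mult.assoc)
  also have "\<dots> = (\<integral>\<^sup>+x. \<integral>\<^sup>+q. indicator B q * ennreal ((hermite_fun 0 (x - q))\<^sup>2) * ennreal ((cmod (u x))\<^sup>2) \<partial>lborel \<partial>lborel)"
    by (rule lborel_pair.Fubini') measurable
  also have "\<dots> = (\<integral>\<^sup>+x. spread B x * ennreal ((cmod (u x))\<^sup>2) \<partial>lborel)"
    unfolding spread_def by (simp add: nn_integral_multc)
  finally show ?thesis .
qed

lemma hermite_fun_0_minus: "hermite_fun 0 (x - q) = hermite_fun 0 (q - x)"
  by (simp add: hermite_fun_0 power2_commute)

lemma nn_integral_gaussian_shift: "(\<integral>\<^sup>+q. ennreal ((hermite_fun 0 (x - q))\<^sup>2) \<partial>lborel) = 1"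
  unfolding hermite_fun_0_minus[of x] using integrable_gaussian_shift[of x] integral_gaussian_shift[of x]
  by (subst nn_integral_eq_integral) auto

lemma spread_UNIV: "spread UNIV x = 1"
  unfolding spread_def using nn_integral_gaussian_shift by simp

lemma husimi_isometry:
  assumes u: "L2 u"
  shows "(\<integral>\<^sup>+q. \<integral>\<^sup>+p. ennreal ((cmod (husimi u q p))\<^sup>2) \<partial>lborel \<partial>lborel) = ennreal ((L2norm u)\<^sup>2)"
  using husimi_marginal[OF u, of UNIV] by (simp add: spread_UNIV nn_integral_L2[OF u])

lemma ft_cmult: "ft (\<lambda>x. c * f x) p = c * ft f p"
  unfolding ft_def mult.assoc integral_mult_right_zero by (rule mult.left_commute)

text \<open>The Fourier transform acts as a quarter turn of the phase plane: it maps one coherent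
  state to another, up to a phase that the modulus removes.\<close>

lemma cmod_husimi_ft:
  assumes f: "integrable lborel f"
  shows "cmod (husimi (ft f) p (- q)) = cmod (husimi f q p)"
proof -
  have int: "integrable lborel (coherent p (- q))"
  proof (rule Bochner_Integration.integrable_bound)
    show "integrable lborel (\<lambda>x. exp (- 1 * (x - p)\<^sup>2 / 2) / pi powr (1/4))"
      using integrable_gaussian[of 1 p] by simp
  qed (auto simp: cmod_coherent hermite_fun_0)
  have ftc: "ft (coherent p (- q)) x = iexp (q * p) * coherent q p x" for x
  proof -
    have "coherent p (- q) = (\<lambda>k. complex_of_real (1 / pi powr (1/4)) * (complex_of_real (exp (- 1 * (k - p)\<^sup>2 / 2)) * iexp (q * k)))"
      by (auto simp: coherent_def hermite_fun_0)
    then have "ft (coherent p (- q)) x = complex_of_real (1 / pi powr (1/4)) * ft (\<lambda>k. complex_of_real (exp (- 1 * (k - p)\<^sup>2 / 2)) * iexp (q * k)) x"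
      by (simp only: ft_cmult)
    also have "\<dots> = complex_of_real (hermite_fun 0 (x - q)) * iexp ((q - x) * p)"
      unfolding ft_gaussian_iexp[OF zero_less_one] by (simp add: hermite_fun_0 power2_commute)
    also have "iexp ((q - x) * p) = iexp (q * p) * iexp (- x * p)" unfolding iexp_mult ..
    also have "complex_of_real (hermite_fun 0 (x - q)) * (iexp (q * p) * iexp (- x * p)) = iexp (q * p) * coherent q p x"
      unfolding coherent_def by (simp add: mult_ac)
    finally show ?thesis .
  qed
  have "(LINT k|lborel. coherent p (- q) k * ft f k) = (LINT k|lborel. ft f k * coherent p (- q) k)" by (simp add: mult.commute)
  also have "\<dots> = (LINT x|lborel. f x * (iexp (q * p) * coherent q p x))"
    unfolding ft_multiplication_formula[OF f int] ftc ..
  also have "\<dots> = (LINT x|lborel. iexp (q * p) * (coherent q p x * f x))" by (simp add: mult_ac)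
  also have "\<dots> = iexp (q * p) * (LINT x|lborel. coherent q p x * f x)" by (rule integral_mult_right_zero)
  finally show ?thesis unfolding husimi_def norm_mult norm_iexp by (simp only: norm_mult norm_iexp mult_1)
qed

lemma tendsto_husimi:
  assumes "L2 u" "\<And>n. L2 (F n)" "(\<lambda>n. L2norm (\<lambda>x. u x - F n x)) \<longlonglongrightarrow> 0"
  shows "(\<lambda>n. cmod (husimi (F n) q p)) \<longlonglongrightarrow> cmod (husimi u q p)"
proof (rule tendsto_norm, rule LIM_zero_cancel, rule Lim_null_comparison[OF always_eventually])
  show "\<forall>n. norm (husimi (F n) q p - husimi u q p) \<le> L2norm (\<lambda>x. u x - F n x)"
    using cmod_husimi_le[OF L2_diff[OF assms(2,1)]] assms by (simp add: husimi_diff L2norm_minus[of u])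
qed (rule assms(3))

text \<open>The quarter turn for truncated functions passes to the limit, because each value of
  \<open>husimi\<close> depends continuously on its argument in L2.\<close>

lemma cmod_husimi_fourier:
  assumes u: "L2 u"
  shows "cmod (husimi (fourier u) p (- q)) = cmod (husimi u q p)"
proof -
  note t = L2_truncated[OF u]
  have L: "L2 (fourier_trunc R u)" for R unfolding fourier_trunc_eq_ft by (rule plancherel(2)[OF t(2) t(1)])
  let ?u = "\<lambda>n x. u x * indicator {-real n..real n} x"
  have eq: "L2norm (\<lambda>x. u x - ?u n x) = L2norm (\<lambda>x. u x * indicator {x. \<bar>x\<bar> > real n} x)" for n
    by (intro arg_cong[where f=L2norm] ext) (auto simp: indicator_def)
  have 1: "(\<lambda>n. cmod (husimi (?u n) q p)) \<longlonglongrightarrow> cmod (husimi u q p)"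
    by (rule tendsto_husimi[OF u t(1)]) (use L2norm_indicator_tail[OF u] eq in simp)
  have 2: "(\<lambda>n. cmod (husimi (fourier_trunc (real n) u) p (- q))) \<longlonglongrightarrow> cmod (husimi (fourier u) p (- q))"
    by (rule tendsto_husimi[OF fourier_spec(1)[OF u] L fourier_lim_sequentially[OF u]])
  have 3: "cmod (husimi (fourier_trunc (real n) u) p (- q)) = cmod (husimi (?u n) q p)" for n
    unfolding fourier_trunc_eq_ft by (rule cmod_husimi_ft[OF t(2)])
  then show ?thesis using LIMSEQ_unique[OF 1 2[unfolded 3]] by simp
qed

subsection \<open>Projection error\<close>

lemma spread_le_1: "spread B x \<le> 1"
proof -
  have "spread B x \<le> spread UNIV x"
    unfolding spread_def by (intro nn_integral_mono) (auto simp: indicator_def)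
  then show ?thesis by (simp add: spread_UNIV)
qed

text \<open>For \<open>|x| <= M\<close> and \<open>|q| > 2 * M\<close>, moving the centre by
  \<open>M\<close> towards \<open>q\<close> lowers the squared distance by at least
  \<open>M^2\<close>. This costs \<open>exp (- M^2)\<close> and leaves a Gaussian of mass 1, once
  for each side.\<close>

lemma spread_tail_le:
  assumes M: "M \<ge> 0" and x: "\<bar>x\<bar> \<le> M"
  shows "spread {q. \<bar>q\<bar> > 2 * M} x \<le> ennreal (2 * exp (- M\<^sup>2))"
proof -
  have le: "(hermite_fun 0 a)\<^sup>2 \<le> exp (- M\<^sup>2) * (hermite_fun 0 b)\<^sup>2" if "M\<^sup>2 + b\<^sup>2 \<le> a\<^sup>2" for a b
  proof -
    have "(hermite_fun 0 a)\<^sup>2 = exp (- a\<^sup>2) / (pi powr (1/4))\<^sup>2"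
      by (simp add: hermite_fun_0 power_divide flip: exp_of_nat_mult)
    also have "\<dots> \<le> exp (- M\<^sup>2 + - b\<^sup>2) / (pi powr (1/4))\<^sup>2"
      using that by (intro divide_right_mono) auto
    also have "\<dots> = exp (- M\<^sup>2) * (exp (- b\<^sup>2) / (pi powr (1/4))\<^sup>2)" by (simp only: exp_add times_divide_eq_right)
    also have "exp (- b\<^sup>2) / (pi powr (1/4))\<^sup>2 = (hermite_fun 0 b)\<^sup>2"
      by (simp add: hermite_fun_0 power_divide flip: exp_of_nat_mult)
    finally show ?thesis .
  qed
  have "indicator {q. \<bar>q\<bar> > 2 * M} q * ennreal ((hermite_fun 0 (x - q))\<^sup>2)
      \<le> ennreal (exp (- M\<^sup>2)) * (ennreal ((hermite_fun 0 (x + M - q))\<^sup>2) + ennreal ((hermite_fun 0 (x - M - q))\<^sup>2))" for q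
  proof (cases "\<bar>q\<bar> > 2 * M")
    case True
    have "(hermite_fun 0 (x - q))\<^sup>2 \<le> exp (- M\<^sup>2) * ((hermite_fun 0 (x + M - q))\<^sup>2 + (hermite_fun 0 (x - M - q))\<^sup>2)"
    proof (cases "q > 0")
      case True
      with \<open>\<bar>q\<bar> > 2 * M\<close> x have "q - x - M \<ge> 0" by auto
      then have "0 \<le> 2 * M * (q - x - M)" using M by simp
      then have "M\<^sup>2 + (x + M - q)\<^sup>2 \<le> (x - q)\<^sup>2" by (simp add: power2_eq_square algebra_simps)
      from le[OF this] show ?thesis by (simp add: distrib_left add_increasing2)
    next
      case False
      with \<open>\<bar>q\<bar> > 2 * M\<close> x have "x - M - q \<ge> 0" by auto
      then have "0 \<le> 2 * M * (x - M - q)" using M by simp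
      then have "M\<^sup>2 + (x - M - q)\<^sup>2 \<le> (x - q)\<^sup>2" by (simp add: power2_eq_square algebra_simps)
      from le[OF this] show ?thesis by (simp add: distrib_left add_increasing)
    qed
    then have "ennreal ((hermite_fun 0 (x - q))\<^sup>2) \<le> ennreal (exp (- M\<^sup>2) * ((hermite_fun 0 (x + M - q))\<^sup>2 + (hermite_fun 0 (x - M - q))\<^sup>2))"
      by (rule ennreal_leI)
    also have "\<dots> = ennreal (exp (- M\<^sup>2)) * (ennreal ((hermite_fun 0 (x + M - q))\<^sup>2) + ennreal ((hermite_fun 0 (x - M - q))\<^sup>2))"
      by (subst ennreal_mult) (auto simp: ennreal_plus)
    finally show ?thesis using True by simp
  qed simp
  then have "spread {q. \<bar>q\<bar> > 2 * M} x \<le> (\<integral>\<^sup>+q. ennreal (exp (- M\<^sup>2)) * (ennreal ((hermite_fun 0 (x + M - q))\<^sup>2) + ennreal ((hermite_fun 0 (x - M - q))\<^sup>2)) \<partial>lborel)"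
    unfolding spread_def by (intro nn_integral_mono) auto
  also have "\<dots> = ennreal (exp (- M\<^sup>2)) * (1 + 1)"
    by (subst nn_integral_cmult, measurable, subst nn_integral_add, measurable) (simp only: nn_integral_gaussian_shift)
  also have "\<dots> = ennreal (2 * exp (- M\<^sup>2))"
    by (simp add: ennreal_mult mult.commute)
  finally show ?thesis .
qed

text \<open>Where \<open>|x| > M\<close> the smearing probability is bounded by 1, elsewhere by the
  Gaussian tail.\<close>

lemma spread_energy_le:
  assumes u: "L2 u" and M: "M \<ge> 0"
  shows "(\<integral>\<^sup>+x. spread {q. \<bar>q\<bar> > 2 * M} x * ennreal ((cmod (u x))\<^sup>2) \<partial>lborel)
    \<le> ennreal ((L2norm (\<lambda>x. u x * indicator {x. \<bar>x\<bar> > M} x))\<^sup>2 + 2 * exp (- M\<^sup>2) * (L2norm u)\<^sup>2)"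
proof -
  note [measurable] = L2_measurable[OF u]
  have t: "L2 (\<lambda>x. u x * indicator {x. \<bar>x\<bar> > M} x)"
    by (rule L2_indicator[OF u]) auto
  have "(\<integral>\<^sup>+x. spread {q. \<bar>q\<bar> > 2 * M} x * ennreal ((cmod (u x))\<^sup>2) \<partial>lborel)
    \<le> (\<integral>\<^sup>+x. ennreal ((cmod (u x * indicator {x. \<bar>x\<bar> > M} x))\<^sup>2) + ennreal (2 * exp (- M\<^sup>2)) * ennreal ((cmod (u x))\<^sup>2) \<partial>lborel)"
  proof (rule nn_integral_mono)
    fix x
    show "spread {q. \<bar>q\<bar> > 2 * M} x * ennreal ((cmod (u x))\<^sup>2)
      \<le> ennreal ((cmod (u x * indicator {x. \<bar>x\<bar> > M} x))\<^sup>2) + ennreal (2 * exp (- M\<^sup>2)) * ennreal ((cmod (u x))\<^sup>2)"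
    proof (cases "\<bar>x\<bar> > M")
      case True
      have "spread {q. \<bar>q\<bar> > 2 * M} x * ennreal ((cmod (u x))\<^sup>2) \<le> 1 * ennreal ((cmod (u x))\<^sup>2)"
        by (rule mult_right_mono[OF spread_le_1]) simp
      then show ?thesis using True by (simp add: add_increasing2)
    next
      case False
      have "spread {q. \<bar>q\<bar> > 2 * M} x * ennreal ((cmod (u x))\<^sup>2) \<le> ennreal (2 * exp (- M\<^sup>2)) * ennreal ((cmod (u x))\<^sup>2)"
        using False by (intro mult_right_mono[OF spread_tail_le[OF M]]) auto
      then show ?thesis by (simp add: add_increasing)
    qed
  qed
  also have "\<dots> = ennreal ((L2norm (\<lambda>x. u x * indicator {x. \<bar>x\<bar> > M} x))\<^sup>2) + ennreal (2 * exp (- M\<^sup>2)) * ennreal ((L2norm u)\<^sup>2)"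
    using L2_measurable[OF t] unfolding nn_integral_L2[OF u, symmetric] nn_integral_L2[OF t, symmetric]
    by (subst nn_integral_add) (auto simp: nn_integral_cmult)
  also have "\<dots> = ennreal ((L2norm (\<lambda>x. u x * indicator {x. \<bar>x\<bar> > M} x))\<^sup>2 + 2 * exp (- M\<^sup>2) * (L2norm u)\<^sup>2)"
    by (subst ennreal_plus) (auto simp: ennreal_mult)
  finally show ?thesis .
qed

abbreviation plane :: "(real \<times> real) measure" where "plane \<equiv> lborel \<Otimes>\<^sub>M lborel"

lemma nn_integral_plane:
  assumes [measurable]: "f \<in> borel_measurable plane"
  shows "(\<integral>\<^sup>+z. f z \<partial>plane) = (\<integral>\<^sup>+q. \<integral>\<^sup>+p. f (q, p) \<partial>lborel \<partial>lborel)"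
  by (rule lborel.nn_integral_fst[symmetric]) measurable

lemma husimi_plane:
  assumes u: "L2 u"
  shows "(\<lambda>z. husimi u (fst z) (snd z)) \<in> borel_measurable plane"
    and "integrable plane (\<lambda>z. (cmod (husimi u (fst z) (snd z)))\<^sup>2)"
    and "(LINT z|plane. (cmod (husimi u (fst z) (snd z)))\<^sup>2) = (L2norm u)\<^sup>2"
proof -
  note [measurable] = L2_measurable[OF u]
  show m [measurable]: "(\<lambda>z. husimi u (fst z) (snd z)) \<in> borel_measurable plane" by measurable
  have nn: "(\<integral>\<^sup>+z. ennreal ((cmod (husimi u (fst z) (snd z)))\<^sup>2) \<partial>plane) = ennreal ((L2norm u)\<^sup>2)"
    by (subst nn_integral_plane) (simp_all add: husimi_isometry[OF u])
  show i: "integrable plane (\<lambda>z. (cmod (husimi u (fst z) (snd z)))\<^sup>2)"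
    using nn by (intro integrableI_nonneg) auto
  show "(LINT z|plane. (cmod (husimi u (fst z) (snd z)))\<^sup>2) = (L2norm u)\<^sup>2"
    using nn nn_integral_eq_integral[OF i] by simp
qed

text \<open>The momentum strip becomes a position strip for \<open>fourier u\<close> after the
  quarter turn; the reflected coordinate \<open>- q\<close> is absorbed by the inner
  integral.\<close>

lemma husimi_tail:
  assumes u: "L2 u" and M: "M \<ge> 0"
  shows "(\<integral>\<^sup>+z. indicator {z. \<bar>fst z\<bar> > 2 * M} z * ennreal ((cmod (husimi u (fst z) (snd z)))\<^sup>2) \<partial>plane)
      \<le> ennreal ((L2norm (\<lambda>x. u x * indicator {x. \<bar>x\<bar> > M} x))\<^sup>2 + 2 * exp (- M\<^sup>2) * (L2norm u)\<^sup>2)"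
    and "(\<integral>\<^sup>+z. indicator {z. \<bar>snd z\<bar> > 2 * M} z * ennreal ((cmod (husimi u (fst z) (snd z)))\<^sup>2) \<partial>plane)
      \<le> ennreal ((L2norm (\<lambda>x. fourier u x * indicator {x. \<bar>x\<bar> > M} x))\<^sup>2 + 2 * exp (- M\<^sup>2) * (L2norm u)\<^sup>2)"
proof -
  note [measurable] = L2_measurable[OF u] L2_measurable[OF fourier_spec(1)[OF u]]
  let ?B = "{q. \<bar>q\<bar> > 2 * M}"
  have "(\<integral>\<^sup>+z. indicator {z. \<bar>fst z\<bar> > 2 * M} z * ennreal ((cmod (husimi u (fst z) (snd z)))\<^sup>2) \<partial>plane)
     = (\<integral>\<^sup>+q. \<integral>\<^sup>+p. indicator ?B q * ennreal ((cmod (husimi u q p))\<^sup>2) \<partial>lborel \<partial>lborel)"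
    by (subst nn_integral_plane) (auto simp: indicator_def)
  also have "\<dots> = (\<integral>\<^sup>+q. indicator ?B q * (\<integral>\<^sup>+p. ennreal ((cmod (husimi u q p))\<^sup>2) \<partial>lborel) \<partial>lborel)"
    by (subst nn_integral_cmult) auto
  also have "\<dots> = (\<integral>\<^sup>+x. spread ?B x * ennreal ((cmod (u x))\<^sup>2) \<partial>lborel)"
    by (rule husimi_marginal[OF u]) measurable
  also note spread_energy_le[OF u M]
  finally show "(\<integral>\<^sup>+z. indicator {z. \<bar>fst z\<bar> > 2 * M} z * ennreal ((cmod (husimi u (fst z) (snd z)))\<^sup>2) \<partial>plane)
      \<le> ennreal ((L2norm (\<lambda>x. u x * indicator {x. \<bar>x\<bar> > M} x))\<^sup>2 + 2 * exp (- M\<^sup>2) * (L2norm u)\<^sup>2)" .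
  let ?W = "fourier u"
  have "(\<integral>\<^sup>+z. indicator {z. \<bar>snd z\<bar> > 2 * M} z * ennreal ((cmod (husimi u (fst z) (snd z)))\<^sup>2) \<partial>plane)
     = (\<integral>\<^sup>+q. \<integral>\<^sup>+p. indicator ?B p * ennreal ((cmod (husimi u q p))\<^sup>2) \<partial>lborel \<partial>lborel)"
    by (subst nn_integral_plane) (auto simp: indicator_def)
  also have "\<dots> = (\<integral>\<^sup>+p. \<integral>\<^sup>+q. indicator ?B p * ennreal ((cmod (husimi u q p))\<^sup>2) \<partial>lborel \<partial>lborel)"
    by (rule lborel_pair.Fubini') measurable
  also have "\<dots> = (\<integral>\<^sup>+p. indicator ?B p * (\<integral>\<^sup>+q. ennreal ((cmod (husimi ?W p (- q)))\<^sup>2) \<partial>lborel) \<partial>lborel)"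
    unfolding cmod_husimi_fourier[OF u] by (subst nn_integral_cmult) auto
  also have "\<dots> = (\<integral>\<^sup>+p. indicator ?B p * (\<integral>\<^sup>+q. ennreal ((cmod (husimi ?W p q))\<^sup>2) \<partial>lborel) \<partial>lborel)"
  proof -
    have "(\<integral>\<^sup>+q. ennreal ((cmod (husimi ?W p q))\<^sup>2) \<partial>lborel) = (\<integral>\<^sup>+q. ennreal ((cmod (husimi ?W p (- q)))\<^sup>2) \<partial>lborel)" for p
      using nn_integral_real_affine[of "\<lambda>q. ennreal ((cmod (husimi ?W p q))\<^sup>2)" "-1" 0] by simp
    then show ?thesis by simp
  qed
  also have "\<dots> = (\<integral>\<^sup>+x. spread ?B x * ennreal ((cmod (?W x))\<^sup>2) \<partial>lborel)"
    by (rule husimi_marginal[OF fourier_spec(1)[OF u]]) measurable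
  also note spread_energy_le[OF fourier_spec(1)[OF u] M]
  also have "ennreal ((L2norm (\<lambda>x. ?W x * indicator {x. \<bar>x\<bar> > M} x))\<^sup>2 + 2 * exp (- M\<^sup>2) * (L2norm ?W)\<^sup>2)
     \<le> ennreal ((L2norm (\<lambda>x. ?W x * indicator {x. \<bar>x\<bar> > M} x))\<^sup>2 + 2 * exp (- M\<^sup>2) * (L2norm u)\<^sup>2)"
    using L2norm_fourier_le[OF u] by (intro ennreal_leI add_left_mono mult_left_mono power_mono) auto
  finally show "(\<integral>\<^sup>+z. indicator {z. \<bar>snd z\<bar> > 2 * M} z * ennreal ((cmod (husimi u (fst z) (snd z)))\<^sup>2) \<partial>plane)
      \<le> ennreal ((L2norm (\<lambda>x. ?W x * indicator {x. \<bar>x\<bar> > M} x))\<^sup>2 + 2 * exp (- M\<^sup>2) * (L2norm u)\<^sup>2)" .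
qed

lemma hproj_error_bound_aux:
  assumes w: "L2 w" and K: "Suc K \<ge> N"
  defines "M \<equiv> 1 / (2 * sqrt 2) * sqrt (real N)"
  shows "L2norm (\<lambda>x. w x - hproj K w x) \<le> sqrt (2 * real N * (exp (real N / 2) / 2 ^ N)) * L2norm w
     + sqrt ((L2norm (\<lambda>x. w x * indicator {x. \<bar>x\<bar> > M} x))\<^sup>2 + (L2norm (\<lambda>x. fourier w x * indicator {x. \<bar>x\<bar> > M} x))\<^sup>2 + 4 * exp (- M\<^sup>2) * (L2norm w)\<^sup>2)"
    (is "_ \<le> sqrt ?A * _ + sqrt ?T")
proof -
  have M: "M \<ge> 0" "M\<^sup>2 = real N / 8" by (auto simp: M_def power_mult_distrib power_divide)
  define v where "v = (\<lambda>x. w x - hproj K w x)"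
  have v: "L2 v" unfolding v_def using w by auto
  define a where "a = (\<lambda>z. cmod (husimi v (fst z) (snd z)))"
  define b where "b = (\<lambda>z. cmod (husimi w (fst z) (snd z)))"
  define box where "box = {z::real\<times>real. \<bar>fst z\<bar> \<le> 2 * M \<and> \<bar>snd z\<bar> \<le> 2 * M}"
  have box_eq: "box = {- (2 * M)..2 * M} \<times> {- (2 * M)..2 * M}" by (auto simp: box_def)
  note hv = husimi_plane[OF v] and hw = husimi_plane[OF w]
  have [measurable]: "a \<in> borel_measurable plane" "b \<in> borel_measurable plane"
    unfolding a_def b_def using hv(1) hw(1) by measurable
  have box_sets [measurable]: "box \<in> sets plane" unfolding box_eq by (rule pair_measureI) auto
  have ia: "integrable plane (\<lambda>z. (a z)\<^sup>2)" and ib: "integrable plane (\<lambda>z. (b z)\<^sup>2)"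
    and Ia: "(LINT z|plane. (a z)\<^sup>2) = (L2norm v)\<^sup>2" and Ib: "(LINT z|plane. (b z)\<^sup>2) = (L2norm w)\<^sup>2"
    using hv hw by (simp_all add: a_def b_def)
  have ab: "integrable plane (\<lambda>z. a z * b z)"
    by (rule Cauchy_Schwarz_integral(1)[OF _ _ ia ib]) auto
  have ab0: "a z * b z \<ge> 0" for z by (simp add: a_def b_def)
  \<comment> \<open>Polarisation is avoided: the squared norm of the projection \<open>w - v\<close>
    equals both \<open>|w|^2 - |v|^2\<close> and the integral of \<open>|V w - V v|^2\<close>, which
    dominates that of \<open>(b - a)^2\<close>. Comparing the two leaves the integral of
    \<open>a * b\<close>.\<close>
  have main: "(L2norm v)\<^sup>2 \<le> (LINT z|plane. a z * b z)"
  proof -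
    let ?p = "\<lambda>x. w x - v x"
    have p: "?p = hproj K w" by (auto simp: v_def)
    have Lp: "L2 ?p" unfolding p by simp
    have "(L2norm ?p)\<^sup>2 = (L2norm w)\<^sup>2 - (L2norm v)\<^sup>2"
      unfolding p v_def L2norm_minus_hproj[OF w] by (simp add: hproj_def L2norm_hsum)
    moreover have "(L2norm ?p)\<^sup>2 \<ge> (LINT z|plane. (b z)\<^sup>2 + (a z)\<^sup>2 - 2 * (a z * b z))"
      unfolding husimi_plane(3)[OF Lp, symmetric]
    proof (rule integral_mono)
      fix z
      have "(b z)\<^sup>2 + (a z)\<^sup>2 - 2 * (a z * b z) = (b z - a z)\<^sup>2" by (simp add: power2_diff)
      also have "\<dots> \<le> (cmod (husimi ?p (fst z) (snd z)))\<^sup>2"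
        unfolding husimi_diff[OF w v] a_def b_def
        using norm_triangle_ineq3[of "husimi w (fst z) (snd z)" "husimi v (fst z) (snd z)"] by (intro abs_le_square_iff[THEN iffD1]) simp
      finally show "(b z)\<^sup>2 + (a z)\<^sup>2 - 2 * (a z * b z) \<le> (cmod (husimi ?p (fst z) (snd z)))\<^sup>2" .
    qed (use ia ib ab husimi_plane(2)[OF Lp] in auto)
    moreover have "(LINT z|plane. (b z)\<^sup>2 + (a z)\<^sup>2 - 2 * (a z * b z)) = (L2norm w)\<^sup>2 + (L2norm v)\<^sup>2 - 2 * (LINT z|plane. a z * b z)"
      using ia ib ab Ia Ib by simp
    ultimately show ?thesis by simp
  qed
  have sq_ind: "(f z * indicator S z)\<^sup>2 = indicator S z * (f z)\<^sup>2" for f :: "real \<times> real \<Rightarrow> real" and S z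
    by (auto simp: indicator_def)
  have i1: "integrable plane (\<lambda>z. (a z * indicator box z)\<^sup>2)"
    by (rule Bochner_Integration.integrable_bound[OF ia]) (auto simp: indicator_def)
  have i2: "integrable plane (\<lambda>z. (b z * indicator (- box) z)\<^sup>2)"
    by (rule Bochner_Integration.integrable_bound[OF ib]) (auto simp: indicator_def)
  have CS1: "(LINT z|plane. \<bar>(a z * indicator box z) * b z\<bar>) \<le> sqrt (LINT z|plane. (a z * indicator box z)\<^sup>2) * sqrt (LINT z|plane. (b z)\<^sup>2)"
    by (rule Cauchy_Schwarz_integral(2)[OF _ _ i1 ib]) auto
  have CS2: "(LINT z|plane. \<bar>a z * (b z * indicator (- box) z)\<bar>) \<le> sqrt (LINT z|plane. (a z)\<^sup>2) * sqrt (LINT z|plane. (b z * indicator (- box) z)\<^sup>2)"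
    by (rule Cauchy_Schwarz_integral(2)[OF _ _ ia i2]) auto
  \<comment> \<open>On the box the smallness sits in \<open>a\<close>, because the residual is
    orthogonal to low modes; off the box it sits in \<open>b\<close>, because \<open>w\<close> has
    small tails there.\<close>
  have split: "(LINT z|plane. a z * b z) = (LINT z|plane. \<bar>(a z * indicator box z) * b z\<bar>) + (LINT z|plane. \<bar>a z * (b z * indicator (- box) z)\<bar>)"
  proof -
    have "a z * b z = \<bar>(a z * indicator box z) * b z\<bar> + \<bar>a z * (b z * indicator (- box) z)\<bar>" for z
      using ab0[of z] by (cases "z \<in> box") auto
    then have "(LINT z|plane. a z * b z) = (LINT z|plane. \<bar>(a z * indicator box z) * b z\<bar> + \<bar>a z * (b z * indicator (- box) z)\<bar>)"
      by (rule Bochner_Integration.integral_cong[OF refl])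
    also have "\<dots> = (LINT z|plane. \<bar>(a z * indicator box z) * b z\<bar>) + (LINT z|plane. \<bar>a z * (b z * indicator (- box) z)\<bar>)"
      by (intro Bochner_Integration.integral_add integrable_abs Cauchy_Schwarz_integral(1)[OF _ _ i1 ib] Cauchy_Schwarz_integral(1)[OF _ _ ia i2]) measurable
    finally show ?thesis .
  qed
  have A: "(LINT z|plane. (a z * indicator box z)\<^sup>2) \<le> ?A * (L2norm v)\<^sup>2"
  proof -
    let ?c = "(L2norm v)\<^sup>2 * (exp (real N / 2) / 2 ^ N)"
    have le: "(a z)\<^sup>2 \<le> ?c" if "z \<in> box" for z
    proof -
      have qp: "(fst z)\<^sup>2 \<le> real N / 2" "(snd z)\<^sup>2 \<le> real N / 2"
        using that power_mono[of "\<bar>fst z\<bar>" "2 * M" 2] power_mono[of "\<bar>snd z\<bar>" "2 * M" 2] M by (auto simp: box_def power_mult_distrib)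
      have "1 \<le> 2 * pi" using pi_gt3 by simp
      then have "1 / sqrt (2 * pi) \<le> 1" by simp
      then have "a z \<le> 1 * cmod (LINT x|lborel. coherent (fst z) (snd z) x * v x)"
        unfolding a_def husimi_def norm_mult norm_of_real by (intro mult_right_mono) auto
      then have "(a z)\<^sup>2 \<le> (cmod (LINT x|lborel. coherent (fst z) (snd z) x * v x))\<^sup>2"
        by (intro power_mono) (auto simp: a_def)
      also have "\<dots> \<le> (L2norm v)\<^sup>2 * (exp (((fst z)\<^sup>2 + (snd z)\<^sup>2) / 2) / 2 ^ Suc K)"
        by (rule coherent_inner_orth_bound[OF v]) (simp add: v_def coef_minus_hproj[OF w])
      also have "\<dots> \<le> ?c"
        using qp K by (intro mult_left_mono frac_le power_increasing) auto
      finally show ?thesis .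
    qed
    \<comment> \<open>The sides have length \<open>4 * M\<close>, so the area is
      \<open>16 * M^2 = 2 * N\<close>.\<close>
    have mb: "measure plane box = 2 * real N" and fb: "emeasure plane box < \<infinity>"
    proof -
      have e: "emeasure plane box = ennreal (4 * M) * ennreal (4 * M)"
        unfolding box_eq using M by (subst lborel.emeasure_pair_measure_Times) auto
      also have "\<dots> = ennreal (2 * real N)" using M by (simp add: ennreal_mult[symmetric] power2_eq_square)
      finally show "measure plane box = 2 * real N" "emeasure plane box < \<infinity>" by (auto simp: measure_def)
    qed
    have "(LINT z|plane. (a z * indicator box z)\<^sup>2) \<le> (LINT z|plane. ?c * indicator box z)"
      using le by (intro integral_mono i1 integrable_mult_right integrable_real_indicator[OF box_sets fb]) (auto simp: indicator_def)
    also have "\<dots> = ?c * measure plane (box \<inter> space plane)" by simp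
    also have "\<dots> = ?A * (L2norm v)\<^sup>2" using mb by (simp add: space_pair_measure)
    finally show ?thesis .
  qed
  \<comment> \<open>The complement of the box is covered by a position strip and a momentum strip,
    each paying one tail and \<open>2 * exp (- M^2)\<close>.\<close>
  have T: "(LINT z|plane. (b z * indicator (- box) z)\<^sup>2) \<le> ?T"
  proof -
    have "ennreal (LINT z|plane. (b z * indicator (- box) z)\<^sup>2) = (\<integral>\<^sup>+z. ennreal ((b z * indicator (- box) z)\<^sup>2) \<partial>plane)"
      by (rule nn_integral_eq_integral[symmetric, OF i2]) auto
    also have "\<dots> \<le> (\<integral>\<^sup>+z. indicator {z. \<bar>fst z\<bar> > 2 * M} z * ennreal ((b z)\<^sup>2) + indicator {z. \<bar>snd z\<bar> > 2 * M} z * ennreal ((b z)\<^sup>2) \<partial>plane)"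
      by (intro nn_integral_mono) (auto simp: indicator_def box_def)
    also have "\<dots> = (\<integral>\<^sup>+z. indicator {z. \<bar>fst z\<bar> > 2 * M} z * ennreal ((b z)\<^sup>2) \<partial>plane) + (\<integral>\<^sup>+z. indicator {z. \<bar>snd z\<bar> > 2 * M} z * ennreal ((b z)\<^sup>2) \<partial>plane)"
      by (rule nn_integral_add) measurable
    also have "\<dots> \<le> ennreal ((L2norm (\<lambda>x. w x * indicator {x. \<bar>x\<bar> > M} x))\<^sup>2 + 2 * exp (- M\<^sup>2) * (L2norm w)\<^sup>2)
       + ennreal ((L2norm (\<lambda>x. fourier w x * indicator {x. \<bar>x\<bar> > M} x))\<^sup>2 + 2 * exp (- M\<^sup>2) * (L2norm w)\<^sup>2)"
      unfolding b_def by (intro add_mono husimi_tail w M)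
    also have "\<dots> = ennreal ?T" by (subst ennreal_plus[symmetric]) (auto simp: algebra_simps)
    finally show ?thesis by (subst (asm) ennreal_le_iff) auto
  qed
  have "(L2norm v)\<^sup>2 \<le> sqrt (?A * (L2norm v)\<^sup>2) * sqrt ((L2norm w)\<^sup>2) + sqrt ((L2norm v)\<^sup>2) * sqrt ?T"
  proof -
    have "sqrt (LINT z|plane. (a z * indicator box z)\<^sup>2) * sqrt (LINT z|plane. (b z)\<^sup>2) \<le> sqrt (?A * (L2norm v)\<^sup>2) * sqrt ((L2norm w)\<^sup>2)"
      unfolding Ib by (intro mult_right_mono real_sqrt_le_mono A) auto
    moreover have "sqrt (LINT z|plane. (a z)\<^sup>2) * sqrt (LINT z|plane. (b z * indicator (- box) z)\<^sup>2) \<le> sqrt ((L2norm v)\<^sup>2) * sqrt ?T"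
      unfolding Ia by (intro mult_left_mono real_sqrt_le_mono T) auto
    ultimately show ?thesis using main CS1 CS2 split by linarith
  qed
  also have "\<dots> = L2norm v * (sqrt ?A * L2norm w + sqrt ?T)"
    unfolding real_sqrt_mult[of ?A] by (simp add: algebra_simps)
  finally have fin: "L2norm v * L2norm v \<le> L2norm v * (sqrt ?A * L2norm w + sqrt ?T)"
    by (simp add: power2_eq_square)
  show ?thesis
  proof (cases "L2norm v = 0")
    case True
    then show ?thesis unfolding v_def[symmetric] by simp
  next
    case False
    then have "L2norm v > 0" using L2norm_nonneg[of v] by linarith
    then show ?thesis using fin unfolding v_def[symmetric] by simp
  qed
qed

text \<open>After squaring, the claim compares \<open>N * (exp (1/2) / 2) ^ N\<close> with
  \<open>exp (- N / 8)\<close>; the quotient is \<open>2 * N\<close> times a geometric sequence, and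
  a convergent sequence is bounded.\<close>

lemma geometric_decay_constant:
  "\<exists>C\<ge>0. \<forall>N::nat. sqrt (2 * real N * (exp (real N / 2) / 2 ^ N)) \<le> C * exp (- real N / 16)"
proof -
  have "(\<lambda>N::nat. 2 * real N * (exp (real N / 2) / 2 ^ N) / exp (- real N / 8)) \<longlonglongrightarrow> 0"
  proof -
    have "(\<lambda>N::nat. 2 * real N * (exp (5/8) / 2) ^ N) \<longlonglongrightarrow> 0"
    proof -
      \<comment> \<open>The exponent is \<open>1/2 + 1/8\<close>. Taking eighth powers,
        \<open>exp 5 < 3 ^ 5 = 243 < 256 = 2 ^ 8\<close>.\<close>
      have "exp (5/8) < (2::real)"
      proof -
        have "exp (5/8 :: real) ^ 8 = exp 1 ^ 5" by (simp flip: exp_of_nat_mult)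
        also have "\<dots> < 3 ^ 5" using e_less_272 by (intro power_strict_mono) auto
        also have "\<dots> < (2::real) ^ 8" by simp
        finally show ?thesis by (rule power_less_imp_less_base) simp
      qed
      then have "\<bar>exp (5/8) / 2 :: real\<bar> < 1" by simp
      from tendsto_mult[OF tendsto_const powser_times_n_limit_0[of "exp (5/8) / 2 :: real"], of 2] this
      show ?thesis by (simp add: mult.assoc)
    qed
    moreover have "2 * real N * (exp (real N / 2) / 2 ^ N) / exp (- real N / 8) = 2 * real N * (exp (5/8) / 2) ^ N" for N
    proof -
      have "exp (real N / 2) / exp (- real N / 8) = exp (5/8) ^ N"
        by (simp flip: exp_diff exp_of_nat_mult)
      moreover have "2 * real N * (exp (real N / 2) / 2 ^ N) / exp (- real N / 8) = 2 * real N * (exp (real N / 2) / exp (- real N / 8)) / 2 ^ N"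
        by simp
      ultimately show ?thesis by (simp only: power_divide times_divide_eq_right)
    qed
    ultimately show ?thesis by simp
  qed
  then have "Bseq (\<lambda>N::nat. 2 * real N * (exp (real N / 2) / 2 ^ N) / exp (- real N / 8))"
    by (intro convergent_imp_Bseq convergentI)
  then obtain B where B: "B > 0" "\<And>N::nat. norm (2 * real N * (exp (real N / 2) / 2 ^ N) / exp (- real N / 8)) \<le> B"
    unfolding Bseq_def by blast
  show ?thesis
  proof (intro exI[of _ "sqrt B"] conjI allI)
    fix N :: nat
    have "2 * real N * (exp (real N / 2) / 2 ^ N) \<le> B * exp (- real N / 8)"
      using B(2)[of N] by (simp add: field_simps abs_mult)
    then have "sqrt (2 * real N * (exp (real N / 2) / 2 ^ N)) \<le> sqrt (B * exp (- real N / 8))"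
      by (rule real_sqrt_le_mono)
    also have "exp (- real N / 8) = (exp (- real N / 16))\<^sup>2" by (simp flip: exp_of_nat_mult)
    also have "sqrt (B * \<dots>) = sqrt B * exp (- real N / 16)" by (simp add: real_sqrt_mult)
    finally show "sqrt (2 * real N * (exp (real N / 2) / 2 ^ N)) \<le> sqrt B * exp (- real N / 16)" .
  qed (use B in auto)
qed

text \<open>The condition \<open>Suc K >= N\<close> also admits the projection of index
  \<open>N - 1\<close>, which is what bounds the N-th coefficient itself.\<close>

theorem hproj_error_bound:
  "\<exists>C\<ge>1. \<forall>N K w. L2 w \<longrightarrow> Suc K \<ge> N \<longrightarrow> L2norm (\<lambda>x. w x - hproj K w x) \<le> C * E_err N 1 w"
proof -
  obtain C where C: "C \<ge> 0" "\<And>N::nat. sqrt (2 * real N * (exp (real N / 2) / 2 ^ N)) \<le> C * exp (- real N / 16)"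
    using geometric_decay_constant by blast
  have "L2norm (\<lambda>x. w x - hproj K w x) \<le> (C + 2) * E_err N 1 w" if w: "L2 w" and K: "Suc K \<ge> N" for N K w
  proof -
    define M where "M = 1 / (2 * sqrt 2) * sqrt (real N)"
    have M2: "M\<^sup>2 = real N / 8" by (auto simp: M_def power_mult_distrib power_divide)
    define x where "x = L2norm (\<lambda>x. w x * indicator {x. \<bar>x\<bar> > M} x)"
    define y where "y = L2norm (\<lambda>x. fourier w x * indicator {x. \<bar>x\<bar> > M} x)"
    define e where "e = exp (- real N / 16)"
    define n where "n = L2norm w"
    have pos: "x \<ge> 0" "y \<ge> 0" "e \<ge> 0" "n \<ge> 0" by (auto simp: x_def y_def e_def n_def)
    have E: "E_err N 1 w = x + y + n * e" by (simp add: E_err_def x_def y_def e_def n_def M_def)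
    have ee: "exp (- M\<^sup>2) = e\<^sup>2" unfolding M2 e_def by (simp flip: exp_of_nat_mult)
    have "L2norm (\<lambda>x. w x - hproj K w x) \<le> sqrt (2 * real N * (exp (real N / 2) / 2 ^ N)) * n + sqrt (x\<^sup>2 + y\<^sup>2 + 4 * exp (- M\<^sup>2) * n\<^sup>2)"
      using hproj_error_bound_aux[OF w K] unfolding M_def x_def y_def n_def .
    also have "\<dots> \<le> (C * e) * n + (x + y + 2 * e * n)"
    proof (intro add_mono mult_right_mono)
      show "sqrt (2 * real N * (exp (real N / 2) / 2 ^ N)) \<le> C * e" using C(2) by (simp add: e_def)
      have "x\<^sup>2 + y\<^sup>2 + 4 * exp (- M\<^sup>2) * n\<^sup>2 \<le> (x + y + 2 * e * n)\<^sup>2"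
        using pos unfolding ee by (simp add: power2_eq_square algebra_simps)
      then show "sqrt (x\<^sup>2 + y\<^sup>2 + 4 * exp (- M\<^sup>2) * n\<^sup>2) \<le> x + y + 2 * e * n"
        using pos by (intro real_le_lsqrt) auto
    qed (use pos in auto)
    also have "\<dots> \<le> (C + 2) * (x + y + n * e)"
      using pos C(1) by (simp add: algebra_simps)
    finally show ?thesis unfolding E .
  qed
  then show ?thesis using C(1) by (intro exI[of _ "C + 2"]) auto
qed

subsection \<open>Smooth cut-offs and weak derivatives\<close>

text \<open>Recursion on the derivative lets products and affine substitutions be treated by
  induction, which the iterates \<open>deriv ^^ k\<close> in \<open>test_fun\<close> do not offer
  directly. The count is shifted: level \<open>k\<close> means \<open>k + 1\<close>
  derivatives.\<close>

primrec smooth_upto :: "nat \<Rightarrow> (real \<Rightarrow> real) \<Rightarrow> bool" where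
  "smooth_upto 0 f \<longleftrightarrow> (\<forall>x. f differentiable (at x))"
| "smooth_upto (Suc k) f \<longleftrightarrow> (\<forall>x. f differentiable (at x)) \<and> smooth_upto k (deriv f)"

lemma smooth_upto_differentiable: "smooth_upto k f \<Longrightarrow> f differentiable (at x)"
  by (cases k) auto

lemma smooth_upto_DERIV: "smooth_upto k f \<Longrightarrow> (f has_real_derivative deriv f x) (at x)"
  using smooth_upto_differentiable DERIV_deriv_iff_real_differentiable by blast

lemma smooth_upto_iterate: "smooth_upto k f \<Longrightarrow> (deriv ^^ k) f differentiable (at x)"
  by (induction k arbitrary: f) (auto simp del: funpow.simps(2) simp: funpow_Suc_right)

lemma smooth_uptoI:
  assumes d: "\<And>x. (f has_real_derivative f' x) (at x)" and "k > 0 \<Longrightarrow> smooth_upto (k - 1) f'"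
  shows "smooth_upto k f"
proof -
  have "deriv f = f'" using d DERIV_imp_deriv by blast
  moreover have "f differentiable (at x)" for x using d real_differentiable_def by blast
  ultimately show ?thesis using assms(2) by (cases k) auto
qed

lemma smooth_upto_continuous: "smooth_upto k f \<Longrightarrow> continuous_on A f"
  by (rule DERIV_continuous_on, rule has_field_derivative_at_within, rule smooth_upto_DERIV)

lemma smooth_upto_Suc_D: "smooth_upto (Suc k) f \<Longrightarrow> smooth_upto k f"
  by (induction k arbitrary: f) auto

lemma smooth_upto_const: "smooth_upto k (\<lambda>x. c)"
proof (induction k arbitrary: c)
  case (Suc k)
  show ?case by (rule smooth_uptoI[where f'="\<lambda>x. 0"]) (use Suc in simp_all)
qed simp

lemma smooth_upto_add:
  assumes "smooth_upto k f" "smooth_upto k g" shows "smooth_upto k (\<lambda>x. f x + g x)"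
  using assms
proof (induction k arbitrary: f g)
  case (Suc k)
  show ?case
  proof (rule smooth_uptoI)
    show "((\<lambda>x. f x + g x) has_real_derivative deriv f x + deriv g x) (at x)" for x
      by (intro DERIV_add smooth_upto_DERIV[OF Suc.prems(1)] smooth_upto_DERIV[OF Suc.prems(2)])
    show "smooth_upto (Suc k - 1) (\<lambda>x. deriv f x + deriv g x)"
      using Suc.IH[of "deriv f" "deriv g"] Suc.prems by simp
  qed
qed auto

lemma smooth_upto_mult:
  assumes "smooth_upto k f" "smooth_upto k g" shows "smooth_upto k (\<lambda>x. f x * g x)"
  using assms
proof (induction k arbitrary: f g)
  case 0
  show ?case
    by (rule smooth_uptoI, rule DERIV_mult[OF smooth_upto_DERIV[OF 0(1)] smooth_upto_DERIV[OF 0(2)]]) simp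
next
  case (Suc k)
  have f: "smooth_upto k (deriv f)" and g: "smooth_upto k (deriv g)" using Suc.prems by simp_all
  have "smooth_upto k (\<lambda>x. deriv f x * g x + deriv g x * f x)"
    by (rule smooth_upto_add[OF Suc.IH[OF f smooth_upto_Suc_D[OF Suc.prems(2)]] Suc.IH[OF g smooth_upto_Suc_D[OF Suc.prems(1)]]])
  then show ?case
    by (intro smooth_uptoI[OF DERIV_mult[OF smooth_upto_DERIV[OF Suc.prems(1)] smooth_upto_DERIV[OF Suc.prems(2)]]]) simp
qed

lemma smooth_upto_affine:
  assumes "smooth_upto k f" shows "smooth_upto k (\<lambda>x. f (a * x + b))"
  using assms
proof (induction k arbitrary: f)
  have aff: "((\<lambda>x. a * x + b) has_real_derivative a) (at x)" for x
    by (auto intro!: derivative_eq_intros)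
  case 0
  show ?case
    by (rule smooth_uptoI, rule DERIV_chain2[OF smooth_upto_DERIV[OF 0] aff]) simp
next
  have aff: "((\<lambda>x. a * x + b) has_real_derivative a) (at x)" for x
    by (auto intro!: derivative_eq_intros)
  case (Suc k)
  then have "smooth_upto k (deriv f)" by simp
  from smooth_upto_mult[OF Suc.IH[OF this] smooth_upto_const[of k a]]
  show ?case
    by (intro smooth_uptoI[OF DERIV_chain2[OF smooth_upto_DERIV[OF Suc.prems] aff]]) simp
qed

text \<open>The classical flat function with an extra power of \<open>1 / x\<close>: the family is
  closed under differentiation up to linear combinations, so all orders are reached by one
  induction.\<close>

definition flat :: "nat \<Rightarrow> real \<Rightarrow> real" where
  "flat n x = (if x > 0 then exp (- 1 / x) / x ^ n else 0)"

text \<open>Term \<open>n + 2\<close> of the exponential series at \<open>1 / x\<close> leaves two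
  spare powers of \<open>x\<close>; a quadratic bound makes the derivative at the origin 0.\<close>

lemma flat_bound: "\<bar>flat n x\<bar> \<le> fact (n + 2) * x\<^sup>2"
proof (cases "x > 0")
  case True
  have "(1 / x) ^ (n + 2) / fact (n + 2) \<le> exp (1 / x)" using True by (intro power_le_exp) simp
  then have "1 \<le> fact (n + 2) * x ^ (n + 2) * exp (1 / x)"
    using True by (simp add: power_divide field_simps del: fact_Suc)
  then have "exp (- 1 / x) * 1 \<le> exp (- 1 / x) * (fact (n + 2) * x ^ (n + 2) * exp (1 / x))"
    by (intro mult_left_mono) auto
  also have "\<dots> = fact (n + 2) * x ^ (n + 2)" by (simp add: exp_minus field_simps del: fact_Suc)
  finally have "exp (- 1 / x) / x ^ n \<le> fact (n + 2) * x ^ (n + 2) / x ^ n"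
    using True by (intro divide_right_mono) auto
  also have "\<dots> = fact (n + 2) * x\<^sup>2" using True by (simp add: power_add power2_eq_square del: fact_Suc)
  finally show ?thesis using True by (simp add: flat_def)
qed (simp add: flat_def)

lemma DERIV_flat: "(flat n has_real_derivative flat (n + 2) x - real n * flat (n + 1) x) (at x)"
proof -
  consider "x > 0" | "x < 0" | "x = 0" by linarith
  then show ?thesis
  proof cases
    case 1
    have "((\<lambda>x. exp (- 1 / x) / x ^ n) has_real_derivative flat (n + 2) x - real n * flat (n + 1) x) (at x)"
    proof (cases n)
      case 0
      then show ?thesis using 1
        by (auto intro!: derivative_eq_intros simp: flat_def power2_eq_square)
    next
      case (Suc m)
      then show ?thesis using 1
        by (auto intro!: derivative_eq_intros simp: flat_def divide_simps power2_eq_square power_add) (cases m; simp add: algebra_simps)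
    qed
    then show ?thesis
      by (rule has_field_derivative_transform_within_open[where S="{0<..}"]) (use 1 in \<open>auto simp: flat_def\<close>)
  next
    case 2
    have "((\<lambda>x. 0) has_real_derivative flat (n + 2) x - real n * flat (n + 1) x) (at x)"
      using 2 by (simp add: flat_def)
    then show ?thesis
      by (rule has_field_derivative_transform_within_open[where S="{..<0}"]) (use 2 in \<open>auto simp: flat_def\<close>)
  next
    case 3
    have "((\<lambda>h. flat n h / h) \<longlongrightarrow> 0) (at 0)"
    proof (rule Lim_null_comparison[OF always_eventually])
      have "norm (flat n h / h) \<le> fact (n + 2) * \<bar>h\<bar>" for h
        using flat_bound[of n h] by (cases "h = 0") (auto simp: abs_divide power2_eq_square divide_simps abs_mult simp del: fact_Suc)
      then show "\<forall>h. norm (flat n h / h) \<le> fact (n + 2) * \<bar>h\<bar>" by blast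
      have "((\<lambda>h::real. fact (n + 2) * \<bar>h\<bar>) \<longlongrightarrow> fact (n + 2) * \<bar>0\<bar>) (at 0)" by (intro tendsto_intros)
      then show "((\<lambda>h::real. fact (n + 2) * \<bar>h\<bar>) \<longlongrightarrow> 0) (at 0)" by simp
    qed
    then show ?thesis using 3 by (simp add: DERIV_def flat_def)
  qed
qed

lemma smooth_upto_flat: "smooth_upto k (flat n)"
proof (induction k arbitrary: n)
  case 0
  show ?case by (rule smooth_uptoI[OF DERIV_flat]) simp
next
  case (Suc k)
  have "smooth_upto k (\<lambda>x. flat (n + 2) x + (- real n) * flat (n + 1) x)"
    by (rule smooth_upto_add[OF Suc smooth_upto_mult[OF smooth_upto_const Suc]])
  then show ?case by (intro smooth_uptoI[OF DERIV_flat]) simp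
qed

definition bump :: "real \<Rightarrow> real" where
  "bump x = flat 0 x * flat 0 (- 1 * x + 1)"

lemma smooth_upto_bump: "smooth_upto k bump"
  unfolding bump_def[abs_def] by (rule smooth_upto_mult[OF smooth_upto_flat smooth_upto_affine[OF smooth_upto_flat]])

lemma continuous_bump: "continuous_on A bump"
  by (rule smooth_upto_continuous[OF smooth_upto_bump])

lemma bump_props: "bump x \<ge> 0" "x \<le> 0 \<Longrightarrow> bump x = 0" "x \<ge> 1 \<Longrightarrow> bump x = 0" "0 < x \<Longrightarrow> x < 1 \<Longrightarrow> bump x > 0"
  by (auto simp: bump_def flat_def)

lemma bump_integral_pos: "integral {0..1} bump > 0"
proof -
  have "integral {0..1} bump \<noteq> 0"
  proof
    assume "integral {0..1} bump = 0"
    then have "(bump has_integral 0) {0..1}"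
      using integrable_integral[OF integrable_continuous_real[OF continuous_bump]] by metis
    then have "bump (1/2) = 0"
      using has_integral_0_cbox_imp_0[of "0::real" 1 bump "1/2"] by (simp add: bump_props continuous_bump)
    then show False using bump_props(4)[of "1/2"] by simp
  qed
  moreover have "integral {0..1} bump \<ge> 0" by (intro integral_nonneg integrable_continuous_real continuous_bump) (auto simp: bump_props)
  ultimately show ?thesis by linarith
qed

definition mollifier :: "real \<Rightarrow> real" where
  "mollifier x = bump x * (1 / integral {0..1} bump)"

text \<open>The lower limit -1 lies left of the support of \<open>mollifier\<close>, so the delicate
  point 0 is interior to the interval on which the integral is differentiated.\<close>

definition smooth_step :: "real \<Rightarrow> real" where
  "smooth_step x = integral {-1..x} mollifier"

lemma smooth_upto_mollifier: "smooth_upto k mollifier"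
  unfolding mollifier_def[abs_def] by (rule smooth_upto_mult[OF smooth_upto_bump smooth_upto_const])

lemma continuous_mollifier: "continuous_on A mollifier"
  by (rule smooth_upto_continuous[OF smooth_upto_mollifier])

lemma measurable_mollifier [measurable]: "mollifier \<in> borel_measurable borel"
  by (rule borel_measurable_continuous_onI[OF continuous_mollifier])

lemma mollifier_props: "mollifier x \<ge> 0" "x \<le> 0 \<Longrightarrow> mollifier x = 0" "x \<ge> 1 \<Longrightarrow> mollifier x = 0"
  using bump_integral_pos by (auto simp: mollifier_def bump_props)

lemma mollifier_bounded: "\<exists>B\<ge>0. \<forall>x. mollifier x \<le> B"
proof -
  have "bounded (mollifier ` {0..1})"
    by (intro compact_imp_bounded compact_continuous_image continuous_mollifier) auto
  then obtain B where "\<forall>y\<in>mollifier ` {0..1}. norm y \<le> B" unfolding bounded_iff by blast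
  then have B: "\<bar>mollifier x\<bar> \<le> B" if "x \<in> {0..1}" for x using that by auto
  have "mollifier x \<le> max B 0" for x
    using B[of x] mollifier_props[of x] by (cases "x \<in> {0..1}") (auto simp: max_def)
  then show ?thesis by (intro exI[of _ "max B 0"]) auto
qed

lemma mollifier_integral: "integral {-1..1} mollifier = 1" "a \<le> 0 \<Longrightarrow> integral {-1..a} mollifier = 0"
  "b \<ge> 1 \<Longrightarrow> integral {1..b} mollifier = 0"
proof -
  show z: "integral {-1..a} mollifier = 0" if "a \<le> 0" for a
    using that integral_cong[of "{-1..a}" mollifier "\<lambda>_. 0"] by (simp add: mollifier_props)
  show "b \<ge> 1 \<Longrightarrow> integral {1..b} mollifier = 0"
    using integral_cong[of "{1..b}" mollifier "\<lambda>_. 0"] by (simp add: mollifier_props)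
  have "integral {-1..1} mollifier = integral {-1..0} mollifier + integral {0..1} mollifier"
    by (intro Henstock_Kurzweil_Integration.integral_combine[symmetric] integrable_continuous_real continuous_mollifier) auto
  also have "integral {0..1} mollifier = integral {0..1} bump * (1 / integral {0..1} bump)"
    unfolding mollifier_def[abs_def] by (rule Henstock_Kurzweil_Integration.integral_mult_left)
  also have "\<dots> = 1" using bump_integral_pos by simp
  finally show "integral {-1..1} mollifier = 1" using z[of 0] by simp
qed

lemma smooth_step_0: "x \<le> 0 \<Longrightarrow> smooth_step x = 0"
  unfolding smooth_step_def by (rule mollifier_integral)

lemma smooth_step_1: "x \<ge> 1 \<Longrightarrow> smooth_step x = 1"
proof -
  assume x: "x \<ge> 1"
  have "integral {-1..x} mollifier = integral {-1..1} mollifier + integral {1..x} mollifier"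
    using x by (intro Henstock_Kurzweil_Integration.integral_combine[symmetric] integrable_continuous_real continuous_mollifier) auto
  then show ?thesis using x by (simp add: smooth_step_def mollifier_integral)
qed

lemma DERIV_smooth_step: "(smooth_step has_real_derivative mollifier x) (at x)"
proof (cases "x < 0")
  case True
  have "((\<lambda>x. 0) has_real_derivative mollifier x) (at x)" using True by (simp add: mollifier_props)
  then show ?thesis
    by (rule has_field_derivative_transform_within_open[where S="{..<0}"]) (use True in \<open>auto simp: smooth_step_0\<close>)
next
  case False
  have "((\<lambda>u. integral {-1..u} mollifier) has_real_derivative mollifier x) (at x within {-1..x + 1})"
    using False by (intro integral_has_real_derivative continuous_mollifier) auto
  then have "(smooth_step has_real_derivative mollifier x) (at x within {-1..x + 1})"
    unfolding smooth_step_def[abs_def] .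
  moreover have "at x within {-1..x + 1} = at x"
    using False by (intro at_within_interior) auto
  ultimately show ?thesis by simp
qed

lemma smooth_upto_step: "smooth_upto k smooth_step"
  by (rule smooth_uptoI[OF DERIV_smooth_step smooth_upto_mollifier])

lemma smooth_step_mono: "x \<le> y \<Longrightarrow> smooth_step x \<le> smooth_step y"
  by (rule DERIV_nonneg_imp_nondecreasing) (auto intro!: exI DERIV_smooth_step simp: mollifier_props)

lemma smooth_step_range: "0 \<le> smooth_step x" "smooth_step x \<le> 1"
  using smooth_step_mono[of "min x 0" x] smooth_step_0[of "min x 0"] smooth_step_mono[of x "max x 1"] smooth_step_1[of "max x 1"] by auto

text \<open>Rises after \<open>a\<close> and falls after \<open>b\<close>, each within a length
  \<open>1 / n\<close>. As \<open>smooth_step\<close> is 0 at 0, the pointwise limit for growing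
  \<open>n\<close> is the indicator of the half-open interval \<open>{a<..b}\<close>. The form
  \<open>n * x + - n * a\<close> fits \<open>smooth_upto_affine\<close>.\<close>

definition plateau :: "real \<Rightarrow> real \<Rightarrow> real \<Rightarrow> real \<Rightarrow> real" where
  "plateau n a b x = smooth_step (n * x + - n * a) + (- 1) * smooth_step (n * x + - n * b)"

lemma smooth_upto_plateau: "smooth_upto k (plateau n a b)"
  unfolding plateau_def[abs_def] by (rule smooth_upto_add[OF smooth_upto_affine[OF smooth_upto_step] smooth_upto_mult[OF smooth_upto_const smooth_upto_affine[OF smooth_upto_step]]])

lemma DERIV_plateau: "(plateau n a b has_real_derivative n * mollifier (n * (x - a)) - n * mollifier (n * (x - b))) (at x)"
proof -
  have aff: "((\<lambda>x. n * x + - n * c) has_real_derivative n) (at x)" for c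
    by (auto intro!: derivative_eq_intros)
  note st = DERIV_chain2[OF DERIV_smooth_step aff]
  have "(plateau n a b has_real_derivative mollifier (n * x + - n * a) * n + (-1) * (mollifier (n * x + - n * b) * n)) (at x)"
    unfolding plateau_def[abs_def] by (rule DERIV_add[OF st DERIV_cmult[OF st]])
  then show ?thesis by (simp add: algebra_simps)
qed

lemma plateau_abs_le: "\<bar>plateau n a b x\<bar> \<le> 1"
  using smooth_step_range[of "n * x + - n * a"] smooth_step_range[of "n * x + - n * b"] by (auto simp: plateau_def)

lemma plateau_outside:
  assumes n: "n \<ge> 1" and ab: "a \<le> b" and x: "x < a \<or> x > b + 1"
  shows "plateau n a b x = 0"
  using x
proof
  assume "x < a"
  then have "n * x \<le> n * a" "n * x \<le> n * b" using n ab by auto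
  then show ?thesis by (simp add: plateau_def smooth_step_0)
next
  assume x: "x > b + 1"
  have "1 * 1 \<le> n * (x - a)" using n ab x by (intro mult_mono) auto
  moreover have "1 * 1 \<le> n * (x - b)" using n ab x by (intro mult_mono) auto
  ultimately show ?thesis by (simp add: plateau_def smooth_step_1 algebra_simps)
qed

lemma measurable_plateau [measurable]: "plateau n a b \<in> borel_measurable borel"
  by (rule borel_measurable_continuous_onI[OF smooth_upto_continuous[OF smooth_upto_plateau]])

section \<open>Weak derivatives tested against smooth plateaus\<close>

lemma test_fun_plateau_mult:
  assumes "\<And>k. smooth_upto k f" "n \<ge> 1" "a \<le> b"
  shows "test_fun (\<lambda>x. f x * plateau n a b x)"
  unfolding test_fun_def
proof
  show "\<forall>k x. (deriv ^^ k) (\<lambda>x. f x * plateau n a b x) differentiable (at x)"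
    by (intro allI, rule smooth_upto_iterate[OF smooth_upto_mult[OF assms(1) smooth_upto_plateau]])
  have "{x. f x * plateau n a b x \<noteq> 0} \<subseteq> {a..b + 1}"
    using plateau_outside[OF assms(2,3)] by force
  then show "bounded {x. f x * plateau n a b x \<noteq> 0}" by (rule bounded_subset[OF bounded_closed_interval])
qed

text \<open>The one way in which \<open>weak_deriv\<close> is exploited: with \<open>f = 1\<close>
  on a fixed interval for increments, and with a Hermite function on growing intervals for
  coefficients.\<close>

lemma weak_deriv_plateau:
  assumes "weak_deriv u v" "\<And>k. smooth_upto k f" "\<And>x. (f has_real_derivative f' x) (at x)" "n \<ge> 1" "a \<le> b"
  shows "(LINT x|lborel. u x * complex_of_real (f' x * plateau n a b x + (n * mollifier (n * (x - a)) - n * mollifier (n * (x - b))) * f x))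
    = - (LINT x|lborel. v x * complex_of_real (f x * plateau n a b x))"
proof -
  have "deriv (\<lambda>x. f x * plateau n a b x) x = f' x * plateau n a b x + (n * mollifier (n * (x - a)) - n * mollifier (n * (x - b))) * f x" for x
    by (rule DERIV_imp_deriv[OF DERIV_mult[OF assms(3) DERIV_plateau]])
  then have d: "deriv (\<lambda>x. f x * plateau n a b x) = (\<lambda>x. f' x * plateau n a b x + (n * mollifier (n * (x - a)) - n * mollifier (n * (x - b))) * f x)"
    by (rule ext)
  show ?thesis
    using assms(1)[unfolded weak_deriv_def, rule_format, OF test_fun_plateau_mult[OF assms(2,4,5)]] unfolding d .
qed

lemma tendsto_plateau: "(\<lambda>m. plateau (real (Suc m)) a b x) \<longlonglongrightarrow> indicator {a<..b} x" if "a \<le> b"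
proof -
  have big: "\<forall>\<^sub>F m in sequentially. real (Suc m) * d \<ge> 1" if "d > 0" for d :: real
  proof -
    obtain N :: nat where N: "1 / d \<le> real N" using real_arch_simple by blast
    show ?thesis using eventually_ge_at_top[of N]
    proof eventually_elim
      fix m assume "N \<le> m"
      then have "1 / d \<le> real (Suc m)" using N by simp
      then show "1 \<le> real (Suc m) * d" using that by (simp add: field_simps)
    qed
  qed
  have eq: "plateau (real (Suc m)) a b x = smooth_step (real (Suc m) * (x - a)) - smooth_step (real (Suc m) * (x - b))" for m
    by (simp add: plateau_def algebra_simps)
  have neg: "smooth_step (real (Suc m) * d) = 0" if "d \<le> 0" for m d
    using that by (intro smooth_step_0 mult_nonneg_nonpos) auto
  have pos: "\<forall>\<^sub>F m in sequentially. smooth_step (real (Suc m) * d) = 1" if "d > 0" for d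
    using big[OF that] by eventually_elim (rule smooth_step_1)
  consider "x \<le> a" | "a < x" "x \<le> b" | "b < x" by linarith
  then have "\<forall>\<^sub>F m in sequentially. plateau (real (Suc m)) a b x = indicator {a<..b} x"
  proof cases
    case 1
    then show ?thesis using \<open>a \<le> b\<close> neg[of "x - a"] neg[of "x - b"] by (simp add: eq del: of_nat_Suc)
  next
    case 2
    from pos[of "x - a"] 2 have "\<forall>\<^sub>F m in sequentially. smooth_step (real (Suc m) * (x - a)) = 1" by simp
    then show ?thesis
      by eventually_elim (use 2 neg[of "x - b"] in \<open>simp add: eq del: of_nat_Suc\<close>)
  next
    case 3
    from pos[of "x - a"] pos[of "x - b"] 3 \<open>a \<le> b\<close>
    have "\<forall>\<^sub>F m in sequentially. smooth_step (real (Suc m) * (x - a)) = 1" "\<forall>\<^sub>F m in sequentially. smooth_step (real (Suc m) * (x - b)) = 1" by simp_all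
    then show ?thesis
      by eventually_elim (use 3 in \<open>simp add: eq del: of_nat_Suc\<close>)
  qed
  then show ?thesis by (rule tendsto_eventually)
qed

lemma lborel_integral_mollifier: "integrable lborel mollifier" "(LINT s|lborel. mollifier s) = 1"
proof -
  have i: "set_integrable lborel {0..1} mollifier"
    by (rule borel_integrable_atLeastAtMost') (rule continuous_mollifier)
  have eq: "(\<lambda>x. indicator {0..1} x *\<^sub>R mollifier x) = mollifier"
  proof
    fix x show "indicator {0..1} x *\<^sub>R mollifier x = mollifier x"
      using mollifier_props(2,3)[of x] by (cases "x < 0"; cases "x > 1") (auto simp: indicator_def)
  qed
  show "integrable lborel mollifier" using i unfolding set_integrable_def eq .
  have "(LINT s|lborel. mollifier s) = integral {0..1} mollifier"
    using set_borel_integral_eq_integral(2)[OF i] unfolding set_lebesgue_integral_def eq .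
  also have "\<dots> = 1"
  proof -
    have "integral {-1..1} mollifier = integral {-1..0} mollifier + integral {0..1} mollifier"
      by (intro Henstock_Kurzweil_Integration.integral_combine[symmetric] integrable_continuous_real continuous_mollifier) auto
    then show ?thesis by (simp add: mollifier_integral)
  qed
  finally show "(LINT s|lborel. mollifier s) = 1" .
qed

text \<open>Substituting \<open>x = a + s / (m + 1)\<close> fixes the kernel and moves the
  dependence on \<open>m\<close> into \<open>u\<close>, where continuity at \<open>a\<close>
  applies. All arguments stay in \<open>{a..a + 1}\<close>, where \<open>u\<close> is
  bounded.\<close>

lemma mollify_tendsto:
  assumes u: "continuous_on UNIV (u :: real \<Rightarrow> complex)"
  shows "(\<lambda>m. LINT x|lborel. u x * complex_of_real (real (Suc m) * mollifier (real (Suc m) * (x - a)))) \<longlonglongrightarrow> u a"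
    and "integrable lborel (\<lambda>x. u x * complex_of_real (real (Suc m) * mollifier (real (Suc m) * (x - a))))"
proof -
  have [measurable]: "u \<in> borel_measurable borel" by (rule borel_measurable_continuous_onI[OF u])
  have "bounded (u ` {a..a + 1})"
    by (intro compact_imp_bounded compact_continuous_image continuous_on_subset[OF u]) auto
  then obtain C where "\<forall>y\<in>u ` {a..a + 1}. norm y \<le> C" unfolding bounded_iff by blast
  then have C: "cmod (u x) \<le> C" if "x \<in> {a..a + 1}" for x using that by auto
  let ?v = "\<lambda>m s. u (a + s / real (Suc m)) * complex_of_real (mollifier s)"
  have bnd: "cmod (?v m s) \<le> C * mollifier s" for m s
  proof (cases "0 \<le> s \<and> s \<le> 1")
    case True
    then have "s / real (Suc m) \<le> 1 / 1" by (intro frac_le) auto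
    moreover have "0 \<le> s / real (Suc m)" using True by simp
    ultimately have "a + s / real (Suc m) \<in> {a..a + 1}" by simp
    from mult_right_mono[OF C[OF this] mollifier_props(1)[of s]] show ?thesis
      unfolding norm_mult norm_of_real abs_of_nonneg[OF mollifier_props(1)] .
  qed (auto simp: mollifier_props not_le)
  have iv: "integrable lborel (?v m)" for m
  proof (rule Bochner_Integration.integrable_bound)
    show "integrable lborel (\<lambda>s. C * mollifier s)" using lborel_integral_mollifier(1) by simp
    show "AE s in lborel. norm (?v m s) \<le> norm (C * mollifier s)"
      unfolding real_norm_def by (rule AE_I2[OF order_trans[OF bnd abs_ge_self]])
  qed measurable
  have sub: "integrable lborel (\<lambda>x. u x * complex_of_real (real (Suc m) * mollifier (real (Suc m) * (x - a)))) \<and>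
     (LINT x|lborel. u x * complex_of_real (real (Suc m) * mollifier (real (Suc m) * (x - a)))) = (LINT s|lborel. ?v m s)" for m
  proof -
    let ?c = "1 / real (Suc m)"
    have eq: "u (a + ?c * s) * complex_of_real (real (Suc m) * mollifier (real (Suc m) * (a + ?c * s - a))) = complex_of_real (real (Suc m)) * ?v m s" for s
      by (simp del: of_nat_Suc)
    let ?F = "\<lambda>x. u x * complex_of_real (real (Suc m) * mollifier (real (Suc m) * (x - a)))"
    have "integrable lborel (\<lambda>s. ?F (a + ?c * s))"
      unfolding eq by (rule integrable_mult_right[OF iv])
    then have 1: "integrable lborel ?F"
      by (subst (asm) lborel_integrable_real_affine_iff) (simp_all del: of_nat_Suc)
    have "(LINT x|lborel. ?F x) = \<bar>?c\<bar> *\<^sub>R (LINT s|lborel. ?F (a + ?c * s))"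
      by (rule lborel_integral_real_affine) (simp del: of_nat_Suc)
    also have "\<dots> = \<bar>?c\<bar> *\<^sub>R (complex_of_real (real (Suc m)) * (LINT s|lborel. ?v m s))"
      unfolding eq integral_mult_right_zero ..
    also have "\<dots> = (LINT s|lborel. ?v m s)"
      by (simp add: scaleR_conv_of_real del: of_nat_Suc)
    finally show ?thesis using 1 by blast
  qed
  then show "integrable lborel (\<lambda>x. u x * complex_of_real (real (Suc m) * mollifier (real (Suc m) * (x - a))))" by blast
  have "(\<lambda>m. LINT s|lborel. ?v m s) \<longlonglongrightarrow> (LINT s|lborel. u a * complex_of_real (mollifier s))"
  proof (rule integral_dominated_convergence)
    show "integrable lborel (\<lambda>s. C * mollifier s)" using lborel_integral_mollifier(1) by simp
    show "AE s in lborel. (\<lambda>m. ?v m s) \<longlonglongrightarrow> u a * complex_of_real (mollifier s)"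
    proof (rule AE_I2)
      fix s :: real
      have "(\<lambda>m. a + s * inverse (real (Suc m))) \<longlonglongrightarrow> a + s * 0"
        by (intro tendsto_intros LIMSEQ_inverse_real_of_nat)
      then have "(\<lambda>m. a + s / real (Suc m)) \<longlonglongrightarrow> a" by (simp only: divide_inverse mult_zero_right add_0_right)
      moreover have "isCont u a" using u by (simp add: continuous_on_eq_continuous_at)
      ultimately have "(\<lambda>m. u (a + s / real (Suc m))) \<longlonglongrightarrow> u a" by (metis isCont_tendsto_compose)
      then show "(\<lambda>m. ?v m s) \<longlonglongrightarrow> u a * complex_of_real (mollifier s)" by (rule tendsto_mult_right)
    qed
    show "AE s in lborel. norm (?v m s) \<le> C * mollifier s" for m by (rule AE_I2[OF bnd])
  qed measurable
  also have "(LINT s|lborel. u a * complex_of_real (mollifier s)) = u a"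
    unfolding integral_mult_right_zero integral_complex_of_real lborel_integral_mollifier(2) by simp
  finally show "(\<lambda>m. LINT x|lborel. u x * complex_of_real (real (Suc m) * mollifier (real (Suc m) * (x - a)))) \<longlonglongrightarrow> u a"
    using sub by simp
qed

text \<open>Steepening plateaus recover the indicator of the interval on the side of
  \<open>u1\<close>, while their derivatives become point evaluations of the continuous
  \<open>u\<close> at \<open>a\<close> and \<open>b\<close>.\<close>

theorem H1_increment:
  assumes "H1 u u1" and ab: "a \<le> b"
  shows "u b - u a = (LINT x|lborel. u1 x * indicator {a<..b} x)"
proof -
  have u: "continuous_on UNIV u" and u1: "L2 u1" and wd: "weak_deriv u u1" using assms(1) by (auto simp: H1_def)
  note [measurable] = L2_measurable[OF u1]
  let ?p = "\<lambda>m. plateau (real (Suc m)) a b"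
  have "(\<lambda>m. LINT x|lborel. u1 x * complex_of_real (?p m x)) \<longlonglongrightarrow> (LINT x|lborel. u1 x * complex_of_real (indicator {a<..b} x))"
  proof (rule integral_dominated_convergence)
    let ?w = "\<lambda>x. cmod (u1 x * indicator {- (max \<bar>a\<bar> \<bar>b + 1\<bar>)..max \<bar>a\<bar> \<bar>b + 1\<bar>} x)"
    show "integrable lborel ?w"
      by (rule integrable_norm[OF L2_truncated(2)[OF u1]])
    show "AE x in lborel. norm (u1 x * complex_of_real (?p m x)) \<le> ?w x" for m
    proof (rule AE_I2)
      fix x
      show "norm (u1 x * complex_of_real (?p m x)) \<le> ?w x"
      proof (cases "x < a \<or> x > b + 1")
        case True
        then show ?thesis using plateau_outside[OF _ ab True, of "real (Suc m)"] by simp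
      next
        case False
        then have "x \<in> {- (max \<bar>a\<bar> \<bar>b + 1\<bar>)..max \<bar>a\<bar> \<bar>b + 1\<bar>}" by auto
        then show ?thesis using plateau_abs_le[of "real (Suc m)" a b x] by (simp add: norm_mult mult_left_le del: of_nat_Suc)
      qed
    qed
    show "AE x in lborel. (\<lambda>m. u1 x * complex_of_real (?p m x)) \<longlonglongrightarrow> u1 x * complex_of_real (indicator {a<..b} x)"
      by (intro AE_I2 tendsto_intros tendsto_plateau ab)
  qed measurable
  then have 1: "(\<lambda>m. - (LINT x|lborel. u1 x * complex_of_real (?p m x))) \<longlonglongrightarrow> - (LINT x|lborel. u1 x * indicator {a<..b} x)"
    by (intro tendsto_minus) (simp add: indicator_def of_bool_def if_distrib cong: if_cong)
  have "- (LINT x|lborel. u1 x * complex_of_real (?p m x)) = (LINT x|lborel. u x * complex_of_real (real (Suc m) * mollifier (real (Suc m) * (x - a))))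
       - (LINT x|lborel. u x * complex_of_real (real (Suc m) * mollifier (real (Suc m) * (x - b))))" for m
  proof -
    have "(LINT x|lborel. u x * complex_of_real (0 * ?p m x + (real (Suc m) * mollifier (real (Suc m) * (x - a)) - real (Suc m) * mollifier (real (Suc m) * (x - b))) * 1))
      = - (LINT x|lborel. u1 x * complex_of_real (1 * ?p m x))"
      by (rule weak_deriv_plateau[OF wd, where f="\<lambda>_. 1" and f'="\<lambda>_. 0"]) (use ab smooth_upto_const in auto)
    moreover have "u x * complex_of_real (0 * ?p m x + (real (Suc m) * mollifier (real (Suc m) * (x - a)) - real (Suc m) * mollifier (real (Suc m) * (x - b))) * 1)
      = u x * complex_of_real (real (Suc m) * mollifier (real (Suc m) * (x - a))) - u x * complex_of_real (real (Suc m) * mollifier (real (Suc m) * (x - b)))" for x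
      by (simp add: right_diff_distrib del: of_nat_Suc)
    ultimately show ?thesis using mollify_tendsto(2)[OF u, of m a] mollify_tendsto(2)[OF u, of m b] by (simp del: of_nat_Suc)
  qed
  then have 2: "(\<lambda>m. - (LINT x|lborel. u1 x * complex_of_real (?p m x))) \<longlonglongrightarrow> u a - u b"
    using tendsto_diff[OF mollify_tendsto(1)[OF u, of a] mollify_tendsto(1)[OF u, of b]] by (simp only:)
  from LIMSEQ_unique[OF 1 2] show ?thesis by (simp add: algebra_simps)
qed

lemma smooth_upto_hermite_fun: "smooth_upto k (hermite_fun n)"
proof (induction k arbitrary: n)
  case 0
  show ?case by (rule smooth_uptoI[OF DERIV_hermite_fun]) simp
next
  case (Suc k)
  have "smooth_upto k (\<lambda>x. sqrt (real n / 2) * hermite_fun (n - 1) x + (- sqrt (real (Suc n) / 2)) * hermite_fun (Suc n) x)"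
    by (rule smooth_upto_add[OF smooth_upto_mult[OF smooth_upto_const Suc] smooth_upto_mult[OF smooth_upto_const Suc]])
  then have "smooth_upto k (hermite_fun' n)" by (simp add: hermite_fun'_def[abs_def])
  then show ?case by (intro smooth_uptoI[OF DERIV_hermite_fun]) simp
qed

text \<open>A Hermite function is no test function, so it is cut off by plateaus on
  \<open>{- m..m}\<close>. The slopes of the cut-off have a bound independent of \<open>m\<close>
  and move out to infinity, hence drop out by dominated convergence.\<close>

theorem H1_coef_parts:
  assumes "H1 u u1"
  shows "coef n u1 = - (LINT x|lborel. u x * complex_of_real (hermite_fun' n x))"
proof -
  have u: "L2 u" and u1: "L2 u1" and wd: "weak_deriv u u1" using assms(1) by (auto simp: H1_def)
  note [measurable] = L2_measurable[OF u1] L2_measurable[OF u]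
  obtain B where B: "B \<ge> 0" "\<And>x. mollifier x \<le> B" using mollifier_bounded by blast
  let ?p = "\<lambda>m. plateau 1 (- real m) (real m)"
  let ?d = "\<lambda>m x. 1 * mollifier (1 * (x - - real m)) - 1 * mollifier (1 * (x - real m))"
  have d_le: "\<bar>?d m x\<bar> \<le> B" for m x
    using B(2)[of "x + real m"] B(2)[of "x - real m"] mollifier_props(1)[of "x + real m"] mollifier_props(1)[of "x - real m"] by auto
  have p1: "\<forall>\<^sub>F m in sequentially. ?p m x = 1 \<and> ?d m x = 0" for x
  proof -
    obtain N :: nat where N: "\<bar>x\<bar> + 1 \<le> real N" using real_arch_simple by blast
    show ?thesis using eventually_ge_at_top[of N]
    proof eventually_elim
      fix m assume "N \<le> m"
      then have "\<bar>x\<bar> + 1 \<le> real m" using N by linarith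
      then show "?p m x = 1 \<and> ?d m x = 0" by (auto simp: plateau_def smooth_step_0 smooth_step_1 mollifier_props)
    qed
  qed
  have Lh: "L2 (\<lambda>x. complex_of_real (hermite_fun n x))" "L2 (\<lambda>x. complex_of_real (hermite_fun' n x))"
    by (rule rapid_L2[OF rapid_of_real] rapid_hermite_fun rapid_hermite_fun')+
  note iuh = L2_mult_integrable(1)[OF u Lh(1)] and iuh' = L2_mult_integrable(1)[OF u Lh(2)] and iu1h = L2_mult_integrable(1)[OF u1 Lh(1)]
  have 1: "(\<lambda>m. LINT x|lborel. u1 x * complex_of_real (hermite_fun n x * ?p m x)) \<longlonglongrightarrow> (LINT x|lborel. u1 x * complex_of_real (hermite_fun n x))"
  proof (rule integral_dominated_convergence[OF _ _ integrable_norm[OF iu1h]])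
    show "AE x in lborel. (\<lambda>m. u1 x * complex_of_real (hermite_fun n x * ?p m x)) \<longlonglongrightarrow> u1 x * complex_of_real (hermite_fun n x)"
    proof (rule AE_I2, rule tendsto_eventually)
      fix x
      show "\<forall>\<^sub>F m in sequentially. u1 x * complex_of_real (hermite_fun n x * ?p m x) = u1 x * complex_of_real (hermite_fun n x)"
        using p1[of x] by eventually_elim simp
    qed
    show "AE x in lborel. norm (u1 x * complex_of_real (hermite_fun n x * ?p m x)) \<le> norm (u1 x * complex_of_real (hermite_fun n x))" for m
    proof (rule AE_I2)
      fix x
      have "cmod (u1 x * complex_of_real (hermite_fun n x)) * \<bar>?p m x\<bar> \<le> cmod (u1 x * complex_of_real (hermite_fun n x)) * 1"
        by (intro mult_left_mono plateau_abs_le) simp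
      then show "norm (u1 x * complex_of_real (hermite_fun n x * ?p m x)) \<le> norm (u1 x * complex_of_real (hermite_fun n x))"
        by (simp add: norm_mult abs_mult mult.assoc)
    qed
  qed measurable
  have 2: "(\<lambda>m. LINT x|lborel. u x * complex_of_real (hermite_fun' n x * ?p m x + ?d m x * hermite_fun n x)) \<longlonglongrightarrow> (LINT x|lborel. u x * complex_of_real (hermite_fun' n x))"
  proof (rule integral_dominated_convergence)
    let ?w = "\<lambda>x. cmod (u x * complex_of_real (hermite_fun' n x)) + B * cmod (u x * complex_of_real (hermite_fun n x))"
    show "integrable lborel ?w" using iuh iuh' by auto
    show "AE x in lborel. (\<lambda>m. u x * complex_of_real (hermite_fun' n x * ?p m x + ?d m x * hermite_fun n x)) \<longlonglongrightarrow> u x * complex_of_real (hermite_fun' n x)"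
    proof (rule AE_I2, rule tendsto_eventually)
      fix x
      show "\<forall>\<^sub>F m in sequentially. u x * complex_of_real (hermite_fun' n x * ?p m x + ?d m x * hermite_fun n x) = u x * complex_of_real (hermite_fun' n x)"
        using p1[of x] by eventually_elim simp
    qed
    show "AE x in lborel. norm (u x * complex_of_real (hermite_fun' n x * ?p m x + ?d m x * hermite_fun n x)) \<le> ?w x" for m
    proof (rule AE_I2)
      fix x
      have "\<bar>hermite_fun' n x * ?p m x + ?d m x * hermite_fun n x\<bar> \<le> \<bar>hermite_fun' n x\<bar> * \<bar>?p m x\<bar> + \<bar>?d m x\<bar> * \<bar>hermite_fun n x\<bar>"
        unfolding abs_mult[symmetric] by (rule abs_triangle_ineq)
      also have "\<dots> \<le> \<bar>hermite_fun' n x\<bar> * 1 + B * \<bar>hermite_fun n x\<bar>"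
        by (intro add_mono mult_left_mono mult_right_mono plateau_abs_le d_le) auto
      finally have "cmod (u x) * \<bar>hermite_fun' n x * ?p m x + ?d m x * hermite_fun n x\<bar> \<le> cmod (u x) * (\<bar>hermite_fun' n x\<bar> * 1 + B * \<bar>hermite_fun n x\<bar>)"
        by (rule mult_left_mono) simp
      then show "norm (u x * complex_of_real (hermite_fun' n x * ?p m x + ?d m x * hermite_fun n x)) \<le> ?w x"
        unfolding norm_mult norm_of_real by (simp add: algebra_simps)
    qed
  qed measurable
  have "(LINT x|lborel. u x * complex_of_real (hermite_fun' n x * ?p m x + ?d m x * hermite_fun n x)) = - (LINT x|lborel. u1 x * complex_of_real (hermite_fun n x * ?p m x))" for m
    by (rule weak_deriv_plateau[OF wd, where f="hermite_fun n" and f'="hermite_fun' n"]) (use smooth_upto_hermite_fun DERIV_hermite_fun in auto)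
  with 2 have "(\<lambda>m. - (LINT x|lborel. u1 x * complex_of_real (hermite_fun n x * ?p m x))) \<longlonglongrightarrow> (LINT x|lborel. u x * complex_of_real (hermite_fun' n x))" by simp
  from LIMSEQ_unique[OF tendsto_minus[OF 1] this]
  have "- (LINT x|lborel. u1 x * complex_of_real (hermite_fun n x)) = (LINT x|lborel. u x * complex_of_real (hermite_fun' n x))" .
  then show ?thesis unfolding coef_def herm_def by (simp add: mult.commute equation_minus_iff)
qed

subsection \<open>Zeros of Hermite functions\<close>

lemma finite_hermite_fun_zeros: "finite {x. hermite_fun n x = 0}" and card_hermite_fun_zeros_le: "card {x. hermite_fun n x = 0} \<le> n"
proof -
  let ?p = "hpoly n :: real poly"
  have p0: "?p \<noteq> 0"
  proof
    assume "?p = 0"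
    then have "coeff ?p n = 0" by (simp only: coeff_0)
    then show False unfolding coeff_hpoly by simp
  qed
  have eq: "{x. hermite_fun n x = 0} = {x. poly ?p x = 0}"
    using poly_hpoly[of n, where 'a=real] by (simp add: hermite_fun_eq)
  show "finite {x. hermite_fun n x = 0}" unfolding eq by (rule poly_roots_finite[OF p0])
  show "card {x. hermite_fun n x = 0} \<le> n"
    unfolding eq using card_poly_roots_bound[OF p0] degree_hpoly_le[of n, where 'a=real] by linarith
qed

lemma hermite_fun_nonzero_between: "a < b \<Longrightarrow> \<exists>c. a < c \<and> c < b \<and> hermite_fun n c \<noteq> 0"
proof (rule ccontr)
  assume "a < b" "\<nexists>c. a < c \<and> c < b \<and> hermite_fun n c \<noteq> 0"
  then have "{a<..<b} \<subseteq> {x. hermite_fun n x = 0}" by auto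
  from finite_subset[OF this finite_hermite_fun_zeros] infinite_Ioo[OF \<open>a < b\<close>] show False by blast
qed

text \<open>A maximum of the square of \<open>F\<close> is interior by the two strict inequalities;
  squaring treats both signs of \<open>F\<close> at once, and \<open>F\<close> is nonzero
  there.\<close>

lemma critical_point_between:
  fixes F :: "real \<Rightarrow> real"
  assumes d: "\<And>x. (F has_real_derivative F' x) (at x)"
    and c: "a < c" "c < b" "\<bar>F a\<bar> < \<bar>F c\<bar>" "\<bar>F b\<bar> < \<bar>F c\<bar>"
  shows "\<exists>z. a < z \<and> z < b \<and> F' z = 0"
proof -
  let ?S = "\<lambda>x. (F x)\<^sup>2"
  have dS: "(?S has_real_derivative 2 * F x * F' x) (at x)" for x
    using DERIV_power[OF d, of 2 x] by (simp add: mult_ac)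
  have "continuous_on {a..b} ?S" by (rule DERIV_continuous_on[OF has_field_derivative_at_within[OF dS]])
  then obtain m where m: "m \<in> {a..b}" "\<And>x. x \<in> {a..b} \<Longrightarrow> ?S x \<le> ?S m"
    using continuous_attains_sup[of "{a..b}" ?S] c(1,2) by fastforce
  have le: "\<bar>F x\<bar> \<le> \<bar>F m\<bar>" if "x \<in> {a..b}" for x
    using m(2)[OF that] by (simp add: abs_le_square_iff)
  have cm: "\<bar>F c\<bar> \<le> \<bar>F m\<bar>" using c by (intro le) auto
  have "m \<noteq> a" "m \<noteq> b" using cm c by auto
  then have ab: "a < m" "m < b" using m(1) by auto
  have "2 * F m * F' m = 0"
  proof (rule DERIV_local_max[OF dS])
    show "0 < min (m - a) (b - m)" using ab by simp
    show "\<forall>y. \<bar>m - y\<bar> < min (m - a) (b - m) \<longrightarrow> ?S y \<le> ?S m"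
    proof (intro allI impI)
      fix y assume "\<bar>m - y\<bar> < min (m - a) (b - m)"
      then have "a \<le> y" "y \<le> b" by linarith+
      then show "?S y \<le> ?S m" by (intro m(2)) simp
    qed
  qed
  then show ?thesis using ab cm c by auto
qed

text \<open>With one more Gaussian factor, differentiation raises the index (Rodrigues' formula).
  Critical points are zeros of the next Hermite function, and decay at both ends gives Rolle's
  theorem on half-lines too.\<close>

lemma hermite_fun_zeros_interlace_aux:
  fixes n :: nat
  defines "F \<equiv> \<lambda>x. hermite_fun n x * exp (- x\<^sup>2 / 2)"
  shows "(F has_real_derivative - sqrt (2 * real (Suc n)) * hermite_fun (Suc n) x * exp (- x\<^sup>2 / 2)) (at x)"
    and "(F \<longlongrightarrow> 0) at_top" "(F \<longlongrightarrow> 0) at_bot" and "F x = 0 \<longleftrightarrow> hermite_fun n x = 0"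
proof -
  have r: "rapid F" unfolding F_def by (rule rapid_mult[OF rapid_hermite_fun rapid_gaussian])
  show "(F \<longlongrightarrow> 0) at_top" "(F \<longlongrightarrow> 0) at_bot" by (rule rapid_tendsto[OF r])+
  show "F x = 0 \<longleftrightarrow> hermite_fun n x = 0" by (simp add: F_def)
  have "(F has_real_derivative hermite_fun' n x * exp (- x\<^sup>2 / 2) + (- x * exp (- x\<^sup>2 / 2)) * hermite_fun n x) (at x)"
    unfolding F_def by (rule DERIV_mult[OF DERIV_hermite_fun]) (auto intro!: derivative_eq_intros)
  then show "(F has_real_derivative - sqrt (2 * real (Suc n)) * hermite_fun (Suc n) x * exp (- x\<^sup>2 / 2)) (at x)"
    by (rule DERIV_cong) (simp add: hermite_fun'_raise left_diff_distrib)
qed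

lemma hermite_fun_Suc_zero_between:
  assumes c: "a < c" "c < b"
    and "\<bar>hermite_fun n a * exp (- a\<^sup>2 / 2)\<bar> < \<bar>hermite_fun n c * exp (- c\<^sup>2 / 2)\<bar>"
    and "\<bar>hermite_fun n b * exp (- b\<^sup>2 / 2)\<bar> < \<bar>hermite_fun n c * exp (- c\<^sup>2 / 2)\<bar>"
  obtains z where "a < z" "z < b" "hermite_fun (Suc n) z = 0"
proof -
  obtain z where z: "a < z" "z < b" "- sqrt (2 * real (Suc n)) * hermite_fun (Suc n) z * exp (- z\<^sup>2 / 2) = 0"
    using critical_point_between[OF hermite_fun_zeros_interlace_aux(1) assms] by blast
  have "sqrt (2 * real (Suc n)) \<noteq> 0" by simp
  then have "hermite_fun (Suc n) z = 0" using z(3) by (simp only: mult_eq_0_iff neg_equal_0_iff_equal exp_not_eq_zero) blast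
  with z show ?thesis using that by blast
qed

lemma hermite_fun_zero_between:
  assumes "hermite_fun n a = 0" "hermite_fun n b = 0" "a < b"
  shows "\<exists>z. a < z \<and> z < b \<and> hermite_fun (Suc n) z = 0"
proof -
  obtain c where c: "a < c" "c < b" "hermite_fun n c \<noteq> 0" using hermite_fun_nonzero_between[OF assms(3)] by blast
  obtain z where "a < z" "z < b" "hermite_fun (Suc n) z = 0"
    by (rule hermite_fun_Suc_zero_between[OF c(1,2), of n]) (simp_all add: assms c)
  then show ?thesis by blast
qed

lemma hermite_fun_zero_above:
  assumes "hermite_fun n a = 0"
  shows "\<exists>z. a < z \<and> hermite_fun (Suc n) z = 0"
proof -
  obtain c where c: "a < c" "hermite_fun n c \<noteq> 0" using hermite_fun_nonzero_between[of a "a + 1"] by fastforce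
  let ?F = "\<lambda>x. hermite_fun n x * exp (- x\<^sup>2 / 2)"
  have "\<bar>?F c\<bar> > 0" using c by simp
  from tendstoD[OF hermite_fun_zeros_interlace_aux(2)[of n] this] have "\<forall>\<^sub>F b in at_top. \<bar>?F b\<bar> < \<bar>?F c\<bar>"
    by (simp only: dist_real_def diff_0_right)
  then have "\<exists>b. c < b \<and> \<bar>?F b\<bar> < \<bar>?F c\<bar>"
    using eventually_happens'[OF _ eventually_conj[OF eventually_gt_at_top[of c]]] trivial_limit_at_top_linorder by blast
  then obtain b where b: "c < b" "\<bar>?F b\<bar> < \<bar>?F c\<bar>" by blast
  obtain z where "a < z" "z < b" "hermite_fun (Suc n) z = 0"
    by (rule hermite_fun_Suc_zero_between[OF c(1) b(1) _ b(2)]) (simp_all add: assms c)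
  then show ?thesis by blast
qed

lemma hermite_fun_zero_below:
  assumes "hermite_fun n a = 0"
  shows "\<exists>z. z < a \<and> hermite_fun (Suc n) z = 0"
proof -
  obtain c where c: "c < a" "hermite_fun n c \<noteq> 0" using hermite_fun_nonzero_between[of "a - 1" a] by fastforce
  let ?F = "\<lambda>x. hermite_fun n x * exp (- x\<^sup>2 / 2)"
  have "\<bar>?F c\<bar> > 0" using c by simp
  from tendstoD[OF hermite_fun_zeros_interlace_aux(3)[of n] this] have "\<forall>\<^sub>F b in at_bot. \<bar>?F b\<bar> < \<bar>?F c\<bar>"
    by (simp only: dist_real_def diff_0_right)
  then have "\<exists>b. b < c \<and> \<bar>?F b\<bar> < \<bar>?F c\<bar>"
    using eventually_happens'[OF _ eventually_conj[OF eventually_gt_at_bot[of c]]] trivial_limit_at_bot_linorder by blast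
  then obtain b where b: "b < c" "\<bar>?F b\<bar> < \<bar>?F c\<bar>" by blast
  obtain z where "b < z" "z < a" "hermite_fun (Suc n) z = 0"
    by (rule hermite_fun_Suc_zero_between[OF b(1) c(1) b(2)]) (simp_all add: assms c)
  then show ?thesis by blast
qed

text \<open>Interlacing: the \<open>n + 1\<close> zeros give one new zero below the lowest, one in
  each of the \<open>n\<close> gaps and one above the highest, that is \<open>n + 2\<close>.\<close>

lemma hermite_fun_zeros_enum:
  "\<exists>f :: nat \<Rightarrow> real. (\<forall>i\<le>n. hermite_fun (Suc n) (f i) = 0) \<and> (\<forall>i<n. f i < f (Suc i))"
proof (induction n)
  case 0
  show ?case by (intro exI[of _ "\<lambda>_. 0"]) (simp add: hermite_fun_def)
next
  case (Suc n)
  then obtain f where f: "\<And>i. i \<le> n \<Longrightarrow> hermite_fun (Suc n) (f i) = 0" "\<And>i. i < n \<Longrightarrow> f i < f (Suc i)" by blast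
  have "\<exists>z. hermite_fun (Suc (Suc n)) z = 0 \<and> (i > 0 \<longrightarrow> f (i - 1) < z) \<and> (i \<le> n \<longrightarrow> z < f i)" if i: "i \<le> Suc n" for i
  proof -
    consider "i = 0" | "0 < i" "i \<le> n" | "i = Suc n" using i by linarith
    then show ?thesis
    proof cases
      case 1
      then show ?thesis using hermite_fun_zero_below[OF f(1)[of 0]] by auto
    next
      case 2
      then obtain j where j: "i = Suc j" by (cases i) auto
      have "hermite_fun (Suc n) (f j) = 0" "hermite_fun (Suc n) (f i) = 0" "f j < f i"
        using f(1)[of j] f(1)[of i] f(2)[of j] 2 j by simp_all
      from hermite_fun_zero_between[OF this] show ?thesis using j by auto
    next
      case 3
      then show ?thesis using hermite_fun_zero_above[OF f(1)[of n]] by auto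
    qed
  qed
  then have "\<forall>i\<in>{..Suc n}. \<exists>z. hermite_fun (Suc (Suc n)) z = 0 \<and> (i > 0 \<longrightarrow> f (i - 1) < z) \<and> (i \<le> n \<longrightarrow> z < f i)"
    by blast
  from bchoice[OF this] obtain g where g: "\<And>i. i \<le> Suc n \<Longrightarrow> hermite_fun (Suc (Suc n)) (g i) = 0 \<and> (i > 0 \<longrightarrow> f (i - 1) < g i) \<and> (i \<le> n \<longrightarrow> g i < f i)"
    by blast
  have "g i < g (Suc i)" if "i < Suc n" for i
  proof -
    have "g i < f i" using g[of i] that by simp
    also have "f i < g (Suc i)" using g[of "Suc i"] that by simp
    finally show ?thesis .
  qed
  then show ?case using g by blast
qed

text \<open>The degree bounds the count from above, the interlacing enumeration from below.\<close>

theorem card_hermite_fun_zeros: "card {x. hermite_fun (Suc n) x = 0} = Suc n"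
proof (rule antisym[OF card_hermite_fun_zeros_le])
  obtain f where f: "\<And>i. i \<le> n \<Longrightarrow> hermite_fun (Suc n) (f i) = 0" "\<And>i. i < n \<Longrightarrow> f i < f (Suc i)"
    using hermite_fun_zeros_enum by blast
  have mono: "f i < f j" if "i < j" "j \<le> n" for i j
    using that
  proof (induction j)
    case (Suc j)
    then show ?case using f(2)[of j] by (cases "i = j") auto
  qed simp
  have "inj_on f {..n}"
  proof (rule inj_onI)
    fix i j assume "i \<in> {..n}" "j \<in> {..n}" "f i = f j"
    then show "i = j" using mono[of i j] mono[of j i] by (cases i j rule: linorder_cases) auto
  qed
  then have "Suc n = card (f ` {..n})" by (simp add: card_image)
  also have "\<dots> \<le> card {x. hermite_fun (Suc n) x = 0}"
    by (intro card_mono finite_hermite_fun_zeros) (use f in auto)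
  finally show "Suc n \<le> card {x. hermite_fun (Suc n) x = 0}" .
qed

section \<open>Slopes at the zeros: oscillator energy, location of zeros, WKB amplitude\<close>

definition henergy :: "nat \<Rightarrow> real \<Rightarrow> real" where
  "henergy n x = ((hermite_fun' n x)\<^sup>2 + (2 * real n + 1 - x\<^sup>2) * (hermite_fun n x)\<^sup>2) / 2"

text \<open>Along solutions of \<open>y'' + (2 * n + 1 - x^2) * y = 0\<close> the energy changes
  only through the explicit \<open>x\<close> in the potential; hence it is greatest at 0.\<close>

lemma DERIV_henergy: "(henergy n has_real_derivative - x * (hermite_fun n x)\<^sup>2) (at x)"
proof -
  have "(henergy n has_real_derivative (2 * hermite_fun' n x * ((x\<^sup>2 - (2 * real n + 1)) * hermite_fun n x)
     + ((- 2 * x) * (hermite_fun n x)\<^sup>2 + (2 * real n + 1 - x\<^sup>2) * (2 * hermite_fun n x * hermite_fun' n x))) / 2) (at x)"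
  proof -
    have Q: "((\<lambda>x. 2 * real n + 1 - x\<^sup>2) has_real_derivative - 2 * x) (at x)" by (auto intro!: derivative_eq_intros)
    have A: "((\<lambda>x. (hermite_fun' n x)\<^sup>2) has_real_derivative 2 * hermite_fun' n x * ((x\<^sup>2 - (2 * real n + 1)) * hermite_fun n x)) (at x)"
      using DERIV_power[OF DERIV_hermite_fun'[of n x], of 2] by (simp add: mult_ac)
    have B: "((\<lambda>x. (hermite_fun n x)\<^sup>2) has_real_derivative 2 * hermite_fun n x * hermite_fun' n x) (at x)"
      using DERIV_power[OF DERIV_hermite_fun[of n x], of 2] by (simp add: mult_ac)
    show ?thesis
      unfolding henergy_def[abs_def]
      by (rule DERIV_cong[OF DERIV_cdivide[OF DERIV_add[OF A DERIV_mult[OF Q B]]]]) (simp add: mult_ac)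
  qed
  then show ?thesis by (rule DERIV_cong) (simp add: algebra_simps)
qed

lemma henergy_le_0: "henergy n x \<le> henergy n 0"
proof (cases "x \<ge> 0")
  case True
  show ?thesis
  proof (rule DERIV_nonpos_imp_nonincreasing[OF True])
    fix t :: real assume "0 \<le> t"
    then show "\<exists>y. (henergy n has_real_derivative y) (at t) \<and> y \<le> 0"
      by (intro exI[of _ "- t * (hermite_fun n t)\<^sup>2"] conjI DERIV_henergy) simp
  qed
next
  case False
  then have "x \<le> 0" by simp
  show ?thesis
  proof (rule DERIV_nonneg_imp_nondecreasing[OF \<open>x \<le> 0\<close>])
    fix t :: real assume "t \<le> 0"
    then show "\<exists>y. (henergy n has_real_derivative y) (at t) \<and> 0 \<le> y"
      by (intro exI[of _ "- t * (hermite_fun n t)\<^sup>2"] conjI DERIV_henergy) (simp add: mult_nonpos_nonneg)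
  qed
qed

text \<open>\<open>x * h_n\<close> has two orthogonal components, with squared coefficients
  \<open>n / 2\<close> and \<open>(n + 1) / 2\<close>.\<close>

lemma hermite_fun_second_moment:
  "integrable lborel (\<lambda>x. x\<^sup>2 * (hermite_fun n x)\<^sup>2)" "(LINT x|lborel. x\<^sup>2 * (hermite_fun n x)\<^sup>2) = real n + 1 / 2"
proof -
  define a b where "a = sqrt (real n / 2)" and "b = sqrt (real (Suc n) / 2)"
  have ab: "a\<^sup>2 = real n / 2" "b\<^sup>2 = real (Suc n) / 2" by (simp_all add: a_def b_def del: of_nat_Suc)
  have eq: "x\<^sup>2 * (hermite_fun n x)\<^sup>2 = a\<^sup>2 * (hermite_fun (n - 1) x * hermite_fun (n - 1) x) + 2 * a * b * (hermite_fun (n - 1) x * hermite_fun (Suc n) x)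
     + b\<^sup>2 * (hermite_fun (Suc n) x * hermite_fun (Suc n) x)" for x
  proof -
    have "x\<^sup>2 * (hermite_fun n x)\<^sup>2 = (x * hermite_fun n x)\<^sup>2" by (simp add: power_mult_distrib)
    then show ?thesis unfolding hermite_fun_rec a_def[symmetric] b_def[symmetric] by (simp only: power2_eq_square) (simp only: algebra_simps)
  qed
  show "integrable lborel (\<lambda>x. x\<^sup>2 * (hermite_fun n x)\<^sup>2)" unfolding eq by simp
  have "(LINT x|lborel. x\<^sup>2 * (hermite_fun n x)\<^sup>2) = a\<^sup>2 + b\<^sup>2"
    unfolding eq by (simp add: hermite_fun_orthonormal)
  then show "(LINT x|lborel. x\<^sup>2 * (hermite_fun n x)\<^sup>2) = real n + 1 / 2" unfolding ab by (simp add: field_simps)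
qed

text \<open>With \<open>l = 2 * n + 1\<close> the second moment is \<open>l / 2\<close>, so at most
  two thirds of the mass lies beyond \<open>T\<close>, where \<open>T^2 = 3 * l / 4\<close>. Within
  \<open>T\<close> the potential is at least \<open>l / 4\<close>, hence
  \<open>h_n^2 <= 8 * G / l\<close> for the energy \<open>G\<close> at 0. The remaining third forces
  \<open>1 / 3 <= 16 * G / sqrt l\<close>.\<close>

lemma henergy_0_lower: "henergy n 0 \<ge> sqrt (2 * real n + 1) / 48"
proof -
  define l where "l = 2 * real n + 1"
  have l: "l > 0" by (simp add: l_def)
  define T where "T = sqrt (3 * l / 4)"
  have T: "T > 0" "T\<^sup>2 = 3 * l / 4" "T \<le> sqrt l" using l by (auto simp: T_def)
  let ?G = "henergy n 0"
  have G0: "?G \<ge> 0" using l by (simp add: henergy_def l_def)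
  have pt: "(hermite_fun n x)\<^sup>2 - x\<^sup>2 * (hermite_fun n x)\<^sup>2 / T\<^sup>2 \<le> 8 * ?G / l * indicator {-T..T} x" for x
  proof (cases "x \<in> {-T..T}")
    case True
    then have "\<bar>x\<bar> \<le> T" by auto
    then have x2: "x\<^sup>2 \<le> 3 * l / 4" using power_mono[of "\<bar>x\<bar>" T 2] T(2) by simp
    have "(l / 4) * (hermite_fun n x)\<^sup>2 \<le> (l - x\<^sup>2) * (hermite_fun n x)\<^sup>2"
      using x2 by (intro mult_right_mono) auto
    also have "\<dots> \<le> 2 * henergy n x" by (simp add: henergy_def l_def)
    also have "\<dots> \<le> 2 * ?G" using henergy_le_0[of n x] by simp
    finally have "(hermite_fun n x)\<^sup>2 \<le> 8 * ?G / l" using l by (simp add: field_simps)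
    moreover have "x\<^sup>2 * (hermite_fun n x)\<^sup>2 / T\<^sup>2 \<ge> 0" by simp
    ultimately have "(hermite_fun n x)\<^sup>2 - x\<^sup>2 * (hermite_fun n x)\<^sup>2 / T\<^sup>2 \<le> 8 * ?G / l" by linarith
    then show ?thesis using True by simp
  next
    case False
    then have "T \<le> \<bar>x\<bar>" by auto
    then have "T\<^sup>2 \<le> x\<^sup>2" using power_mono[of T "\<bar>x\<bar>" 2] T by simp
    then have "(hermite_fun n x)\<^sup>2 * T\<^sup>2 \<le> x\<^sup>2 * (hermite_fun n x)\<^sup>2" by (simp add: mult.commute mult_right_mono)
    then show ?thesis using False T(1) by (simp add: field_simps)
  qed
  note m = hermite_fun_second_moment[of n]
  have i0: "integrable lborel (\<lambda>x. (hermite_fun n x)\<^sup>2)" "(LINT x|lborel. (hermite_fun n x)\<^sup>2) = 1"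
    using integrable_hermite_fun_mult[of n n] hermite_fun_orthonormal[of n n] by (simp_all add: power2_eq_square)
  have iT: "integrable lborel (indicator {-T..T} :: real \<Rightarrow> real)"
    by (intro integrable_real_indicator) (auto simp: emeasure_lborel_Icc_eq)
  have "(LINT x|lborel. (hermite_fun n x)\<^sup>2 - x\<^sup>2 * (hermite_fun n x)\<^sup>2 / T\<^sup>2) \<le> (LINT x|lborel. 8 * ?G / l * indicator {-T..T} x)"
    using pt i0 m iT by (intro integral_mono) auto
  also have "(LINT x|lborel. (hermite_fun n x)\<^sup>2 - x\<^sup>2 * (hermite_fun n x)\<^sup>2 / T\<^sup>2) = 1 - (real n + 1 / 2) / T\<^sup>2"
    using i0 m by simp
  also have "(real n + 1 / 2) / T\<^sup>2 = 2 / 3" unfolding T(2) using l by (simp add: l_def field_simps)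
  also have "(LINT x|lborel. 8 * ?G / l * indicator {-T..T} x) = 8 * ?G / l * (2 * T)" using T(1) by simp
  finally have "1 / 3 \<le> 8 * ?G / l * (2 * T)" by simp
  also have "\<dots> \<le> 8 * ?G / l * (2 * sqrt l)" using T(3) G0 l by (intro mult_left_mono) auto
  also have "\<dots> = 16 * ?G / sqrt l" using l by (simp add: field_simps)
  finally have "sqrt l / 48 \<le> ?G" using l by (simp add: field_simps)
  then show ?thesis by (simp add: l_def)
qed

lemma nondecreasing_limits_zero:
  fixes Z :: "real \<Rightarrow> real"
  assumes mono: "\<And>s t. 0 < s \<Longrightarrow> s \<le> t \<Longrightarrow> Z s \<le> Z t"
    and 0: "(Z \<longlongrightarrow> 0) (at_right 0)" and top: "(Z \<longlongrightarrow> 0) at_top" and t: "t > 0"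
  shows "Z t = 0"
proof (rule antisym)
  show "Z t \<le> 0"
    by (rule tendsto_lowerbound[OF top]) (use mono[OF t] in \<open>auto intro: eventually_mono[OF eventually_ge_at_top[of t]]\<close>)
  show "0 \<le> Z t"
  proof (rule tendsto_upperbound[OF 0])
    show "\<forall>\<^sub>F s in at_right 0. Z s \<le> Z t"
      using eventually_at_right_less[of 0] eventually_at_right_real[OF t]
      by eventually_elim (use mono in auto)
  qed simp
qed

text \<open>Hardy-type comparison with \<open>sqrt t\<close>, which solves
  \<open>z'' = - z / (4 * t^2)\<close>. If the potential stayed below \<open>1 / (4 * t^2)\<close>
  to the right of the zero, then \<open>Z = h * (h' - h / (2 * t))\<close> would be nondecreasing
  with limit 0 at both ends, hence zero, and so would \<open>h\<close> on the half-line.\<close>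

lemma hermite_fun_zero_turning_point:
  assumes X: "hermite_fun n X = 0"
  shows "\<exists>t>0. 1 / (4 * t\<^sup>2) \<le> 2 * real n + 1 - (X + t)\<^sup>2"
proof (rule ccontr)
  assume "\<not> ?thesis"
  then have q: "1 / (4 * t\<^sup>2) - (2 * real n + 1 - (X + t)\<^sup>2) > 0" if "t > 0" for t using that by force
  let ?h = "\<lambda>t. hermite_fun n (X + t)" and ?d = "\<lambda>t. hermite_fun' n (X + t)"
  define Z where "Z = (\<lambda>t. ?h t * ?d t - (?h t)\<^sup>2 / (2 * t))"
  have dh: "(?h has_real_derivative ?d t) (at t)" for t
    using DERIV_hermite_fun[of n "t + X"] unfolding DERIV_shift by (simp add: add.commute)
  have dd: "(?d has_real_derivative ((X + t)\<^sup>2 - (2 * real n + 1)) * ?h t) (at t)" for t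
    using DERIV_hermite_fun'[of n "t + X"] unfolding DERIV_shift by (simp add: add.commute)
  have dZ: "(Z has_real_derivative (?d t - ?h t / (2 * t))\<^sup>2 + (?h t)\<^sup>2 * (1 / (4 * t\<^sup>2) - (2 * real n + 1 - (X + t)\<^sup>2))) (at t)" if "t > 0" for t
  proof -
    have "(Z has_real_derivative (?d t * ?d t + ((X + t)\<^sup>2 - (2 * real n + 1)) * ?h t * ?h t)
        - ((2 * ?h t * ?d t) * (2 * t) - (?h t)\<^sup>2 * 2) / (2 * t * (2 * t))) (at t)"
      unfolding Z_def using that
      by (intro DERIV_diff DERIV_mult DERIV_divide dh dd) (auto intro!: derivative_eq_intros dh)
    then show ?thesis
      by (rule DERIV_cong) (use that in \<open>simp add: power2_eq_square field_simps\<close>)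
  qed
  have Z0: "Z t = 0" if "t > 0" for t
  proof (rule nondecreasing_limits_zero[of Z, OF _ _ _ that])
    fix s t :: real assume st: "0 < s" "s \<le> t"
    show "Z s \<le> Z t"
    proof (rule DERIV_nonneg_imp_nondecreasing[OF st(2)])
      fix x assume "s \<le> x" "x \<le> t"
      then have "x > 0" using st by simp
      show "\<exists>y. (Z has_real_derivative y) (at x) \<and> 0 \<le> y"
        using dZ[OF \<open>x > 0\<close>] q[OF \<open>x > 0\<close>] by (intro exI conjI) (auto intro!: add_nonneg_nonneg mult_nonneg_nonneg)
    qed
  next
    have h0: "(?h \<longlongrightarrow> 0) (at_right 0)" and d0: "(?d \<longlongrightarrow> hermite_fun' n X) (at_right 0)"
      using tendsto_within_subset[OF DERIV_isCont[OF dh[of 0], unfolded isCont_def] subset_UNIV]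
        tendsto_within_subset[OF DERIV_isCont[OF dd[of 0], unfolded isCont_def] subset_UNIV] X by simp_all
    have quot: "((\<lambda>t. ?h t / t) \<longlongrightarrow> hermite_fun' n X) (at_right 0)"
      using tendsto_within_subset[OF dh[of 0, unfolded DERIV_def] subset_UNIV] X by simp
    have "((\<lambda>t. ?h t * ?d t - ?h t * (?h t / t) / 2) \<longlongrightarrow> 0 * hermite_fun' n X - 0 * hermite_fun' n X / 2) (at_right 0)"
      by (intro tendsto_intros h0 d0 quot) simp
    then show "(Z \<longlongrightarrow> 0) (at_right 0)" by (simp add: Z_def power2_eq_square mult.commute)
  next
    have tr: "filterlim (\<lambda>t. X + t) at_top at_top" by (rule filterlim_tendsto_add_at_top[OF tendsto_const filterlim_ident])
    have h: "(?h \<longlongrightarrow> 0) at_top" and d: "(?d \<longlongrightarrow> 0) at_top"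
      by (rule filterlim_compose[OF rapid_tendsto(1)[OF rapid_hermite_fun] tr] filterlim_compose[OF rapid_tendsto(1)[OF rapid_hermite_fun'] tr])+
    have i: "((\<lambda>t::real. 1 / (2 * t)) \<longlongrightarrow> 0) at_top" by real_asymp
    have "((\<lambda>t. ?h t * ?d t - (?h t)\<^sup>2 * (1 / (2 * t))) \<longlongrightarrow> 0 * 0 - 0\<^sup>2 * 0) at_top"
      by (intro tendsto_intros h d i)
    then show "(Z \<longlongrightarrow> 0) at_top" by (simp add: Z_def)
  qed
  have "?h t = 0" if t: "t > 0" for t
  proof -
    have "((\<lambda>t. 0) has_real_derivative (?d t - ?h t / (2 * t))\<^sup>2 + (?h t)\<^sup>2 * (1 / (4 * t\<^sup>2) - (2 * real n + 1 - (X + t)\<^sup>2))) (at t)"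
      by (rule has_field_derivative_transform_within_open[OF dZ[OF t], of "{0<..}"]) (use t Z0 in auto)
    then have "(?d t - ?h t / (2 * t))\<^sup>2 + (?h t)\<^sup>2 * (1 / (4 * t\<^sup>2) - (2 * real n + 1 - (X + t)\<^sup>2)) = 0"
      using DERIV_unique[OF _ DERIV_const] by blast
    moreover have "(?h t)\<^sup>2 * (1 / (4 * t\<^sup>2) - (2 * real n + 1 - (X + t)\<^sup>2)) \<ge> 0" using q[OF t] by (intro mult_nonneg_nonneg) auto
    ultimately have "(?h t)\<^sup>2 * (1 / (4 * t\<^sup>2) - (2 * real n + 1 - (X + t)\<^sup>2)) = 0"
      by (smt (verit) zero_le_power2)
    then show ?thesis using q[OF t] by simp
  qed
  note h0 = this
  have "hermite_fun n x = 0" if "x > X" for x using h0[of "x - X"] that by simp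
  then show False using hermite_fun_nonzero_between[of X "X + 1" n] by auto
qed

text \<open>Expanding \<open>(X + t)^2\<close> gives \<open>Q >= 1 / (4 * t^2) + 2 * X * t\<close>.
  The arithmetic-geometric mean of the three terms \<open>a\<close>, \<open>b\<close>,
  \<open>b\<close> removes the unknown \<open>t\<close>, since
  \<open>a * b^2 = X^2 / 4\<close>.\<close>

lemma hermite_fun_zero_bound:
  assumes X: "hermite_fun n X = 0" "X \<ge> 0"
  defines "Q \<equiv> 2 * real n + 1 - X\<^sup>2"
  shows "Q > 0" "Q ^ 3 \<ge> X\<^sup>2"
proof -
  obtain t where t: "t > 0" "1 / (4 * t\<^sup>2) \<le> 2 * real n + 1 - (X + t)\<^sup>2"
    using hermite_fun_zero_turning_point[OF X(1)] by blast
  define a b where "a = 1 / (4 * t\<^sup>2)" and "b = X * t"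
  have a: "a > 0" and b: "b \<ge> 0" using t X by (auto simp: a_def b_def)
  have "a + 2 * b \<le> Q"
  proof -
    have "(X + t)\<^sup>2 = X\<^sup>2 + t\<^sup>2 + 2 * (X * t)" by (simp add: power2_sum)
    then show ?thesis using t(2) zero_le_power2[of t] unfolding Q_def a_def b_def by linarith
  qed
  then show "Q > 0" using a b by linarith
  have "X\<^sup>2 \<le> 27 * a * b\<^sup>2" using t by (simp add: a_def b_def power_mult_distrib field_simps)
  also have "\<dots> \<le> (a + 2 * b) ^ 3"
  proof -
    have "(a + 2 * b) ^ 3 - 27 * a * b\<^sup>2 = (a - b)\<^sup>2 * (a + 8 * b)" by (simp add: power2_eq_square power3_eq_cube algebra_simps)
    also have "\<dots> \<ge> 0" using a b by simp
    finally show ?thesis by simp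
  qed
  also have "\<dots> \<le> Q ^ 3" using \<open>a + 2 * b \<le> Q\<close> a b by (intro power_mono) auto
  finally show "Q ^ 3 \<ge> X\<^sup>2" .
qed

lemma hermite_fun_minus: "hermite_fun n (- x) = (-1) ^ n * hermite_fun n x"
proof -
  have "hermite n (- x) = (-1) ^ n * hermite n x"
    by (induction n rule: induct_nat_012) (auto simp: algebra_simps)
  then show ?thesis by (simp add: hermite_fun_eq)
qed

lemma hermite_fun'_minus_power2: "(hermite_fun' n (- x))\<^sup>2 = (hermite_fun' n x)\<^sup>2"
proof (cases n)
  case 0
  then show ?thesis by (simp add: hermite_fun'_def hermite_fun_minus)
next
  case (Suc m)
  have "hermite_fun' n (- x) = (-1) ^ m * hermite_fun' n x"
    unfolding hermite_fun'_def hermite_fun_minus Suc by (simp add: right_diff_distrib)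
  then show ?thesis by (simp add: power_mult_distrib flip: power_mult)
qed

text \<open>With frequency \<open>S = sqrt (l - x^2)\<close>, energy over frequency is the adiabatic
  invariant. Subtracting \<open>x / (2 * S^2) * h * h'\<close> cancels the leading oscillation: the
  corrected quotient has derivative \<open>- (l + 2 * x^2) / (2 * S^5) * h * h'\<close>. As
  \<open>x / S^3\<close> has derivative \<open>(l + 2 * x^2) / S^5\<close>, the exponential factor
  is exactly strong enough to dominate this remainder.\<close>

lemma hermite_fun_amplitude_mono:
  fixes n :: nat and X :: real
  defines "l \<equiv> 2 * real n + 1"
  assumes X: "X \<ge> 0" "l - X\<^sup>2 > 0" "X\<^sup>2 \<le> (l - X\<^sup>2) ^ 3"
  defines "A \<equiv> \<lambda>x. (henergy n x - x / (2 * (sqrt (l - x\<^sup>2))\<^sup>2) * (hermite_fun n x * hermite_fun' n x)) * (1 / sqrt (l - x\<^sup>2)) * exp (x / sqrt (l - x\<^sup>2) ^ 3)"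
  shows "A 0 \<le> A X"
proof (rule DERIV_nonneg_imp_nondecreasing[OF X(1)])
  fix x assume x: "0 \<le> x" "x \<le> X"
  define s where "s = (\<lambda>x. sqrt (l - x\<^sup>2))"
  define S where "S = s x"
  define H where "H = hermite_fun n x"
  define D where "D = hermite_fun' n x"
  have xX: "x\<^sup>2 \<le> X\<^sup>2" using x by (intro power_mono) auto
  then have pos: "l - x\<^sup>2 > 0" using X(2) by linarith
  have S: "S > 0" and S2: "S\<^sup>2 = l - x\<^sup>2" using pos by (auto simp: S_def s_def)
  \<comment> \<open>As \<open>x\<close> grows to \<open>X\<close>, the square \<open>x^2\<close>
    grows and \<open>l - x^2\<close> shrinks, so the condition at \<open>X\<close> is the hardest
    one and is inherited.\<close>
  have xS: "x \<le> S ^ 3"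
  proof (rule power2_le_imp_le)
    have "x\<^sup>2 \<le> (l - X\<^sup>2) ^ 3" using xX X(3) by linarith
    also have "\<dots> \<le> (l - x\<^sup>2) ^ 3" using xX X(2) by (intro power_mono) auto
    also have "\<dots> = (S ^ 3)\<^sup>2" unfolding S2[symmetric] by (simp flip: power_mult)
    finally show "x\<^sup>2 \<le> (S ^ 3)\<^sup>2" .
  qed (use S in auto)
  have ds: "(s has_real_derivative - x / S) (at x)"
  proof -
    have "((\<lambda>x. l - x\<^sup>2) has_real_derivative - 2 * x) (at x)" by (auto intro!: derivative_eq_intros)
    from DERIV_chain2[OF DERIV_real_sqrt[OF pos] this] show ?thesis
      unfolding s_def S_def by (rule DERIV_cong) (simp add: field_simps)
  qed
  have dinv: "((\<lambda>x. 1 / s x) has_real_derivative x / S ^ 3) (at x)"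
    by (rule DERIV_cong[OF DERIV_divide[OF DERIV_const ds]]) (use S in \<open>auto simp: S_def[symmetric] power3_eq_cube field_simps\<close>)
  have ds3: "((\<lambda>x. s x ^ 3) has_real_derivative - 3 * x * S) (at x)"
    by (rule DERIV_cong[OF DERIV_power[OF ds]]) (use S in \<open>simp add: S_def[symmetric] power2_eq_square field_simps\<close>)
  have ds2: "((\<lambda>x. 2 * (s x)\<^sup>2) has_real_derivative - 4 * x) (at x)"
    by (rule DERIV_cong[OF DERIV_cmult[OF DERIV_power[OF ds]]]) (use S in \<open>simp add: S_def[symmetric] field_simps\<close>)
  have dr: "((\<lambda>x. x / s x ^ 3) has_real_derivative (l + 2 * x\<^sup>2) / S ^ 5) (at x)"
  proof (rule DERIV_cong[OF DERIV_divide[OF DERIV_ident ds3]])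
    show "(1 * s x ^ 3 - x * (- 3 * x * S)) / (s x ^ 3 * s x ^ 3) = (l + 2 * x\<^sup>2) / S ^ 5"
    proof -
      have "l + 2 * x\<^sup>2 = S\<^sup>2 + 3 * x\<^sup>2" using S2 by simp
      then show ?thesis using S unfolding S_def[symmetric] by (simp add: field_simps power2_eq_square eval_nat_numeral)
    qed
  qed (use S in \<open>auto simp: S_def[symmetric]\<close>)
  have dc: "((\<lambda>x. x / (2 * (s x)\<^sup>2)) has_real_derivative (l + x\<^sup>2) / (2 * S ^ 4)) (at x)"
  proof (rule DERIV_cong[OF DERIV_divide[OF DERIV_ident ds2]])
    show "(1 * (2 * (s x)\<^sup>2) - x * (- 4 * x)) / (2 * (s x)\<^sup>2 * (2 * (s x)\<^sup>2)) = (l + x\<^sup>2) / (2 * S ^ 4)"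
    proof -
      have "l + x\<^sup>2 = S\<^sup>2 + 2 * x\<^sup>2" using S2 by simp
      then show ?thesis using S unfolding S_def[symmetric] by (simp add: field_simps power2_eq_square eval_nat_numeral)
    qed
  qed (use S in \<open>auto simp: S_def[symmetric]\<close>)
  have dhd: "((\<lambda>x. hermite_fun n x * hermite_fun' n x) has_real_derivative D\<^sup>2 - S\<^sup>2 * H\<^sup>2) (at x)"
  proof (rule DERIV_cong[OF DERIV_mult[OF DERIV_hermite_fun DERIV_hermite_fun']])
    have "x\<^sup>2 - (2 * real n + 1) = - S\<^sup>2" using S2 by (simp add: l_def)
    then show "hermite_fun' n x * hermite_fun' n x + (x\<^sup>2 - (2 * real n + 1)) * hermite_fun n x * hermite_fun n x = D\<^sup>2 - S\<^sup>2 * H\<^sup>2"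
      by (simp only: D_def H_def) (simp add: power2_eq_square)
  qed
  define L where "L = (D\<^sup>2 + S\<^sup>2 * H\<^sup>2) / 2 - x / (2 * S\<^sup>2) * (H * D)"
  have G: "henergy n x = (D\<^sup>2 + S\<^sup>2 * H\<^sup>2) / 2" unfolding henergy_def D_def H_def S2 l_def ..
  have dL: "((\<lambda>x. henergy n x - x / (2 * (s x)\<^sup>2) * (hermite_fun n x * hermite_fun' n x)) has_real_derivative
      - (x / S\<^sup>2) * L - (l + 2 * x\<^sup>2) / (2 * S ^ 4) * (H * D)) (at x)"
  proof (rule DERIV_cong[OF DERIV_diff[OF DERIV_henergy DERIV_mult[OF dc dhd]]])
    have l: "l + x\<^sup>2 = S\<^sup>2 + 2 * x\<^sup>2" "l + 2 * x\<^sup>2 = S\<^sup>2 + 3 * x\<^sup>2" using S2 by simp_all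
    have S4: "S ^ 4 = (S\<^sup>2)\<^sup>2" by (simp flip: power_mult)
    have alg: "- x * h - ((q + 2 * x\<^sup>2) / (2 * q\<^sup>2) * P + (d - q * h) * (x / (2 * q)))
       = - (x / q) * ((d + q * h) / 2 - x / (2 * q) * P) - (q + 3 * x\<^sup>2) / (2 * q\<^sup>2) * P" if "q \<noteq> 0" for x h q P d :: real
      using that by (simp add: field_simps power2_eq_square)
    have "S\<^sup>2 \<noteq> 0" using S by simp
    from alg[OF this] show "- x * (hermite_fun n x)\<^sup>2 - ((l + x\<^sup>2) / (2 * S ^ 4) * (hermite_fun n x * hermite_fun' n x) + (D\<^sup>2 - S\<^sup>2 * H\<^sup>2) * (x / (2 * (s x)\<^sup>2)))
       = - (x / S\<^sup>2) * L - (l + 2 * x\<^sup>2) / (2 * S ^ 4) * (H * D)"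
      unfolding H_def[symmetric] D_def[symmetric] S_def[symmetric] L_def l S4 .
  qed
  define e where "e = exp (x / S ^ 3)"
  have de: "((\<lambda>x. exp (x / s x ^ 3)) has_real_derivative e * ((l + 2 * x\<^sup>2) / S ^ 5)) (at x)"
    unfolding e_def S_def by (rule DERIV_chain2[OF DERIV_exp dr[unfolded S_def]])
  have Aeq: "A = (\<lambda>x. (henergy n x - x / (2 * (s x)\<^sup>2) * (hermite_fun n x * hermite_fun' n x)) * (1 / s x) * exp (x / s x ^ 3))"
    by (simp add: A_def s_def)
  \<comment> \<open>The term \<open>- (x / S^2) * L\<close> from the energy cancels against the
    derivative \<open>x / S^3\<close> of \<open>1 / s\<close>; the part with \<open>H * D\<close>
    and the contribution of the exponential remain.\<close>
  have "(A has_real_derivative e * (l + 2 * x\<^sup>2) / S ^ 6 * (L - S / 2 * (H * D))) (at x)"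
    unfolding Aeq
  proof (rule DERIV_cong[OF DERIV_mult[OF DERIV_mult[OF dL dinv] de]])
    have Lx: "henergy n x - x / (2 * (s x)\<^sup>2) * (hermite_fun n x * hermite_fun' n x) = L"
      unfolding L_def G H_def[symmetric] D_def[symmetric] S_def[symmetric] ..
    show "((- (x / S\<^sup>2) * L - (l + 2 * x\<^sup>2) / (2 * S ^ 4) * (H * D)) * (1 / s x)
         + x / S ^ 3 * (henergy n x - x / (2 * (s x)\<^sup>2) * (hermite_fun n x * hermite_fun' n x))) * exp (x / s x ^ 3)
       + e * ((l + 2 * x\<^sup>2) / S ^ 5) * ((henergy n x - x / (2 * (s x)\<^sup>2) * (hermite_fun n x * hermite_fun' n x)) * (1 / s x))
       = e * (l + 2 * x\<^sup>2) / S ^ 6 * (L - S / 2 * (H * D))"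
    proof -
      have alg: "((- (x / S\<^sup>2) * L - M / (2 * S ^ 4) * P) * (1 / S) + x / S ^ 3 * L) * e + e * (M / S ^ 5) * (L * (1 / S))
         = e * M / S ^ 6 * (L - S / 2 * P)" for M P :: real
      proof -
        have 1: "x / S\<^sup>2 * (1 / S) = x / S ^ 3" using S by (simp add: power2_eq_square power3_eq_cube)
        have 2: "M / (2 * S ^ 4) * (1 / S) = M / S ^ 6 * (S / 2)" "M / S ^ 5 * (1 / S) = M / S ^ 6"
          using S by (simp_all add: field_simps eval_nat_numeral)
        have "((- (x / S\<^sup>2) * L - M / (2 * S ^ 4) * P) * (1 / S) + x / S ^ 3 * L) * e + e * (M / S ^ 5) * (L * (1 / S))
          = (- (x / S\<^sup>2 * (1 / S)) * L - (M / (2 * S ^ 4) * (1 / S)) * P + x / S ^ 3 * L) * e + e * (M / S ^ 5 * (1 / S)) * L"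
          by (simp add: left_diff_distrib diff_divide_distrib mult_ac)
        also have "\<dots> = e * M / S ^ 6 * (L - S / 2 * P)"
          unfolding 1 2 by (simp add: right_diff_distrib left_diff_distrib diff_divide_distrib mult_ac)
        finally show ?thesis .
      qed
      show ?thesis unfolding Lx unfolding S_def[symmetric] e_def[symmetric] by (rule alg)
    qed
  qed
  then have dA: "(A has_real_derivative e * (l + 2 * x\<^sup>2) / S ^ 6 * (L - S / 2 * (H * D))) (at x)" .
  \<comment> \<open>Both the correction in \<open>L\<close> and the subtracted term are at most half
    of \<open>S * |H * D|\<close>; the first one uses \<open>x <= S ^ 3\<close>. Their sum is at
    most the energy \<open>(D^2 + S^2 * H^2) / 2\<close>.\<close>
  have L0: "L - S / 2 * (H * D) \<ge> 0"
  proof -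
    define m where "m = S * \<bar>H * D\<bar>"
    have "0 \<le> (\<bar>D\<bar> - S * \<bar>H\<bar>)\<^sup>2" by simp
    then have m: "m \<le> (D\<^sup>2 + S\<^sup>2 * H\<^sup>2) / 2"
      by (simp add: m_def power2_diff power_mult_distrib abs_mult algebra_simps)
    have "x / (2 * S\<^sup>2) * (H * D) \<le> S ^ 3 / (2 * S\<^sup>2) * \<bar>H * D\<bar>"
      using xS x(1) S by (intro order_trans[OF mult_left_mono[OF abs_ge_self] mult_right_mono] divide_right_mono) auto
    also have "\<dots> = m / 2" using S by (simp add: m_def power2_eq_square power3_eq_cube)
    finally have 1: "x / (2 * S\<^sup>2) * (H * D) \<le> m / 2" .
    have "S / 2 * (H * D) \<le> S / 2 * \<bar>H * D\<bar>" using S by (intro mult_left_mono abs_ge_self) auto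
    then have 2: "S / 2 * (H * D) \<le> m / 2" by (simp add: m_def)
    show ?thesis unfolding L_def using m 1 2 by linarith
  qed
  have E0: "e * (l + 2 * x\<^sup>2) / S ^ 6 \<ge> 0" using S by (simp add: e_def l_def)
  show "\<exists>y. (A has_real_derivative y) (at x) \<and> 0 \<le> y" using dA mult_nonneg_nonneg[OF E0 L0] by blast
qed

text \<open>At a zero the amplitude is \<open>y'^2 / (2 * S)\<close> times
  \<open>exp (X / S ^ 3)\<close>, at most \<open>exp 1 <= 3\<close>; at 0 it is at least
  \<open>1 / 48\<close>. This gives \<open>y'^2 >= S / 72\<close>.\<close>

lemma hermite_fun_zero_deriv_nonneg:
  assumes h: "hermite_fun (Suc N) X = 0" and X0: "X \<ge> 0" and N: "N \<ge> 1"
  shows "real N powr (1/6) / 72 \<le> (hermite_fun' (Suc N) X)\<^sup>2"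
proof -
  define l where "l = 2 * real (Suc N) + 1"
  define S where "S = sqrt (l - X\<^sup>2)"
  have Q: "l - X\<^sup>2 > 0" "X\<^sup>2 \<le> (l - X\<^sup>2) ^ 3"
    using hermite_fun_zero_bound[OF h X0] by (simp_all add: l_def)
  have S: "S > 0" "S\<^sup>2 = l - X\<^sup>2" using Q by (auto simp: S_def)
  have l: "l > 0" "l \<ge> 2" by (auto simp: l_def)
  have S6: "S ^ 6 = (l - X\<^sup>2) ^ 3" unfolding S(2)[symmetric] by (simp flip: power_mult)
  have XS: "X \<le> S ^ 3"
  proof (rule power2_le_imp_le)
    have "(S ^ 3)\<^sup>2 = S ^ 6" by (simp only: power_mult[symmetric]) simp
    then show "X\<^sup>2 \<le> (S ^ 3)\<^sup>2" unfolding S6 using Q(2) by simp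
  qed (use S in simp)
  let ?n = "Suc N"
  have "henergy ?n 0 / sqrt l \<le> henergy ?n X / S * exp (X / S ^ 3)"
    using hermite_fun_amplitude_mono[OF X0, of ?n] Q h unfolding l_def[symmetric] S_def by simp
  also have "\<dots> \<le> henergy ?n X / S * 3"
  proof (rule mult_left_mono)
    have "exp (X / S ^ 3) \<le> exp 1" using XS S by simp
    then show "exp (X / S ^ 3) \<le> 3" using e_less_272 by linarith
    show "0 \<le> henergy ?n X / S" using S h by (simp add: henergy_def)
  qed
  also have "henergy ?n X = (hermite_fun' ?n X)\<^sup>2 / 2" by (simp add: henergy_def h)
  finally have "henergy ?n 0 / sqrt l \<le> 3 / 2 * (hermite_fun' ?n X)\<^sup>2 / S" by simp
  moreover have "1 / 48 \<le> henergy ?n 0 / sqrt l"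
    using henergy_0_lower[of ?n] l(1) unfolding l_def[symmetric] by (simp add: field_simps)
  ultimately have "1 / 48 \<le> 3 / 2 * (hermite_fun' ?n X)\<^sup>2 / S" by linarith
  then have main: "S / 72 \<le> (hermite_fun' ?n X)\<^sup>2" using S(1) by (simp add: field_simps)
  \<comment> \<open>A zero far out has \<open>S ^ 6 >= X^2 >= N\<close>; a zero in the inner region
    has \<open>S^2 >= l / 2\<close>, which is at least 1 and at least \<open>N\<close>.\<close>
  have "real N \<le> S ^ 6"
  proof (cases "X\<^sup>2 \<ge> l / 2")
    case True
    then have "real N \<le> X\<^sup>2" by (simp add: l_def)
    then show ?thesis using Q(2) unfolding S6 by linarith
  next
    case False
    then have "l / 2 \<le> l - X\<^sup>2" by simp
    then have "(l / 2) ^ 3 \<le> (l - X\<^sup>2) ^ 3" using l by (intro power_mono) auto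
    moreover have "(l / 2) ^ 1 \<le> (l / 2) ^ 3" using l by (intro power_increasing) auto
    moreover have "real N \<le> (l / 2) ^ 1" by (simp add: l_def)
    ultimately show ?thesis unfolding S6 by linarith
  qed
  then have "real N powr (1/6) \<le> (S ^ 6) powr (1/6)" by (intro powr_mono2) auto
  also have "\<dots> = S" 
  proof -
    have "S ^ 6 = S powr 6" using S(1) by simp
    then have "(S ^ 6) powr (1/6) = S powr (6 * (1/6))" by (simp only: powr_powr)
    then show ?thesis using S(1) by simp
  qed
  finally show ?thesis using main by linarith
qed

text \<open>Parity of the Hermite functions reduces negative zeros to positive ones.\<close>

theorem hermite_fun_zero_deriv:
  assumes h: "hermite_fun (Suc N) X = 0" and N: "N \<ge> 1"
  shows "real N powr (1/6) / 72 \<le> (hermite_fun' (Suc N) X)\<^sup>2"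
proof (cases "X \<ge> 0")
  case False
  then show ?thesis using hermite_fun_zero_deriv_nonneg[of N "- X"] h N
    by (simp add: hermite_fun_minus hermite_fun'_minus_power2)
qed (use hermite_fun_zero_deriv_nonneg[OF h _ N] in simp)

lemma hermite_fun_zero_square_less:
  assumes h: "hermite_fun n X = 0"
  shows "X\<^sup>2 < 2 * real n + 1"
proof (cases "X \<ge> 0")
  case True
  then show ?thesis using hermite_fun_zero_bound(1)[OF h] by simp
next
  case False
  then show ?thesis using hermite_fun_zero_bound(1)[of n "- X"] h by (simp add: hermite_fun_minus)
qed

text \<open>All zeros satisfy \<open>x^2 < l\<close>, so between two of them
  \<open>|y''| <= l * |y|\<close>. From a zero to the extremum with height \<open>K\<close>, where
  the slope is 0, two mean value steps give \<open>K <= (b - a)^2 * l * K\<close>.\<close>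

theorem hermite_fun_zeros_gap:
  assumes a: "hermite_fun n a = 0" and b: "hermite_fun n b = 0" and ab: "a < b"
  shows "1 / sqrt (2 * real n + 1) \<le> b - a"
proof -
  define l where "l = 2 * real n + 1"
  have l: "l > 0" by (simp add: l_def)
  let ?f = "\<lambda>x. \<bar>hermite_fun n x\<bar>"
  have "continuous_on {a..b} ?f" by (intro continuous_intros continuous_hermite_fun)
  then obtain m where m: "m \<in> {a..b}" "\<And>x. x \<in> {a..b} \<Longrightarrow> ?f x \<le> ?f m"
    using continuous_attains_sup[of "{a..b}" ?f] ab by fastforce
  define K where "K = ?f m"
  obtain c where c: "a < c" "c < b" "hermite_fun n c \<noteq> 0" using hermite_fun_nonzero_between[OF ab] by blast
  have K: "K > 0" using m(2)[of c] c by (auto simp: K_def)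
  then have "m \<noteq> a" "m \<noteq> b" using a b by (auto simp: K_def)
  then have am: "a < m" "m < b" using m(1) by auto
  have d2: "((\<lambda>x. (hermite_fun n x)\<^sup>2) has_real_derivative 2 * hermite_fun n m * hermite_fun' n m) (at m)"
    using DERIV_power[OF DERIV_hermite_fun[of n m], of 2] by (simp add: mult_ac)
  have "2 * hermite_fun n m * hermite_fun' n m = 0"
  proof (rule DERIV_local_max[OF d2])
    show "0 < min (m - a) (b - m)" using am by simp
    show "\<forall>y. \<bar>m - y\<bar> < min (m - a) (b - m) \<longrightarrow> (hermite_fun n y)\<^sup>2 \<le> (hermite_fun n m)\<^sup>2"
    proof (intro allI impI)
      fix y assume "\<bar>m - y\<bar> < min (m - a) (b - m)"
      then have "a \<le> y" "y \<le> b" by linarith+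
      then have "?f y \<le> ?f m" by (intro m(2)) simp
      then show "(hermite_fun n y)\<^sup>2 \<le> (hermite_fun n m)\<^sup>2" by (simp add: abs_le_square_iff)
    qed
  qed
  then have dm: "hermite_fun' n m = 0" using K by (simp add: K_def)
  obtain z where z: "a < z" "z < m" "hermite_fun n m - hermite_fun n a = (m - a) * hermite_fun' n z"
    using MVT2[OF am(1), of "hermite_fun n" "hermite_fun' n"] DERIV_hermite_fun by blast
  obtain w where w: "z < w" "w < m" "hermite_fun' n m - hermite_fun' n z = (m - z) * ((w\<^sup>2 - l) * hermite_fun n w)"
    using MVT2[OF z(2), of "hermite_fun' n" "\<lambda>x. (x\<^sup>2 - l) * hermite_fun n x"] DERIV_hermite_fun' unfolding l_def by blast
  have "w\<^sup>2 \<le> l"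
  proof -
    have "a < w" "w < b" using w(1,2) z(1,2) am by linarith+
    then have "\<bar>w\<bar> \<le> max \<bar>a\<bar> \<bar>b\<bar>" by linarith
    then have "w\<^sup>2 \<le> (max \<bar>a\<bar> \<bar>b\<bar>)\<^sup>2" using power_mono[of "\<bar>w\<bar>" "max \<bar>a\<bar> \<bar>b\<bar>" 2] by simp
    also have "\<dots> \<le> l" using hermite_fun_zero_square_less[OF a] hermite_fun_zero_square_less[OF b]
      unfolding l_def by (cases "\<bar>a\<bar> \<le> \<bar>b\<bar>") (simp_all add: max_def)
    finally show ?thesis .
  qed
  then have "\<bar>w\<^sup>2 - l\<bar> \<le> l" by simp
  moreover have "?f w \<le> K" unfolding K_def using w(1,2) z(1,2) am by (intro m(2)) auto
  ultimately have "\<bar>w\<^sup>2 - l\<bar> * ?f w \<le> l * K" using l by (intro mult_mono) auto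
  then have "(m - z) * (\<bar>w\<^sup>2 - l\<bar> * ?f w) \<le> (b - a) * (l * K)"
    using w(1,2) z(1,2) am l K by (intro mult_mono[of "m - z" "b - a" "\<bar>w\<^sup>2 - l\<bar> * ?f w" "l * K"]) auto
  moreover have "\<bar>hermite_fun' n z\<bar> = (m - z) * (\<bar>w\<^sup>2 - l\<bar> * ?f w)"
  proof -
    have "hermite_fun' n z = - ((m - z) * ((w\<^sup>2 - l) * hermite_fun n w))" using w(3) unfolding dm by linarith
    then show ?thesis using z(2) by (simp add: abs_mult)
  qed
  ultimately have "\<bar>hermite_fun' n z\<bar> \<le> (b - a) * (l * K)" by simp
  then have "(m - a) * \<bar>hermite_fun' n z\<bar> \<le> (b - a) * ((b - a) * (l * K))"
    using am by (intro mult_mono) auto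
  moreover have "K = (m - a) * \<bar>hermite_fun' n z\<bar>"
  proof -
    have "hermite_fun n m = (m - a) * hermite_fun' n z" using z(3) unfolding a by linarith
    then show ?thesis unfolding K_def using am(1) by (simp add: abs_mult)
  qed
  moreover have "(b - a) * ((b - a) * (l * K)) = (b - a)\<^sup>2 * l * K" by (simp only: power2_eq_square mult.assoc)
  ultimately have "1 * K \<le> (b - a)\<^sup>2 * l * K" by (simp only: mult_1_left)
  then have "1 \<le> (b - a)\<^sup>2 * l" using K by (rule mult_right_le_imp_le)
  then have "1 / l \<le> (b - a)\<^sup>2" using l by (simp only: pos_divide_le_eq)
  moreover have "(1 / sqrt l)\<^sup>2 = 1 / l" unfolding power_divide using l by simp
  ultimately have "(1 / sqrt l)\<^sup>2 \<le> (b - a)\<^sup>2" by (rule ord_eq_le_trans[rotated])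
  moreover have "0 \<le> b - a" using ab by simp
  ultimately show ?thesis unfolding l_def[symmetric] by (rule power2_le_imp_le)
qed

subsection \<open>Interpolation at the Hermite nodes\<close>

lemma rapid_gaussian_poly: "rapid (\<lambda>x::real. exp (- x\<^sup>2 / 2) * poly p x)"
proof (induction p)
  case 0
  then show ?case using rapid_cmult[OF rapid_gaussian, of 0] by simp
next
  case (pCons a p)
  have "(\<lambda>x. exp (- x\<^sup>2 / 2) * poly (pCons a p) x) = (\<lambda>x. a * exp (- x\<^sup>2 / 2) + x * (exp (- x\<^sup>2 / 2) * poly p x))"
    by (rule ext) (simp add: algebra_simps)
  then show ?case
    using rapid_add[OF rapid_cmult[OF rapid_gaussian, of a] rapid_mult_ident[OF pCons(2)]] by simp
qed

lemma gaussian_real_poly_eq_hsum: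
  fixes p :: "real poly"
  assumes "degree p \<le> K"
  shows "\<exists>c. \<forall>x. complex_of_real (exp (- x\<^sup>2 / 2) * poly p x) = hsum c K x"
proof -
  define \<psi> where "\<psi> = map_poly complex_of_real p"
  have \<psi>: "poly \<psi> (of_real x) = of_real (poly p x)" for x
    unfolding \<psi>_def by (induction p) (auto simp: map_poly_pCons)
  have "degree \<psi> \<le> K" using assms unfolding \<psi>_def by (simp add: degree_map_poly)
  from gaussian_poly_eq_hsum[OF this] show ?thesis unfolding \<psi> of_real_mult .
qed

section \<open>Lagrange functions of the Hermite nodes\<close>

definition nodes :: "nat \<Rightarrow> real set" where
  "nodes N = {x. hermite_fun (Suc N) x = 0}"

lemma finite_nodes: "finite (nodes N)" and card_nodes: "card (nodes N) = Suc N"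
  unfolding nodes_def by (rule finite_hermite_fun_zeros card_hermite_fun_zeros)+

text \<open>Exact polynomial division, with the L2 normalisation of the Hermite function included,
  keeps the quotient defined at the node itself.\<close>

definition node_poly :: "nat \<Rightarrow> real \<Rightarrow> real poly" where
  "node_poly N X = smult (1 / (pi powr (1/4) * sqrt (2 ^ Suc N * fact (Suc N)))) (hpoly (Suc N)) div [:- X, 1:]"

text \<open>The quotient of \<open>hermite_fun (Suc N)\<close> by \<open>x - X\<close>. Its value at
  \<open>X\<close> is the slope \<open>hermite_fun' (Suc N) X\<close> and not 1;
  \<open>lagrange\<close> divides by it.\<close>

definition card_fun :: "nat \<Rightarrow> real \<Rightarrow> real \<Rightarrow> real" where
  "card_fun N X x = exp (- x\<^sup>2 / 2) * poly (node_poly N X) x"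

lemma node_poly:
  assumes X: "X \<in> nodes N"
  shows "degree (node_poly N X) \<le> N" and "(x - X) * card_fun N X x = hermite_fun (Suc N) x"
proof -
  let ?P = "smult (1 / (pi powr (1/4) * sqrt (2 ^ Suc N * fact (Suc N)))) (hpoly (Suc N)) :: real poly"
  have P: "hermite_fun (Suc N) x = exp (- x\<^sup>2 / 2) * poly ?P x" for x
    using poly_hpoly[of "Suc N" x, where 'a=real] by (simp add: hermite_fun_eq del: hpoly.simps)
  have "poly ?P X = 0" using X P[of X] by (simp add: nodes_def)
  then have dvd: "[:- X, 1:] dvd ?P" by (simp only: poly_eq_0_iff_dvd)
  then have eq: "?P = [:- X, 1:] * node_poly N X" by (simp only: node_poly_def dvd_mult_div_cancel)
  show "(x - X) * card_fun N X x = hermite_fun (Suc N) x"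
    unfolding P eq card_fun_def by (simp add: algebra_simps)
  show "degree (node_poly N X) \<le> N"
  proof (cases "node_poly N X = 0")
    case False
    have "degree ?P = Suc (degree (node_poly N X))"
      unfolding eq using False by (subst degree_mult_eq) auto
    moreover have "degree ?P \<le> Suc N" by (rule order_trans[OF degree_smult_le degree_hpoly_le])
    ultimately show ?thesis by simp
  qed simp
qed

definition card_fun' :: "nat \<Rightarrow> real \<Rightarrow> real \<Rightarrow> real" where
  "card_fun' N X x = exp (- x\<^sup>2 / 2) * poly (pderiv (node_poly N X)) x - x * card_fun N X x"

lemma DERIV_card_fun: "(card_fun N X has_real_derivative card_fun' N X x) (at x)"
proof -
  have g: "((\<lambda>x. exp (- x\<^sup>2 / 2)) has_real_derivative - x * exp (- x\<^sup>2 / 2)) (at x)"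
    by (auto intro!: derivative_eq_intros)
  show ?thesis
    unfolding card_fun_def[abs_def]
    by (rule DERIV_cong[OF DERIV_mult[OF g poly_DERIV]]) (simp add: card_fun'_def card_fun_def)
qed

lemma rapid_card_fun: "rapid (card_fun N X)"
  unfolding card_fun_def[abs_def] by (rule rapid_gaussian_poly)

lemma rapid_card_fun': "rapid (card_fun' N X)"
  unfolding card_fun'_def[abs_def] by (rule rapid_diff[OF rapid_gaussian_poly rapid_mult_ident[OF rapid_card_fun]])

lemma card_fun_node:
  assumes "X \<in> nodes N" "W \<in> nodes N"
  shows "card_fun N X W = (if W = X then hermite_fun' (Suc N) X else 0)"
proof (cases "W = X")
  case False
  then show ?thesis using node_poly(2)[OF assms(1), of W] assms(2) by (simp add: nodes_def)
next
  case True
  have sub: "((\<lambda>x. x - X) has_real_derivative 1) (at X)" by (auto intro!: derivative_eq_intros)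
  have "((\<lambda>x. (x - X) * card_fun N X x) has_real_derivative 1 * card_fun N X X + card_fun' N X X * (X - X)) (at X)"
    by (rule DERIV_mult[OF sub DERIV_card_fun])
  then have "(hermite_fun (Suc N) has_real_derivative card_fun N X X) (at X)"
    unfolding node_poly(2)[OF assms(1)] by simp
  from DERIV_unique[OF this DERIV_hermite_fun] show ?thesis using True by simp
qed

text \<open>The factor \<open>x - W\<close> inside the first function completes the second one to
  \<open>hermite_fun (Suc N)\<close>; the cofactor is a Gaussian times a polynomial of degree at
  most \<open>N\<close>.\<close>

lemma card_fun_orthogonal:
  assumes X: "X \<in> nodes N" and W: "W \<in> nodes N" and ne: "X \<noteq> W"
  shows "(LINT x|lborel. card_fun N X x * card_fun N W x) = 0"
proof -
  have "card_fun N X W = 0" using card_fun_node[OF X W] ne by simp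
  then have "poly (node_poly N X) W = 0" by (simp add: card_fun_def)
  then obtain r where r: "node_poly N X = [:- W, 1:] * r" unfolding poly_eq_0_iff_dvd by blast
  have dr: "degree r \<le> N"
  proof (cases "r = 0")
    case False
    have "degree (node_poly N X) = Suc (degree r)"
      unfolding r using False by (subst degree_mult_eq) auto
    then show ?thesis using node_poly(1)[OF X] by simp
  qed simp
  have "card_fun N X x * card_fun N W x = hermite_fun (Suc N) x * (exp (- x\<^sup>2 / 2) * poly r x)" for x
    unfolding node_poly(2)[OF W, symmetric] card_fun_def r by (simp add: algebra_simps)
  then show ?thesis using hermite_fun_orth_poly[OF dr] by simp
qed

text \<open>With \<open>y\<close> the Hermite function and \<open>k = y / (x - X)\<close>,
  integrating the derivative of \<open>(x - X) * k^2 = y * k\<close> gives that the integral of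
  \<open>k^2\<close> is -2 times that of \<open>y * k'\<close>. Modulo Gaussian times polynomials of
  degree at most \<open>N\<close>, which are orthogonal to \<open>y\<close>, the function
  \<open>k'\<close> is \<open>- y\<close>.\<close>

lemma card_fun_norm:
  assumes X: "X \<in> nodes N"
  shows "(LINT x|lborel. card_fun N X x * card_fun N X x) = 2"
proof -
  let ?y = "hermite_fun (Suc N)" and ?k = "card_fun N X"
  let ?e = "\<lambda>x. exp (- x\<^sup>2 / 2) * poly (pderiv (node_poly N X)) x"
  have sub: "((\<lambda>x. x - X) has_real_derivative 1) (at x)" for x by (auto intro!: derivative_eq_intros)
  have F: "((\<lambda>x. (x - X) * ?k x * ?k x) has_real_derivative ?k x * ?k x + 2 * (?y x * card_fun' N X x)) (at x)" for x
    by (rule DERIV_cong[OF DERIV_mult[OF DERIV_mult[OF sub DERIV_card_fun] DERIV_card_fun]])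
       (simp add: node_poly(2)[OF X, symmetric] algebra_simps)
  have split: "?y x * card_fun' N X x = ?y x * ?e x - ?y x * ?y x - X * (?y x * ?k x)" for x
  proof -
    have "x * ?k x = ?y x + X * ?k x" using node_poly(2)[OF X, of x] by (simp add: algebra_simps)
    then show ?thesis unfolding card_fun'_def by (simp add: algebra_simps)
  qed
  have rkk: "rapid (\<lambda>x. ?k x * ?k x)" by (rule rapid_mult[OF rapid_card_fun rapid_card_fun])
  have rye: "rapid (\<lambda>x. ?y x * ?e x)" by (rule rapid_mult[OF rapid_hermite_fun rapid_gaussian_poly])
  have ryk: "rapid (\<lambda>x. ?y x * ?k x)" by (rule rapid_mult[OF rapid_hermite_fun rapid_card_fun])
  have ryk': "rapid (\<lambda>x. ?y x * card_fun' N X x)" by (rule rapid_mult[OF rapid_hermite_fun rapid_card_fun'])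
  have "(LINT x|lborel. ?k x * ?k x + 2 * (?y x * card_fun' N X x)) = 0"
  proof (rule rapid_integral_derivative)
    show "((\<lambda>x. ?y x * ?k x) has_vector_derivative ?k x * ?k x + 2 * (?y x * card_fun' N X x)) (at x)" for x
      using F[of x] unfolding node_poly(2)[OF X] has_real_derivative_iff_has_vector_derivative .
  qed (rule ryk rapid_add[OF rkk rapid_cmult[OF ryk']])+
  then have 1: "(LINT x|lborel. ?k x * ?k x) + 2 * (LINT x|lborel. ?y x * card_fun' N X x) = 0"
    using rapid_integrable[OF rkk] rapid_integrable[OF ryk'] by simp
  have "(LINT x|lborel. ?y x * ?e x) = 0"
    by (rule hermite_fun_orth_poly) (use node_poly(1)[OF X] degree_pderiv[of "node_poly N X"] in simp)
  moreover have "(LINT x|lborel. ?y x * ?k x) = 0"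
    unfolding card_fun_def by (rule hermite_fun_orth_poly[OF node_poly(1)[OF X]])
  ultimately have "(LINT x|lborel. ?y x * card_fun' N X x) = - 1"
    unfolding split using rapid_integrable[OF rye] rapid_integrable[OF ryk] hermite_fun_orthonormal[of "Suc N" "Suc N"] by simp
  with 1 show ?thesis by simp
qed

definition lagrange :: "nat \<Rightarrow> (real \<Rightarrow> complex) \<Rightarrow> real \<Rightarrow> complex" where
  "lagrange N v x = (\<Sum>X\<in>nodes N. v X / complex_of_real (hermite_fun' (Suc N) X) * complex_of_real (card_fun N X x))"

lemma lagrange_eq_hsum: "\<exists>d. lagrange N v = hsum d N"
proof -
  have "\<forall>X\<in>nodes N. \<exists>c. \<forall>x. complex_of_real (card_fun N X x) = hsum c N x"
    unfolding card_fun_def using gaussian_real_poly_eq_hsum node_poly(1) by blast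
  from bchoice[OF this] obtain c where c: "\<And>X x. X \<in> nodes N \<Longrightarrow> complex_of_real (card_fun N X x) = hsum (c X) N x"
    by blast
  have "lagrange N v x = hsum (\<lambda>n. \<Sum>X\<in>nodes N. v X / complex_of_real (hermite_fun' (Suc N) X) * c X n) N x" for x
  proof -
    have "lagrange N v x = (\<Sum>X\<in>nodes N. \<Sum>n\<le>N. v X / complex_of_real (hermite_fun' (Suc N) X) * c X n * herm n x)"
      unfolding lagrange_def by (intro sum.cong refl) (simp add: c hsum_def sum_distrib_left mult.assoc)
    also have "\<dots> = (\<Sum>n\<le>N. \<Sum>X\<in>nodes N. v X / complex_of_real (hermite_fun' (Suc N) X) * c X n * herm n x)"
      by (rule sum.swap)
    finally show ?thesis by (simp only: hsum_def sum_distrib_right)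
  qed
  then show ?thesis by blast
qed

lemma lagrange_node:
  assumes W: "W \<in> nodes N" and N: "N \<ge> 1"
  shows "lagrange N v W = v W"
proof -
  have "hermite_fun' (Suc N) W \<noteq> 0"
  proof
    assume "hermite_fun' (Suc N) W = 0"
    then have "real N powr (1/6) / 72 \<le> 0" using hermite_fun_zero_deriv[OF _ N, of W] W by (simp add: nodes_def)
    moreover have "real N powr (1/6) > 0" using N by simp
    ultimately show False by simp
  qed
  then have "v X / complex_of_real (hermite_fun' (Suc N) X) * complex_of_real (card_fun N X W) = (if X = W then v W else 0)"
    if "X \<in> nodes N" for X using card_fun_node[OF that W] by simp
  then have "lagrange N v W = (\<Sum>X\<in>nodes N. if X = W then v W else 0)"
    unfolding lagrange_def by (intro sum.cong refl)
  then show ?thesis using W finite_nodes by simp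
qed

lemma L2norm_lagrange:
  "(L2norm (lagrange N v))\<^sup>2 = (\<Sum>X\<in>nodes N. 2 * (cmod (v X))\<^sup>2 / (hermite_fun' (Suc N) X)\<^sup>2)"
proof -
  define a where "a = (\<lambda>X. v X / complex_of_real (hermite_fun' (Suc N) X))"
  have ik: "integrable lborel (\<lambda>x. card_fun N X x * card_fun N W x)" for X W
    by (rule rapid_integrable[OF rapid_mult[OF rapid_card_fun rapid_card_fun]])
  have ikc: "complex_integrable lborel (\<lambda>x. complex_of_real (card_fun N X x * card_fun N W x))" for X W
    by (rule integrable_of_real[OF ik])
  have I: "(LINT x|lborel. card_fun N X x * card_fun N W x) = (if X = W then 2 else 0)" if "X \<in> nodes N" "W \<in> nodes N" for X W
    using card_fun_norm card_fun_orthogonal that by simp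
  have ex: "lagrange N v x * cnj (lagrange N v x) = (\<Sum>X\<in>nodes N. \<Sum>W\<in>nodes N. a X * cnj (a W) * complex_of_real (card_fun N X x * card_fun N W x))" for x
  proof -
    have "cnj (lagrange N v x) = (\<Sum>W\<in>nodes N. cnj (a W) * complex_of_real (card_fun N W x))"
      by (simp add: lagrange_def a_def)
    moreover have "lagrange N v x = (\<Sum>X\<in>nodes N. a X * complex_of_real (card_fun N X x))"
      by (simp add: lagrange_def a_def)
    ultimately show ?thesis by (simp only: sum_product) (simp add: mult_ac)
  qed
  have "complex_of_real ((L2norm (lagrange N v))\<^sup>2) = (LINT x|lborel. lagrange N v x * cnj (lagrange N v x))"
    unfolding L2norm_power2 integral_complex_of_real[symmetric] complex_norm_square ..
  also have "\<dots> = (\<Sum>X\<in>nodes N. \<Sum>W\<in>nodes N. a X * cnj (a W) * (LINT x|lborel. complex_of_real (card_fun N X x * card_fun N W x)))"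
    unfolding ex using ikc by (simp del: of_real_mult)
  also have "\<dots> = (\<Sum>X\<in>nodes N. \<Sum>W\<in>nodes N. if X = W then 2 * (a X * cnj (a X)) else 0)"
    by (intro sum.cong refl) (simp only: integral_complex_of_real I, simp)
  also have "\<dots> = (\<Sum>X\<in>nodes N. 2 * (a X * cnj (a X)))"
    using finite_nodes by simp
  also have "\<dots> = complex_of_real (\<Sum>X\<in>nodes N. 2 * (cmod (a X))\<^sup>2)"
    unfolding of_real_sum of_real_mult complex_norm_square by simp
  finally have "(L2norm (lagrange N v))\<^sup>2 = (\<Sum>X\<in>nodes N. 2 * (cmod (a X))\<^sup>2)" by (simp only: of_real_eq_iff)
  then show ?thesis by (simp add: a_def norm_divide power_divide)
qed

section \<open>Stability of the interpolation operator\<close>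

lemma node_value_bound:
  assumes v: "L2 v" and v1: "L2 v1" and h: "h > 0"
    and inc: "\<And>a b. a \<le> b \<Longrightarrow> v b - v a = (LINT x|lborel. v1 x * indicator {a<..b} x)"
  shows "(cmod (v X))\<^sup>2 \<le> 2 / h * (LINT x|lborel. indicator {X<..X+h} x * (cmod (v x))\<^sup>2)
     + 2 * h * (LINT x|lborel. indicator {X<..X+h} x * (cmod (v1 x))\<^sup>2)"
proof -
  let ?I = "{X<..X+h}"
  let ?B = "LINT x|lborel. indicator ?I x * (cmod (v1 x))\<^sup>2"
  note [measurable] = L2_measurable[OF v] L2_measurable[OF v1]
  have sI: "?I \<in> sets lborel" by simp
  have iI: "integrable lborel (indicator ?I :: real \<Rightarrow> real)"
    using h by (intro integrable_real_indicator) auto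
  have ind: "L2 (\<lambda>x. indicator {X<..t} x)" "(L2norm (\<lambda>x. indicator {X<..t} x))\<^sup>2 = t - X" if "X \<le> t" for t
  proof -
    have eq: "(\<lambda>x. (cmod (indicator {X<..t} x))\<^sup>2) = indicator {X<..t}" by (auto simp: indicator_def)
    have "integrable lborel (indicator {X<..t} :: real \<Rightarrow> real)"
      using that by (intro integrable_real_indicator) auto
    then show "L2 (\<lambda>x. indicator {X<..t} x)" unfolding L2_def eq by simp
    show "(L2norm (\<lambda>x. indicator {X<..t} x))\<^sup>2 = t - X" unfolding L2norm_power2 eq using that by simp
  qed
  have vI: "L2 (\<lambda>x. v1 x * indicator ?I x)" by (rule L2_indicator[OF v1 sI])
  have nB: "(L2norm (\<lambda>x. v1 x * indicator ?I x))\<^sup>2 = ?B"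
    unfolding L2norm_power2 by (intro Bochner_Integration.integral_cong) (auto simp: indicator_def)
  have iv: "integrable lborel (\<lambda>x. indicator ?I x * (cmod (v x))\<^sup>2)"
    using L2_integrable[OF v] by (rule Bochner_Integration.integrable_bound) (auto simp: indicator_def)
  \<comment> \<open>The node value is compared with nearby values by
    \<open>|v X|^2 <= 2 * |v x|^2 + 2 * |v x - v X|^2\<close>, the increment is bounded by
    Cauchy-Schwarz, and the result is averaged over the interval. A one-sided interval keeps
    neighbouring nodes apart.\<close>
  have pt: "(cmod (v X))\<^sup>2 * indicator ?I x \<le> 2 * (indicator ?I x * (cmod (v x))\<^sup>2) + 2 * h * ?B * indicator ?I x" for x
  proof (cases "x \<in> ?I")
    case True
    then have xX: "X \<le> x" "x - X \<le> h" by auto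
    have "v x - v X = (LINT t|lborel. v1 t * indicator {X<..x} t)" by (rule inc[OF xX(1)])
    also have "\<dots> = (LINT t|lborel. (v1 t * indicator ?I t) * indicator {X<..x} t)"
      using xX by (intro Bochner_Integration.integral_cong) (auto simp: indicator_def)
    finally have "cmod (v x - v X) \<le> L2norm (\<lambda>x. v1 x * indicator ?I x) * L2norm (\<lambda>t. indicator {X<..x} t)"
      using L2_mult_integrable(3)[OF vI ind(1)[OF xX(1)]] by simp
    then have "(cmod (v x - v X))\<^sup>2 \<le> ?B * (x - X)"
      using power_mono[of "cmod (v x - v X)" _ 2] unfolding power_mult_distrib nB[symmetric] ind(2)[OF xX(1), symmetric]
      by (metis norm_ge_zero power_mult_distrib)
    also have "\<dots> \<le> ?B * h" using xX(2) by (intro mult_left_mono) auto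
    finally have d: "(cmod (v x - v X))\<^sup>2 \<le> ?B * h" .
    have "cmod (v X) \<le> cmod (v x) + cmod (v x - v X)" using norm_triangle_sub[of "v X" "v x"] by (simp add: norm_minus_commute)
    then have "(cmod (v X))\<^sup>2 \<le> (cmod (v x) + cmod (v x - v X))\<^sup>2" by (intro power_mono) auto
    also have "\<dots> \<le> 2 * (cmod (v x))\<^sup>2 + 2 * (cmod (v x - v X))\<^sup>2"
      using sum_squares_bound[of "cmod (v x)" "cmod (v x - v X)"] by (simp add: power2_sum)
    also have "\<dots> \<le> 2 * (cmod (v x))\<^sup>2 + 2 * (?B * h)" using d by simp
    finally show ?thesis using True by (simp add: mult_ac)
  qed simp
  have "(LINT x|lborel. (cmod (v X))\<^sup>2 * indicator ?I x) \<le> (LINT x|lborel. 2 * (indicator ?I x * (cmod (v x))\<^sup>2) + 2 * h * ?B * indicator ?I x)"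
    using pt by (intro integral_mono Bochner_Integration.integrable_add integrable_mult_right iI iv)
  also have "\<dots> = (LINT x|lborel. 2 * (indicator ?I x * (cmod (v x))\<^sup>2)) + (LINT x|lborel. 2 * h * ?B * indicator ?I x)"
    by (intro Bochner_Integration.integral_add integrable_mult_right iI iv)
  also have "\<dots> = 2 * (LINT x|lborel. indicator ?I x * (cmod (v x))\<^sup>2) + 2 * h * ?B * h"
    using h by simp
  also have "(LINT x|lborel. (cmod (v X))\<^sup>2 * indicator ?I x) = (cmod (v X))\<^sup>2 * h" using h by simp
  finally have fin: "(cmod (v X))\<^sup>2 * h \<le> 2 * (LINT x|lborel. indicator ?I x * (cmod (v x))\<^sup>2) + 2 * h * ?B * h" .
  have "(cmod (v X))\<^sup>2 \<le> (2 * (LINT x|lborel. indicator ?I x * (cmod (v x))\<^sup>2) + 2 * h * ?B * h) / h"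
    using fin h by (simp only: pos_le_divide_eq)
  also have "\<dots> = 2 / h * (LINT x|lborel. indicator ?I x * (cmod (v x))\<^sup>2) + 2 * h * ?B"
    using h by (simp add: add_divide_distrib)
  finally show ?thesis .
qed

lemma sum_disjoint_integrals_le:
  assumes v: "L2 v" and h: "h > 0" and fin: "finite A"
    and gap: "\<And>a b. a \<in> A \<Longrightarrow> b \<in> A \<Longrightarrow> a < b \<Longrightarrow> h \<le> b - a"
  shows "(\<Sum>X\<in>A. LINT x|lborel. indicator {X<..X+h} x * (cmod (v x))\<^sup>2) \<le> (L2norm v)\<^sup>2"
proof -
  note [measurable] = L2_measurable[OF v]
  have i: "integrable lborel (\<lambda>x. indicator {X<..X+h} x * (cmod (v x))\<^sup>2)" for X
    using L2_integrable[OF v] by (rule Bochner_Integration.integrable_bound) (auto simp: indicator_def)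
  \<comment> \<open>Half-open intervals of length \<open>h\<close> at points at least
    \<open>h\<close> apart are disjoint, so no \<open>x\<close> is counted twice.\<close>
  have le1: "(\<Sum>X\<in>A. indicator {X<..X+h} x :: real) \<le> 1" for x
  proof -
    have "(\<Sum>X\<in>A. indicator {X<..X+h} x :: real) = real (card {X\<in>A. x \<in> {X<..X+h}})"
      using fin by (simp add: indicator_def sum.If_cases Int_def of_bool_def)
    also have "card {X\<in>A. x \<in> {X<..X+h}} \<le> 1"
    proof -
      have "a = b" if "a \<in> {X\<in>A. x \<in> {X<..X+h}}" "b \<in> {X\<in>A. x \<in> {X<..X+h}}" for a b
        using gap[of a b] gap[of b a] that by (cases a b rule: linorder_cases) auto
      then show ?thesis using fin by (simp add: card_le_Suc0_iff_eq)
    qed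
    finally show ?thesis by simp
  qed
  have "(\<Sum>X\<in>A. LINT x|lborel. indicator {X<..X+h} x * (cmod (v x))\<^sup>2) = (LINT x|lborel. (\<Sum>X\<in>A. indicator {X<..X+h} x * (cmod (v x))\<^sup>2))"
    using i by simp
  also have "\<dots> \<le> (LINT x|lborel. (cmod (v x))\<^sup>2)"
  proof (rule integral_mono)
    show "integrable lborel (\<lambda>x. \<Sum>X\<in>A. indicator {X<..X+h} x * (cmod (v x))\<^sup>2)" using i by simp
    show "(\<Sum>X\<in>A. indicator {X<..X+h} x * (cmod (v x))\<^sup>2) \<le> (cmod (v x))\<^sup>2" for x
      using mult_right_mono[OF le1[of x], of "(cmod (v x))\<^sup>2"] unfolding sum_distrib_right by simp
  qed (rule L2_integrable[OF v])
  finally show ?thesis unfolding L2norm_power2 .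
qed

theorem L2norm_lagrange_le:
  assumes v: "L2 v" and v1: "L2 v1" and N: "N \<ge> 1"
    and inc: "\<And>a b. a \<le> b \<Longrightarrow> v b - v a = (LINT x|lborel. v1 x * indicator {a<..b} x)"
  shows "L2norm (lagrange N v) \<le> 30 * (real N powr (1/6) * L2norm v + real N powr (-1/3) * L2norm v1)"
proof -
  define l where "l = 2 * real (Suc N) + 1"
  have l: "l > 0" "real N \<le> l" "l \<le> 5 * real N" using N by (auto simp: l_def)
  \<comment> \<open>The guaranteed gap between nodes. In terms of \<open>m\<close>, the sixth root
    of \<open>N\<close>, it is of order \<open>1 / m ^ 3\<close>, so that \<open>m\<close> is the
    only scale left.\<close>
  define h where "h = 1 / sqrt l"
  have h: "h > 0" using l by (simp add: h_def)
  define m where "m = real N powr (1/6)"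
  have m: "m > 0" using N by (simp add: m_def)
  have m3: "m ^ 3 = sqrt (real N)"
  proof -
    have "m ^ 3 = m powr 3" using m by simp
    also have "\<dots> = real N powr (1/6 * 3)" unfolding m_def powr_powr ..
    finally show ?thesis by (simp add: powr_half_sqrt)
  qed
  have mi: "real N powr (-1/3) = 1 / m\<^sup>2"
  proof -
    have "m\<^sup>2 = m powr 2" using m by simp
    also have "\<dots> = real N powr (1/6 * 2)" unfolding m_def powr_powr ..
    finally have "m\<^sup>2 = real N powr (1/3)" by simp
    moreover have "real N powr (-1/3) = inverse (real N powr (1/3))" using powr_minus[of "real N" "1/3"] by simp
    ultimately show ?thesis by (simp add: inverse_eq_divide)
  qed
  have gap: "h \<le> b - a" if "a \<in> nodes N" "b \<in> nodes N" "a < b" for a b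
    using hermite_fun_zeros_gap[of "Suc N" a b] that unfolding h_def l_def nodes_def by blast
  let ?A = "\<lambda>X. LINT x|lborel. indicator {X<..X+h} x * (cmod (v x))\<^sup>2"
  let ?B = "\<lambda>X. LINT x|lborel. indicator {X<..X+h} x * (cmod (v1 x))\<^sup>2"
  have "(L2norm (lagrange N v))\<^sup>2 \<le> (\<Sum>X\<in>nodes N. 144 / m * (2 / h * ?A X + 2 * h * ?B X))"
    unfolding L2norm_lagrange
  proof (rule sum_mono)
    fix X assume X: "X \<in> nodes N"
    have "m / 72 \<le> (hermite_fun' (Suc N) X)\<^sup>2"
      using hermite_fun_zero_deriv[OF _ N, of X] X unfolding nodes_def m_def by blast
    then have "2 * (cmod (v X))\<^sup>2 / (hermite_fun' (Suc N) X)\<^sup>2 \<le> 2 * (cmod (v X))\<^sup>2 / (m / 72)"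
      using m by (intro divide_left_mono mult_pos_pos) auto
    also have "\<dots> = 144 / m * (cmod (v X))\<^sup>2" by simp
    also have "\<dots> \<le> 144 / m * (2 / h * ?A X + 2 * h * ?B X)"
      using m by (intro mult_left_mono node_value_bound[OF v v1 h inc]) auto
    finally show "2 * (cmod (v X))\<^sup>2 / (hermite_fun' (Suc N) X)\<^sup>2 \<le> 144 / m * (2 / h * ?A X + 2 * h * ?B X)" .
  qed
  also have "\<dots> = 144 / m * (2 / h * (\<Sum>X\<in>nodes N. ?A X) + 2 * h * (\<Sum>X\<in>nodes N. ?B X))"
    by (simp only: sum_distrib_left sum.distrib distrib_left)
  also have "\<dots> \<le> 144 / m * (2 / h * (L2norm v)\<^sup>2 + 2 * h * (L2norm v1)\<^sup>2)"
    using m h sum_disjoint_integrals_le[OF v h finite_nodes gap] sum_disjoint_integrals_le[OF v1 h finite_nodes gap]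
    by (intro mult_left_mono add_mono) auto
  also have "\<dots> \<le> 144 / m * (6 * m ^ 3 * (L2norm v)\<^sup>2 + 2 * (1 / m ^ 3) * (L2norm v1)\<^sup>2)"
  proof -
    have "sqrt l \<le> sqrt (9 * real N)" using l by (intro real_sqrt_le_mono) auto
    also have "\<dots> = 3 * m ^ 3" unfolding m3 by (simp add: real_sqrt_mult)
    finally have a: "2 / h \<le> 6 * m ^ 3" by (simp add: h_def)
    have "m ^ 3 \<le> sqrt l" unfolding m3 using l by simp
    then have b: "2 * h \<le> 2 * (1 / m ^ 3)" unfolding h_def using m l by (intro mult_left_mono divide_left_mono) auto
    show ?thesis using a b m by (intro mult_left_mono add_mono mult_right_mono) auto
  qed
  \<comment> \<open>\<open>144 = 2 * 72\<close> comes from the norm of the Lagrange functions and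
    the slope bound; it is multiplied by 6 and by 2. Finally \<open>30^2 = 900\<close> covers both
    coefficients.\<close>
  also have "\<dots> = 864 * (m * L2norm v)\<^sup>2 + 288 * (1 / m\<^sup>2 * L2norm v1)\<^sup>2"
    using m by (simp add: power_mult_distrib power_divide field_simps eval_nat_numeral)
  also have "\<dots> \<le> (30 * (m * L2norm v + 1 / m\<^sup>2 * L2norm v1))\<^sup>2"
  proof -
    have alg: "864 * p\<^sup>2 + 288 * q\<^sup>2 \<le> (30 * (p + q))\<^sup>2" if "p \<ge> 0" "q \<ge> 0" for p q :: real
      using that by (simp add: power2_eq_square algebra_simps)
    show ?thesis using m by (intro alg) auto
  qed
  finally show ?thesis
    unfolding mi m_def[symmetric] by (rule power2_le_imp_le) (use m in auto)
qed

section \<open>The interpolation operator as a Lagrange sum\<close>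

lemma Pspace_1: "Pspace N 1 = {p. \<exists>\<psi>::complex poly. degree \<psi> \<le> N \<and> p = (\<lambda>x. of_real (exp (- x\<^sup>2 / 2)) * poly \<psi> (of_real x))}"
  by (simp add: Pspace_def)

lemma hsum_in_Pspace: "hsum c N \<in> Pspace N 1"
  using hsum_eq_gaussian_poly[of N c] unfolding Pspace_1 by auto

text \<open>Two candidates differ by a Gaussian times a polynomial of degree at most
  \<open>N\<close> with \<open>N + 1\<close> roots.\<close>

lemma Pspace_unique:
  assumes "p \<in> Pspace N 1" "p' \<in> Pspace N 1" "\<And>x. x \<in> nodes N \<Longrightarrow> p x = p' x"
  shows "p = p'"
proof -
  obtain \<psi> \<psi>' :: "complex poly" where \<psi>: "degree \<psi> \<le> N" "p = (\<lambda>x. of_real (exp (- x\<^sup>2 / 2)) * poly \<psi> (of_real x))"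
    "degree \<psi>' \<le> N" "p' = (\<lambda>x. of_real (exp (- x\<^sup>2 / 2)) * poly \<psi>' (of_real x))"
    using assms(1,2) unfolding Pspace_1 by blast
  have "\<psi> - \<psi>' = 0"
  proof (rule ccontr)
    assume ne: "\<psi> - \<psi>' \<noteq> 0"
    have "complex_of_real ` nodes N \<subseteq> {z. poly (\<psi> - \<psi>') z = 0}"
      using assms(3) unfolding \<psi>(2,4) by auto
    then have "card (complex_of_real ` nodes N) \<le> card {z. poly (\<psi> - \<psi>') z = 0}"
      by (rule card_mono[OF poly_roots_finite[OF ne]])
    also have "\<dots> \<le> degree (\<psi> - \<psi>')" by (rule card_poly_roots_bound[OF ne])
    also have "\<dots> \<le> N" using \<psi>(1,3) by (rule degree_diff_le)
    finally show False by (simp add: card_image inj_on_def card_nodes)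
  qed
  then show ?thesis unfolding \<psi>(2,4) by simp
qed

text \<open>Stated for arbitrary coefficients \<open>c\<close>: the operator reproduces the finite
  Hermite sum and acts on the rest. The projection coefficients give the error splitting, and
  \<open>c = 0\<close> gives the plain Lagrange form used for rescaling.\<close>

theorem interp_eq_lagrange:
  assumes N: "N \<ge> 1"
  shows "interp N 1 u = (\<lambda>x. hsum c N x + lagrange N (\<lambda>x. u x - hsum c N x) x)"
proof -
  let ?v = "\<lambda>x. u x - hsum c N x"
  obtain d where d: "lagrange N ?v = hsum d N" using lagrange_eq_hsum by blast
  let ?p = "\<lambda>x. hsum c N x + lagrange N ?v x"
  have "?p = hsum (\<lambda>n. c n + d n) N"
    unfolding d by (rule ext) (simp add: hsum_def sum.distrib distrib_right)
  then have P: "?p \<in> Pspace N 1" using hsum_in_Pspace by metis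
  have V: "?p x = u x" if "x \<in> nodes N" for x using lagrange_node[OF that N] by simp
  have eq: "(\<forall>x. hermite_fun (Suc N) x = 0 \<longrightarrow> p (x / 1) = u (x / 1)) \<longleftrightarrow> (\<forall>x\<in>nodes N. p x = u x)" for p
    by (auto simp: nodes_def)
  show ?thesis unfolding interp_def eq
  proof (rule the_equality)
    show "?p \<in> Pspace N 1 \<and> (\<forall>x\<in>nodes N. ?p x = u x)" using P V by blast
    fix p assume p: "p \<in> Pspace N 1 \<and> (\<forall>x\<in>nodes N. p x = u x)"
    show "p = ?p" by (rule Pspace_unique[OF _ P]) (use p V in auto)
  qed
qed

subsection \<open>Estimates for scaling factor one\<close>

definition dhsum :: "(nat \<Rightarrow> complex) \<Rightarrow> nat \<Rightarrow> real \<Rightarrow> complex" where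
  "dhsum c K x = (\<Sum>n\<le>K. c n * complex_of_real (hermite_fun' n x))"

lemma hsum_has_vector_derivative: "(hsum c K has_vector_derivative dhsum c K x) (at x)"
proof -
  have "((\<lambda>x. complex_of_real (hermite_fun n x)) has_vector_derivative complex_of_real (hermite_fun' n x)) (at x)" for n
    using DERIV_hermite_fun[of n x] by (intro has_vector_derivative_of_real) (simp add: has_real_derivative_iff_has_vector_derivative)
  then show ?thesis
    unfolding hsum_def[abs_def] dhsum_def herm_def
    by (intro has_vector_derivative_sum has_vector_derivative_mult_right)
qed

text \<open>Hermite coefficients of the derivative of a sum of degree \<open>K\<close>, which has
  degree \<open>K + 1\<close>. The first guard drops coefficients beyond \<open>K\<close>, the
  second excludes the truncated index at \<open>m = 0\<close>.\<close>

definition dcoef :: "(nat \<Rightarrow> complex) \<Rightarrow> nat \<Rightarrow> nat \<Rightarrow> complex" where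
  "dcoef c K m = (if Suc m \<le> K then c (Suc m) * complex_of_real (sqrt (real (Suc m) / 2)) else 0)
     - (if 0 < m \<and> m \<le> Suc K then c (m - 1) * complex_of_real (sqrt (real m / 2)) else 0)"

lemma dhsum_eq_hsum: "dhsum c K = hsum (dcoef c K) (Suc K)"
proof
  fix x
  let ?s = "\<lambda>m. complex_of_real (sqrt (real m / 2))"
  have 1: "(\<Sum>n\<le>K. c n * ?s n * herm (n - 1) x) = (\<Sum>m\<le>Suc K. (if Suc m \<le> K then c (Suc m) * ?s (Suc m) else 0) * herm m x)"
  proof -
    have "(\<Sum>n\<le>K. c n * ?s n * herm (n - 1) x) = (\<Sum>n\<in>{1..K}. c n * ?s n * herm (n - 1) x)"
      by (rule sum.mono_neutral_right) (auto simp: not_le)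
    also have "\<dots> = (\<Sum>m\<in>{m. Suc m \<le> K}. c (Suc m) * ?s (Suc m) * herm m x)"
      by (rule sum.reindex_bij_witness[where i=Suc and j="\<lambda>n. n - 1"]) auto
    also have "\<dots> = (\<Sum>m\<le>Suc K. if Suc m \<le> K then c (Suc m) * ?s (Suc m) * herm m x else 0)"
      by (subst sum.inter_filter[symmetric]) (auto intro!: sum.cong)
    finally show ?thesis by (simp add: if_distrib[of "\<lambda>y. y * herm _ x"] cong: if_cong)
  qed
  have 2: "(\<Sum>n\<le>K. c n * ?s (Suc n) * herm (Suc n) x) = (\<Sum>m\<le>Suc K. (if 0 < m \<and> m \<le> Suc K then c (m - 1) * ?s m else 0) * herm m x)"
    unfolding sum.atMost_Suc_shift by (simp del: of_nat_Suc)
  have "dhsum c K x = (\<Sum>n\<le>K. c n * ?s n * herm (n - 1) x) - (\<Sum>n\<le>K. c n * ?s (Suc n) * herm (Suc n) x)"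
    unfolding dhsum_def hermite_fun'_def herm_def
    by (simp add: sum_subtractf[symmetric] right_diff_distrib mult.assoc del: of_nat_Suc)
  also have "\<dots> = hsum (dcoef c K) (Suc K) x"
    unfolding 1 2 hsum_def dcoef_def by (simp only: left_diff_distrib sum_subtractf)
  finally show "dhsum c K x = hsum (dcoef c K) (Suc K) x" .
qed

lemma L2_dhsum [intro, simp]: "L2 (dhsum c K)"
  unfolding dhsum_eq_hsum by simp

text \<open>The lowered and raised parts are separated by
  \<open>|p - q|^2 <= 2 * |p|^2 + 2 * |q|^2\<close>. Mode \<open>n\<close> then carries the weight
  \<open>2 * (n / 2 + (n + 1) / 2) = 2 * n + 1\<close>.\<close>

lemma L2norm_dhsum_le: "L2norm (dhsum c K) \<le> sqrt (2 * real K + 1) * L2norm (hsum c K)"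
proof -
  let ?s = "\<lambda>m. complex_of_real (sqrt (real m / 2))"
  have s: "(cmod (?s m))\<^sup>2 = real m / 2" for m by (simp only: norm_of_real power2_abs) simp
  define a where "a = (\<lambda>m. if Suc m \<le> K then c (Suc m) * ?s (Suc m) else 0)"
  define b where "b = (\<lambda>m. if 0 < m \<and> m \<le> Suc K then c (m - 1) * ?s m else 0)"
  have le2: "(cmod (p - q))\<^sup>2 \<le> 2 * (cmod p)\<^sup>2 + 2 * (cmod q)\<^sup>2" for p q
  proof -
    have "(cmod (p - q))\<^sup>2 \<le> (cmod p + cmod q)\<^sup>2" by (intro power_mono norm_triangle_ineq4) auto
    also have "\<dots> \<le> 2 * (cmod p)\<^sup>2 + 2 * (cmod q)\<^sup>2"
      using sum_squares_bound[of "cmod p" "cmod q"] by (simp add: power2_sum)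
    finally show ?thesis .
  qed
  have A: "(\<Sum>m\<le>Suc K. (cmod (a m))\<^sup>2) = (\<Sum>n\<le>K. (cmod (c n))\<^sup>2 * (real n / 2))"
  proof -
    have "(\<Sum>m\<le>Suc K. (cmod (a m))\<^sup>2) = (\<Sum>m\<le>Suc K. if Suc m \<le> K then (cmod (c (Suc m)))\<^sup>2 * (real (Suc m) / 2) else 0)"
      by (intro sum.cong refl) (simp add: a_def norm_mult power_mult_distrib s del: of_nat_Suc norm_of_real)
    also have "\<dots> = (\<Sum>m\<in>{m. Suc m \<le> K}. (cmod (c (Suc m)))\<^sup>2 * (real (Suc m) / 2))"
      by (subst sum.inter_filter[symmetric]) (auto intro!: sum.cong)
    also have "\<dots> = (\<Sum>n\<in>{1..K}. (cmod (c n))\<^sup>2 * (real n / 2))"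
      by (rule sum.reindex_bij_witness[where i="\<lambda>n. n - 1" and j=Suc]) auto
    also have "\<dots> = (\<Sum>n\<le>K. (cmod (c n))\<^sup>2 * (real n / 2))"
      by (rule sum.mono_neutral_left) (auto simp: not_le)
    finally show ?thesis .
  qed
  have B: "(\<Sum>m\<le>Suc K. (cmod (b m))\<^sup>2) = (\<Sum>n\<le>K. (cmod (c n))\<^sup>2 * (real (Suc n) / 2))"
    unfolding sum.atMost_Suc_shift
    by (simp add: b_def norm_mult power_mult_distrib s del: of_nat_Suc norm_of_real)
  have "(L2norm (dhsum c K))\<^sup>2 = (\<Sum>m\<le>Suc K. (cmod (a m - b m))\<^sup>2)"
    unfolding dhsum_eq_hsum L2norm_hsum dcoef_def a_def b_def ..
  also have "\<dots> \<le> (\<Sum>m\<le>Suc K. 2 * (cmod (a m))\<^sup>2 + 2 * (cmod (b m))\<^sup>2)"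
    by (intro sum_mono le2)
  also have "\<dots> = 2 * (\<Sum>m\<le>Suc K. (cmod (a m))\<^sup>2) + 2 * (\<Sum>m\<le>Suc K. (cmod (b m))\<^sup>2)"
    by (simp only: sum.distrib sum_distrib_left)
  also have "\<dots> = (\<Sum>n\<le>K. (cmod (c n))\<^sup>2 * (2 * real n + 1))"
    unfolding A B sum_distrib_left sum.distrib[symmetric] by (intro sum.cong refl) (simp add: algebra_simps)
  also have "\<dots> \<le> (\<Sum>n\<le>K. (cmod (c n))\<^sup>2 * (2 * real K + 1))"
    by (intro sum_mono mult_left_mono) auto
  also have "\<dots> = (sqrt (2 * real K + 1) * L2norm (hsum c K))\<^sup>2"
    unfolding power_mult_distrib L2norm_hsum by (simp add: sum_distrib_right[symmetric] mult.commute)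
  finally show ?thesis by (rule power2_le_imp_le) simp
qed

lemma hsum_increment:
  assumes "a \<le> b"
  shows "hsum c K b - hsum c K a = (LINT x|lborel. dhsum c K x * indicator {a<..b} x)"
proof -
  have cont: "continuous_on {a..b} (dhsum c K)"
    unfolding dhsum_def[abs_def] by (intro continuous_intros continuous_hermite_fun)
  have [measurable]: "dhsum c K \<in> borel_measurable lborel" by (rule L2_measurable) simp
  have "hsum c K b - hsum c K a = (LINT x|lborel. indicator {a..b} x *\<^sub>R dhsum c K x)"
    by (rule integral_FTC_atLeastAtMost[symmetric, OF assms has_vector_derivative_at_within[OF hsum_has_vector_derivative] cont])
  also have "\<dots> = (LINT x|lborel. dhsum c K x * indicator {a<..b} x)"
  proof (rule integral_cong_AE)
    show "AE x in lborel. indicator {a..b} x *\<^sub>R dhsum c K x = dhsum c K x * indicator {a<..b} x"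
      \<comment> \<open>The closed and the half-open interval differ only in the point
        \<open>a\<close>.\<close>
      using AE_lborel_singleton[of a] by eventually_elim (auto simp: indicator_def)
  qed measurable
  finally show ?thesis .
qed

section \<open>Projection versus differentiation, for a fixed projection constant
  \<open>C\<close>\<close>

lemma E_err_nonneg: "E_err N \<beta> w \<ge> 0"
  by (simp add: E_err_def)

context
  fixes C :: real and N :: nat
  assumes C: "C \<ge> 1"
    and proj: "\<And>K w. L2 w \<Longrightarrow> Suc K \<ge> N \<Longrightarrow> L2norm (\<lambda>x. w x - hproj K w x) \<le> C * E_err N 1 w"
    and N: "N \<ge> 1"
begin

text \<open>A coefficient beyond the cut is a coefficient of the projection error. For index
  \<open>N\<close> the cut is made at \<open>N - 1\<close>, for \<open>Suc N\<close> at
  \<open>N\<close>.\<close>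

lemma coef_tail_bound:
  assumes w: "L2 w"
  shows "cmod (coef N w) \<le> C * E_err N 1 w" "cmod (coef (Suc N) w) \<le> C * E_err N 1 w"
proof -
  have "cmod (coef N w) = cmod (coef N (\<lambda>x. w x - hproj (N - 1) w x))" using N by (subst coef_minus_hproj_gt[OF w]) simp_all
  also have "\<dots> \<le> L2norm (\<lambda>x. w x - hproj (N - 1) w x)" by (intro cmod_coef_le L2_diff w L2_hproj)
  also have "\<dots> \<le> C * E_err N 1 w" by (rule proj[OF w]) simp
  finally show "cmod (coef N w) \<le> C * E_err N 1 w" .
  have "cmod (coef (Suc N) w) = cmod (coef (Suc N) (\<lambda>x. w x - hproj N w x))" by (subst coef_minus_hproj_gt[OF w]) simp_all
  also have "\<dots> \<le> L2norm (\<lambda>x. w x - hproj N w x)" by (intro cmod_coef_le L2_diff w L2_hproj)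
  also have "\<dots> \<le> C * E_err N 1 w" by (rule proj[OF w]) simp
  finally show "cmod (coef (Suc N) w) \<le> C * E_err N 1 w" .
qed

text \<open>The commutator of differentiation and projection: the projected derivative receives mode
  \<open>N + 1\<close> of \<open>u\<close> at index \<open>N\<close>, and the derivative of the
  projection leaks mode \<open>N\<close> of \<open>u\<close> into index \<open>N + 1\<close>. Both
  carry the same factor.\<close>

definition boundary :: "(real \<Rightarrow> complex) \<Rightarrow> nat \<Rightarrow> complex" where
  "boundary u m = complex_of_real (sqrt (real (Suc N) / 2)) * (if m = N then coef (Suc N) u else if m = Suc N then coef N u else 0)"

lemma coef_weak_deriv:
  assumes "H1 u u1"
  shows "coef m u1 = coef (Suc m) u * complex_of_real (sqrt (real (Suc m) / 2)) - coef (m - 1) u * complex_of_real (sqrt (real m / 2))"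
proof -
  have u: "L2 u" using assms by (simp add: H1_def)
  have i: "complex_integrable lborel (\<lambda>x. herm n x * u x)" for n by (rule L2_mult_integrable[OF L2_herm u])
  have "(LINT x|lborel. u x * complex_of_real (hermite_fun' m x))
    = (LINT x|lborel. complex_of_real (sqrt (real m / 2)) * (herm (m - 1) x * u x) - complex_of_real (sqrt (real (Suc m) / 2)) * (herm (Suc m) x * u x))"
    unfolding hermite_fun'_def herm_def by (intro Bochner_Integration.integral_cong refl) (simp add: algebra_simps del: of_nat_Suc)
  also have "\<dots> = complex_of_real (sqrt (real m / 2)) * coef (m - 1) u - complex_of_real (sqrt (real (Suc m) / 2)) * coef (Suc m) u"
    unfolding coef_def using i by (simp del: of_nat_Suc)
  finally show ?thesis unfolding H1_coef_parts[OF assms] by (simp add: mult.commute del: of_nat_Suc)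
qed

lemma dhsum_coef_eq:
  assumes "H1 u u1"
  shows "dhsum (\<lambda>n. coef n u) N x = hproj N u1 x - hsum (boundary u) (Suc N) x"
proof -
  have "hproj N u1 x = hsum (\<lambda>n. if n \<le> N then coef n u1 else 0) (Suc N) x"
    by (simp add: hproj_def hsum_def)
  moreover have "dcoef (\<lambda>n. coef n u) N m = (if m \<le> N then coef m u1 else 0) - boundary u m" if mle: "m \<le> Suc N" for m
  proof -
    consider "m < N" | "m = N" | "m = Suc N" using mle by linarith
    then show ?thesis
      by cases (auto simp: dcoef_def boundary_def coef_weak_deriv[OF assms] simp del: of_nat_Suc)
  qed
  ultimately show ?thesis
    unfolding dhsum_eq_hsum by (simp add: hsum_def left_diff_distrib sum_subtractf[symmetric] del: sum.atMost_Suc)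
qed

lemma L2norm_boundary:
  assumes u: "L2 u"
  shows "L2norm (hsum (boundary u) (Suc N)) \<le> 2 * sqrt (real N) * (C * E_err N 1 u)"
proof -
  let ?e = "C * E_err N 1 u"
  have e: "?e \<ge> 0" using C E_err_nonneg by simp
  have sq: "(cmod (complex_of_real (sqrt (real (Suc N) / 2))))\<^sup>2 = real (Suc N) / 2" by (simp only: norm_of_real power2_abs) simp
  have "(L2norm (hsum (boundary u) (Suc N)))\<^sup>2 = (cmod (boundary u N))\<^sup>2 + (cmod (boundary u (Suc N)))\<^sup>2"
  proof -
    have "(\<Sum>m\<le>Suc N. (cmod (boundary u m))\<^sup>2) = (\<Sum>m\<in>{N, Suc N}. (cmod (boundary u m))\<^sup>2)"
      by (rule sum.mono_neutral_right) (auto simp: boundary_def)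
    then show ?thesis unfolding L2norm_hsum by simp
  qed
  also have "\<dots> = real (Suc N) / 2 * ((cmod (coef (Suc N) u))\<^sup>2 + (cmod (coef N u))\<^sup>2)"
    unfolding boundary_def norm_mult power_mult_distrib sq by (simp add: distrib_left)
  \<comment> \<open>For \<open>N >= 1\<close> the factor \<open>(N + 1) / 2\<close> is at most
    \<open>N\<close>.\<close>
  also have "\<dots> \<le> real N * (?e\<^sup>2 + ?e\<^sup>2)"
    using N e by (intro mult_mono add_mono power_mono coef_tail_bound[OF u]) auto
  also have "\<dots> \<le> (2 * sqrt (real N) * ?e)\<^sup>2" by (simp add: power_mult_distrib)
  finally show ?thesis by (rule power2_le_imp_le) (use e in simp)
qed

lemma first_derivative_bound:
  assumes "H1 u u1"
  shows "L2norm (\<lambda>x. u1 x - dhsum (\<lambda>n. coef n u) N x) \<le> C * E_err N 1 u1 + 2 * sqrt (real N) * (C * E_err N 1 u)"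
proof -
  have u: "L2 u" "L2 u1" using assms by (auto simp: H1_def)
  have "L2norm (\<lambda>x. u1 x - dhsum (\<lambda>n. coef n u) N x) = L2norm (\<lambda>x. (u1 x - hproj N u1 x) + hsum (boundary u) (Suc N) x)"
    unfolding dhsum_coef_eq[OF assms] by (intro arg_cong[where f=L2norm] ext) simp
  also have "\<dots> \<le> L2norm (\<lambda>x. u1 x - hproj N u1 x) + L2norm (hsum (boundary u) (Suc N))"
    by (intro L2norm_triangle L2_diff u L2_hproj L2_hsum)
  also have "\<dots> \<le> C * E_err N 1 u1 + 2 * sqrt (real N) * (C * E_err N 1 u)"
    by (intro add_mono proj u L2norm_boundary) simp
  finally show ?thesis .
qed

lemma dhsum_has_vector_derivative: "(dhsum c K has_vector_derivative dhsum (dcoef c K) (Suc K) x) (at x)"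
  unfolding dhsum_eq_hsum[of c K] by (rule hsum_has_vector_derivative)

text \<open>The commutator identity is differentiated once more, so the error is the
  first-derivative error of \<open>u1\<close> plus the derivative of the commutator term, to which
  the inverse inequality applies.\<close>

lemma second_derivative_bound:
  assumes h: "H1 u u1" and h1: "H1 u1 u2"
  shows "L2norm (\<lambda>x. u2 x - dhsum (dcoef (\<lambda>n. coef n u) N) (Suc N) x)
    \<le> C * E_err N 1 u2 + 2 * sqrt (real N) * (C * E_err N 1 u1) + 5 * real N * (C * E_err N 1 u)"
proof -
  have u: "L2 u" "L2 u1" "L2 u2" using h h1 by (auto simp: H1_def)
  have eq: "dhsum (dcoef (\<lambda>n. coef n u) N) (Suc N) x = dhsum (\<lambda>n. coef n u1) N x - dhsum (boundary u) (Suc N) x" for x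
  proof -
    have "(dhsum (\<lambda>n. coef n u) N has_vector_derivative dhsum (\<lambda>n. coef n u1) N x - dhsum (boundary u) (Suc N) x) (at x)"
      unfolding dhsum_coef_eq[OF h] hproj_def by (intro has_vector_derivative_diff hsum_has_vector_derivative)
    then show ?thesis using vector_derivative_at dhsum_has_vector_derivative by metis
  qed
  have "L2norm (\<lambda>x. u2 x - dhsum (dcoef (\<lambda>n. coef n u) N) (Suc N) x) = L2norm (\<lambda>x. (u2 x - dhsum (\<lambda>n. coef n u1) N x) + dhsum (boundary u) (Suc N) x)"
    unfolding eq by (intro arg_cong[where f=L2norm] ext) simp
  also have "\<dots> \<le> L2norm (\<lambda>x. u2 x - dhsum (\<lambda>n. coef n u1) N x) + L2norm (dhsum (boundary u) (Suc N))"
    by (intro L2norm_triangle L2_diff u L2_dhsum)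
  also have "\<dots> \<le> (C * E_err N 1 u2 + 2 * sqrt (real N) * (C * E_err N 1 u1)) + 5 * real N * (C * E_err N 1 u)"
  proof (rule add_mono[OF first_derivative_bound[OF h1]])
    let ?e = "C * E_err N 1 u"
    have e: "?e \<ge> 0" using C E_err_nonneg by simp
    have "L2norm (dhsum (boundary u) (Suc N)) \<le> sqrt (2 * real (Suc N) + 1) * L2norm (hsum (boundary u) (Suc N))"
      by (rule L2norm_dhsum_le)
    \<comment> \<open>For \<open>N >= 1\<close> one has \<open>2 * N + 3 <= 25 / 4 * N\<close>, a
      bound with a rational root.\<close>
    also have "\<dots> \<le> sqrt (25 / 4 * real N) * (2 * sqrt (real N) * ?e)"
      using N by (intro mult_mono real_sqrt_le_mono L2norm_boundary u) auto
    also have "sqrt (25 / 4 * real N) = 5 / 2 * sqrt (real N)" by (simp add: real_sqrt_mult real_sqrt_divide)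
    also have "5 / 2 * sqrt (real N) * (2 * sqrt (real N) * ?e) = 5 * (sqrt (real N) * sqrt (real N)) * ?e" by simp
    also have "\<dots> = 5 * real N * ?e" by simp
    finally show "L2norm (dhsum (boundary u) (Suc N)) \<le> 5 * real N * ?e" .
  qed
  finally show ?thesis by simp
qed

text \<open>The correction is the interpolant of the projection error. Its derivative brings a term
  with \<open>sqrt N\<close>, and \<open>N^(-1/3) * sqrt N = N^(1/6)\<close> merges it with the
  first one, whence the factor 3.\<close>

lemma interpolation_correction:
  assumes h: "H1 u u1"
  obtains d where "interp N 1 u = (\<lambda>x. hproj N u x + hsum d N x)"
    and "L2norm (hsum d N) \<le> 30 * C * (3 * real N powr (1/6) * E_err N 1 u + real N powr (-1/3) * E_err N 1 u1)"
proof -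
  have u: "L2 u" "L2 u1" using h by (auto simp: H1_def)
  let ?v = "\<lambda>x. u x - hproj N u x" and ?v1 = "\<lambda>x. u1 x - dhsum (\<lambda>n. coef n u) N x"
  have v: "L2 ?v" "L2 ?v1" using u by auto
  obtain d where d: "lagrange N ?v = hsum d N" using lagrange_eq_hsum by blast
  have I: "interp N 1 u = (\<lambda>x. hproj N u x + hsum d N x)"
    using interp_eq_lagrange[OF N, of u "\<lambda>n. coef n u"] d unfolding hproj_def by simp
  have inc: "?v b - ?v a = (LINT x|lborel. ?v1 x * indicator {a<..b} x)" if ab: "a \<le> b" for a b
  proof -
    have ii: "complex_integrable lborel (\<lambda>x. w x * indicator {a<..b} x)" if w: "L2 w" for w
    proof -
      note [measurable] = L2_measurable[OF w]
      show ?thesis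
        by (rule Bochner_Integration.integrable_bound[OF L2_truncated(2)[OF w, of "\<bar>a\<bar> + \<bar>b\<bar>"]])
          (measurable, auto simp: indicator_def)
    qed
    have "?v b - ?v a = (u b - u a) - (hsum (\<lambda>n. coef n u) N b - hsum (\<lambda>n. coef n u) N a)"
      by (simp add: hproj_def)
    also have "\<dots> = (LINT x|lborel. u1 x * indicator {a<..b} x) - (LINT x|lborel. dhsum (\<lambda>n. coef n u) N x * indicator {a<..b} x)"
      unfolding H1_increment[OF h ab] hsum_increment[OF ab] ..
    also have "\<dots> = (LINT x|lborel. ?v1 x * indicator {a<..b} x)"
      using ii[OF u(2)] ii[OF L2_dhsum] by (simp add: left_diff_distrib)
    finally show ?thesis .
  qed
  let ?m = "real N powr (1/6)" and ?k = "real N powr (-1/3)"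
  have mk: "?k * sqrt (real N) = ?m"
    using N by (simp add: powr_half_sqrt[symmetric] powr_add[symmetric])
  have "L2norm (hsum d N) \<le> 30 * (?m * L2norm ?v + ?k * L2norm ?v1)"
    unfolding d[symmetric] by (rule L2norm_lagrange_le[OF v N inc])
  also have "\<dots> \<le> 30 * (?m * (C * E_err N 1 u) + ?k * (C * E_err N 1 u1 + 2 * sqrt (real N) * (C * E_err N 1 u)))"
    by (intro mult_left_mono add_mono proj u first_derivative_bound h) auto
  also have "\<dots> = 30 * (?m * (C * E_err N 1 u) + ?k * (C * E_err N 1 u1) + 2 * (?k * sqrt (real N)) * (C * E_err N 1 u))"
    by (simp add: distrib_left)
  also have "\<dots> = 30 * C * (3 * ?m * E_err N 1 u + ?k * E_err N 1 u1)"
    unfolding mk by (simp add: algebra_simps)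
  finally show ?thesis using that[of d] I by blast
qed

section \<open>The three error estimates\<close>

lemma powr_identities:
  "real N powr (1/6) \<ge> 1" "sqrt (real N) * real N powr (1/6) = real N powr (2/3)" "sqrt (real N) * real N powr (-1/3) = real N powr (1/6)"
  "real N * real N powr (1/6) = real N powr (7/6)" "real N * real N powr (-1/3) = real N powr (2/3)"
  "real N \<le> real N powr (7/6)" "sqrt (real N) \<le> real N powr (2/3)"
proof -
  have n: "real N \<ge> 1" using N by simp
  have s: "sqrt (real N) = real N powr (1/2)" by (simp add: powr_half_sqrt)
  have o: "real N = real N powr 1" using N by simp
  show "real N powr (1/6) \<ge> 1" by (rule ge_one_powr_ge_zero[OF n]) simp
  show "sqrt (real N) * real N powr (1/6) = real N powr (2/3)" "sqrt (real N) * real N powr (-1/3) = real N powr (1/6)"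
    unfolding s powr_add[symmetric] by simp_all
  show "real N * real N powr (1/6) = real N powr (7/6)"
    using powr_add[of "real N" 1 "1/6"] N by simp
  show "real N * real N powr (-1/3) = real N powr (2/3)"
    using powr_add[of "real N" 1 "-1/3"] N by simp
  show "real N \<le> real N powr (7/6)" using powr_mono[of 1 "7/6" "real N"] n by simp
  show "sqrt (real N) \<le> real N powr (2/3)" unfolding s using n by (intro powr_mono) auto
qed

text \<open>The largest numerical coefficient in the three estimates is 365; 400 is a common upper
  bound.\<close>

lemma estimate_0:
  assumes h: "H1 u u1"
  shows "L2norm (\<lambda>x. u x - interp N 1 u x) \<le> 400 * C * (real N powr (-1/3) * E_err N 1 u1 + real N powr (1/6) * E_err N 1 u)"
proof -
  have u: "L2 u" "L2 u1" using h by (auto simp: H1_def)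
  define e0 e1 where "e0 = E_err N 1 u" and "e1 = E_err N 1 u1"
  define m k where "m = real N powr (1/6)" and "k = real N powr (-1/3)"
  have pos: "e0 \<ge> 0" "e1 \<ge> 0" "m \<ge> 1" "k \<ge> 0" using powr_identities E_err_nonneg by (auto simp: e0_def e1_def m_def k_def)
  obtain d where I: "interp N 1 u = (\<lambda>x. hproj N u x + hsum d N x)" and d: "L2norm (hsum d N) \<le> 30 * C * (3 * m * e0 + k * e1)"
    using interpolation_correction[OF h] unfolding m_def k_def e0_def e1_def by metis
  have "L2norm (\<lambda>x. u x - interp N 1 u x) = L2norm (\<lambda>x. (u x - hproj N u x) - hsum d N x)"
    unfolding I by (intro arg_cong[where f=L2norm] ext) simp
  also have "\<dots> \<le> L2norm (\<lambda>x. u x - hproj N u x) + L2norm (hsum d N)"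
    by (intro L2norm_triangle_diff L2_diff u L2_hproj L2_hsum)
  also have "\<dots> \<le> C * e0 + 30 * C * (3 * m * e0 + k * e1)"
    using proj[OF u(1), of N] d by (simp add: e0_def)
  also have "\<dots> \<le> C * (m * e0) + 30 * C * (3 * m * e0 + k * e1)"
    using pos C mult_right_mono[of 1 m e0] by (intro add_right_mono mult_left_mono) auto
  also have "\<dots> = C * (91 * (m * e0) + 30 * (k * e1))" by (simp add: algebra_simps)
  also have "\<dots> \<le> C * (400 * (m * e0) + 400 * (k * e1))"
    using pos C by (intro mult_left_mono add_mono mult_right_mono) auto
  finally show ?thesis by (simp add: algebra_simps e0_def e1_def m_def k_def)
qed

text \<open>One inverse inequality on the correction costs \<open>sqrt N\<close>, which lifts
  N^(1/6) to N^(2/3) and N^(-1/3) to N^(1/6); these dominate the projection part.\<close>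

lemma estimate_1:
  assumes h: "H1 u u1"
  shows "L2norm (\<lambda>x. u1 x - vector_derivative (interp N 1 u) (at x)) \<le> 400 * C * (real N powr (1/6) * E_err N 1 u1 + real N powr (2/3) * E_err N 1 u)"
proof -
  have u: "L2 u" "L2 u1" using h by (auto simp: H1_def)
  define e0 e1 where "e0 = E_err N 1 u" and "e1 = E_err N 1 u1"
  define m k s where "m = real N powr (1/6)" and "k = real N powr (-1/3)" and "s = sqrt (real N)"
  define M where "M = real N powr (2/3)"
  have pos: "e0 \<ge> 0" "e1 \<ge> 0" "m \<ge> 1" "k \<ge> 0" "s \<ge> 0" and id: "s * m = M" "s * k = m" "s \<le> M"
    using powr_identities E_err_nonneg by (auto simp: e0_def e1_def m_def k_def s_def M_def)
  obtain d where I: "interp N 1 u = (\<lambda>x. hproj N u x + hsum d N x)" and d: "L2norm (hsum d N) \<le> 30 * C * (3 * m * e0 + k * e1)"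
    using interpolation_correction[OF h] unfolding m_def k_def e0_def e1_def by metis
  have vd: "vector_derivative (interp N 1 u) (at x) = dhsum (\<lambda>n. coef n u) N x + dhsum d N x" for x
    unfolding I hproj_def by (intro vector_derivative_at has_vector_derivative_add hsum_has_vector_derivative)
  have "L2norm (\<lambda>x. u1 x - vector_derivative (interp N 1 u) (at x)) = L2norm (\<lambda>x. (u1 x - dhsum (\<lambda>n. coef n u) N x) - dhsum d N x)"
    unfolding vd by (intro arg_cong[where f=L2norm] ext) simp
  also have "\<dots> \<le> L2norm (\<lambda>x. u1 x - dhsum (\<lambda>n. coef n u) N x) + L2norm (dhsum d N)"
    by (intro L2norm_triangle_diff L2_diff u L2_dhsum)
  also have "\<dots> \<le> (C * e1 + 2 * s * (C * e0)) + 2 * s * (30 * C * (3 * m * e0 + k * e1))"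
  proof (rule add_mono)
    show "L2norm (\<lambda>x. u1 x - dhsum (\<lambda>n. coef n u) N x) \<le> C * e1 + 2 * s * (C * e0)"
      using first_derivative_bound[OF h] by (simp add: e0_def e1_def s_def)
    have "sqrt (2 * real N + 1) \<le> sqrt (4 * real N)" using N by (intro real_sqrt_le_mono) auto
    then have "sqrt (2 * real N + 1) \<le> 2 * s" by (simp add: s_def real_sqrt_mult)
    then have "sqrt (2 * real N + 1) * L2norm (hsum d N) \<le> 2 * s * (30 * C * (3 * m * e0 + k * e1))"
      using d pos by (intro mult_mono) auto
    then show "L2norm (dhsum d N) \<le> 2 * s * (30 * C * (3 * m * e0 + k * e1))" using L2norm_dhsum_le[of d N] by linarith
  qed
  also have "\<dots> = C * (e1 + 2 * (s * e0) + 180 * ((s * m) * e0) + 60 * ((s * k) * e1))"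
    by (simp add: algebra_simps)
  also have "\<dots> \<le> C * (m * e1 + 2 * (M * e0) + 180 * (M * e0) + 60 * (m * e1))"
    using pos id C mult_right_mono[of 1 m e1] mult_right_mono[of s M e0] by (intro mult_left_mono add_mono) auto
  also have "\<dots> = C * (61 * (m * e1) + 182 * (M * e0))" by (simp add: algebra_simps)
  also have "\<dots> \<le> C * (400 * (m * e1) + 400 * (M * e0))"
    using pos C by (intro mult_left_mono add_mono mult_right_mono) (auto simp: M_def)
  finally show ?thesis by (simp add: algebra_simps e0_def e1_def m_def M_def)
qed

text \<open>Two inverse inequalities cost a factor \<open>N\<close> on the correction. The term with
  \<open>u2\<close> comes from the projection alone and so carries no power of
  \<open>N\<close>.\<close>

lemma estimate_2:
  assumes h: "H1 u u1" and h1: "H1 u1 u2"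
  shows "L2norm (\<lambda>x. u2 x - vector_derivative (\<lambda>y. vector_derivative (interp N 1 u) (at y)) (at x))
    \<le> 400 * C * (E_err N 1 u2 + real N powr (2/3) * E_err N 1 u1 + real N powr (7/6) * E_err N 1 u)"
proof -
  have u: "L2 u" "L2 u1" "L2 u2" using h h1 by (auto simp: H1_def)
  define e0 e1 e2 where "e0 = E_err N 1 u" and "e1 = E_err N 1 u1" and "e2 = E_err N 1 u2"
  define m k s where "m = real N powr (1/6)" and "k = real N powr (-1/3)" and "s = sqrt (real N)"
  define M P n where "M = real N powr (2/3)" and "P = real N powr (7/6)" and "n = real N"
  have pos: "e0 \<ge> 0" "e1 \<ge> 0" "e2 \<ge> 0" "m \<ge> 1" "k \<ge> 0" "s \<ge> 0" "n \<ge> 0" "M \<ge> 0" "P \<ge> 0" and id: "n * m = P" "n * k = M" "s \<le> M" "n \<le> P"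
    using powr_identities E_err_nonneg by (auto simp: e0_def e1_def e2_def m_def k_def s_def M_def P_def n_def)
  obtain d where I: "interp N 1 u = (\<lambda>x. hproj N u x + hsum d N x)" and d: "L2norm (hsum d N) \<le> 30 * C * (3 * m * e0 + k * e1)"
    using interpolation_correction[OF h] unfolding m_def k_def e0_def e1_def by metis
  have vd: "vector_derivative (interp N 1 u) (at x) = dhsum (\<lambda>n. coef n u) N x + dhsum d N x" for x
    unfolding I hproj_def by (intro vector_derivative_at has_vector_derivative_add hsum_has_vector_derivative)
  have vd2: "vector_derivative (\<lambda>y. vector_derivative (interp N 1 u) (at y)) (at x) = dhsum (dcoef (\<lambda>n. coef n u) N) (Suc N) x + dhsum (dcoef d N) (Suc N) x" for x
    unfolding vd by (intro vector_derivative_at has_vector_derivative_add dhsum_has_vector_derivative)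
  have "L2norm (\<lambda>x. u2 x - vector_derivative (\<lambda>y. vector_derivative (interp N 1 u) (at y)) (at x))
     = L2norm (\<lambda>x. (u2 x - dhsum (dcoef (\<lambda>n. coef n u) N) (Suc N) x) - dhsum (dcoef d N) (Suc N) x)"
    unfolding vd2 by (intro arg_cong[where f=L2norm] ext) simp
  also have "\<dots> \<le> L2norm (\<lambda>x. u2 x - dhsum (dcoef (\<lambda>n. coef n u) N) (Suc N) x) + L2norm (dhsum (dcoef d N) (Suc N))"
    by (intro L2norm_triangle_diff L2_diff u L2_dhsum)
  also have "\<dots> \<le> (C * e2 + 2 * s * (C * e1) + 5 * n * (C * e0)) + 4 * n * (30 * C * (3 * m * e0 + k * e1))"
  proof (rule add_mono)
    show "L2norm (\<lambda>x. u2 x - dhsum (dcoef (\<lambda>n. coef n u) N) (Suc N) x) \<le> C * e2 + 2 * s * (C * e1) + 5 * n * (C * e0)"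
      using second_derivative_bound[OF h h1] by (simp add: e0_def e1_def e2_def s_def n_def)
    have "L2norm (dhsum (dcoef d N) (Suc N)) \<le> sqrt (2 * real (Suc N) + 1) * L2norm (dhsum d N)"
      unfolding dhsum_eq_hsum[of d N] by (rule L2norm_dhsum_le)
    also have "\<dots> \<le> sqrt (2 * real (Suc N) + 1) * (sqrt (2 * real N + 1) * L2norm (hsum d N))"
      by (intro mult_left_mono L2norm_dhsum_le) simp
    also have "\<dots> = sqrt ((2 * real (Suc N) + 1) * (2 * real N + 1)) * L2norm (hsum d N)"
      by (simp add: real_sqrt_mult)
    \<comment> \<open>\<open>(2 * N + 3) * (2 * N + 1) <= 15 * N^2 <= (4 * N)^2\<close> for
      \<open>N >= 1\<close>.\<close>
    also have "\<dots> \<le> 4 * n * L2norm (hsum d N)"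
    proof (rule mult_right_mono)
      have "(2 * real (Suc N) + 1) * (2 * real N + 1) \<le> (5 * real N) * (3 * real N)"
        using N by (intro mult_mono) auto
      also have "\<dots> \<le> (4 * n)\<^sup>2" by (simp add: n_def power2_eq_square)
      finally show "sqrt ((2 * real (Suc N) + 1) * (2 * real N + 1)) \<le> 4 * n"
        using pos by (intro real_le_lsqrt) auto
    qed simp
    also have "\<dots> \<le> 4 * n * (30 * C * (3 * m * e0 + k * e1))"
      using d pos by (intro mult_left_mono) auto
    finally show "L2norm (dhsum (dcoef d N) (Suc N)) \<le> 4 * n * (30 * C * (3 * m * e0 + k * e1))" .
  qed
  also have "\<dots> = C * (e2 + 2 * (s * e1) + 5 * (n * e0) + 360 * ((n * m) * e0) + 120 * ((n * k) * e1))"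
    by (simp add: algebra_simps)
  also have "\<dots> \<le> C * (e2 + 2 * (M * e1) + 5 * (P * e0) + 360 * (P * e0) + 120 * (M * e1))"
    using pos id C mult_right_mono[of s M e1] mult_right_mono[of n P e0] by (intro mult_left_mono add_mono) auto
  also have "\<dots> = C * (1 * e2 + 122 * (M * e1) + 365 * (P * e0))" by (simp add: algebra_simps)
  also have "\<dots> \<le> C * (400 * e2 + 400 * (M * e1) + 400 * (P * e0))"
    using pos C by (intro mult_left_mono add_mono mult_right_mono) auto
  finally show ?thesis by (simp add: algebra_simps e0_def e1_def e2_def M_def P_def)
qed

end

subsection \<open>Rescaling\<close>

lemma lborel_integral_scale:
  fixes f :: "real \<Rightarrow> 'a::{banach, second_countable_topology}"
  assumes "\<beta> > 0"
  shows "(LINT x|lborel. f (\<beta> * x)) = (1 / \<beta>) *\<^sub>R (LINT x|lborel. f x)"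
  using lborel_integral_real_affine[of \<beta> f 0] assms by simp

lemma L2_scale: "\<beta> > 0 \<Longrightarrow> L2 f \<Longrightarrow> L2 (\<lambda>x. f (\<beta> * x))"
  using lborel_integrable_real_affine_iff[of \<beta> "\<lambda>x. (cmod (f x))\<^sup>2" 0] by (auto simp: L2_def)

lemma L2norm_scale: "\<beta> > 0 \<Longrightarrow> L2norm (\<lambda>x. f (\<beta> * x)) = L2norm f / sqrt \<beta>"
  unfolding L2norm_def using lborel_integral_scale[of \<beta> "\<lambda>x. (cmod (f x))\<^sup>2"]
  by (simp add: real_sqrt_divide)

text \<open>The prefactor is carried along because the derivative of a dilation is a dilation with
  prefactor \<open>c / \<beta>\<close>.\<close>

definition dilate :: "complex \<Rightarrow> real \<Rightarrow> (real \<Rightarrow> complex) \<Rightarrow> real \<Rightarrow> complex" where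
  "dilate c \<beta> w x = c * w (x / \<beta>)"

lemma L2_dilate: "\<beta> > 0 \<Longrightarrow> L2 w \<Longrightarrow> L2 (dilate c \<beta> w)"
  unfolding dilate_def[abs_def] using L2_cmult[OF L2_scale[of "1 / \<beta>" w]] by simp

lemma L2norm_dilate: "\<beta> > 0 \<Longrightarrow> L2norm (dilate c \<beta> w) = cmod c * sqrt \<beta> * L2norm w"
  unfolding dilate_def[abs_def] L2norm_cmult using L2norm_scale[of "1 / \<beta>" w]
  by (simp add: real_sqrt_divide)

lemma fourier_trunc_dilate:
  assumes b: "\<beta> > 0"
  shows "fourier_trunc R (dilate c \<beta> w) k = c * complex_of_real \<beta> * fourier_trunc (R / \<beta>) w (\<beta> * k)"
proof -
  have "(LINT x|lborel. dilate c \<beta> w x * indicator {-R..R} x * iexp (- k * x))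
     = \<beta> *\<^sub>R (LINT x|lborel. dilate c \<beta> w (\<beta> * x) * indicator {-R..R} (\<beta> * x) * iexp (- k * (\<beta> * x)))"
    using lborel_integral_scale[OF b, of "\<lambda>x. dilate c \<beta> w x * indicator {-R..R} x * iexp (- k * x)"] b
    by (simp only: scaleR_scaleR) simp
  also have "(\<lambda>x. dilate c \<beta> w (\<beta> * x) * indicator {-R..R} (\<beta> * x) * iexp (- k * (\<beta> * x)))
     = (\<lambda>x. c * (w x * indicator {-(R/\<beta>)..R/\<beta>} x * iexp (- (\<beta> * k) * x)))"
  proof
    fix x
    have "indicator {-R..R} (\<beta> * x) = (indicator {-(R/\<beta>)..R/\<beta>} x :: complex)"
      using b by (auto simp: indicator_def field_simps)
    moreover have "- k * (\<beta> * x) = - (\<beta> * k) * x" by simp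
    ultimately show "dilate c \<beta> w (\<beta> * x) * indicator {-R..R} (\<beta> * x) * iexp (- k * (\<beta> * x)) = c * (w x * indicator {-(R/\<beta>)..R/\<beta>} x * iexp (- (\<beta> * k) * x))"
      using b by (simp only: dilate_def mult.assoc nonzero_mult_div_cancel_left[OF less_imp_neq[OF b, symmetric]])
  qed
  also have "(LINT x|lborel. c * (w x * indicator {-(R/\<beta>)..R/\<beta>} x * iexp (- (\<beta> * k) * x)))
      = c * (LINT x|lborel. w x * indicator {-(R/\<beta>)..R/\<beta>} x * iexp (- (\<beta> * k) * x))"
    by (rule integral_mult_right_zero)
  finally show ?thesis
    unfolding fourier_trunc_eq_ft ft_def by (simp only: scaleR_conv_of_real mult_ac)
qed

text \<open>Stated as a vanishing norm, since \<open>fourier\<close> is determined only up to null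
  sets. The truncations obey the scaling law exactly, with radius \<open>R / \<beta>\<close>, and
  both sides are limits of them.\<close>

lemma fourier_dilate:
  assumes b: "\<beta> > 0" and w: "L2 w"
  shows "L2norm (\<lambda>k. fourier (dilate c \<beta> w) k - c * complex_of_real \<beta> * fourier w (\<beta> * k)) = 0"
proof -
  have L: "L2 (dilate c \<beta> w)" by (rule L2_dilate[OF b w])
  let ?W = "fourier w" and ?V = "fourier (dilate c \<beta> w)"
  let ?T = "\<lambda>R. fourier_trunc R (dilate c \<beta> w)"
  let ?D = "L2norm (\<lambda>k. ?V k - c * complex_of_real \<beta> * ?W (\<beta> * k))"
  have LT: "L2 (fourier_trunc R u)" if "L2 u" for R u
    unfolding fourier_trunc_eq_ft by (rule plancherel(2)[OF L2_truncated(2)[OF that] L2_truncated(1)[OF that]])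
  have LW: "L2 (\<lambda>k. c * complex_of_real \<beta> * ?W (\<beta> * k))" by (intro L2_cmult L2_scale b fourier_spec(1) w)
  have LV: "L2 ?V" by (rule fourier_spec(1)[OF L])
  have eq: "L2norm (\<lambda>k. ?T R k - c * complex_of_real \<beta> * ?W (\<beta> * k)) = cmod c * sqrt \<beta> * L2norm (\<lambda>k. ?W k - fourier_trunc (R / \<beta>) w k)" for R
  proof -
    have "L2norm (\<lambda>k. ?T R k - c * complex_of_real \<beta> * ?W (\<beta> * k)) = L2norm (\<lambda>k. (- c * complex_of_real \<beta>) * (?W (\<beta> * k) - fourier_trunc (R / \<beta>) w (\<beta> * k)))"
      unfolding fourier_trunc_dilate[OF b] by (intro arg_cong[where f=L2norm] ext) (simp add: algebra_simps)
    also have "\<dots> = cmod (- c * complex_of_real \<beta>) * (L2norm (\<lambda>k. ?W k - fourier_trunc (R / \<beta>) w k) / sqrt \<beta>)"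
      unfolding L2norm_cmult L2norm_scale[OF b, of "\<lambda>k. ?W k - fourier_trunc (R / \<beta>) w k", symmetric] ..
    also have "\<dots> = cmod c * (\<beta> / sqrt \<beta>) * L2norm (\<lambda>k. ?W k - fourier_trunc (R / \<beta>) w k)"
      using b by (simp add: norm_mult)
    also have "\<beta> / sqrt \<beta> = sqrt \<beta>" using b by (simp add: real_div_sqrt)
    finally show ?thesis .
  qed
  have "filterlim (\<lambda>R::real. R / \<beta>) at_top at_top"
    using filterlim_tendsto_pos_mult_at_top[OF tendsto_const[of "1 / \<beta>"] _ filterlim_ident] b by simp
  then have 1: "((\<lambda>R. L2norm (\<lambda>k. ?W k - fourier_trunc (R / \<beta>) w k)) \<longlongrightarrow> 0) at_top"
    by (rule filterlim_compose[OF fourier_spec(2)[OF w]])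
  have "((\<lambda>R. L2norm (\<lambda>k. ?V k - ?T R k) + cmod c * sqrt \<beta> * L2norm (\<lambda>k. ?W k - fourier_trunc (R / \<beta>) w k)) \<longlongrightarrow> 0 + cmod c * sqrt \<beta> * 0) at_top"
    by (intro tendsto_add tendsto_mult_left fourier_spec(2)[OF L] 1)
  then have lim: "((\<lambda>R. L2norm (\<lambda>k. ?V k - ?T R k) + cmod c * sqrt \<beta> * L2norm (\<lambda>k. ?W k - fourier_trunc (R / \<beta>) w k)) \<longlongrightarrow> 0) at_top"
    by simp
  have "?D \<le> 0"
  proof (rule tendsto_lowerbound[OF lim])
    show "\<forall>\<^sub>F R in at_top. ?D \<le> L2norm (\<lambda>k. ?V k - ?T R k) + cmod c * sqrt \<beta> * L2norm (\<lambda>k. ?W k - fourier_trunc (R / \<beta>) w k)"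
    proof (intro always_eventually allI)
      fix R
      have "?D = L2norm (\<lambda>k. (?V k - ?T R k) + (?T R k - c * complex_of_real \<beta> * ?W (\<beta> * k)))" by simp
      also have "\<dots> \<le> L2norm (\<lambda>k. ?V k - ?T R k) + L2norm (\<lambda>k. ?T R k - c * complex_of_real \<beta> * ?W (\<beta> * k))"
        by (intro L2norm_triangle L2_diff LV LW LT[OF L])
      finally show "?D \<le> L2norm (\<lambda>k. ?V k - ?T R k) + cmod c * sqrt \<beta> * L2norm (\<lambda>k. ?W k - fourier_trunc (R / \<beta>) w k)"
        unfolding eq .
    qed
  qed simp
  then show ?thesis using L2norm_nonneg by (intro antisym)
qed

text \<open>Makes the tail norms in \<open>E_err\<close> independent of the representative chosen by
  \<open>fourier\<close>.\<close>

lemma L2norm_eq_indicator: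
  assumes f: "L2 f" and g: "L2 g" and 0: "L2norm (\<lambda>x. f x - g x) = 0" and A: "A \<in> sets lborel"
  shows "L2norm (\<lambda>x. f x * indicator A x) = L2norm (\<lambda>x. g x * indicator A x)"
proof -
  have z: "L2norm (\<lambda>x. f x * indicator A x - g x * indicator A x) = 0"
  proof (rule antisym)
    have "L2norm (\<lambda>x. f x * indicator A x - g x * indicator A x) \<le> L2norm (\<lambda>x. f x - g x)"
      by (intro L2norm_mono L2_diff f g) (auto simp: indicator_def)
    then show "L2norm (\<lambda>x. f x * indicator A x - g x * indicator A x) \<le> 0" using 0 by simp
  qed simp
  note fg = L2_indicator[OF f A] L2_indicator[OF g A]
  show ?thesis
    using L2norm_triangle_minus[OF fg] L2norm_triangle_minus[OF fg(2,1)] z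
      L2norm_minus[of "\<lambda>x. f x * indicator A x" "\<lambda>x. g x * indicator A x"] by linarith
qed

text \<open>The cut-offs \<open>/ \<beta>\<close> in space and \<open>* \<beta>\<close> in frequency
  are what a dilation turns into those at scale one, and all three summands pick up the same
  factor.\<close>

lemma E_err_dilate:
  assumes b: "\<beta> > 0" and w: "L2 w"
  shows "E_err N 1 (dilate c \<beta> w) = cmod c * sqrt \<beta> * E_err N \<beta> w"
proof -
  define M where "M = 1 / (2 * sqrt 2) * sqrt (real N)"
  let ?W = "fourier w"
  have 1: "L2norm (\<lambda>x. dilate c \<beta> w x * indicator {x. \<bar>x\<bar> > M / 1} x) = cmod c * sqrt \<beta> * L2norm (\<lambda>x. w x * indicator {x. \<bar>x\<bar> > M / \<beta>} x)"
  proof -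
    have "(\<lambda>x. dilate c \<beta> w x * indicator {x. \<bar>x\<bar> > M / 1} x) = dilate c \<beta> (\<lambda>x. w x * indicator {x. \<bar>x\<bar> > M / \<beta>} x)"
      using b by (auto simp: dilate_def indicator_def fun_eq_iff abs_div divide_less_cancel)
    then show ?thesis by (simp only: L2norm_dilate[OF b])
  qed
  have 2: "L2norm (\<lambda>k. fourier (dilate c \<beta> w) k * indicator {k. \<bar>k\<bar> > M * 1} k) = cmod c * sqrt \<beta> * L2norm (\<lambda>k. ?W k * indicator {k. \<bar>k\<bar> > M * \<beta>} k)"
  proof -
    have LW: "L2 (\<lambda>k. c * complex_of_real \<beta> * ?W (\<beta> * k))" by (intro L2_cmult L2_scale b fourier_spec(1) w)
    have "L2norm (\<lambda>k. fourier (dilate c \<beta> w) k * indicator {k. \<bar>k\<bar> > M * 1} k) = L2norm (\<lambda>k. c * complex_of_real \<beta> * ?W (\<beta> * k) * indicator {k. \<bar>k\<bar> > M * 1} k)"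
      by (rule L2norm_eq_indicator[OF fourier_spec(1)[OF L2_dilate[OF b w]] LW fourier_dilate[OF b w]]) auto
    also have "(\<lambda>k. c * complex_of_real \<beta> * ?W (\<beta> * k) * indicator {k. \<bar>k\<bar> > M * 1} k)
      = (\<lambda>k. (c * complex_of_real \<beta>) * (\<lambda>k. ?W k * indicator {k. \<bar>k\<bar> > M * \<beta>} k) (\<beta> * k))"
      using b by (auto simp: indicator_def fun_eq_iff abs_mult mult.commute)
    also have "L2norm \<dots> = cmod (c * complex_of_real \<beta>) * (L2norm (\<lambda>k. ?W k * indicator {k. \<bar>k\<bar> > M * \<beta>} k) / sqrt \<beta>)"
      unfolding L2norm_cmult L2norm_scale[OF b, of "\<lambda>k. ?W k * indicator {k. \<bar>k\<bar> > M * \<beta>} k"] ..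
    also have "\<dots> = cmod c * (\<beta> / sqrt \<beta>) * L2norm (\<lambda>k. ?W k * indicator {k. \<bar>k\<bar> > M * \<beta>} k)"
      using b by (simp add: norm_mult)
    also have "\<beta> / sqrt \<beta> = sqrt \<beta>" using b by (simp add: real_div_sqrt)
    finally show ?thesis .
  qed
  show ?thesis
    unfolding E_err_def M_def[symmetric] 1 2 L2norm_dilate[OF b] by (simp add: algebra_simps)
qed

section \<open>Dilation of weak derivatives and of the interpolation operator\<close>

lemma smooth_upto_test_fun: "test_fun \<phi> \<Longrightarrow> smooth_upto k \<phi>"
proof -
  assume "test_fun \<phi>"
  then have "\<And>j x. (deriv ^^ j) \<phi> differentiable (at x)" unfolding test_fun_def by blast
  then show ?thesis
  proof (induction k arbitrary: \<phi>)
    case 0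
    then show ?case using 0[of 0] by simp
  next
    case (Suc k)
    have "(deriv ^^ j) (deriv \<phi>) differentiable (at x)" for j x
      using Suc.prems[of "Suc j" x] by (simp only: funpow_Suc_right o_apply)
    then show ?case using Suc.IH[of "deriv \<phi>"] Suc.prems[of 0] by simp
  qed
qed

lemma test_fun_scale:
  assumes "test_fun \<phi>" and b: "\<beta> > 0"
  shows "test_fun (\<lambda>x. \<phi> (\<beta> * x))"
  unfolding test_fun_def
proof
  have "smooth_upto k (\<lambda>x. \<phi> (\<beta> * x + 0))" for k
    by (rule smooth_upto_affine[OF smooth_upto_test_fun[OF assms(1)]])
  then show "\<forall>k x. (deriv ^^ k) (\<lambda>x. \<phi> (\<beta> * x)) differentiable (at x)"
    using smooth_upto_iterate by simp
  obtain B where B: "\<And>x. \<phi> x \<noteq> 0 \<Longrightarrow> \<bar>x\<bar> \<le> B"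
    using assms(1) unfolding test_fun_def bounded_iff by auto
  have "\<bar>x\<bar> \<le> B / \<beta>" if "\<phi> (\<beta> * x) \<noteq> 0" for x
    using B[OF that] b by (simp add: abs_mult field_simps)
  then show "bounded {x. \<phi> (\<beta> * x) \<noteq> 0}" unfolding bounded_iff by auto
qed

text \<open>The dilation is moved from the function to the test function by a change of
  variables.\<close>

lemma weak_deriv_dilate:
  assumes wd: "weak_deriv u u1" and b: "\<beta> > 0"
  shows "weak_deriv (dilate c \<beta> u) (dilate (c / complex_of_real \<beta>) \<beta> u1)"
  unfolding weak_deriv_def
proof (intro allI impI)
  fix \<phi> assume \<phi>: "test_fun \<phi>"
  let ?\<psi> = "\<lambda>x. \<phi> (\<beta> * x)"
  have d: "deriv ?\<psi> x = \<beta> * deriv \<phi> (\<beta> * x)" for x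
  proof -
    have "((\<lambda>x. \<beta> * x) has_real_derivative \<beta>) (at x)" by (auto intro!: derivative_eq_intros)
    from DERIV_imp_deriv[OF DERIV_chain2[OF smooth_upto_DERIV[OF smooth_upto_test_fun[OF \<phi>]] this]]
    show ?thesis by (simp add: mult.commute)
  qed
  have main: "(LINT x|lborel. u x * complex_of_real (\<beta> * deriv \<phi> (\<beta> * x))) = - (LINT x|lborel. u1 x * complex_of_real (\<phi> (\<beta> * x)))"
    using wd test_fun_scale[OF \<phi> b] unfolding weak_deriv_def by (simp only: d[symmetric])
  have sc: "(LINT x|lborel. f x) = \<beta> *\<^sub>R (LINT x|lborel. f (\<beta> * x))" for f :: "real \<Rightarrow> complex"
    using lborel_integral_scale[OF b, of f] b by simp
  have dil: "dilate a \<beta> v (\<beta> * x) = a * v x" for a v x using b by (simp add: dilate_def)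
  have "(LINT x|lborel. dilate c \<beta> u x * complex_of_real (deriv \<phi> x)) = \<beta> *\<^sub>R (LINT x|lborel. c * u x * complex_of_real (deriv \<phi> (\<beta> * x)))"
    by (subst sc) (simp only: dil)
  also have "\<dots> = \<beta> *\<^sub>R (LINT x|lborel. (c / complex_of_real \<beta>) * (u x * complex_of_real (\<beta> * deriv \<phi> (\<beta> * x))))"
    using b by (intro arg_cong[where f="(*\<^sub>R) \<beta>"] Bochner_Integration.integral_cong refl) simp
  also have "\<dots> = \<beta> *\<^sub>R ((c / complex_of_real \<beta>) * - (LINT x|lborel. u1 x * complex_of_real (\<phi> (\<beta> * x))))"
    by (simp only: integral_mult_right_zero main)
  also have "\<dots> = - (\<beta> *\<^sub>R (LINT x|lborel. (c / complex_of_real \<beta>) * (u1 x * complex_of_real (\<phi> (\<beta> * x)))))"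
    by (simp only: integral_mult_right_zero mult_minus_right scaleR_minus_right)
  also have "\<dots> = - (LINT x|lborel. dilate (c / complex_of_real \<beta>) \<beta> u1 x * complex_of_real (\<phi> x))"
    by (subst (2) sc) (simp only: dil mult.assoc)
  finally show "(LINT x|lborel. dilate c \<beta> u x * complex_of_real (deriv \<phi> x)) = - (LINT x|lborel. dilate (c / complex_of_real \<beta>) \<beta> u1 x * complex_of_real (\<phi> x))" .
qed

lemma H1_dilate:
  assumes h: "H1 u u1" and b: "\<beta> > 0"
  shows "H1 (dilate c \<beta> u) (dilate (c / complex_of_real \<beta>) \<beta> u1)"
proof -
  have "continuous_on UNIV (dilate c \<beta> u)"
    unfolding dilate_def[abs_def] using h b by (intro continuous_intros continuous_on_compose2[of UNIV u UNIV "\<lambda>x. x / \<beta>"]) (auto simp: H1_def)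
  then show ?thesis using h b unfolding H1_def by (simp add: L2_dilate weak_deriv_dilate)
qed

lemma Pspace_scale:
  assumes p: "p \<in> Pspace N \<beta>" and b: "\<beta> > 0" "\<gamma> > 0"
  shows "(\<lambda>x. p (\<gamma> * x)) \<in> Pspace N (\<beta> * \<gamma>)"
proof -
  obtain \<psi> :: "complex poly" where \<psi>: "degree \<psi> \<le> N" "p = (\<lambda>x. of_real (exp (- (\<beta>\<^sup>2 * x\<^sup>2) / 2)) * poly \<psi> (of_real x))"
    using p unfolding Pspace_def by blast
  have "degree (pcompose \<psi> [:0, of_real \<gamma>:]) \<le> N" using \<psi>(1) b by (simp add: degree_pcompose)
  moreover have "(\<lambda>x. p (\<gamma> * x)) = (\<lambda>x. of_real (exp (- ((\<beta> * \<gamma>)\<^sup>2 * x\<^sup>2) / 2)) * poly (pcompose \<psi> [:0, of_real \<gamma>:]) (of_real x))"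
    unfolding \<psi>(2) by (simp add: poly_pcompose power_mult_distrib mult_ac)
  ultimately show ?thesis unfolding Pspace_def by blast
qed

text \<open>The dilated interpolant lies in \<open>Pspace N \<beta>\<close> and has the right values
  at the nodes divided by \<open>\<beta>\<close>; uniqueness is pulled back to scale one.\<close>

lemma interp_scale:
  assumes b: "\<beta> > 0" and N: "N \<ge> 1"
  shows "interp N \<beta> u = (\<lambda>x. interp N 1 (dilate 1 \<beta> u) (\<beta> * x))"
proof -
  let ?U = "dilate 1 \<beta> u"
  define c where "c = (\<lambda>_::nat. 0::complex)"
  obtain d where d: "lagrange N (\<lambda>x. ?U x - hsum c N x) = hsum d N" using lagrange_eq_hsum by blast
  have c0: "hsum c N x = 0" for x by (simp add: hsum_def c_def)
  have I: "interp N 1 ?U = hsum d N" unfolding interp_eq_lagrange[OF N, of ?U c] unfolding d by (simp add: c0)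
  have node: "interp N 1 ?U x = ?U x" if "x \<in> nodes N" for x
    unfolding interp_eq_lagrange[OF N, of ?U c] c0 using lagrange_node[OF that N] by simp
  let ?p = "\<lambda>x. interp N 1 ?U (\<beta> * x)"
  have P: "?p \<in> Pspace N \<beta>"
    using Pspace_scale[OF hsum_in_Pspace[of d N] zero_less_one b] unfolding I by simp
  have V: "?p (x / \<beta>) = u (x / \<beta>)" if "x \<in> nodes N" for x
    using node[OF that] b by (simp add: dilate_def)
  show ?thesis unfolding interp_def[of N \<beta>]
  proof (rule the_equality)
    show "?p \<in> Pspace N \<beta> \<and> (\<forall>x. hermite_fun (Suc N) x = 0 \<longrightarrow> ?p (x / \<beta>) = u (x / \<beta>))"
      using P V by (simp add: nodes_def)
    fix p assume p: "p \<in> Pspace N \<beta> \<and> (\<forall>x. hermite_fun (Suc N) x = 0 \<longrightarrow> p (x / \<beta>) = u (x / \<beta>))"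
    have "(\<lambda>x. p (1 / \<beta> * x)) \<in> Pspace N (\<beta> * (1 / \<beta>))"
      using p b by (intro Pspace_scale) auto
    then have "(\<lambda>x. p (x / \<beta>)) \<in> Pspace N 1" using b by simp
    moreover have "interp N 1 ?U \<in> Pspace N 1" unfolding I by (rule hsum_in_Pspace)
    ultimately have "(\<lambda>x. p (x / \<beta>)) = interp N 1 ?U"
      by (rule Pspace_unique) (use p node in \<open>simp add: nodes_def dilate_def\<close>)
    then have "p (\<beta> * x / \<beta>) = interp N 1 ?U (\<beta> * x)" for x by metis
    then show "p = ?p" using b by (intro ext) simp
  qed
qed

lemma interp_1_eq_hsum:
  assumes "N \<ge> 1" obtains d where "interp N 1 u = hsum d N"
proof -
  obtain d where d: "lagrange N (\<lambda>x. u x - hsum (\<lambda>_. 0) N x) = hsum d N" using lagrange_eq_hsum by blast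
  have "interp N 1 u = hsum d N"
    unfolding interp_eq_lagrange[OF assms, of u "\<lambda>_. 0"] d by (rule ext) (simp add: hsum_def)
  then show ?thesis by (rule that)
qed

lemma has_vector_derivative_scale:
  assumes "(f has_vector_derivative f') (at (\<beta> * x))"
  shows "((\<lambda>x::real. f (\<beta> * x)) has_vector_derivative \<beta> *\<^sub>R f') (at x)"
proof -
  have "((\<lambda>x. \<beta> * x) has_real_derivative \<beta>) (at x)" by (auto intro!: derivative_eq_intros)
  from vector_diff_chain_at[OF this[unfolded has_real_derivative_iff_has_vector_derivative] assms]
  show ?thesis by (simp add: o_def)
qed

lemma interp_derivatives_scale:
  fixes u :: "real \<Rightarrow> complex"
  assumes b: "\<beta> > 0" and N: "N \<ge> 1"
  defines "p \<equiv> interp N 1 (dilate 1 \<beta> u)"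
  shows "vector_derivative (interp N \<beta> u) (at x) = \<beta> *\<^sub>R vector_derivative p (at (\<beta> * x))"
    and "vector_derivative (\<lambda>y. vector_derivative (interp N \<beta> u) (at y)) (at x) = \<beta>\<^sup>2 *\<^sub>R vector_derivative (\<lambda>y. vector_derivative p (at y)) (at (\<beta> * x))"
proof -
  obtain d where d: "p = hsum d N" unfolding p_def using interp_1_eq_hsum[OF N] by blast
  have p1: "(p has_vector_derivative dhsum d N y) (at y)" for y unfolding d by (rule hsum_has_vector_derivative)
  have v1: "vector_derivative p (at y) = dhsum d N y" for y by (rule vector_derivative_at[OF p1])
  have p2: "((\<lambda>y. vector_derivative p (at y)) has_vector_derivative dhsum (dcoef d N) (Suc N) y) (at y)" for y
    unfolding v1 dhsum_eq_hsum[of d N] by (rule hsum_has_vector_derivative)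
  have v2: "vector_derivative (\<lambda>y. vector_derivative p (at y)) (at y) = dhsum (dcoef d N) (Suc N) y" for y by (rule vector_derivative_at[OF p2])
  have I: "interp N \<beta> u = (\<lambda>x. p (\<beta> * x))" unfolding p_def by (rule interp_scale[OF b N])
  show A: "vector_derivative (interp N \<beta> u) (at x) = \<beta> *\<^sub>R vector_derivative p (at (\<beta> * x))" for x
    unfolding I v1 by (rule vector_derivative_at[OF has_vector_derivative_scale[OF p1]])
  have "((\<lambda>y. \<beta> *\<^sub>R vector_derivative p (at (\<beta> * y))) has_vector_derivative \<beta> *\<^sub>R (\<beta> *\<^sub>R dhsum (dcoef d N) (Suc N) (\<beta> * x))) (at x)"
    by (intro bounded_linear.has_vector_derivative[OF bounded_linear_scaleR_right] has_vector_derivative_scale p2)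
  then show "vector_derivative (\<lambda>y. vector_derivative (interp N \<beta> u) (at y)) (at x) = \<beta>\<^sup>2 *\<^sub>R vector_derivative (\<lambda>y. vector_derivative p (at y)) (at (\<beta> * x))"
    unfolding A v2 by (subst vector_derivative_at) (simp_all add: power2_eq_square)
qed

theorem theorem3p6:
  shows "\<exists>C > 0. \<forall>(N::nat) (\<beta>::real). N \<ge> 1 \<longrightarrow> \<beta> > 0 \<longrightarrow>
    (\<forall>u u1. H1 u u1 \<longrightarrow>
       L2norm (\<lambda>x. u x - interp N \<beta> u x)
         \<le> C * (1 / \<beta> * real N powr (-1/3) * E_err N \<beta> u1
                + real N powr (1/6) * E_err N \<beta> u)) \<and>
    (\<forall>u u1. H1 u u1 \<longrightarrow>
       L2norm (\<lambda>x. u1 x - vector_derivative (interp N \<beta> u) (at x))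
         \<le> C * (real N powr (1/6) * E_err N \<beta> u1
                + \<beta> * real N powr (2/3) * E_err N \<beta> u)) \<and>
    (\<forall>u u1 u2. H2 u u1 u2 \<longrightarrow>
       L2norm (\<lambda>x. u2 x - vector_derivative (\<lambda>y. vector_derivative (interp N \<beta> u) (at y)) (at x))
         \<le> C * (E_err N \<beta> u2 + \<beta> * real N powr (2/3) * E_err N \<beta> u1
                + \<beta>^2 * real N powr (7/6) * E_err N \<beta> u))"
proof -
  obtain C where C: "C \<ge> 1" and proj: "\<And>N K w. L2 w \<Longrightarrow> Suc K \<ge> N \<Longrightarrow> L2norm (\<lambda>x. w x - hproj K w x) \<le> C * E_err N 1 w"
    using hproj_error_bound by blast
  let ?D = "400 * C"
  show ?thesis
  proof (intro exI[of _ ?D] conjI allI impI)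
    show "0 < ?D" using C by simp
  next
    fix N :: nat and \<beta> :: real and u u1
    assume N: "N \<ge> 1" and b: "\<beta> > 0" and h: "H1 u u1"
    let ?U = "dilate 1 \<beta> u" and ?U1 = "dilate (1 / complex_of_real \<beta>) \<beta> u1"
    have u: "L2 u" "L2 u1" using h by (auto simp: H1_def)
    have H: "H1 ?U ?U1" by (rule H1_dilate[OF h b])
    have E: "E_err N 1 ?U = sqrt \<beta> * E_err N \<beta> u" "E_err N 1 ?U1 = 1 / \<beta> * sqrt \<beta> * E_err N \<beta> u1"
      using b by (simp_all add: E_err_dilate u norm_divide)
    have s: "sqrt \<beta> > 0" using b by simp
    \<comment> \<open>Each \<open>E_err\<close> of a dilated function carries a factor
      \<open>sqrt \<beta>\<close>, which cancels the \<open>1 / sqrt \<beta>\<close> from the change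
      of variables; each derivative leaves a further \<open>1 / \<beta>\<close>.\<close>
    have "L2norm (\<lambda>x. u x - interp N \<beta> u x) = L2norm (\<lambda>x. (\<lambda>x. ?U x - interp N 1 ?U x) (\<beta> * x))"
      unfolding interp_scale[OF b N] using b by (simp add: dilate_def)
    also have "\<dots> = L2norm (\<lambda>x. ?U x - interp N 1 ?U x) / sqrt \<beta>" by (rule L2norm_scale[OF b])
    also have "\<dots> \<le> ?D * (real N powr (-1/3) * E_err N 1 ?U1 + real N powr (1/6) * E_err N 1 ?U) / sqrt \<beta>"
      using s by (intro divide_right_mono estimate_0[OF C proj N H]) auto
    also have "\<dots> = ?D * (1 / \<beta> * real N powr (-1/3) * E_err N \<beta> u1 + real N powr (1/6) * E_err N \<beta> u)"
      unfolding E using s b by (simp add: field_simps)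
    finally show "L2norm (\<lambda>x. u x - interp N \<beta> u x) \<le> ?D * (1 / \<beta> * real N powr (-1/3) * E_err N \<beta> u1 + real N powr (1/6) * E_err N \<beta> u)" .
  next
    fix N :: nat and \<beta> :: real and u u1
    assume N: "N \<ge> 1" and b: "\<beta> > 0" and h: "H1 u u1"
    let ?U = "dilate 1 \<beta> u" and ?U1 = "dilate (1 / complex_of_real \<beta>) \<beta> u1"
    have u: "L2 u" "L2 u1" using h by (auto simp: H1_def)
    have H: "H1 ?U ?U1" by (rule H1_dilate[OF h b])
    have E: "E_err N 1 ?U = sqrt \<beta> * E_err N \<beta> u" "E_err N 1 ?U1 = 1 / \<beta> * sqrt \<beta> * E_err N \<beta> u1"
      using b by (simp_all add: E_err_dilate u norm_divide)
    have s: "sqrt \<beta> > 0" using b by simp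
    let ?F = "\<lambda>x. ?U1 x - vector_derivative (interp N 1 ?U) (at x)"
    \<comment> \<open>\<open>?U1\<close> contains \<open>1 / \<beta>\<close>, so the factor
      \<open>\<beta>\<close> of the chain rule can be taken out of the whole difference.\<close>
    have "L2norm (\<lambda>x. u1 x - vector_derivative (interp N \<beta> u) (at x)) = L2norm (\<lambda>x. complex_of_real \<beta> * ?F (\<beta> * x))"
      unfolding interp_derivatives_scale(1)[OF b N] using b by (simp add: dilate_def scaleR_conv_of_real right_diff_distrib)
    also have "\<dots> = \<beta> * (L2norm ?F / sqrt \<beta>)" unfolding L2norm_cmult L2norm_scale[OF b, of ?F] using b by simp
    also have "\<dots> \<le> \<beta> * (?D * (real N powr (1/6) * E_err N 1 ?U1 + real N powr (2/3) * E_err N 1 ?U) / sqrt \<beta>)"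
      using s b by (intro mult_left_mono divide_right_mono estimate_1[OF C proj N H]) auto
    also have "\<dots> = ?D * (real N powr (1/6) * E_err N \<beta> u1 + \<beta> * real N powr (2/3) * E_err N \<beta> u)"
      unfolding E using s b by (simp add: field_simps)
    finally show "L2norm (\<lambda>x. u1 x - vector_derivative (interp N \<beta> u) (at x)) \<le> ?D * (real N powr (1/6) * E_err N \<beta> u1 + \<beta> * real N powr (2/3) * E_err N \<beta> u)" .
  next
    fix N :: nat and \<beta> :: real and u u1 u2
    assume N: "N \<ge> 1" and b: "\<beta> > 0" and h2: "H2 u u1 u2"
    let ?U = "dilate 1 \<beta> u" and ?U1 = "dilate (1 / complex_of_real \<beta>) \<beta> u1" and ?U2 = "dilate (1 / complex_of_real \<beta> / complex_of_real \<beta>) \<beta> u2"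
    \<comment> \<open>\<open>H2\<close> includes continuity of \<open>u1\<close>, so
      \<open>u1\<close> is itself an \<open>H1\<close> function with weak derivative
      \<open>u2\<close>.\<close>
    have h: "H1 u u1" and h1: "H1 u1 u2" using h2 by (auto simp: H2_def H1_def)
    have u: "L2 u" "L2 u1" "L2 u2" using h h1 by (auto simp: H1_def)
    have H: "H1 ?U ?U1" by (rule H1_dilate[OF h b])
    have H': "H1 ?U1 ?U2" by (rule H1_dilate[OF h1 b])
    have E: "E_err N 1 ?U = sqrt \<beta> * E_err N \<beta> u" "E_err N 1 ?U1 = 1 / \<beta> * sqrt \<beta> * E_err N \<beta> u1" "E_err N 1 ?U2 = 1 / \<beta>\<^sup>2 * sqrt \<beta> * E_err N \<beta> u2"
      using b by (simp_all add: E_err_dilate u norm_divide norm_mult power2_eq_square)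
    have s: "sqrt \<beta> > 0" using b by simp
    let ?F = "\<lambda>x. ?U2 x - vector_derivative (\<lambda>y. vector_derivative (interp N 1 ?U) (at y)) (at x)"
    have "L2norm (\<lambda>x. u2 x - vector_derivative (\<lambda>y. vector_derivative (interp N \<beta> u) (at y)) (at x)) = L2norm (\<lambda>x. complex_of_real (\<beta>\<^sup>2) * ?F (\<beta> * x))"
      unfolding interp_derivatives_scale(2)[OF b N] using b by (simp add: dilate_def scaleR_conv_of_real right_diff_distrib power2_eq_square)
    also have "\<dots> = \<beta>\<^sup>2 * (L2norm ?F / sqrt \<beta>)" unfolding L2norm_cmult L2norm_scale[OF b, of ?F] by (simp add: norm_power)
    also have "\<dots> \<le> \<beta>\<^sup>2 * (?D * (E_err N 1 ?U2 + real N powr (2/3) * E_err N 1 ?U1 + real N powr (7/6) * E_err N 1 ?U) / sqrt \<beta>)"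
      using s by (intro mult_left_mono divide_right_mono estimate_2[OF C proj N H H']) auto
    also have "\<dots> = ?D * (E_err N \<beta> u2 + \<beta> * real N powr (2/3) * E_err N \<beta> u1 + \<beta>^2 * real N powr (7/6) * E_err N \<beta> u)"
      unfolding E using s b by (simp add: field_simps power2_eq_square)
    finally show "L2norm (\<lambda>x. u2 x - vector_derivative (\<lambda>y. vector_derivative (interp N \<beta> u) (at y)) (at x))
      \<le> ?D * (E_err N \<beta> u2 + \<beta> * real N powr (2/3) * E_err N \<beta> u1 + \<beta>^2 * real N powr (7/6) * E_err N \<beta> u)" .
  qed
qed

end
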